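(* Let $H\in(0,\tfrac12]$ and let $(B_t)_{t\ge 0}$ be the one-dimensional fractional Brownian motion with Hurst parameter $H$, realised on the classical Wiener space $(\boldsymbol{W},\mathcal{H},P)$ by $B_t=\int_0^t K(t,s)\,d\omega(s)$. Then $$c_{2,1}\left(\limsup_{t\downarrow0}\frac{B_t}{\sqrt{2t^{2H}\log\log(1/t)}}<1\right)=0.$$
   Context: Classical Wiener space: $\boldsymbol{W}$ is the space of continuous paths $\omega:[0,\infty)\to\mathbb{R}$ with $\omega(0)=0$, with the topology of uniform convergence on compact sets; $P$ is Wiener measure, under which the coordinate process $(\omega(t))_{t\ge0}$ is a standard Brownian motion; $\mathcal{H}$ is the Hilbert space of absolutely continuous $h\in\boldsymbol{W}$ with $\dot h\in L^2([0,\infty))$, $\|h\|_{\mathcal H}^2=\int_0^\infty|\dot h(t)|^2dt$. For $h\in\mathcal H$ let $[h]=\int_0^\infty\dot h\,d\omega$ (Itô/Wiener integral). Sobolev spaces: for smooth $F=f([h_1],\dots,[h_n])$ with $f$ smooth with partial derivatives of polynomial growth, $DF=\sum_i\partial_if([h_1],\dots,[h_n])h_i$, and $D^kF$ ($\mathcal H^{\otimes k}$-valued) is defined inductively. For $r\in\mathbb{N}=\{1,2,\dots\}$ and $1<p<\infty$, $\mathbb{D}^p_r$ is the completion of the smooth functionals under $\|F\|_{\mathbb D^p_r}=\big(\mathbb E[|F|^p]+\sum_{k=1}^r\mathbb E[\|D^kF\|_{\mathcal H^{\otimes k}}^p]\big)^{1/p}$. Capacity: for open $O\subset\boldsymbol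 W$, $c_{p,r}(O)=\inf\{\|\varphi\|_{\mathbb D^p_r}:\varphi\in\mathbb D^p_r,\ \varphi\ge1\text{ a.e. on }O,\ \varphi\ge0\text{ a.e. on }\boldsymbol W\}$; for arbitrary $A\subset\boldsymbol W$, $c_{p,r}(A)=\inf\{c_{p,r}(O):A\subset O,\ O\text{ open}\}$. Thus $c_{2,1}$ is the case $p=2$, $r=1$. A set $A$ is slim if $c_{p,r}(A)=0$ for all $r\in\mathbb N$ and $1<p<\infty$. Kernel: for $t>s>0$, with $\beta(\cdot,\cdot)$ the Beta function, if $H<\frac12$: $K(t,s)=\sqrt{\frac{2H}{(1-2H)\beta(1-2H,H+\frac12)}}\Big[\big(\tfrac ts\big)^{H-\frac12}(t-s)^{H-\frac12}-(H-\tfrac12)s^{\frac12-H}\int_s^tu^{H-\frac32}(u-s)^{H-\frac12}du\Big]$; if $H=\frac12$: $K=1$. Then $B$ is a centred Gaussian process with $\mathbb E[B_tB_s]=\frac12(t^{2H}+s^{2H}-|t-s|^{2H})$ and $B_t\in\mathbb D^p_r$ for all $p,r$. Choice of version: $B$ denotes a version such that each $B_t$ is quasi-continuous (for all $r\in\mathbb N$, $1<p<\infty$, $\varepsilon>0$ there is an open $O_\varepsilon\subset\boldsymbol W$ with $c_{p,r}(O_\varepsilon)<\varepsilon$ and $B_t$ continuous on $\boldsymbol W\setminus O_\varepsilon$) and $t\mapsto B_t(\omega)$ is continuous for every $\omega$ outside a slim set. *)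

theory Defs
  imports "HOL-Probability.Probability"
begin

section \<open>Classical Wiener space\<close>

text \<open>A path on \<open>[0,\<infinity>)\<close> is encoded as a function on the whole real line that vanishes
  on the negative half-line, so that equal paths are equal functions.\<close>

definition wiener_space :: "(real \<Rightarrow> real) set" where
  "wiener_space = {\<omega>. continuous_on {0..} \<omega> \<and> \<omega> 0 = 0 \<and> (\<forall>t<0. \<omega> t = 0)}"

definition wiener_open :: "(real \<Rightarrow> real) set \<Rightarrow> bool" where
  "wiener_open U \<longleftrightarrow> U \<subseteq> wiener_space \<and>
    (\<forall>\<omega>\<in>U. \<exists>T>0. \<exists>\<epsilon>>0. \<forall>\<eta>\<in>wiener_space. (\<forall>t\<in>{0..T}. \<bar>\<eta> t - \<omega> t\<bar> < \<epsilon>) \<longrightarrow> \<eta> \<in> U)"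

text \<open>The topology of uniform convergence on compact sets.\<close>

definition wiener_topology :: "(real \<Rightarrow> real) topology" where
  "wiener_topology = topology wiener_open"

lemma istopology_wiener_open: "istopology wiener_open"
  unfolding istopology_def
proof (intro conjI allI impI)
  fix S U assume S: "wiener_open S" and U: "wiener_open U"
  show "wiener_open (S \<inter> U)"
    unfolding wiener_open_def
  proof (intro conjI ballI)
    show "S \<inter> U \<subseteq> wiener_space" using S by (auto simp: wiener_open_def)
  next
    fix \<omega> assume w: "\<omega> \<in> S \<inter> U"
    obtain T1 e1 where T1: "T1 > 0" "e1 > 0"
      "\<forall>\<eta>\<in>wiener_space. (\<forall>t\<in>{0..T1}. \<bar>\<eta> t - \<omega> t\<bar> < e1) \<longrightarrow> \<eta> \<in> S"
      using S w unfolding wiener_open_def by blast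
    obtain T2 e2 where T2: "T2 > 0" "e2 > 0"
      "\<forall>\<eta>\<in>wiener_space. (\<forall>t\<in>{0..T2}. \<bar>\<eta> t - \<omega> t\<bar> < e2) \<longrightarrow> \<eta> \<in> U"
      using U w unfolding wiener_open_def by blast
    show "\<exists>T>0. \<exists>\<epsilon>>0. \<forall>\<eta>\<in>wiener_space. (\<forall>t\<in>{0..T}. \<bar>\<eta> t - \<omega> t\<bar> < \<epsilon>) \<longrightarrow> \<eta> \<in> S \<inter> U"
    proof (rule exI[of _ "max T1 T2"], rule conjI, goal_cases)
      case 1 show ?case using T1(1) by simp
    next
      case 2 show ?case
        using T1 T2 by (intro exI[of _ "min e1 e2"]) (force simp: le_max_iff_disj)
    qed
  qed
next
  fix \<K> assume K: "\<forall>S\<in>\<K>. wiener_open S"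
  show "wiener_open (\<Union>\<K>)"
    unfolding wiener_open_def
  proof (intro conjI ballI)
    show "\<Union>\<K> \<subseteq> wiener_space" using K by (auto simp: wiener_open_def)
  next
    fix \<omega> assume "\<omega> \<in> \<Union>\<K>"
    then obtain S where S: "S \<in> \<K>" "\<omega> \<in> S" by blast
    with K obtain T e where "T > 0" "e > 0"
      "\<forall>\<eta>\<in>wiener_space. (\<forall>t\<in>{0..T}. \<bar>\<eta> t - \<omega> t\<bar> < e) \<longrightarrow> \<eta> \<in> S"
      unfolding wiener_open_def by blast
    with S show "\<exists>T>0. \<exists>\<epsilon>>0. \<forall>\<eta>\<in>wiener_space. (\<forall>t\<in>{0..T}. \<bar>\<eta> t - \<omega> t\<bar> < \<epsilon>) \<longrightarrow> \<eta> \<in> \<Union>\<K>"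
      by blast
  qed
qed

lemma openin_wiener_topology: "openin wiener_topology U \<longleftrightarrow> wiener_open U"
  by (simp add: wiener_topology_def topology_inverse'[OF istopology_wiener_open])

lemma topspace_wiener_topology: "topspace wiener_topology = wiener_space"
proof -
  have "wiener_open wiener_space"
    by (auto simp: wiener_open_def intro!: exI[of _ "1::real"])
  then show ?thesis
    by (metis openin_wiener_topology openin_subset openin_topspace subset_antisym wiener_open_def)
qed

text \<open>Wiener measure is the unique Borel probability measure on Wiener space under which the
  coordinate process is a standard Brownian motion; the start at \<open>0\<close> and the continuity
  of paths are part of the definition of the space.\<close>

definition wiener_measure :: "(real \<Rightarrow> real) measure \<Rightarrow> bool" where
  "wiener_measure P \<longleftrightarrow>
     prob_space P \<and>
     space P = wiener_space \<and>
     sets P = sigma_sets wiener_space {U. openin wiener_topology U} \<and>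
     (\<forall>s t. 0 \<le> s \<and> s < t \<longrightarrow>
        distributed P lborel (\<lambda>\<omega>. \<omega> t - \<omega> s) (normal_density 0 (sqrt (t - s)))) \<and>
     (\<forall>(n::nat) (\<tau>::nat \<Rightarrow> real). 0 \<le> \<tau> 0 \<and> (\<forall>i<n. \<tau> i < \<tau> (Suc i)) \<longrightarrow>
        prob_space.indep_vars P (\<lambda>_. borel) (\<lambda>i \<omega>. \<omega> (\<tau> (Suc i)) - \<omega> (\<tau> i)) {..<n})"

section \<open>The Cameron--Martin space\<close>

definition abs_continuous_on :: "real set \<Rightarrow> (real \<Rightarrow> real) \<Rightarrow> bool" where
  "abs_continuous_on S h \<longleftrightarrow>
    (\<forall>\<epsilon>>0. \<exists>\<delta>>0. \<forall>(n::nat) a b.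
       (\<forall>i<n. a i \<le> b i \<and> {a i..b i} \<subseteq> S) \<and>
       (\<forall>i<n. \<forall>j<n. i \<noteq> j \<longrightarrow> {a i<..<b i} \<inter> {a j<..<b j} = {}) \<and>
       (\<Sum>i<n. b i - a i) < \<delta>
       \<longrightarrow> (\<Sum>i<n. \<bar>h (b i) - h (a i)\<bar>) < \<epsilon>)"

definition square_integrable :: "(real \<Rightarrow> real) \<Rightarrow> bool" where
  "square_integrable g \<longleftrightarrow>
     set_borel_measurable lborel {0..} g \<and> set_integrable lborel {0..} (\<lambda>s. (g s)\<^sup>2)"

text \<open>An absolutely continuous \<open>h\<close> is differentiable almost everywhere, so \<open>deriv h\<close>
  represents the class \<open>\<dot>h\<close> (on the remaining null set its value is irrelevant).\<close>

definition cameron_martin :: "(real \<Rightarrow> real) set" where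
  "cameron_martin = {h \<in> wiener_space.
     (\<forall>T>0. abs_continuous_on {0..T} h) \<and> square_integrable (deriv h)}"

definition cm_inner :: "(real \<Rightarrow> real) \<Rightarrow> (real \<Rightarrow> real) \<Rightarrow> real" where
  "cm_inner h k = (LINT s:{0..}|lborel. deriv h s * deriv k s)"

section \<open>The Wiener integral\<close>

definition step_fun :: "nat \<Rightarrow> (nat \<Rightarrow> real) \<Rightarrow> (nat \<Rightarrow> real) \<Rightarrow> real \<Rightarrow> real" where
  "step_fun n a \<tau> s = (\<Sum>i<n. a i * indicator {\<tau> i<..\<tau> (Suc i)} s)"

definition step_integral :: "nat \<Rightarrow> (nat \<Rightarrow> real) \<Rightarrow> (nat \<Rightarrow> real) \<Rightarrow> (real \<Rightarrow> real) \<Rightarrow> real" where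
  "step_integral n a \<tau> \<omega> = (\<Sum>i<n. a i * (\<omega> (\<tau> (Suc i)) - \<omega> (\<tau> i)))"

text \<open>\<open>X\<close> is a version of \<open>\<integral>\<^sub>0\<^sup>\<infinity> g d\<omega>\<close>: integrals of step functions approximating
  \<open>g\<close> in \<open>L\<^sup>2([0,\<infinity>))\<close> converge to \<open>X\<close> in \<open>L\<^sup>2(P)\<close>.\<close>

definition is_wiener_integral ::
    "(real \<Rightarrow> real) measure \<Rightarrow> (real \<Rightarrow> real) \<Rightarrow> ((real \<Rightarrow> real) \<Rightarrow> real) \<Rightarrow> bool" where
  "is_wiener_integral P g X \<longleftrightarrow> X \<in> borel_measurable P \<and>
    (\<exists>(n :: nat \<Rightarrow> nat) (a :: nat \<Rightarrow> nat \<Rightarrow> real) (\<tau> :: nat \<Rightarrow> nat \<Rightarrow> real).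
       (\<forall>m. 0 \<le> \<tau> m 0 \<and> (\<forall>i<n m. \<tau> m i < \<tau> m (Suc i))) \<and>
       (\<lambda>m. \<integral>\<^sup>+s\<in>{0..}. ennreal ((g s - step_fun (n m) (a m) (\<tau> m) s)\<^sup>2) \<partial>lborel)
          \<longlonglongrightarrow> 0 \<and>
       (\<lambda>m. \<integral>\<^sup>+\<omega>. ennreal ((X \<omega> - step_integral (n m) (a m) (\<tau> m) \<omega>)\<^sup>2) \<partial>P)
          \<longlonglongrightarrow> 0)"

text \<open>The integral is unique only up to null sets; an arbitrary version is chosen.\<close>

definition wiener_integral ::
    "(real \<Rightarrow> real) measure \<Rightarrow> (real \<Rightarrow> real) \<Rightarrow> (real \<Rightarrow> real) \<Rightarrow> real" where
  "wiener_integral P g = (SOME X. is_wiener_integral P g X)"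

definition cm_integral ::
    "(real \<Rightarrow> real) measure \<Rightarrow> (real \<Rightarrow> real) \<Rightarrow> (real \<Rightarrow> real) \<Rightarrow> real" where
  "cm_integral P h = wiener_integral P (deriv h)"

section \<open>Smooth functionals and their derivatives\<close>

text \<open>A function on \<open>\<real>\<^sup>n\<close>, with \<open>n\<close> varying, is encoded as a function of a sequence that
  depends only on the coordinates \<open>0, \<dots>, n - 1\<close>.\<close>

definition partial_deriv :: "nat \<Rightarrow> ((nat \<Rightarrow> real) \<Rightarrow> real) \<Rightarrow> (nat \<Rightarrow> real) \<Rightarrow> real" where
  "partial_deriv i f x = deriv (\<lambda>s. f (x(i := s))) (x i)"

fun iter_partial :: "nat list \<Rightarrow> ((nat \<Rightarrow> real) \<Rightarrow> real) \<Rightarrow> (nat \<Rightarrow> real) \<Rightarrow> real" where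
  "iter_partial [] f = f"
| "iter_partial (i # I) f = partial_deriv i (iter_partial I f)"

definition smooth_poly_growth :: "nat \<Rightarrow> ((nat \<Rightarrow> real) \<Rightarrow> real) \<Rightarrow> bool" where
  "smooth_poly_growth n f \<longleftrightarrow>
     (\<forall>x y. (\<forall>i<n. x i = y i) \<longrightarrow> f x = f y) \<and>
     (\<forall>I. set I \<subseteq> {..<n} \<longrightarrow>
        continuous_on UNIV (iter_partial I f) \<and>
        (\<forall>x. \<forall>i<n. (\<lambda>s. iter_partial I f (x(i := s))) differentiable (at (x i))) \<and>
        (\<exists>C. \<exists>N::nat. \<forall>x. \<bar>iter_partial I f x\<bar> \<le> C * (1 + (\<Sum>i<n. \<bar>x i\<bar>)) ^ N))"

text \<open>\<open>F = f([h\<^sub>0], \<dots>, [h\<^sub>n\<^sub>-\<^sub>1])\<close> almost surely.\<close>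

definition smooth_functional ::
    "(real \<Rightarrow> real) measure \<Rightarrow> nat \<Rightarrow> ((nat \<Rightarrow> real) \<Rightarrow> real) \<Rightarrow> (nat \<Rightarrow> real \<Rightarrow> real)
      \<Rightarrow> ((real \<Rightarrow> real) \<Rightarrow> real) \<Rightarrow> bool" where
  "smooth_functional P n f h F \<longleftrightarrow>
     smooth_poly_growth n f \<and> (\<forall>i<n. h i \<in> cameron_martin) \<and>
     F \<in> borel_measurable P \<and> (AE \<omega> in P. F \<omega> = f (\<lambda>i. cm_integral P (h i) \<omega>))"

definition index_tuples :: "nat \<Rightarrow> nat \<Rightarrow> nat list set" where
  "index_tuples n k = {I. length I = k \<and> set I \<subseteq> {..<n}}"

text \<open>The inductive definition of \<open>D\<^sup>kF\<close> gives
  \<open>D\<^sup>kF = \<Sum>\<^sub>I \<partial>\<^sub>I f([h\<^sub>0], \<dots>, [h\<^sub>n\<^sub>-\<^sub>1]) h\<^bsub>I!0\<^esub> \<otimes> \<dots> \<otimes> h\<^bsub>I!(k-1)\<^esub>\<close>,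
  the sum being over all \<open>k\<close>-tuples \<open>I\<close> of indices. Its norm in the Hilbert space tensor power
  comes from the inner product
  \<open>\<langle>u\<^sub>0 \<otimes> \<dots> \<otimes> u\<^sub>k\<^sub>-\<^sub>1, v\<^sub>0 \<otimes> \<dots> \<otimes> v\<^sub>k\<^sub>-\<^sub>1\<rangle> = \<Prod>\<^sub>l \<langle>u\<^sub>l, v\<^sub>l\<rangle>\<close>.\<close>

definition malliavin_coeff ::
    "(real \<Rightarrow> real) measure \<Rightarrow> ((nat \<Rightarrow> real) \<Rightarrow> real) \<Rightarrow> (nat \<Rightarrow> real \<Rightarrow> real) \<Rightarrow> nat list
      \<Rightarrow> (real \<Rightarrow> real) \<Rightarrow> real" where
  "malliavin_coeff P f h I \<omega> = iter_partial I f (\<lambda>i. cm_integral P (h i) \<omega>)"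

definition malliavin_norm ::
    "(real \<Rightarrow> real) measure \<Rightarrow> nat \<Rightarrow> ((nat \<Rightarrow> real) \<Rightarrow> real) \<Rightarrow> (nat \<Rightarrow> real \<Rightarrow> real) \<Rightarrow> nat
      \<Rightarrow> (real \<Rightarrow> real) \<Rightarrow> real" where
  "malliavin_norm P n f h k \<omega> =
     sqrt (\<Sum>I\<in>index_tuples n k. \<Sum>J\<in>index_tuples n k.
       malliavin_coeff P f h I \<omega> * malliavin_coeff P f h J \<omega>
         * (\<Prod>l<k. cm_inner (h (I ! l)) (h (J ! l))))"

section \<open>Sobolev spaces\<close>

text \<open>\<open>F\<close> is a smooth functional with Sobolev norm \<open>c\<close>. The derivatives, and hence \<open>c\<close>, do not
  depend on the representation of \<open>F\<close>.\<close>

definition smooth_sobolev_norm ::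
    "(real \<Rightarrow> real) measure \<Rightarrow> real \<Rightarrow> nat \<Rightarrow> ((real \<Rightarrow> real) \<Rightarrow> real) \<Rightarrow> real \<Rightarrow> bool" where
  "smooth_sobolev_norm P p r F c \<longleftrightarrow>
    (\<exists>n f h. smooth_functional P n f h F \<and>
       c = ((\<integral>\<omega>. \<bar>F \<omega>\<bar> powr p \<partial>P)
             + (\<Sum>k=1..r. \<integral>\<omega>. malliavin_norm P n f h k \<omega> powr p \<partial>P)) powr (1 / p))"

text \<open>\<open>\<phi>\<close> belongs to the completion of the smooth functionals, and has norm \<open>c\<close> there: some
  Cauchy sequence of smooth functionals represents it. Since the derivative operators are
  closable, the completion embeds into \<open>L\<^sup>p(P)\<close>; the class of the Cauchy sequence is identified
  with its \<open>L\<^sup>p\<close> limit, and its norm is the limit of the norms.\<close>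

definition sobolev_norm ::
    "(real \<Rightarrow> real) measure \<Rightarrow> real \<Rightarrow> nat \<Rightarrow> ((real \<Rightarrow> real) \<Rightarrow> real) \<Rightarrow> real \<Rightarrow> bool" where
  "sobolev_norm P p r \<phi> c \<longleftrightarrow> \<phi> \<in> borel_measurable P \<and>
    (\<exists>F d. (\<forall>m. smooth_sobolev_norm P p r (F m) (d m)) \<and> d \<longlonglongrightarrow> c \<and>
       (\<forall>\<epsilon>>0. \<exists>M. \<forall>m\<ge>M. \<forall>l\<ge>M.
          \<exists>e<\<epsilon>. smooth_sobolev_norm P p r (\<lambda>\<omega>. F m \<omega> - F l \<omega>) e) \<and>
       (\<lambda>m. \<integral>\<^sup>+\<omega>. ennreal (\<bar>F m \<omega> - \<phi> \<omega>\<bar> powr p) \<partial>P) \<longlonglongrightarrow> 0)"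

section \<open>Capacities\<close>

definition open_capacity ::
    "(real \<Rightarrow> real) measure \<Rightarrow> real \<Rightarrow> nat \<Rightarrow> (real \<Rightarrow> real) set \<Rightarrow> real" where
  "open_capacity P p r U = Inf {c. \<exists>\<phi>. sobolev_norm P p r \<phi> c \<and>
     (AE \<omega> in P. \<omega> \<in> U \<longrightarrow> \<phi> \<omega> \<ge> 1) \<and> (AE \<omega> in P. \<phi> \<omega> \<ge> 0)}"

definition capacity ::
    "(real \<Rightarrow> real) measure \<Rightarrow> real \<Rightarrow> nat \<Rightarrow> (real \<Rightarrow> real) set \<Rightarrow> real" where
  "capacity P p r A = Inf {open_capacity P p r U | U. openin wiener_topology U \<and> A \<subseteq> U}"

definition slim :: "(real \<Rightarrow> real) measure \<Rightarrow> (real \<Rightarrow> real) set \<Rightarrow> bool" where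
  "slim P A \<longleftrightarrow> A \<subseteq> wiener_space \<and> (\<forall>r\<ge>1. \<forall>p>1. capacity P p r A = 0)"

definition quasi_continuous ::
    "(real \<Rightarrow> real) measure \<Rightarrow> ((real \<Rightarrow> real) \<Rightarrow> real) \<Rightarrow> bool" where
  "quasi_continuous P X \<longleftrightarrow>
    (\<forall>r\<ge>1. \<forall>p>1. \<forall>\<epsilon>>0. \<exists>U. openin wiener_topology U \<and> capacity P p r U < \<epsilon> \<and>
       continuous_map (subtopology wiener_topology (wiener_space - U)) euclideanreal X)"

section \<open>Fractional Brownian motion on Wiener space\<close>

text \<open>Used for \<open>0 < H \<le> 1/2\<close> and \<open>0 < s < t\<close> only.\<close>

definition fbm_kernel :: "real \<Rightarrow> real \<Rightarrow> real \<Rightarrow> real" where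
  "fbm_kernel H t s =
    (if H = 1/2 then 1
     else sqrt (2 * H / ((1 - 2 * H) * Beta (1 - 2 * H) (H + 1/2))) *
       ((t / s) powr (H - 1/2) * (t - s) powr (H - 1/2)
        - (H - 1/2) * s powr (1/2 - H)
          * (LINT u:{s..t}|lborel. u powr (H - 3/2) * (u - s) powr (H - 1/2))))"

definition fbm_version ::
    "(real \<Rightarrow> real) measure \<Rightarrow> real \<Rightarrow> (real \<Rightarrow> (real \<Rightarrow> real) \<Rightarrow> real) \<Rightarrow> bool" where
  "fbm_version P H B \<longleftrightarrow>
    (\<forall>t\<ge>0. AE \<omega> in P.
       B t \<omega> = wiener_integral P (\<lambda>s. fbm_kernel H t s * indicator {0<..<t} s) \<omega>) \<and>
    (\<forall>t\<ge>0. quasi_continuous P (B t)) \<and>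
    (\<exists>N. slim P N \<and> (\<forall>\<omega>\<in>wiener_space - N. continuous_on {0..} (\<lambda>t. B t \<omega>)))"

end

theory Submission
  imports Defs
begin

text \<open>
  Fix \<open>\<epsilon>\<close> and let \<open>t\<^sub>m = q\<^sup>m\<close> with \<open>q\<close> small. By quasi-continuity it suffices to find, for every \<open>n\<close>,
  functionals of small \<open>\<D>\<^sup>2\<^sub>1\<close>-norm that are at least \<open>1\<close> where
  \<open>max\<^bsub>n \<le> m \<le> M\<^esub> B(t\<^sub>m) / \<phi>(t\<^sub>m) \<le> 1 - \<epsilon>\<close>, \<open>\<phi>\<close> being the scale of the iterated logarithm. Such functionals
  are smooth cut-offs of (a smooth version of) this maximum: their gradient is bounded by a
  constant, because the gradient of a maximum is a convex combination of the normalised kernels, and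
  lives, up to an arbitrarily small error, where the maximum is at most \<open>1 - \<epsilon> / 2\<close>. That event has
  small probability for large \<open>M\<close>: the part of the Wiener integral \<open>B(t\<^sub>m)\<close> over \<open>(t\<^sub>m\<^sub>+\<^sub>1, t\<^sub>m]\<close> carries
  almost all of the variance \<open>t\<^sub>m\<^sup>2\<^sup>H\<close>, and these parts are independent.
\<close>

section \<open>The Wiener integral\<close>

text \<open>The capacity charges the gradient, and a steep cut-off has a large one. A logistic
  cut-off F of slope \<gamma> satisfies |DF| \<le> \<gamma> F, so its squared norm is at most (1 +
  \<gamma>^2) E[F^2], and E[F^2] is at most 4 times the probability of the bad event plus 4 exp(-2
  \<gamma> \<delta>), where \<delta> is the margin between the levels. This fixes the order of
  choices: \<gamma> so that the exponential beats \<gamma>^2; then the number of times, so that the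
  probability is small compared with 1 / (1 + \<gamma>^2); and the sharpness \<beta> of the smooth
  maximum last. The gradient bound only uses that each kernel divided by \<phi>(t) has norm at most
  1. Norms are computed from representations of functionals, without appeal to their uniqueness.
  Hence (u + v)^2 \<le> 2 u^2 + 2 v^2 takes the place of the triangle inequality, and rates of order
  4^(-j) in countable sums pay for the accumulated factors 2. Independence is used for step
  integrals only, so each Wiener integral is compared with a step integral on its own interval, with
  an error of summable probability.\<close>

lemma finite_grid:
  fixes D :: "real set"
  assumes "finite D" "D \<noteq> {}"
  obtains N \<sigma> where "\<And>i j. i < j \<Longrightarrow> j \<le> N \<Longrightarrow> \<sigma> i < \<sigma> j" "\<sigma> ` {..(N::nat)} = D"
proof -
  let ?l = "sorted_list_of_set D"
  have len: "length ?l = card D" by simp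
  have s: "sorted_wrt (<) ?l" by (rule strict_sorted_list_of_set)
  have c: "card D > 0" using assms by (simp add: card_gt_0_iff)
  have 1: "?l ! i < ?l ! j" if "i < j" "j \<le> card D - 1" for i j
    using sorted_wrt_nth_less[OF s that(1)] that c len by simp
  have "{..card D - 1} = {0..<length ?l}" using c by auto
  then have "(\<lambda>i. ?l ! i) ` {..card D - 1} = set (map (\<lambda>i. ?l ! i) [0..<length ?l])"
    by (simp only: set_map set_upt)
  then have 2: "(\<lambda>i. ?l ! i) ` {..card D - 1} = D"
    using assms(1) by (simp only: map_nth set_sorted_list_of_set)
  show ?thesis using that[of "card D - 1" "(!) ?l"] 1 2 by blast
qed

text \<open>A grid cell lies inside (x, y] exactly when its right endpoint does, because x and y are
  themselves grid points; the selected increments therefore telescope.\<close>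

lemma increment_on_grid:
  fixes \<sigma> :: "nat \<Rightarrow> real"
  assumes \<sigma>: "\<And>i j. i < j \<Longrightarrow> j \<le> N \<Longrightarrow> \<sigma> i < \<sigma> j"
    and "x \<in> \<sigma> ` {..N}" "y \<in> \<sigma> ` {..N}" "x \<le> y"
  shows "(\<Sum>j<N. indicator {x<..y} (\<sigma> (Suc j)) * (f (\<sigma> (Suc j)) - f (\<sigma> j))) = f y - (f x :: real)"
proof -
  obtain p r where p: "p \<le> N" "x = \<sigma> p" and r: "r \<le> N" "y = \<sigma> r" using assms by auto
  have pr: "p \<le> r" using \<sigma>[of r p] p r assms(4) by force
  have less: "\<sigma> i < \<sigma> j \<longleftrightarrow> i < j" if "i \<le> N" "j \<le> N" for i j
    using \<sigma>[of i j] \<sigma>[of j i] that by (cases i j rule: linorder_cases) auto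
  have ind: "indicator {x<..y} (\<sigma> (Suc j)) = (if p \<le> j \<and> j < r then 1 else (0::real))" if "j < N" for j
    using less[of p "Suc j"] less[of r "Suc j"] p r that
    by (auto simp: indicator_def less_Suc_eq_le Suc_le_eq not_le)
  have "(\<Sum>j<N. indicator {x<..y} (\<sigma> (Suc j)) * (f (\<sigma> (Suc j)) - f (\<sigma> j)))
      = (\<Sum>j\<in>{p..<r}. f (\<sigma> (Suc j)) - f (\<sigma> j))"
  proof (rule sum.mono_neutral_cong_right)
    show "{p..<r} \<subseteq> {..<N}" using r by auto
    show "\<forall>i\<in>{..<N} - {p..<r}. indicator {x<..y} (\<sigma> (Suc i)) * (f (\<sigma> (Suc i)) - f (\<sigma> i)) = 0"
      using r(1) by (auto simp: ind)
    show "\<And>i. i \<in> {p..<r} \<Longrightarrow> indicator {x<..y} (\<sigma> (Suc i)) * (f (\<sigma> (Suc i)) - f (\<sigma> i)) =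
              f (\<sigma> (Suc i)) - f (\<sigma> i)"
      using r(1) by (auto simp: ind)
  qed simp
  also have "\<dots> = f y - f x" using pr p r sum_Suc_diff'[of p r "f \<circ> \<sigma>"] by simp
  finally show ?thesis .
qed

text \<open>Repeated points are allowed, unlike in \<open>is_wiener_integral\<close>: clamping a
  partition to an interval moves many of its points to the ends.\<close>

definition partition_upto :: "nat \<Rightarrow> (nat \<Rightarrow> real) \<Rightarrow> bool" where
  "partition_upto n \<tau> \<longleftrightarrow> 0 \<le> \<tau> 0 \<and> (\<forall>i<n. \<tau> i \<le> \<tau> (Suc i))"

lemma partition_upto_mono:
  assumes "partition_upto n \<tau>" "i \<le> j" "j \<le> n" shows "\<tau> i \<le> \<tau> j"
  using assms(2,3)
proof (induction j rule: dec_induct)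
  case (step m)
  then have "\<tau> i \<le> \<tau> m" by simp
  also have "\<tau> m \<le> \<tau> (Suc m)" using step assms(1) unfolding partition_upto_def by simp
  finally show ?case .
qed simp

lemma partition_upto_nonneg: "partition_upto n \<tau> \<Longrightarrow> i \<le> n \<Longrightarrow> 0 \<le> \<tau> i"
  using partition_upto_mono[of n \<tau> 0 i] by (auto simp: partition_upto_def)

text \<open>The step function is constant on every cell of the finer grid, and its value at the
  right endpoint of the cell becomes the new coefficient.\<close>

lemma step_integral_on_grid:
  assumes \<sigma>: "\<And>i j. i < j \<Longrightarrow> j \<le> N \<Longrightarrow> \<sigma> i < \<sigma> j"
    and \<tau>: "partition_upto n \<tau>" "\<tau> ` {..n} \<subseteq> \<sigma> ` {..N}"
  shows "step_integral n a \<tau> \<omega> = step_integral N (\<lambda>j. step_fun n a \<tau> (\<sigma> (Suc j))) \<sigma> \<omega>"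
proof -
  have "step_integral n a \<tau> \<omega> = (\<Sum>i<n. a i *
      (\<Sum>j<N. indicator {\<tau> i<..\<tau> (Suc i)} (\<sigma> (Suc j)) * (\<omega> (\<sigma> (Suc j)) - \<omega> (\<sigma> j))))"
    unfolding step_integral_def
  proof (rule sum.cong[OF refl])
    fix i assume "i \<in> {..<n}"
    then have "\<tau> i \<in> \<sigma> ` {..N}" "\<tau> (Suc i) \<in> \<sigma> ` {..N}" "\<tau> i \<le> \<tau> (Suc i)"
      using \<tau> by (auto simp: partition_upto_def)
    from increment_on_grid[of N \<sigma>, OF \<sigma> this, of \<omega>]
    show "a i * (\<omega> (\<tau> (Suc i)) - \<omega> (\<tau> i)) = a i *
      (\<Sum>j<N. indicator {\<tau> i<..\<tau> (Suc i)} (\<sigma> (Suc j)) * (\<omega> (\<sigma> (Suc j)) - \<omega> (\<sigma> j)))" by simp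
  qed
  also have "\<dots> = step_integral N (\<lambda>j. step_fun n a \<tau> (\<sigma> (Suc j))) \<sigma> \<omega>"
    unfolding step_integral_def step_fun_def sum_distrib_left sum_distrib_right
    by (subst sum.swap) (simp add: mult.assoc)
  finally show ?thesis .
qed

text \<open>A step function is itself a step integral, namely of the path \<open>x \<mapsto> 1[s \<le> x]\<close>.\<close>

lemma step_fun_eq_step_integral:
  assumes "partition_upto n \<tau>"
  shows "step_fun n a \<tau> s = step_integral n a \<tau> (indicator {s..})"
  unfolding step_fun_def step_integral_def
proof (rule sum.cong[OF refl])
  fix i assume "i \<in> {..<n}"
  then have "\<tau> i \<le> \<tau> (Suc i)" using assms by (auto simp: partition_upto_def)
  then show "a i * indicator {\<tau> i<..\<tau> (Suc i)} s = a i * (indicator {s..} (\<tau> (Suc i)) - indicator {s..} (\<tau> i))"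
    by (auto simp: indicator_def)
qed

lemma step_integral_diff_coeff:
  "step_integral n (\<lambda>i. c * a i - d * b i) \<tau> \<omega> = c * step_integral n a \<tau> \<omega> - d * step_integral n b \<tau> \<omega>"
  by (simp add: step_integral_def algebra_simps sum.distrib sum_subtractf sum_distrib_left)

lemma strict_grid_partition:
  assumes "\<And>i j. i < j \<Longrightarrow> j \<le> N \<Longrightarrow> \<sigma> i < \<sigma> j" "\<sigma> ` {..N} \<subseteq> {0..}"
  shows "partition_upto N \<sigma>"
proof -
  have "0 \<le> \<sigma> 0" using assms(2) by auto
  moreover have "\<sigma> i \<le> \<sigma> (Suc i)" if "i < N" for i using assms(1)[of i "Suc i"] that by simp
  ultimately show ?thesis by (simp add: partition_upto_def)
qed

text \<open>Differences of step integrals become single step integrals over strictly increasing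
  times, as the independence in \<open>wiener_measure\<close> requires.\<close>

lemma common_grid:
  assumes "partition_upto n \<tau>" "partition_upto n' \<tau>'"
  obtains N b \<sigma> where "0 \<le> \<sigma> 0" "\<And>i. i < N \<Longrightarrow> \<sigma> i < \<sigma> (Suc i)"
    "\<And>s. step_fun N b \<sigma> s = step_fun n a \<tau> s - step_fun n' a' \<tau>' s"
    "\<And>\<omega>. step_integral N b \<sigma> \<omega> = step_integral n a \<tau> \<omega> - step_integral n' a' \<tau>' \<omega>"
proof -
  obtain N \<sigma> where \<sigma>: "\<And>i j. i < j \<Longrightarrow> j \<le> N \<Longrightarrow> \<sigma> i < \<sigma> j" "\<sigma> ` {..(N::nat)} = \<tau> ` {..n} \<union> \<tau>' ` {..n'}"
    by (rule finite_grid[of "\<tau> ` {..n} \<union> \<tau>' ` {..n'}"]) auto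
  have pos: "\<sigma> ` {..N} \<subseteq> {0..}"
    unfolding \<sigma>(2) using assms partition_upto_nonneg by auto
  have p: "partition_upto N \<sigma>" by (rule strict_grid_partition[OF \<sigma>(1) pos])
  let ?b = "\<lambda>j. step_fun n a \<tau> (\<sigma> (Suc j)) - step_fun n' a' \<tau>' (\<sigma> (Suc j))"
  have I: "step_integral N ?b \<sigma> \<omega> = step_integral n a \<tau> \<omega> - step_integral n' a' \<tau>' \<omega>" for \<omega>
    using step_integral_on_grid[of N \<sigma>, OF \<sigma>(1) assms(1), of a \<omega>]
      step_integral_on_grid[of N \<sigma>, OF \<sigma>(1) assms(2), of a' \<omega>] \<sigma>(2)
      step_integral_diff_coeff[of N 1 _ 1] by simp
  \<comment> \<open>The identity of integrals is algebraic and holds for discontinuous paths too;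
    the path \<open>indicator {s..}\<close> turns it into the identity of step functions.\<close>
  have "step_fun N ?b \<sigma> s = step_fun n a \<tau> s - step_fun n' a' \<tau>' s" for s
    using I[of "indicator {s..}"] step_fun_eq_step_integral[OF p, of ?b s]
      step_fun_eq_step_integral[OF assms(1), of a s] step_fun_eq_step_integral[OF assms(2), of a' s]
    by linarith
  moreover have "\<sigma> i < \<sigma> (Suc i)" if "i < N" for i using \<sigma>(1)[of i "Suc i"] that by simp
  moreover have "0 \<le> \<sigma> 0" using p by (simp add: partition_upto_def)
  ultimately show ?thesis using I that[of \<sigma> N ?b] by blast
qed

lemma partition_upto_strict:
  "0 \<le> \<tau> 0 \<Longrightarrow> (\<And>i. i < n \<Longrightarrow> \<tau> i < \<tau> (Suc i)) \<Longrightarrow> partition_upto n \<tau>"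
  by (auto simp: partition_upto_def less_imp_le)

lemma partition_disjoint:
  assumes "partition_upto n \<tau>" "i < n" "j < n" "i \<noteq> j"
  shows "indicator {\<tau> i<..\<tau> (Suc i)} s * indicator {\<tau> j<..\<tau> (Suc j)} s = (0::real)"
proof -
  have "\<tau> (Suc i) \<le> \<tau> j \<or> \<tau> (Suc j) \<le> \<tau> i"
    using partition_upto_mono[OF assms(1), of "Suc i" j] partition_upto_mono[OF assms(1), of "Suc j" i] assms
    by (cases i j rule: linorder_cases) auto
  then show ?thesis by (auto simp: indicator_def)
qed

lemma step_fun_square:
  assumes "partition_upto n \<tau>"
  shows "(step_fun n a \<tau> s)\<^sup>2 = (\<Sum>i<n. (a i)\<^sup>2 * indicator {\<tau> i<..\<tau> (Suc i)} s)"
proof -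
  have "(step_fun n a \<tau> s)\<^sup>2 = (\<Sum>i<n. \<Sum>j<n. a i * a j * (indicator {\<tau> i<..\<tau> (Suc i)} s * indicator {\<tau> j<..\<tau> (Suc j)} s))"
    unfolding step_fun_def power2_eq_square sum_product by (simp add: algebra_simps)
  also have "\<dots> = (\<Sum>i<n. \<Sum>j<n. if j = i then (a i)\<^sup>2 * indicator {\<tau> i<..\<tau> (Suc i)} s else 0)"
  proof (intro sum.cong refl)
    fix i j assume "i \<in> {..<n}" "j \<in> {..<n}"
    then show "a i * a j * (indicator {\<tau> i<..\<tau> (Suc i)} s * indicator {\<tau> j<..\<tau> (Suc j)} s) =
        (if j = i then (a i)\<^sup>2 * indicator {\<tau> i<..\<tau> (Suc i)} s else 0)"
      using partition_disjoint[OF assms, of i j s]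
      by (cases "j = i") (simp_all add: power2_eq_square indicator_def)
  qed
  also have "\<dots> = (\<Sum>i<n. (a i)\<^sup>2 * indicator {\<tau> i<..\<tau> (Suc i)} s)" by simp
  finally show ?thesis .
qed

lemma step_fun_measurable [measurable]: "step_fun n a \<tau> \<in> borel_measurable borel"
  unfolding step_fun_def[abs_def] by measurable

lemma nn_integral_step_fun_square:
  assumes "partition_upto n \<tau>"
  shows "(\<integral>\<^sup>+s\<in>{0..}. ennreal ((step_fun n a \<tau> s)\<^sup>2) \<partial>lborel) =
    ennreal (\<Sum>i<n. (a i)\<^sup>2 * (\<tau> (Suc i) - \<tau> i))"
proof -
  have le: "0 \<le> \<tau> i" "\<tau> i \<le> \<tau> (Suc i)" if "i < n" for i
    using that partition_upto_nonneg[OF assms, of i] assms by (auto simp: partition_upto_def)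
  have "(\<integral>\<^sup>+s\<in>{0..}. ennreal ((step_fun n a \<tau> s)\<^sup>2) \<partial>lborel) =
     (\<integral>\<^sup>+s. (\<Sum>i<n. ennreal ((a i)\<^sup>2) * indicator {\<tau> i<..\<tau> (Suc i)} s) \<partial>lborel)"
  proof (rule nn_integral_cong)
    fix s
    have "ennreal ((step_fun n a \<tau> s)\<^sup>2) = (\<Sum>i<n. ennreal ((a i)\<^sup>2) * indicator {\<tau> i<..\<tau> (Suc i)} s)"
      unfolding step_fun_square[OF assms]
      by (subst sum_ennreal[symmetric]) (auto simp: indicator_def)
    moreover have "\<dots> = 0" if "s < 0"
      using le that by (intro sum.neutral) (force simp: indicator_def)
    ultimately show "ennreal ((step_fun n a \<tau> s)\<^sup>2) * indicator {0..} s = (\<Sum>i<n. ennreal ((a i)\<^sup>2) * indicator {\<tau> i<..\<tau> (Suc i)} s)"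
      by (cases "s < 0") (auto simp: indicator_def)
  qed
  also have "\<dots> = (\<Sum>i<n. ennreal ((a i)\<^sup>2) * ennreal (\<tau> (Suc i) - \<tau> i))"
    using le by (subst nn_integral_sum) (auto intro!: sum.cong simp: nn_integral_cmult)
  also have "\<dots> = ennreal (\<Sum>i<n. (a i)\<^sup>2 * (\<tau> (Suc i) - \<tau> i))"
    using le by (subst sum_ennreal[symmetric]) (auto simp: ennreal_mult)
  finally show ?thesis .
qed

section \<open>Gaussian laws of step integrals and the Ito isometry\<close>

locale wiener = prob_space P for P :: "(real \<Rightarrow> real) measure" +
  assumes wiener: "wiener_measure P"
begin

lemma increment_normal:
  "0 \<le> s \<Longrightarrow> s < t \<Longrightarrow> distributed P lborel (\<lambda>\<omega>. \<omega> t - \<omega> s) (normal_density 0 (sqrt (t - s)))"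
  using wiener unfolding wiener_measure_def by blast

lemma increments_indep:
  "0 \<le> \<tau> 0 \<Longrightarrow> (\<And>i. i < n \<Longrightarrow> \<tau> i < \<tau> (Suc i)) \<Longrightarrow>
    indep_vars (\<lambda>_. borel) (\<lambda>i \<omega>. \<omega> (\<tau> (Suc i)) - \<omega> (\<tau> i)) {..<n}"
  using wiener unfolding wiener_measure_def by blast

lemma increment_measurable:
  assumes "0 \<le> s" "s \<le> t" shows "(\<lambda>\<omega>. \<omega> t - \<omega> s) \<in> borel_measurable P"
proof (cases "s = t")
  case False
  then have "s < t" using assms by simp
  from increment_normal[OF assms(1) this] show ?thesis
    by (auto simp: distributed_def)
qed simp

lemma step_integral_measurable:
  assumes "partition_upto n \<tau>" shows "step_integral n a \<tau> \<in> borel_measurable P"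
  unfolding step_integral_def[abs_def]
proof (intro borel_measurable_sum borel_measurable_times borel_measurable_const increment_measurable)
  fix i assume "i \<in> {..<n}"
  then show "0 \<le> \<tau> i" "\<tau> i \<le> \<tau> (Suc i)"
    using partition_upto_nonneg[OF assms, of i] assms by (auto simp: partition_upto_def)
qed

text \<open>The centred normal law with variance v. In the degenerate case X vanishes everywhere,
  not merely almost surely: for a step integral over a strict partition, variance zero means that
  all coefficients are zero.\<close>

definition gauss :: "((real \<Rightarrow> real) \<Rightarrow> real) \<Rightarrow> real \<Rightarrow> bool" where
  "gauss X v \<longleftrightarrow> (if v = 0 then \<forall>\<omega>. X \<omega> = 0
     else v > 0 \<and> distributed P lborel X (normal_density 0 (sqrt v)))"

lemma step_integral_gauss:
  assumes "0 \<le> \<tau> 0" "\<And>i. i < n \<Longrightarrow> \<tau> i < \<tau> (Suc i)"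
  shows "gauss (step_integral n a \<tau>) (\<Sum>i<n. (a i)\<^sup>2 * (\<tau> (Suc i) - \<tau> i))"
proof -
  \<comment> \<open>Terms with coefficient zero are removed first, since
    \<open>sum_indep_normal\<close> requires positive standard deviations.\<close>
  define I where "I = {i. i < n \<and> a i \<noteq> 0}"
  have I: "finite I" "I \<subseteq> {..<n}" by (auto simp: I_def)
  have pos: "0 \<le> \<tau> i" if "i < n" for i
    using partition_upto_nonneg[OF partition_upto_strict[of \<tau> n], of i] assms that by auto
  have X: "step_integral n a \<tau> = (\<lambda>\<omega>. \<Sum>i\<in>I. a i * (\<omega> (\<tau> (Suc i)) - \<omega> (\<tau> i)))"
    unfolding step_integral_def[abs_def]
    by (intro ext sum.mono_neutral_right) (auto simp: I_def)
  have v: "(\<Sum>i<n. (a i)\<^sup>2 * (\<tau> (Suc i) - \<tau> i)) = (\<Sum>i\<in>I. (a i)\<^sup>2 * (\<tau> (Suc i) - \<tau> i))"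
    by (intro sum.mono_neutral_right) (auto simp: I_def)
  show ?thesis
  proof (cases "I = {}")
    case True then show ?thesis unfolding v X gauss_def by simp
  next
    case False
    have p: "(\<Sum>i\<in>I. (a i)\<^sup>2 * (\<tau> (Suc i) - \<tau> i)) > 0"
      by (rule sum_pos) (use I False assms in \<open>auto simp: I_def\<close>)
    have "indep_vars (\<lambda>_. borel) (\<lambda>i \<omega>. \<omega> (\<tau> (Suc i)) - \<omega> (\<tau> i)) I"
      by (rule indep_vars_subset[OF increments_indep[of \<tau> n, OF assms] I(2)])
    then have ind: "indep_vars (\<lambda>_. borel) (\<lambda>i \<omega>. a i * (\<omega> (\<tau> (Suc i)) - \<omega> (\<tau> i))) I"
      by (rule indep_vars_compose2[where Y="\<lambda>i x. a i * x"]) simp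
    have "distributed P lborel (\<lambda>\<omega>. \<Sum>i\<in>I. a i * (\<omega> (\<tau> (Suc i)) - \<omega> (\<tau> i)))
       (normal_density (\<Sum>i\<in>I. 0) (sqrt (\<Sum>i\<in>I. (\<bar>a i\<bar> * sqrt (\<tau> (Suc i) - \<tau> i))\<^sup>2)))"
    proof (rule sum_indep_normal[OF I(1) False ind])
      fix i assume i: "i \<in> I"
      then have "i < n" "a i \<noteq> 0" by (auto simp: I_def)
      then show "0 < \<bar>a i\<bar> * sqrt (\<tau> (Suc i) - \<tau> i)" using assms by simp
      show "distributed P lborel (\<lambda>\<omega>. a i * (\<omega> (\<tau> (Suc i)) - \<omega> (\<tau> i))) (normal_density 0 (\<bar>a i\<bar> * sqrt (\<tau> (Suc i) - \<tau> i)))"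
        using normal_density_affine[OF increment_normal[OF pos[OF \<open>i<n\<close>] assms(2)[OF \<open>i<n\<close>]], of "a i" 0]
          \<open>a i \<noteq> 0\<close> assms(2)[OF \<open>i<n\<close>] by simp
    qed
    moreover have "(\<Sum>i\<in>I. (\<bar>a i\<bar> * sqrt (\<tau> (Suc i) - \<tau> i))\<^sup>2) = (\<Sum>i\<in>I. (a i)\<^sup>2 * (\<tau> (Suc i) - \<tau> i))"
      using assms I by (intro sum.cong) (auto simp: power_mult_distrib less_imp_le)
    ultimately show ?thesis using p unfolding gauss_def X v by simp
  qed
qed

text \<open>The case \<open>k = 1\<close> is the Ito isometry; all \<open>k\<close> are needed
  because the functions in smooth functionals may grow polynomially.\<close>

lemma gauss_even_moment:
  assumes "gauss X v"
  shows "(\<integral>\<^sup>+\<omega>. ennreal (X \<omega> ^ (2 * k)) \<partial>P) = ennreal (fact (2 * k) / (2 ^ k * fact k) * v ^ k)"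
proof (cases "v = 0")
  case True
  with assms show ?thesis
    by (cases "k = 0") (auto simp: gauss_def emeasure_space_1 zero_power)
next
  case False
  with assms have v: "v > 0" and d: "distributed P lborel X (normal_density 0 (sqrt v))"
    by (auto simp: gauss_def)
  have hb: "has_bochner_integral lborel (\<lambda>x. normal_density 0 (sqrt v) x * (x - 0) ^ (2 * k))
      (fact (2 * k) / ((2 / (sqrt v)\<^sup>2)^k * fact k))"
    by (rule normal_moment_even) (use v in simp)
  have "(\<integral>\<^sup>+\<omega>. ennreal (X \<omega> ^ (2 * k)) \<partial>P) = (\<integral>\<^sup>+x. ennreal (normal_density 0 (sqrt v) x) * ennreal (x ^ (2 * k)) \<partial>lborel)"
    by (rule distributed_nn_integral[OF d, symmetric]) simp
  also have "\<dots> = (\<integral>\<^sup>+x. ennreal (normal_density 0 (sqrt v) x * (x - 0) ^ (2 * k)) \<partial>lborel)"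
    by (intro nn_integral_cong) (simp add: ennreal_mult')
  also have "\<dots> = ennreal (fact (2 * k) / ((2 / (sqrt v)\<^sup>2)^k * fact k))"
    by (subst nn_integral_eq_integral[OF integrable.intros[OF hb]])
      (simp_all only: has_bochner_integral_integral_eq[OF hb], auto)
  also have "fact (2 * k) / ((2 / (sqrt v)\<^sup>2)^k * fact k) = fact (2 * k) / (2 ^ k * fact k) * v ^ k"
    using v by (simp add: power_divide field_simps)
  finally show ?thesis .
qed

text \<open>Over a common grid the difference is one centred Gaussian step integral. Its second
  moment is its variance, which is also the squared norm of the difference of the step
  functions.\<close>

lemma nn_integral_step_integral_diff:
  assumes "partition_upto n \<tau>" "partition_upto n' \<tau>'"
  shows "(\<integral>\<^sup>+\<omega>. ennreal ((step_integral n a \<tau> \<omega> - step_integral n' a' \<tau>' \<omega>)\<^sup>2) \<partial>P) =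
    (\<integral>\<^sup>+s\<in>{0..}. ennreal ((step_fun n a \<tau> s - step_fun n' a' \<tau>' s)\<^sup>2) \<partial>lborel)"
proof -
  obtain N b \<sigma> where g: "0 \<le> \<sigma> 0" "\<And>i. i < N \<Longrightarrow> \<sigma> i < \<sigma> (Suc i)"
    and f: "\<And>s. step_fun N b \<sigma> s = step_fun n a \<tau> s - step_fun n' a' \<tau>' s"
      "\<And>\<omega>. step_integral N b \<sigma> \<omega> = step_integral n a \<tau> \<omega> - step_integral n' a' \<tau>' \<omega>"
    using common_grid[OF assms] by metis
  show ?thesis
    using gauss_even_moment[OF step_integral_gauss[of \<sigma> N b, OF g], of 1]
      nn_integral_step_fun_square[OF partition_upto_strict[of \<sigma> N, OF g], of b]
    unfolding f by (simp add: numeral_2_eq_2)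
qed

lemma nn_integral_step_integral:
  assumes "partition_upto n \<tau>"
  shows "(\<integral>\<^sup>+\<omega>. ennreal ((step_integral n a \<tau> \<omega>)\<^sup>2) \<partial>P) =
    (\<integral>\<^sup>+s\<in>{0..}. ennreal ((step_fun n a \<tau> s)\<^sup>2) \<partial>lborel)"
  using nn_integral_step_integral_diff[OF assms, of 0 "\<lambda>_. 0" a "\<lambda>_. 0"]
  by (simp add: partition_upto_def step_integral_def step_fun_def)

end

section \<open>Density of step functions in L^2\<close>

lemma square_diff_le: "((x::real) - y)\<^sup>2 \<le> 2 * (x - z)\<^sup>2 + 2 * (z - y)\<^sup>2"
  using sum_squares_ge_zero[of "x - z - (z - y)" 0] by (simp add: power2_eq_square algebra_simps)

text \<open>This stands in for the triangle inequality in L^2. The factor 2 is harmless wherever the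
  lemma is applied, and square roots of possibly infinite integrals are avoided.\<close>

lemma nn_integral_square_diff_le:
  fixes f g h :: "'a \<Rightarrow> real"
  assumes [measurable]: "f \<in> borel_measurable M" "g \<in> borel_measurable M" "h \<in> borel_measurable M"
  shows "(\<integral>\<^sup>+x. ennreal ((f x - h x)\<^sup>2) \<partial>M) \<le>
    2 * (\<integral>\<^sup>+x. ennreal ((f x - g x)\<^sup>2) \<partial>M) + 2 * (\<integral>\<^sup>+x. ennreal ((g x - h x)\<^sup>2) \<partial>M)"
proof -
  have "(\<integral>\<^sup>+x. ennreal ((f x - h x)\<^sup>2) \<partial>M) \<le> (\<integral>\<^sup>+x. 2 * ennreal ((f x - g x)\<^sup>2) + 2 * ennreal ((g x - h x)\<^sup>2) \<partial>M)"
  proof (rule nn_integral_mono)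
    fix x
    have "ennreal ((f x - h x)\<^sup>2) \<le> ennreal (2 * (f x - g x)\<^sup>2 + 2 * (g x - h x)\<^sup>2)"
      by (rule ennreal_leI[OF square_diff_le])
    also have "\<dots> = 2 * ennreal ((f x - g x)\<^sup>2) + 2 * ennreal ((g x - h x)\<^sup>2)"
      by (simp add: ennreal_mult)
    finally show "ennreal ((f x - h x)\<^sup>2) \<le> 2 * ennreal ((f x - g x)\<^sup>2) + 2 * ennreal ((g x - h x)\<^sup>2)" .
  qed
  also have "\<dots> = 2 * (\<integral>\<^sup>+x. ennreal ((f x - g x)\<^sup>2) \<partial>M) + 2 * (\<integral>\<^sup>+x. ennreal ((g x - h x)\<^sup>2) \<partial>M)"
    by (simp add: nn_integral_add nn_integral_cmult)
  finally show ?thesis .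
qed

lemma nn_integral_dominated_to_zero:
  fixes u :: "nat \<Rightarrow> 'a \<Rightarrow> real"
  assumes [measurable]: "\<And>i. u i \<in> borel_measurable M" and w: "integrable M w"
    and b: "\<And>i x. x \<in> space M \<Longrightarrow> \<bar>u i x\<bar> \<le> w x" and l: "AE x in M. (\<lambda>i. u i x) \<longlonglongrightarrow> 0"
    and nn: "\<And>i x. 0 \<le> u i x"
  shows "(\<lambda>i. \<integral>\<^sup>+x. ennreal (u i x) \<partial>M) \<longlonglongrightarrow> 0"
proof -
  have [measurable]: "w \<in> borel_measurable M" using w by auto
  have fin: "(\<integral>\<^sup>+x. ennreal (w x) \<partial>M) < \<infinity>"
  proof -
    have "(\<integral>\<^sup>+x. ennreal (w x) \<partial>M) \<le> (\<integral>\<^sup>+x. ennreal (norm (w x)) \<partial>M)"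
      by (intro nn_integral_mono ennreal_leI) simp
    also have "\<dots> < \<infinity>" using w by (simp add: integrable_iff_bounded)
    finally show ?thesis .
  qed
  have "(\<lambda>i. \<integral>\<^sup>+x. ennreal (u i x) \<partial>M) \<longlonglongrightarrow> (\<integral>\<^sup>+x. 0 \<partial>M)"
  proof (rule nn_integral_dominated_convergence[where w="\<lambda>x. ennreal (w x)"])
    show "AE x in M. ennreal (u i x) \<le> ennreal (w x)" for i
    proof (rule AE_I2, rule ennreal_leI)
      fix x assume "x \<in> space M"
      from b[OF this, of i] show "u i x \<le> w x" by linarith
    qed
    show "AE x in M. (\<lambda>i. ennreal (u i x)) \<longlonglongrightarrow> 0"
      using l
    proof eventually_elim
      fix x assume "(\<lambda>i. u i x) \<longlonglongrightarrow> 0"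
      from tendsto_ennrealI[OF this] show "(\<lambda>i. ennreal (u i x)) \<longlonglongrightarrow> 0" by simp
    qed
  qed (use fin in auto)
  then show ?thesis by simp
qed

text \<open>The cells are open on the left, so s lies in the cell with number ceiling(s n) - 1, and
  the value taken is that of c at the left endpoint of this cell.\<close>

lemma step_fun_uniform:
  fixes c :: "real \<Rightarrow> real"
  assumes n: "n > (0::nat)"
  shows "step_fun (T * n) (\<lambda>i. c (i / n)) (\<lambda>i. i / n) s =
    (if 0 < s \<and> s \<le> T then c ((real_of_int \<lceil>s * n\<rceil> - 1) / n) else 0)"
proof -
  define k where "k = \<lceil>s * n\<rceil>"
  have k: "real_of_int k - 1 < s * n" "s * n \<le> k" unfolding k_def by linarith+
  have mem: "s \<in> {real i / n<..real (Suc i) / n} \<longleftrightarrow> int i = k - 1" for i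
  proof -
    have "s \<in> {real i / n<..real (Suc i) / n} \<longleftrightarrow> real i < s * n \<and> s * n \<le> real (Suc i)"
      using n by (simp only: greaterThanAtMost_iff pos_divide_less_eq pos_le_divide_eq of_nat_0_less_iff)
    also have "\<dots> \<longleftrightarrow> int i = k - 1"
      unfolding k_def using ceiling_eq_iff[of "s * n" "int i + 1"] by auto
    finally show ?thesis .
  qed
  show ?thesis
  proof (cases "0 < s \<and> s \<le> T")
    case True
    then have "0 < s * n" "s * n \<le> T * n" using n by auto
    then have "0 < k" "k \<le> T * n"
      unfolding k_def by (simp, metis ceiling_le_iff of_int_of_nat_eq of_nat_mult)
    then have i: "nat (k - 1) < T * n" "int (nat (k - 1)) = k - 1" by linarith+
    have "step_fun (T * n) (\<lambda>i. c (i / n)) (\<lambda>i. i / n) s = (\<Sum>i<T*n. if i = nat (k - 1) then c (i / n) else 0)"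
      unfolding step_fun_def indicator_def
    proof (rule sum.cong[OF refl])
      fix i
      have "int i = k - 1 \<longleftrightarrow> i = nat (k - 1)" using \<open>0 < k\<close> by linarith
      then show "c (real i / real n) * of_bool (s \<in> {real i / real n<..real (Suc i) / real n}) =
          (if i = nat (k - 1) then c (real i / real n) else 0)"
        unfolding mem by simp
    qed
    also have "\<dots> = c (real (nat (k - 1)) / n)" using i(1) by (simp only: sum.delta finite_lessThan lessThan_iff if_True)
    also have "real (nat (k - 1)) = real_of_int k - 1" using i(2) by linarith
    finally show ?thesis using True by (simp add: k_def)
  next
    case False
    have "i / n < s \<and> s \<le> Suc i / n \<longrightarrow> 0 < s \<and> s \<le> T" if "i < T * n" for i
    proof -
      have "Suc i \<le> T * n" using that by simp
      then have "real (Suc i) / n \<le> T" using n by (metis divide_le_eq of_nat_0_less_iff of_nat_le_iff of_nat_mult)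
      moreover have "0 \<le> real i / n" by simp
      ultimately show ?thesis by linarith
    qed
    with False show ?thesis by (auto simp: step_fun_def indicator_def intro!: sum.neutral)
  qed
qed

lemma step_fun_uniform_tendsto:
  fixes c :: "real \<Rightarrow> real"
  assumes c: "continuous_on UNIV c" and s: "0 < s" "s \<le> real T"
  shows "(\<lambda>n. step_fun (T * Suc n) (\<lambda>i. c (i / Suc n)) (\<lambda>i. i / Suc n) s) \<longlonglongrightarrow> c s"
proof -
  have "(\<lambda>n. (real_of_int \<lceil>s * Suc n\<rceil> - 1) / Suc n) \<longlonglongrightarrow> s"
  proof (rule tendsto_sandwich[where f="\<lambda>n. s - 1 / Suc n" and h="\<lambda>n. s"])
    show "\<forall>\<^sub>F n in sequentially. s - 1 / Suc n \<le> (real_of_int \<lceil>s * Suc n\<rceil> - 1) / Suc n"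
    proof (intro always_eventually allI)
      fix n
      have "s * Suc n - 1 \<le> real_of_int \<lceil>s * Suc n\<rceil> - 1" by linarith
      then have "(s * Suc n - 1) / Suc n \<le> (real_of_int \<lceil>s * Suc n\<rceil> - 1) / Suc n"
        by (rule divide_right_mono) simp
      moreover have "(s * Suc n - 1) / Suc n = s - 1 / Suc n" by (simp add: diff_divide_distrib)
      ultimately show "s - 1 / Suc n \<le> (real_of_int \<lceil>s * Suc n\<rceil> - 1) / Suc n" by simp
    qed
    show "\<forall>\<^sub>F n in sequentially. (real_of_int \<lceil>s * Suc n\<rceil> - 1) / Suc n \<le> s"
    proof (intro always_eventually allI)
      fix n
      have "real_of_int \<lceil>s * Suc n\<rceil> - 1 \<le> s * Suc n" by linarith
      then have "(real_of_int \<lceil>s * Suc n\<rceil> - 1) / Suc n \<le> (s * Suc n) / Suc n"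
        by (rule divide_right_mono) simp
      then show "(real_of_int \<lceil>s * Suc n\<rceil> - 1) / Suc n \<le> s" by simp
    qed
    show "(\<lambda>n. s - 1 / Suc n) \<longlonglongrightarrow> s"
      using tendsto_diff[OF tendsto_const[of s] LIMSEQ_inverse_real_of_nat] by (simp add: inverse_eq_divide)
  qed simp
  then have "(\<lambda>n. c ((real_of_int \<lceil>s * Suc n\<rceil> - 1) / Suc n)) \<longlonglongrightarrow> c s"
    by (rule continuous_on_tendsto_compose[OF c]) auto
  then show ?thesis using s step_fun_uniform[OF zero_less_Suc, of T _ c s] by (simp only: if_True simp_thms)
qed

text \<open>Left-endpoint step functions converge pointwise on (0, T] by continuity, and the bound C
  supplies the dominating function.\<close>

lemma step_approx_continuous:
  fixes c :: "real \<Rightarrow> real"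
  assumes c: "continuous_on UNIV c" and b: "\<And>s. \<bar>c s\<bar> \<le> C" and e: "0 < e"
  obtains n a \<tau> where "0 \<le> \<tau> 0" "\<And>i. i < n \<Longrightarrow> \<tau> i < \<tau> (Suc i)"
    "(\<integral>\<^sup>+s\<in>{0..}. ennreal ((indicator {0<..real T} s * c s - step_fun n a \<tau> s)\<^sup>2) \<partial>lborel) < e"
proof -
  have [measurable]: "c \<in> borel_measurable borel" using c by (rule borel_measurable_continuous_onI)
  define S where "S n = step_fun (T * Suc n) (\<lambda>i. c (i / Suc n)) (\<lambda>i. i / Suc n)" for n
  define r where "r n s = (real_of_int \<lceil>s * real (Suc n)\<rceil> - 1) / real (Suc n)" for n s
  have S: "S n s = (if 0 < s \<and> s \<le> T then c (r n s) else 0)" for n s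
    unfolding S_def r_def by (rule step_fun_uniform) simp
  have [measurable]: "S n \<in> borel_measurable borel" for n by (simp add: S_def step_fun_measurable)
  define u where "u n s = (indicator {0<..real T} s * c s - S n s)\<^sup>2 * indicator {0..} s" for n s
  have "(\<lambda>n. \<integral>\<^sup>+s. ennreal (u n s) \<partial>lborel) \<longlonglongrightarrow> 0"
  proof (rule nn_integral_dominated_to_zero[where w="\<lambda>s. (2 * C)\<^sup>2 * indicator {0..real T} s"])
    fix n s
    show "\<bar>u n s\<bar> \<le> (2 * C)\<^sup>2 * indicator {0..real T} s"
    proof (cases "0 < s \<and> s \<le> T")
      case True
      have "\<bar>c s - c (r n s)\<bar> \<le> \<bar>2 * C\<bar>"
        using b[of s] b[of "r n s"] by linarith
      then have "(c s - c (r n s))\<^sup>2 \<le> (2 * C)\<^sup>2" by (simp only: abs_le_square_iff)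
      then show ?thesis using True by (simp add: u_def S)
    next
      case False
      then show ?thesis by (auto simp: u_def S indicator_def)
    qed
  next
    have "(\<lambda>n. u n s) \<longlonglongrightarrow> 0" for s
    proof (cases "0 < s \<and> s \<le> T")
      case True
      then have "(\<lambda>n. S n s) \<longlonglongrightarrow> c s" unfolding S_def by (intro step_fun_uniform_tendsto c) auto
      then have "(\<lambda>n. (c s - S n s)\<^sup>2) \<longlonglongrightarrow> (c s - c s)\<^sup>2"
        by (intro tendsto_intros)
      with True show ?thesis by (simp add: u_def)
    next
      case False
      then have "u n s = 0" for n by (auto simp: u_def S)
      then show ?thesis by simp
    qed
    then show "AE s in lborel. (\<lambda>n. u n s) \<longlonglongrightarrow> 0" by simp
    show "integrable lborel (\<lambda>s. (2 * C)\<^sup>2 * indicator {0..real T} s)" by simp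
    show "u n \<in> borel_measurable lborel" for n unfolding u_def[abs_def] by measurable
    show "0 \<le> u n s" for n s by (simp add: u_def)
  qed
  from order_tendstoD(2)[OF this e] obtain n where n: "(\<integral>\<^sup>+s. ennreal (u n s) \<partial>lborel) < e"
    by (auto simp: eventually_sequentially)
  have "(\<integral>\<^sup>+s\<in>{0..}. ennreal ((indicator {0<..real T} s * c s - S n s)\<^sup>2) \<partial>lborel) = (\<integral>\<^sup>+s. ennreal (u n s) \<partial>lborel)"
    unfolding u_def by (intro nn_integral_cong) (simp add: indicator_def)
  then have "(\<integral>\<^sup>+s\<in>{0..}. ennreal ((indicator {0<..real T} s * c s - S n s)\<^sup>2) \<partial>lborel) < e" using n by simp
  then show ?thesis unfolding S_def
    by (rule that[rotated -1]) (auto simp: divide_strict_right_mono)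
qed

lemma numeral_mult_ennreal: "0 \<le> x \<Longrightarrow> numeral w * ennreal x = ennreal (numeral w * x)"
  by (simp add: ennreal_mult)

text \<open>Cutting g off in range and domain comes first, because the later errors are then bounded
  by a multiple of the indicator of [0, N]. The continuous approximants are clamped in the same way,
  which keeps them continuous.\<close>

lemma step_approx_L2:
  fixes g :: "real \<Rightarrow> real"
  assumes g [measurable]: "g \<in> borel_measurable borel" and e: "0 < (e::real)"
    and fin: "(\<integral>\<^sup>+s\<in>{0..}. ennreal ((g s)\<^sup>2) \<partial>lborel) < \<infinity>"
  obtains n a \<tau> where "0 \<le> \<tau> 0" "\<And>i. i < n \<Longrightarrow> \<tau> i < \<tau> (Suc i)"
    "(\<integral>\<^sup>+s\<in>{0..}. ennreal ((g s - step_fun n a \<tau> s)\<^sup>2) \<partial>lborel) < ennreal e"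
proof -
  define clamp where "clamp N x = max (- real N) (min (real N) x)" for N :: nat and x :: real
  have clamp_b: "\<bar>clamp N x\<bar> \<le> N" for N x unfolding clamp_def by linarith
  have clamp_c: "continuous_on A (clamp N)" for A N unfolding clamp_def by (intro continuous_intros)
  have [measurable]: "clamp N \<in> borel_measurable borel" for N
    by (rule borel_measurable_continuous_onI[OF clamp_c])
  have g2: "integrable lborel (\<lambda>s. (g s)\<^sup>2 * indicator {0..} s)"
  proof (rule integrableI_bounded)
    have "(\<integral>\<^sup>+s. ennreal (norm ((g s)\<^sup>2 * indicator {0..} s)) \<partial>lborel) = (\<integral>\<^sup>+s\<in>{0..}. ennreal ((g s)\<^sup>2) \<partial>lborel)"
      by (intro nn_integral_cong) (simp add: indicator_def)
    with fin show "(\<integral>\<^sup>+s. ennreal (norm ((g s)\<^sup>2 * indicator {0..} s)) \<partial>lborel) < \<infinity>" by simp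
  qed simp
  have set_eq: "(\<integral>\<^sup>+s\<in>{0..}. ennreal ((f s)\<^sup>2) \<partial>lborel) = (\<integral>\<^sup>+s. ennreal ((f s)\<^sup>2 * indicator {0..} s) \<partial>lborel)" for f :: "real \<Rightarrow> real"
    by (intro nn_integral_cong) (simp add: indicator_def)
  \<comment> \<open>Three errors are combined by \<open>nn_integral_square_diff_le\<close> with
    total weight 2 + 4 + 4 = 10, so e / 16 for each of them stays below e.\<close>
  have ew: "0 < ennreal (e / 16)" using e by simp
  have "(\<lambda>N. \<integral>\<^sup>+s. ennreal ((g s - indicator {0<..real N} s * clamp N (g s))\<^sup>2 * indicator {0..} s) \<partial>lborel) \<longlonglongrightarrow> 0"
  proof (rule nn_integral_dominated_to_zero[OF _ g2])
    fix N s
    have "\<bar>g s - indicator {0<..real N} s * clamp N (g s)\<bar> \<le> \<bar>g s\<bar>"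
      by (auto simp: indicator_def clamp_def)
    then have "(g s - indicator {0<..real N} s * clamp N (g s))\<^sup>2 \<le> (g s)\<^sup>2"
      by (simp add: abs_le_square_iff)
    then show "\<bar>(g s - indicator {0<..real N} s * clamp N (g s))\<^sup>2 * indicator {0..} s\<bar> \<le> (g s)\<^sup>2 * indicator {0..} s"
      by (simp add: indicator_def)
  next
    show "AE s in lborel. (\<lambda>N. (g s - indicator {0<..real N} s * clamp N (g s))\<^sup>2 * indicator {0..} s) \<longlonglongrightarrow> 0"
      using AE_lborel_singleton[of "0::real"]
    proof eventually_elim
      fix s :: real assume s: "s \<noteq> 0"
      obtain N0 where N0: "real N0 \<ge> max \<bar>g s\<bar> s" using real_arch_simple by blast
      have "(g s - indicator {0<..real N} s * clamp N (g s))\<^sup>2 * indicator {0..} s = 0" if "N \<ge> N0" for N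
      proof -
        have "real N \<ge> real N0" using that by simp
        then have "clamp N (g s) = g s" "s \<le> N" using N0 unfolding clamp_def by linarith+
        then show ?thesis using s by (auto simp: indicator_def)
      qed
      then show "(\<lambda>N. (g s - indicator {0<..real N} s * clamp N (g s))\<^sup>2 * indicator {0..} s) \<longlonglongrightarrow> 0"
        by (intro tendsto_eventually eventually_sequentiallyI)
    qed
  qed auto
  from order_tendstoD(2)[OF this ew] obtain N where
    N: "(\<integral>\<^sup>+s. ennreal ((g s - indicator {0<..real N} s * clamp N (g s))\<^sup>2 * indicator {0..} s) \<partial>lborel) < ennreal (e / 16)"
    by (auto simp: eventually_sequentially)
  text \<open>A measurable function is an a.e. limit of continuous ones.\<close>
  have "g \<in> borel_measurable lebesgue" using g by (simp add: measurable_completion)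
  then have "g measurable_on UNIV"
    by (rule lebesgue_measurable_imp_measurable_on) simp
  then obtain Z c where Z: "negligible Z" and c: "\<And>n. continuous_on UNIV (c n)"
     and cl: "\<And>x. x \<notin> Z \<Longrightarrow> (\<lambda>n. c n x) \<longlonglongrightarrow> g x"
    unfolding measurable_on_def by auto
  have [measurable]: "c n \<in> borel_measurable borel" for n using c by (rule borel_measurable_continuous_onI)
  have "(\<lambda>n. \<integral>\<^sup>+s. ennreal ((indicator {0<..real N} s * clamp N (g s) - indicator {0<..real N} s * clamp N (c n s))\<^sup>2 * indicator {0..} s) \<partial>lborel) \<longlonglongrightarrow> 0"
  proof (rule nn_integral_dominated_to_zero[where w="\<lambda>s. (2 * real N)\<^sup>2 * indicator {0..real N} s"])
    fix n s
    have "\<bar>clamp N (g s) - clamp N (c n s)\<bar> \<le> \<bar>2 * real N\<bar>"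
      using clamp_b[of N "g s"] clamp_b[of N "c n s"] by linarith
    then have "(clamp N (g s) - clamp N (c n s))\<^sup>2 \<le> (2 * real N)\<^sup>2" by (subst (asm) abs_le_square_iff)
    then show "\<bar>(indicator {0<..real N} s * clamp N (g s) - indicator {0<..real N} s * clamp N (c n s))\<^sup>2 * indicator {0..} s\<bar>
      \<le> (2 * real N)\<^sup>2 * indicator {0..real N} s" by (auto simp: indicator_def)
  next
    have "AE s in lebesgue. s \<notin> Z" using Z by (simp add: AE_not_in negligible_iff_null_sets)
    then have "AE s in lborel. s \<notin> Z" by (simp add: AE_completion_iff)
    then show "AE s in lborel. (\<lambda>n. (indicator {0<..real N} s * clamp N (g s) - indicator {0<..real N} s * clamp N (c n s))\<^sup>2 * indicator {0..} s) \<longlonglongrightarrow> 0"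
    proof eventually_elim
      fix s assume "s \<notin> Z"
      have "(\<lambda>n. clamp N (c n s)) \<longlonglongrightarrow> clamp N (g s)"
        by (rule continuous_on_tendsto_compose[OF clamp_c[of UNIV] cl[OF \<open>s \<notin> Z\<close>]]) auto
      then have "(\<lambda>n. (indicator {0<..real N} s * clamp N (g s) - indicator {0<..real N} s * clamp N (c n s))\<^sup>2 * indicator {0..} s)
        \<longlonglongrightarrow> (indicator {0<..real N} s * clamp N (g s) - indicator {0<..real N} s * clamp N (g s))\<^sup>2 * indicator {0..} s"
        by (intro tendsto_intros)
      then show "(\<lambda>n. (indicator {0<..real N} s * clamp N (g s) - indicator {0<..real N} s * clamp N (c n s))\<^sup>2 * indicator {0..} s) \<longlonglongrightarrow> 0"
        by simp
    qed
  qed auto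
  from order_tendstoD(2)[OF this ew] obtain n where
    n: "(\<integral>\<^sup>+s. ennreal ((indicator {0<..real N} s * clamp N (g s) - indicator {0<..real N} s * clamp N (c n s))\<^sup>2 * indicator {0..} s) \<partial>lborel) < ennreal (e / 16)"
    by (auto simp: eventually_sequentially)
  have "continuous_on UNIV (\<lambda>s. clamp N (c n s))"
    using continuous_on_compose2[OF clamp_c[of UNIV] c] by auto
  then obtain m a \<tau> where s: "0 \<le> \<tau> 0" "\<And>i. i < m \<Longrightarrow> \<tau> i < \<tau> (Suc i)"
    and "(\<integral>\<^sup>+s\<in>{0..}. ennreal ((indicator {0<..real N} s * clamp N (c n s) - step_fun m a \<tau> s)\<^sup>2) \<partial>lborel) < ennreal (e / 16)"
    by (rule step_approx_continuous[where c="\<lambda>s. clamp N (c n s)" and T=N, OF _ clamp_b ew]) blast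
  then have m: "(\<integral>\<^sup>+s. ennreal ((indicator {0<..real N} s * clamp N (c n s) - step_fun m a \<tau> s)\<^sup>2 * indicator {0..} s) \<partial>lborel) < ennreal (e / 16)"
    by (simp only: set_eq)
  have sq: "(\<integral>\<^sup>+s. ennreal ((f s - h s)\<^sup>2 * indicator {0..} s) \<partial>lborel) \<le>
      2 * (\<integral>\<^sup>+s. ennreal ((f s - k s)\<^sup>2 * indicator {0..} s) \<partial>lborel) + 2 * (\<integral>\<^sup>+s. ennreal ((k s - h s)\<^sup>2 * indicator {0..} s) \<partial>lborel)"
    if [measurable]: "f \<in> borel_measurable borel" "h \<in> borel_measurable borel" "k \<in> borel_measurable borel" for f h k :: "real \<Rightarrow> real"
  proof -
    have eq: "(\<integral>\<^sup>+s. ennreal ((u s - v s)\<^sup>2 * indicator {0..} s) \<partial>lborel) = (\<integral>\<^sup>+s. ennreal ((u s * indicator {0..} s - v s * indicator {0..} s)\<^sup>2) \<partial>lborel)"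
      for u v :: "real \<Rightarrow> real" by (intro nn_integral_cong) (simp add: indicator_def)
    show ?thesis unfolding eq by (rule nn_integral_square_diff_le) auto
  qed
  have "(\<integral>\<^sup>+s. ennreal ((g s - step_fun m a \<tau> s)\<^sup>2 * indicator {0..} s) \<partial>lborel) \<le>
     2 * (\<integral>\<^sup>+s. ennreal ((g s - indicator {0<..real N} s * clamp N (g s))\<^sup>2 * indicator {0..} s) \<partial>lborel) +
     2 * (2 * (\<integral>\<^sup>+s. ennreal ((indicator {0<..real N} s * clamp N (g s) - indicator {0<..real N} s * clamp N (c n s))\<^sup>2 * indicator {0..} s) \<partial>lborel)
     + 2 * (\<integral>\<^sup>+s. ennreal ((indicator {0<..real N} s * clamp N (c n s) - step_fun m a \<tau> s)\<^sup>2 * indicator {0..} s) \<partial>lborel))"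
    by (rule order_trans[OF sq[where k="\<lambda>s. indicator {0<..real N} s * clamp N (g s)"] add_left_mono[OF mult_left_mono[OF sq]]])
       (simp_all, measurable)
  also have "\<dots> \<le> 2 * ennreal (e / 16) + 2 * (2 * ennreal (e / 16) + 2 * ennreal (e / 16))"
    using N n m by (intro add_mono mult_left_mono) auto
  also have "\<dots> = ennreal (10 * e / 16)"
    using e by (simp add: numeral_mult_ennreal ennreal_plus[symmetric] del: ennreal_plus)
  also have "\<dots> < ennreal e" using e by (simp add: ennreal_less_iff)
  finally have "(\<integral>\<^sup>+s\<in>{0..}. ennreal ((g s - step_fun m a \<tau> s)\<^sup>2) \<partial>lborel) < ennreal e"
    by (simp only: set_eq)
  with s show ?thesis by (rule that)
qed

section \<open>L^2 limits and almost everywhere convergence\<close>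

lemma nn_integral_fatou_bound:
  fixes u :: "nat \<Rightarrow> 'a \<Rightarrow> real"
  assumes [measurable]: "\<And>l. u l \<in> borel_measurable M"
    and lim: "AE x in M. (\<lambda>l. u l x) \<longlonglongrightarrow> v x"
    and bd: "eventually (\<lambda>l. (\<integral>\<^sup>+x. ennreal (u l x) \<partial>M) \<le> C) sequentially"
  shows "(\<integral>\<^sup>+x. ennreal (v x) \<partial>M) \<le> C"
proof -
  have "(\<integral>\<^sup>+x. ennreal (v x) \<partial>M) = (\<integral>\<^sup>+x. liminf (\<lambda>l. ennreal (u l x)) \<partial>M)"
  proof (rule nn_integral_cong_AE)
    show "AE x in M. ennreal (v x) = liminf (\<lambda>l. ennreal (u l x))"
      using lim
    proof eventually_elim
      fix x assume "(\<lambda>l. u l x) \<longlonglongrightarrow> v x"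
      then show "ennreal (v x) = liminf (\<lambda>l. ennreal (u l x))"
        using lim_imp_Liminf[OF sequentially_bot tendsto_ennrealI[of "\<lambda>l. u l x" "v x"]] by simp
    qed
  qed
  also have "\<dots> \<le> liminf (\<lambda>l. \<integral>\<^sup>+x. ennreal (u l x) \<partial>M)"
    by (rule nn_integral_liminf) simp
  also have "\<dots> \<le> limsup (\<lambda>l. \<integral>\<^sup>+x. ennreal (u l x) \<partial>M)"
    by (rule Liminf_le_Limsup) simp
  also have "\<dots> \<le> C" by (rule Limsup_bounded[OF bd])
  finally show ?thesis .
qed

lemma nn_integral_L2_AE_subseq:
  fixes Y :: "nat \<Rightarrow> 'a \<Rightarrow> real"
  assumes [measurable]: "\<And>m. Y m \<in> borel_measurable M"
    and lim: "(\<lambda>m. \<integral>\<^sup>+x. ennreal ((Y m x)\<^sup>2) \<partial>M) \<longlonglongrightarrow> 0"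
  obtains r :: "nat \<Rightarrow> nat" where "strict_mono r" "AE x in M. (\<lambda>m. Y (r m) x) \<longlonglongrightarrow> 0"
proof -
  from order_tendstoD(2)[OF lim, of 1] obtain M0 where
    M0: "\<And>m. m \<ge> M0 \<Longrightarrow> (\<integral>\<^sup>+x. ennreal ((Y m x)\<^sup>2) \<partial>M) < 1"
    unfolding eventually_sequentially by (metis zero_less_one)
  \<comment> \<open>Finitely many of the integrals may be infinite; starting at M0 makes every term
    integrable.\<close>
  let ?u = "\<lambda>m x. (Y (m + M0) x)\<^sup>2"
  have int: "integrable M (?u m)" for m
  proof (rule integrableI_bounded)
    show "(\<integral>\<^sup>+x. ennreal (norm (?u m x)) \<partial>M) < \<infinity>"
      using order_less_trans[OF M0[of "m + M0"], of \<infinity>] by simp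
  qed simp
  have "(\<lambda>m. enn2real (\<integral>\<^sup>+x. ennreal (?u m x) \<partial>M)) \<longlonglongrightarrow> 0"
    by (rule tendsto_enn2real) (use LIMSEQ_ignore_initial_segment[OF lim, of M0] in simp_all)
  moreover have "(\<integral>x. norm (?u m x) \<partial>M) = enn2real (\<integral>\<^sup>+x. ennreal (?u m x) \<partial>M)" for m
    by (subst integral_eq_nn_integral) auto
  ultimately have "(\<lambda>m. \<integral>x. norm (?u m x) \<partial>M) \<longlonglongrightarrow> 0" by simp
  from tendsto_L1_AE_subseq[OF int this] obtain r where
    r: "strict_mono r" "AE x in M. (\<lambda>m. ?u (r m) x) \<longlonglongrightarrow> 0" by auto
  show ?thesis
  proof (rule that)
    show "strict_mono (\<lambda>m. r m + M0)" using r(1) by (simp add: strict_mono_def)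
    show "AE x in M. (\<lambda>m. Y (r m + M0) x) \<longlonglongrightarrow> 0"
      using r(2) by eventually_elim (simp add: power_tendsto_0_iff)
  qed
qed

text \<open>The splitting |y| \<le> 4^(-k) + 4^k y^2 converts the squared L^2 bounds into the L^1
  bounds 5 * 4^(-k). These are summable, so the increments are summable almost everywhere.\<close>

lemma AE_convergent_of_fast_L2:
  fixes X :: "nat \<Rightarrow> 'a \<Rightarrow> real"
  assumes fin: "emeasure M (space M) = 1"
    and [measurable]: "\<And>k. X k \<in> borel_measurable M"
    and bd: "\<And>k. (\<integral>\<^sup>+x. ennreal ((X k x - X (Suc k) x)\<^sup>2) \<partial>M) \<le> ennreal (4 * (1/16) ^ k)"
  shows "AE x in M. convergent (\<lambda>k. X k x)"
proof -
  have b1: "(\<integral>\<^sup>+x. ennreal \<bar>X k x - X (Suc k) x\<bar> \<partial>M) \<le> ennreal (5 * (1/4) ^ k)" for k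
  proof -
    have "\<bar>y\<bar> \<le> (1/4) ^ k + 4 ^ k * y\<^sup>2" for y :: real
    proof -
      have "0 \<le> ((1/2) ^ k - 2 ^ k * \<bar>y\<bar>)\<^sup>2" by simp
      also have "\<dots> = ((1/2)^k)\<^sup>2 - 2 * ((1/2)^k * 2^k) * \<bar>y\<bar> + (2 ^ k)\<^sup>2 * \<bar>y\<bar>\<^sup>2"
        unfolding power2_diff by (simp add: power2_eq_square algebra_simps)
      also have "((1/2)^k)\<^sup>2 = (1/4 :: real)^k" by (simp flip: power_mult_distrib add: power2_eq_square)
      also have "(1/2)^k * 2^k = (1 :: real)" by (simp flip: power_mult_distrib)
      also have "(2 ^ k)\<^sup>2 = (4 :: real) ^ k" by (simp flip: power_mult_distrib add: power2_eq_square)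
      finally have "0 \<le> (1/4)^k - 2 * \<bar>y\<bar> + 4 ^ k * y\<^sup>2" by simp
      moreover have "0 \<le> (1/4::real)^k" "0 \<le> 4 ^ k * y\<^sup>2" by simp_all
      ultimately show ?thesis by linarith
    qed
    then have "(\<integral>\<^sup>+x. ennreal \<bar>X k x - X (Suc k) x\<bar> \<partial>M) \<le> (\<integral>\<^sup>+x. ennreal ((1/4) ^ k) + ennreal (4 ^ k) * ennreal ((X k x - X (Suc k) x)\<^sup>2) \<partial>M)"
      by (intro nn_integral_mono) (simp flip: ennreal_plus ennreal_mult)
    also have "\<dots> = ennreal ((1/4) ^ k) + ennreal (4 ^ k) * (\<integral>\<^sup>+x. ennreal ((X k x - X (Suc k) x)\<^sup>2) \<partial>M)"
      using fin by (simp add: nn_integral_add nn_integral_cmult)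
    also have "\<dots> \<le> ennreal ((1/4) ^ k) + ennreal (4 ^ k) * ennreal (4 * (1/16) ^ k)"
      by (intro add_left_mono mult_left_mono bd) simp
    also have "\<dots> = ennreal ((1/4) ^ k + 4 ^ k * (4 * (1/16) ^ k))"
      by (simp flip: ennreal_plus ennreal_mult)
    also have "(1/4) ^ k + 4 ^ k * (4 * (1/16) ^ k) = 5 * (1/4 :: real) ^ k"
    proof -
      have "(4::real) ^ k * (1/16) ^ k = (1/4) ^ k" by (simp flip: power_mult_distrib)
      then show ?thesis by simp
    qed
    finally show ?thesis .
  qed
  have "(\<integral>\<^sup>+x. (\<Sum>k. ennreal \<bar>X k x - X (Suc k) x\<bar>) \<partial>M) = (\<Sum>k. \<integral>\<^sup>+x. ennreal \<bar>X k x - X (Suc k) x\<bar> \<partial>M)"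
    by (rule nn_integral_suminf) simp
  also have "\<dots> \<le> (\<Sum>k. ennreal (5 * (1/4) ^ k))" by (intro suminf_le b1) auto
  also have "\<dots> < \<infinity>" by (subst suminf_ennreal2) (auto intro!: summable_mult summable_geometric)
  finally have "AE x in M. (\<Sum>k. ennreal \<bar>X k x - X (Suc k) x\<bar>) \<noteq> \<infinity>"
    by (intro nn_integral_noteq_infinite) auto
  then show ?thesis
  proof eventually_elim
    fix x assume "(\<Sum>k. ennreal \<bar>X k x - X (Suc k) x\<bar>) \<noteq> \<infinity>"
    then have "summable (\<lambda>k. \<bar>X k x - X (Suc k) x\<bar>)"
      by (intro summable_suminf_not_top) auto
    then have "summable (\<lambda>k. X k x - X (Suc k) x)" by (rule summable_rabs_cancel)
    then have "convergent (\<lambda>n. X 0 x - (\<Sum>k<n. X k x - X (Suc k) x))"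
      unfolding summable_iff_convergent by (intro convergent_diff convergent_const)
    moreover have "(\<lambda>n. X 0 x - (\<Sum>k<n. X k x - X (Suc k) x)) = (\<lambda>k. X k x)"
      using sum_lessThan_telescope'[of "\<lambda>k. X k x"] by auto
    ultimately show "convergent (\<lambda>k. X k x)" by simp
  qed
qed

section \<open>Existence and moments of the Wiener integral\<close>

lemma is_wiener_integralE:
  assumes "is_wiener_integral P g X"
  obtains n a \<tau> where "\<And>m. 0 \<le> \<tau> m 0" "\<And>m i. i < n m \<Longrightarrow> \<tau> m i < \<tau> m (Suc i)"
    "(\<lambda>m. \<integral>\<^sup>+s\<in>{0..}. ennreal ((g s - step_fun (n m) (a m) (\<tau> m) s)\<^sup>2) \<partial>lborel) \<longlonglongrightarrow> 0"
    "(\<lambda>m. \<integral>\<^sup>+\<omega>. ennreal ((X \<omega> - step_integral (n m) (a m) (\<tau> m) \<omega>)\<^sup>2) \<partial>P) \<longlonglongrightarrow> 0"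
  using assms unfolding is_wiener_integral_def
  apply (elim conjE exE)
  subgoal for n a \<tau> by (rule that[of \<tau> n a]) auto
  done

lemma is_wiener_integral_cong:
  assumes "AE s in lborel. 0 \<le> s \<longrightarrow> g s = g' s"
  shows "is_wiener_integral P g = is_wiener_integral P g'"
proof -
  have "(\<integral>\<^sup>+s\<in>{0..}. ennreal ((g s - f s)\<^sup>2) \<partial>lborel) = (\<integral>\<^sup>+s\<in>{0..}. ennreal ((g' s - f s)\<^sup>2) \<partial>lborel)" for f
    by (rule nn_integral_cong_AE) (use assms in \<open>auto simp: indicator_def elim!: eventually_mono\<close>)
  then show ?thesis unfolding is_wiener_integral_def[abs_def] by simp
qed

text \<open>Equal predicates give equal choices, so integrands that agree almost everywhere have
  literally the same chosen integral, not only almost surely equal ones.\<close>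

lemma wiener_integral_cong:
  "AE s in lborel. 0 \<le> s \<longrightarrow> g s = g' s \<Longrightarrow> wiener_integral P g = wiener_integral P g'"
  unfolding wiener_integral_def by (simp cong: is_wiener_integral_cong)

context wiener
begin

text \<open>\<open>wiener_integral\<close> is a Hilbert choice, about which nothing is known until
  some version has been constructed. The step functions are chosen with geometric errors so that
  their integrals converge almost surely along the whole sequence, which supplies a pointwise
  candidate.\<close>

lemma wiener_integral_exists:
  assumes g [measurable]: "g \<in> borel_measurable borel"
    and fin: "(\<integral>\<^sup>+s\<in>{0..}. ennreal ((g s)\<^sup>2) \<partial>lborel) < \<infinity>"
  shows "\<exists>X. is_wiener_integral P g X"
proof -
  define Q where "Q k p = (case p of (n, a, \<tau>) \<Rightarrow> 0 \<le> \<tau> 0 \<and> (\<forall>i<n. \<tau> i < \<tau> (Suc i)) \<and>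
     (\<integral>\<^sup>+s\<in>{0..}. ennreal ((g s - step_fun n a \<tau> s)\<^sup>2) \<partial>lborel) < ennreal ((1/16)^k))"
     for k :: nat and p :: "nat \<times> (nat \<Rightarrow> real) \<times> (nat \<Rightarrow> real)"
  have "\<exists>p. Q k p" for k
  proof -
    obtain n a \<tau> where "0 \<le> \<tau> 0" "\<And>i. i < n \<Longrightarrow> \<tau> i < \<tau> (Suc i)"
      "(\<integral>\<^sup>+s\<in>{0..}. ennreal ((g s - step_fun n a \<tau> s)\<^sup>2) \<partial>lborel) < ennreal ((1/16)^k)"
      by (rule step_approx_L2[OF g _ fin, of "(1/16)^k"]) auto
    then have "Q k (n, a, \<tau>)" by (simp add: Q_def)
    then show ?thesis ..
  qed
  then obtain p where p: "\<And>k. Q k (p k)" by metis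
  define n where "n k = fst (p k)" for k
  define a where "a k = fst (snd (p k))" for k
  define \<tau> where "\<tau> k = snd (snd (p k))" for k
  have pk: "p k = (n k, a k, \<tau> k)" for k by (simp add: n_def a_def \<tau>_def)
  have t: "0 \<le> \<tau> k 0" "\<forall>i<n k. \<tau> k i < \<tau> k (Suc i)"
    and err: "(\<integral>\<^sup>+s\<in>{0..}. ennreal ((g s - step_fun (n k) (a k) (\<tau> k) s)\<^sup>2) \<partial>lborel) \<le> ennreal ((1/16)^k)" for k
    using p[of k] by (auto simp: Q_def pk)
  have part: "partition_upto (n k) (\<tau> k)" for k using t[of k] by (intro partition_upto_strict) auto
  define X where "X k = step_integral (n k) (a k) (\<tau> k)" for k
  have [measurable]: "X k \<in> borel_measurable P" for k
    unfolding X_def by (rule step_integral_measurable[OF part])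
  have bd: "(\<integral>\<^sup>+\<omega>. ennreal ((X k \<omega> - X l \<omega>)\<^sup>2) \<partial>P) \<le> ennreal (4 * (1/16)^k)" if "k \<le> l" for k l
  proof -
    let ?S = "\<lambda>k s. step_fun (n k) (a k) (\<tau> k) s * indicator {0..} s"
    have eq: "(\<integral>\<^sup>+s\<in>{0..}. ennreal ((u s - v s)\<^sup>2) \<partial>lborel) = (\<integral>\<^sup>+s. ennreal ((u s * indicator {0..} s - v s * indicator {0..} s)\<^sup>2) \<partial>lborel)"
      for u v :: "real \<Rightarrow> real" by (intro nn_integral_cong) (simp add: indicator_def)
    have com: "(\<integral>\<^sup>+s\<in>{0..}. ennreal ((u s - v s)\<^sup>2) \<partial>lborel) = (\<integral>\<^sup>+s\<in>{0..}. ennreal ((v s - u s)\<^sup>2) \<partial>lborel)"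
      for u v :: "real \<Rightarrow> real" by (simp add: power2_commute)
    have "(\<integral>\<^sup>+\<omega>. ennreal ((X k \<omega> - X l \<omega>)\<^sup>2) \<partial>P) =
        (\<integral>\<^sup>+s\<in>{0..}. ennreal ((step_fun (n k) (a k) (\<tau> k) s - step_fun (n l) (a l) (\<tau> l) s)\<^sup>2) \<partial>lborel)"
      unfolding X_def by (rule nn_integral_step_integral_diff[OF part part])
    also have "\<dots> \<le> 2 * (\<integral>\<^sup>+s\<in>{0..}. ennreal ((step_fun (n k) (a k) (\<tau> k) s - g s)\<^sup>2) \<partial>lborel)
       + 2 * (\<integral>\<^sup>+s\<in>{0..}. ennreal ((g s - step_fun (n l) (a l) (\<tau> l) s)\<^sup>2) \<partial>lborel)"
      unfolding eq by (rule nn_integral_square_diff_le) auto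
    also have "\<dots> \<le> 2 * ennreal ((1/16)^k) + 2 * ennreal ((1/16)^l)"
      by (intro add_mono mult_left_mono err) (subst com, rule err, simp_all)
    also have "\<dots> \<le> 2 * ennreal ((1/16)^k) + 2 * ennreal ((1/16)^k)"
      using that by (intro add_mono mult_left_mono ennreal_leI power_decreasing) auto
    also have "\<dots> = ennreal (4 * (1/16)^k)"
      by (simp add: numeral_mult_ennreal ennreal_plus[symmetric] del: ennreal_plus)
    finally show ?thesis .
  qed
  have conv: "AE \<omega> in P. convergent (\<lambda>k. X k \<omega>)"
    by (rule AE_convergent_of_fast_L2[OF emeasure_space_1]) (auto intro: bd)
  define Y where "Y \<omega> = lim (\<lambda>k. X k \<omega>)" for \<omega>
  have [measurable]: "Y \<in> borel_measurable P" unfolding Y_def[abs_def] by (rule borel_measurable_lim_metric) simp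
  \<comment> \<open>Fatou's lemma as l grows in the Cauchy estimate \<open>bd\<close>.\<close>
  have bY: "(\<integral>\<^sup>+\<omega>. ennreal ((Y \<omega> - X k \<omega>)\<^sup>2) \<partial>P) \<le> ennreal (4 * (1/16)^k)" for k
  proof (rule nn_integral_fatou_bound[where u="\<lambda>l \<omega>. (X k \<omega> - X l \<omega>)\<^sup>2"])
    show "AE \<omega> in P. (\<lambda>l. (X k \<omega> - X l \<omega>)\<^sup>2) \<longlonglongrightarrow> (Y \<omega> - X k \<omega>)\<^sup>2"
      using conv
    proof eventually_elim
      fix \<omega> assume "convergent (\<lambda>k. X k \<omega>)"
      then have "(\<lambda>l. X l \<omega>) \<longlonglongrightarrow> Y \<omega>" unfolding Y_def by (simp add: convergent_LIMSEQ_iff)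
      then have "(\<lambda>l. (X k \<omega> - X l \<omega>)\<^sup>2) \<longlonglongrightarrow> (X k \<omega> - Y \<omega>)\<^sup>2"
        by (intro tendsto_power tendsto_diff tendsto_const)
      then show "(\<lambda>l. (X k \<omega> - X l \<omega>)\<^sup>2) \<longlonglongrightarrow> (Y \<omega> - X k \<omega>)\<^sup>2" by (simp add: power2_commute)
    qed
    show "eventually (\<lambda>l. (\<integral>\<^sup>+\<omega>. ennreal ((X k \<omega> - X l \<omega>)\<^sup>2) \<partial>P) \<le> ennreal (4 * (1/16)^k)) sequentially"
      by (rule eventually_sequentiallyI[of k]) (rule bd)
  qed simp
  have z: "(\<lambda>k. ennreal (c * (1/16)^k)) \<longlonglongrightarrow> 0" for c
  proof -
    have "(\<lambda>k. ennreal (c * (1/16)^k)) \<longlonglongrightarrow> ennreal (c * 0)"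
      by (intro tendsto_ennrealI tendsto_mult tendsto_const LIMSEQ_realpow_zero) auto
    then show ?thesis by simp
  qed
  have "is_wiener_integral P g Y"
    unfolding is_wiener_integral_def
  proof (rule conjI, simp, rule exI[of _ n], rule exI[of _ a], rule exI[of _ \<tau>], intro conjI)
    show "\<forall>m. 0 \<le> \<tau> m 0 \<and> (\<forall>i<n m. \<tau> m i < \<tau> m (Suc i))" using t by blast
    show "(\<lambda>m. \<integral>\<^sup>+ s\<in>{0..}. ennreal ((g s - step_fun (n m) (a m) (\<tau> m) s)\<^sup>2)\<partial>lborel) \<longlonglongrightarrow> 0"
      by (rule tendsto_sandwich[OF _ _ tendsto_const z[of 1]]) (use err in auto)
    show "(\<lambda>m. \<integral>\<^sup>+ \<omega>. ennreal ((Y \<omega> - step_integral (n m) (a m) (\<tau> m) \<omega>)\<^sup>2)\<partial>P) \<longlonglongrightarrow> 0"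
      by (rule tendsto_sandwich[OF _ _ tendsto_const z[of 4]]) (use bY in \<open>auto simp: X_def\<close>)
  qed
  then show ?thesis by blast
qed

lemma wiener_integral:
  assumes "g \<in> borel_measurable borel" "(\<integral>\<^sup>+s\<in>{0..}. ennreal ((g s)\<^sup>2) \<partial>lborel) < \<infinity>"
  shows "is_wiener_integral P g (wiener_integral P g)"
  unfolding wiener_integral_def using wiener_integral_exists[OF assms] by (rule someI_ex)

text \<open>That the limit is itself Gaussian is not shown. The approximating step integrals are
  Gaussian with variances eventually at most \<open>2 + 2 * V\<close>, so their moments are
  uniformly bounded, and Fatou's lemma along an almost surely convergent subsequence bounds those of
  X.\<close>

lemma wiener_integral_even_moment_finite:
  assumes X: "is_wiener_integral P g X" and g [measurable]: "g \<in> borel_measurable borel"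
    and fin: "(\<integral>\<^sup>+s\<in>{0..}. ennreal ((g s)\<^sup>2) \<partial>lborel) < \<infinity>"
  shows "(\<integral>\<^sup>+\<omega>. ennreal (X \<omega> ^ (2 * k)) \<partial>P) < \<infinity>"
proof -
  obtain n a \<tau> where t: "\<And>m. 0 \<le> \<tau> m 0" "\<And>m i. i<n m \<Longrightarrow> \<tau> m i < \<tau> m (Suc i)"
    and g_lim: "(\<lambda>m. \<integral>\<^sup>+ s\<in>{0..}. ennreal ((g s - step_fun (n m) (a m) (\<tau> m) s)\<^sup>2)\<partial>lborel) \<longlonglongrightarrow> 0"
    and X_lim: "(\<lambda>m. \<integral>\<^sup>+ \<omega>. ennreal ((X \<omega> - step_integral (n m) (a m) (\<tau> m) \<omega>)\<^sup>2)\<partial>P) \<longlonglongrightarrow> 0"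
    by (rule is_wiener_integralE[OF X]) blast
  have Xm [measurable]: "X \<in> borel_measurable P" using X by (simp add: is_wiener_integral_def)
  have part: "partition_upto (n m) (\<tau> m)" for m using t by (intro partition_upto_strict) auto
  have [measurable]: "step_integral (n m) (a m) (\<tau> m) \<in> borel_measurable P" for m
    by (rule step_integral_measurable[OF part])
  define v where "v m = (\<Sum>i<n m. (a m i)\<^sup>2 * (\<tau> m (Suc i) - \<tau> m i))" for m
  have gm: "gauss (step_integral (n m) (a m) (\<tau> m)) (v m)" for m
    unfolding v_def by (rule step_integral_gauss) (use t in auto)
  obtain V where V: "0 \<le> V" "(\<integral>\<^sup>+s\<in>{0..}. ennreal ((g s)\<^sup>2) \<partial>lborel) = ennreal V"
    using fin by (cases "(\<integral>\<^sup>+s\<in>{0..}. ennreal ((g s)\<^sup>2) \<partial>lborel)") auto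
  have "eventually (\<lambda>m. v m \<le> 2 + 2 * V) sequentially"
    using order_tendstoD(2)[OF g_lim zero_less_one]
  proof eventually_elim
    fix m assume m: "(\<integral>\<^sup>+ s\<in>{0..}. ennreal ((g s - step_fun (n m) (a m) (\<tau> m) s)\<^sup>2)\<partial>lborel) < 1"
    have eq: "(\<integral>\<^sup>+s\<in>{0..}. ennreal ((u s)\<^sup>2) \<partial>lborel) = (\<integral>\<^sup>+s. ennreal ((u s * indicator {0..} s)\<^sup>2) \<partial>lborel)"
      for u :: "real \<Rightarrow> real" by (intro nn_integral_cong) (simp add: indicator_def)
    have "ennreal (v m) = (\<integral>\<^sup>+s\<in>{0..}. ennreal ((step_fun (n m) (a m) (\<tau> m) s)\<^sup>2) \<partial>lborel)"
      unfolding v_def by (rule nn_integral_step_fun_square[OF part, symmetric])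
    also have "\<dots> \<le> 2 * (\<integral>\<^sup>+ s\<in>{0..}. ennreal ((g s - step_fun (n m) (a m) (\<tau> m) s)\<^sup>2)\<partial>lborel) + 2 * (\<integral>\<^sup>+s\<in>{0..}. ennreal ((g s)\<^sup>2) \<partial>lborel)"
      using nn_integral_square_diff_le[of "\<lambda>s. step_fun (n m) (a m) (\<tau> m) s * indicator {0..} s" lborel "\<lambda>s. g s * indicator {0..} s" "\<lambda>_. 0"]
      unfolding eq by (simp add: power2_commute left_diff_distrib)
    also have "\<dots> \<le> 2 * 1 + 2 * ennreal V" unfolding V by (intro add_mono mult_left_mono less_imp_le[OF m]) auto
    also have "\<dots> = ennreal (2 + 2 * V)" using V(1) by (simp add: ennreal_mult')
    finally show "v m \<le> 2 + 2 * V" using V(1) by (simp del: ennreal_plus)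
  qed
  then have bd: "eventually (\<lambda>m. (\<integral>\<^sup>+\<omega>. ennreal (step_integral (n m) (a m) (\<tau> m) \<omega> ^ (2 * k)) \<partial>P) \<le>
      ennreal (fact (2 * k) / (2 ^ k * fact k) * (2 + 2 * V) ^ k)) sequentially"
  proof eventually_elim
    fix m assume "v m \<le> 2 + 2 * V"
    moreover have "0 \<le> v m" unfolding v_def using t by (intro sum_nonneg) (auto simp: less_imp_le)
    ultimately show "(\<integral>\<^sup>+\<omega>. ennreal (step_integral (n m) (a m) (\<tau> m) \<omega> ^ (2 * k)) \<partial>P) \<le>
      ennreal (fact (2 * k) / (2 ^ k * fact k) * (2 + 2 * V) ^ k)"
      unfolding gauss_even_moment[OF gm] by (intro ennreal_leI mult_left_mono power_mono) auto
  qed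
  obtain r where r: "strict_mono r" "AE \<omega> in P. (\<lambda>m. X \<omega> - step_integral (n (r m)) (a (r m)) (\<tau> (r m)) \<omega>) \<longlonglongrightarrow> 0"
    using nn_integral_L2_AE_subseq[OF _ X_lim] by auto
  have "(\<integral>\<^sup>+\<omega>. ennreal (X \<omega> ^ (2 * k)) \<partial>P) \<le> ennreal (fact (2 * k) / (2 ^ k * fact k) * (2 + 2 * V) ^ k)"
  proof (rule nn_integral_fatou_bound[where u="\<lambda>m \<omega>. step_integral (n (r m)) (a (r m)) (\<tau> (r m)) \<omega> ^ (2 * k)"])
    show "AE \<omega> in P. (\<lambda>l. step_integral (n (r l)) (a (r l)) (\<tau> (r l)) \<omega> ^ (2 * k)) \<longlonglongrightarrow> X \<omega> ^ (2 * k)"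
      using r(2)
    proof eventually_elim
      fix \<omega> assume "(\<lambda>m. X \<omega> - step_integral (n (r m)) (a (r m)) (\<tau> (r m)) \<omega>) \<longlonglongrightarrow> 0"
      from tendsto_diff[OF tendsto_const[of "X \<omega>"] this]
      have "(\<lambda>m. step_integral (n (r m)) (a (r m)) (\<tau> (r m)) \<omega>) \<longlonglongrightarrow> X \<omega>" by simp
      then show "(\<lambda>l. step_integral (n (r l)) (a (r l)) (\<tau> (r l)) \<omega> ^ (2 * k)) \<longlonglongrightarrow> X \<omega> ^ (2 * k)"
        by (rule tendsto_power)
    qed
    show "eventually (\<lambda>l. (\<integral>\<^sup>+\<omega>. ennreal (step_integral (n (r l)) (a (r l)) (\<tau> (r l)) \<omega> ^ (2 * k)) \<partial>P) \<le>
      ennreal (fact (2 * k) / (2 ^ k * fact k) * (2 + 2 * V) ^ k)) sequentially"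
      by (rule eventually_subseq[OF r(1) bd])
  qed simp
  then show ?thesis by (rule le_less_trans) simp
qed

end

section \<open>Sobolev norms of smooth functionals\<close>

lemma iter_partial_local:
  assumes "\<And>x y. (\<And>i. i < n \<Longrightarrow> x i = y i) \<Longrightarrow> f x = f y"
    and "set I \<subseteq> {..<n}" and "\<And>i. i < n \<Longrightarrow> x i = y i"
  shows "iter_partial I f x = iter_partial I f y"
  using assms(2,3)
proof (induction I arbitrary: x y)
  case Nil then show ?case using assms(1)[of x y] by simp
next
  case (Cons i I)
  have "iter_partial I f (x(i := s)) = iter_partial I f (y(i := s))" for s
    by (rule Cons.IH) (use Cons.prems in auto)
  then show ?case using Cons.prems by (simp add: partial_deriv_def)
qed

lemma smooth_poly_growth_local:
  assumes "smooth_poly_growth n f" "set I \<subseteq> {..<n}" "\<And>i. i < n \<Longrightarrow> x i = y i"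
  shows "iter_partial I f x = iter_partial I f y"
  by (rule iter_partial_local[of n, OF _ assms(2,3)]) (use assms(1) in \<open>auto simp: smooth_poly_growth_def\<close>)

lemma smooth_poly_growth_deriv:
  assumes "smooth_poly_growth n f" "set I \<subseteq> {..<n}" "i < n"
  shows "((\<lambda>s. iter_partial I f (x(i := s))) has_real_derivative iter_partial (i # I) f x) (at (x i))"
proof -
  have "(\<lambda>s. iter_partial I f (x(i := s))) differentiable (at (x i))"
    using assms unfolding smooth_poly_growth_def by blast
  then show ?thesis by (simp add: partial_deriv_def DERIV_deriv_iff_real_differentiable)
qed

lemma smooth_poly_growth_bound:
  assumes "smooth_poly_growth n f" "set I \<subseteq> {..<n}"
  obtains C :: real and N :: nat where "0 \<le> C" "\<And>x. \<bar>iter_partial I f x\<bar> \<le> C * (1 + (\<Sum>i<n. \<bar>x i\<bar>)) ^ N"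
proof -
  obtain C and N :: nat where C: "\<And>x. \<bar>iter_partial I f x\<bar> \<le> C * (1 + (\<Sum>i<n. \<bar>x i\<bar>)) ^ N"
    using assms unfolding smooth_poly_growth_def by blast
  from C[of "\<lambda>_. 0"] have "0 \<le> C" by (simp add: order_trans[OF abs_ge_zero])
  then show ?thesis using C that by blast
qed

text \<open>A linear combination of two functionals is a function of the concatenated lists of arguments.\<close>

definition concat_comb :: "nat \<Rightarrow> real \<Rightarrow> ((nat \<Rightarrow> real) \<Rightarrow> real) \<Rightarrow> real \<Rightarrow> ((nat \<Rightarrow> real) \<Rightarrow> real) \<Rightarrow> (nat \<Rightarrow> real) \<Rightarrow> real" where
  "concat_comb n a f b g x = a * f x + b * g (\<lambda>i. x (i + n))"

text \<open>For a sum of functions of separate variables the mixed derivatives vanish. Only the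
  empty list of indices satisfies both conditions, so at most one of the two terms survives for any
  other list.\<close>

lemma iter_partial_concat_comb:
  assumes f: "smooth_poly_growth n f" and g: "smooth_poly_growth m g" and I: "set I \<subseteq> {..<n + m}"
  shows "iter_partial I (concat_comb n a f b g) x = a * (if set I \<subseteq> {..<n} then iter_partial I f x else 0)
      + b * (if set I \<subseteq> {n..} then iter_partial (map (\<lambda>i. i - n) I) g (\<lambda>i. x (i + n)) else 0)"
    and "i < n + m \<Longrightarrow> ((\<lambda>s. iter_partial I (concat_comb n a f b g) (x(i := s))) has_real_derivative
      iter_partial (i # I) (concat_comb n a f b g) x) (at (x i))"
proof -
  define A where "A I x = (if set I \<subseteq> {..<n} then iter_partial I f x else 0)" for I x
  define B where "B I x = (if set I \<subseteq> {n..} then iter_partial (map (\<lambda>i. i - n) I) g (\<lambda>i. x (i + n)) else 0)" for I x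
  have dA: "((\<lambda>s. A I (x(i := s))) has_real_derivative A (i # I) x) (at (x i))" if "i < n + m" for I i x
  proof (cases "set I \<subseteq> {..<n} \<and> i < n")
    case True
    then show ?thesis using smooth_poly_growth_deriv[OF f, of I i x] by (simp add: A_def)
  next
    case False
    then have z: "A (i # I) x = 0" by (auto simp: A_def)
    have "A I (x(i := s)) = A I x" for s
      using False by (auto simp: A_def intro!: smooth_poly_growth_local[OF f])
    then show ?thesis unfolding z by simp
  qed
  have dB: "((\<lambda>s. B I (x(i := s))) has_real_derivative B (i # I) x) (at (x i))"
    if I: "set I \<subseteq> {..<n + m}" and i: "i < n + m" for I i x
  proof (cases "set I \<subseteq> {n..} \<and> n \<le> i")
    case True
    have sh: "(\<lambda>j. (x(i := s)) (j + n)) = (\<lambda>j. x (j + n))(i - n := s)" for s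
      using True by (auto simp: fun_eq_iff)
    have "set (map (\<lambda>i. i - n) I) \<subseteq> {..<m}" "i - n < m" using True I i by auto
    from smooth_poly_growth_deriv[OF g this, of "\<lambda>j. x (j + n)"]
    show ?thesis using True by (simp add: B_def sh del: fun_upd_apply)
  next
    case False
    then have z: "B (i # I) x = 0" by (auto simp: B_def)
    have "B I (x(i := s)) = B I x" for s
    proof (cases "set I \<subseteq> {n..}")
      case True
      then have "i < n" using False by simp
      then have "(\<lambda>j. (x(i := s)) (j + n)) = (\<lambda>j. x (j + n))" by auto
      then show ?thesis by (simp add: B_def)
    next
      case False then show ?thesis unfolding B_def by (simp only: if_False)
    qed
    then show ?thesis unfolding z by simp
  qed
  have eq: "iter_partial I (concat_comb n a f b g) x = a * A I x + b * B I x" if "set I \<subseteq> {..<n + m}" for I x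
    using that
  proof (induction I arbitrary: x)
    case Nil show ?case by (simp add: A_def B_def concat_comb_def)
  next
    case (Cons i I)
    have "((\<lambda>s. a * A I (x(i := s)) + b * B I (x(i := s))) has_real_derivative a * A (i # I) x + b * B (i # I) x) (at (x i))"
      by (intro DERIV_add DERIV_cmult dA dB) (use Cons.prems in auto)
    then have "((\<lambda>s. iter_partial I (concat_comb n a f b g) (x(i := s))) has_real_derivative a * A (i # I) x + b * B (i # I) x) (at (x i))"
      using Cons.IH Cons.prems by simp
    from DERIV_imp_deriv[OF this] show ?case by (simp add: partial_deriv_def)
  qed
  show "iter_partial I (concat_comb n a f b g) x = a * (if set I \<subseteq> {..<n} then iter_partial I f x else 0)
      + b * (if set I \<subseteq> {n..} then iter_partial (map (\<lambda>i. i - n) I) g (\<lambda>i. x (i + n)) else 0)"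
    using eq[OF I, of x] unfolding A_def B_def .
  assume i: "i < n + m"
  have d: "((\<lambda>s. a * A I (x(i := s)) + b * B I (x(i := s))) has_real_derivative a * A (i # I) x + b * B (i # I) x) (at (x i))"
    by (intro DERIV_add DERIV_cmult dA dB I i)
  have "set (i # I) \<subseteq> {..<n + m}" using I i by simp
  then show "((\<lambda>s. iter_partial I (concat_comb n a f b g) (x(i := s))) has_real_derivative
      iter_partial (i # I) (concat_comb n a f b g) x) (at (x i))"
    unfolding eq[OF I] eq[OF \<open>set (i # I) \<subseteq> {..<n + m}\<close>] by (intro d)
qed

lemma power_growth_mono:
  fixes s t C D :: real
  assumes "0 \<le> s" "s \<le> t" "0 \<le> C" "C \<le> D" "k \<le> l" shows "C * (1 + s) ^ k \<le> D * (1 + t) ^ l"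
proof -
  have "(1 + s) ^ k \<le> (1 + t) ^ k" using assms by (intro power_mono) auto
  also have "\<dots> \<le> (1 + t) ^ l" using assms by (intro power_increasing) auto
  finally show ?thesis using assms by (intro mult_mono) auto
qed

lemma smooth_poly_growth_concat_comb:
  assumes f: "smooth_poly_growth n f" and g: "smooth_poly_growth m g"
  shows "smooth_poly_growth (n + m) (concat_comb n a f b g)"
  unfolding smooth_poly_growth_def
proof (intro conjI allI impI)
  fix x y :: "nat \<Rightarrow> real" assume "\<forall>i<n + m. x i = y i"
  then show "concat_comb n a f b g x = concat_comb n a f b g y"
    using smooth_poly_growth_local[OF f, of "[]" x y] smooth_poly_growth_local[OF g, of "[]" "\<lambda>i. x (i + n)" "\<lambda>i. y (i + n)"]
    by (simp add: concat_comb_def)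
next
  fix I assume I: "set I \<subseteq> {..<n + m}"
  let ?sh = "\<lambda>x i. x (i + n) :: real"
  let ?J = "map (\<lambda>i. i - n) I"
  have J: "set ?J \<subseteq> {..<m}" if "set I \<subseteq> {n..}"
  proof -
    have "n \<le> i \<and> i < n + m" if "i \<in> set I" for i using I \<open>set I \<subseteq> {n..}\<close> that by auto
    then show ?thesis by force
  qed
  note eq = iter_partial_concat_comb(1)[OF f g I, of a b]
  have shc: "continuous_on UNIV ?sh"
    by (intro continuous_on_coordinatewise_then_product continuous_on_product_coordinates)
  have cg: "continuous_on UNIV (\<lambda>x. iter_partial ?J g (?sh x))" if "set I \<subseteq> {n..}"
  proof -
    have "continuous_on UNIV (iter_partial ?J g)" using g J[OF that] unfolding smooth_poly_growth_def by blast
    from continuous_on_compose2[OF this shc] show ?thesis by simp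
  qed
  have cf: "continuous_on UNIV (iter_partial I f)" if "set I \<subseteq> {..<n}"
    using f that unfolding smooth_poly_growth_def by blast
  show "continuous_on UNIV (iter_partial I (concat_comb n a f b g))"
    unfolding eq[abs_def] using cf cg
    by (cases "set I \<subseteq> {..<n}"; cases "set I \<subseteq> {n..}")
      (simp_all only: if_True if_False mult_zero_right add_0_left add_0_right, auto intro!: continuous_intros)
  show "(\<lambda>s. iter_partial I (concat_comb n a f b g) (x(i := s))) differentiable (at (x i))" if "i < n + m" for x i
    using iter_partial_concat_comb(2)[OF f g I that] real_differentiable_def by blast
  obtain C N where C: "0 \<le> C" "\<And>x. (if set I \<subseteq> {..<n} then \<bar>iter_partial I f x\<bar> else 0) \<le> C * (1 + (\<Sum>i<n. \<bar>x i\<bar>)) ^ (N::nat)"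
  proof (cases "set I \<subseteq> {..<n}")
    case True
    then show ?thesis using smooth_poly_growth_bound[OF f True] that by (simp only: if_True) blast
  next
    case False
    show ?thesis by (rule that[of 0 0]) (simp_all only: False if_False mult_zero_left order_refl)
  qed
  obtain D M where D: "0 \<le> D" "\<And>x. (if set I \<subseteq> {n..} then \<bar>iter_partial ?J g x\<bar> else 0) \<le> D * (1 + (\<Sum>i<m. \<bar>x i\<bar>)) ^ (M::nat)"
  proof (cases "set I \<subseteq> {n..}")
    case True
    then show ?thesis using smooth_poly_growth_bound[OF g J[OF True]] that by (simp only: if_True) blast
  next
    case False
    show ?thesis by (rule that[of 0 0]) (simp_all only: False if_False mult_zero_left order_refl)
  qed
  have "\<bar>iter_partial I (concat_comb n a f b g) x\<bar> \<le> (\<bar>a\<bar> * C + \<bar>b\<bar> * D) * (1 + (\<Sum>i<n + m. \<bar>x i\<bar>)) ^ (max N M)" for x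
  proof -
    have s: "(\<Sum>i<n + m. \<bar>x i\<bar>) = (\<Sum>i<n. \<bar>x i\<bar>) + (\<Sum>i<m. \<bar>x (i + n)\<bar>)"
      using sum.atLeastLessThan_concat[of 0 n "n + m" "\<lambda>i. \<bar>x i\<bar>"] sum.shift_bounds_nat_ivl[of "\<lambda>i. \<bar>x i\<bar>" 0 n m]
      by (simp add: atLeast0LessThan add.commute)
    have nn: "0 \<le> (\<Sum>i<n. \<bar>x i\<bar>)" "0 \<le> (\<Sum>i<m. \<bar>x (i + n)\<bar>)" by (simp_all add: sum_nonneg)
    have "\<bar>iter_partial I (concat_comb n a f b g) x\<bar> \<le>
       \<bar>a\<bar> * (if set I \<subseteq> {..<n} then \<bar>iter_partial I f x\<bar> else 0) + \<bar>b\<bar> * (if set I \<subseteq> {n..} then \<bar>iter_partial ?J g (?sh x)\<bar> else 0)"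
      unfolding eq by (rule order_trans[OF abs_triangle_ineq]) (simp add: abs_mult)
    also have "\<dots> \<le> \<bar>a\<bar> * (C * (1 + (\<Sum>i<n. \<bar>x i\<bar>)) ^ N) + \<bar>b\<bar> * (D * (1 + (\<Sum>i<m. \<bar>?sh x i\<bar>)) ^ M)"
      by (intro add_mono mult_left_mono C(2)[of x] D(2)[of "?sh x"]) auto
    also have "\<dots> \<le> \<bar>a\<bar> * (C * (1 + (\<Sum>i<n + m. \<bar>x i\<bar>)) ^ (max N M)) + \<bar>b\<bar> * (D * (1 + (\<Sum>i<n + m. \<bar>x i\<bar>)) ^ (max N M))"
      using nn s C D by (intro add_mono mult_left_mono power_growth_mono) auto
    also have "\<dots> = (\<bar>a\<bar> * C + \<bar>b\<bar> * D) * (1 + (\<Sum>i<n + m. \<bar>x i\<bar>)) ^ (max N M)" by (simp add: algebra_simps)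
    finally show ?thesis .
  qed
  then show "\<exists>C. \<exists>N::nat. \<forall>x. \<bar>iter_partial I (concat_comb n a f b g) x\<bar> \<le> C * (1 + (\<Sum>i<n + m. \<bar>x i\<bar>)) ^ N" by blast
qed

context wiener
begin

lemma cm_integral_measurable_moments:
  assumes h: "h \<in> cameron_martin"
  shows "cm_integral P h \<in> borel_measurable P" "(\<integral>\<^sup>+\<omega>. ennreal (cm_integral P h \<omega> ^ (2 * k)) \<partial>P) < \<infinity>"
proof -
  \<comment> \<open>\<open>square_integrable\<close> controls the derivative on [0, infinity) only.
    Cutting it off there gives a Borel function without changing the integral.\<close>
  define g where "g s = indicator {0..} s * deriv h s" for s
  have sq: "square_integrable (deriv h)" using h by (simp add: cameron_martin_def)
  have gm: "g \<in> borel_measurable borel"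
    using sq unfolding square_integrable_def set_borel_measurable_def g_def[abs_def] by simp
  have "integrable lborel (\<lambda>s. (g s)\<^sup>2)"
  proof -
    have "(\<lambda>s. (g s)\<^sup>2) = (\<lambda>s. indicator {0..} s *\<^sub>R (deriv h s)\<^sup>2)" by (auto simp: g_def indicator_def)
    then show ?thesis using sq unfolding square_integrable_def set_integrable_def by simp
  qed
  then have "(\<integral>\<^sup>+s. ennreal (norm ((g s)\<^sup>2)) \<partial>lborel) < \<infinity>" by (simp add: integrable_iff_bounded)
  also have "(\<integral>\<^sup>+s. ennreal (norm ((g s)\<^sup>2)) \<partial>lborel) = (\<integral>\<^sup>+s\<in>{0..}. ennreal ((g s)\<^sup>2) \<partial>lborel)"
    by (intro nn_integral_cong) (simp add: g_def indicator_def)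
  finally have fin: "(\<integral>\<^sup>+s\<in>{0..}. ennreal ((g s)\<^sup>2) \<partial>lborel) < \<infinity>" .
  have "cm_integral P h = wiener_integral P g"
    unfolding cm_integral_def by (rule wiener_integral_cong) (simp add: g_def)
  then have W: "is_wiener_integral P g (cm_integral P h)" using wiener_integral[OF gm fin] by simp
  show "cm_integral P h \<in> borel_measurable P" using W by (simp add: is_wiener_integral_def)
  show "(\<integral>\<^sup>+\<omega>. ennreal (cm_integral P h \<omega> ^ (2 * k)) \<partial>P) < \<infinity>"
    by (rule wiener_integral_even_moment_finite[OF W gm fin])
qed

lemma iter_partial_measurable:
  assumes f: "smooth_poly_growth n f" "set I \<subseteq> {..<n}" and X: "\<And>i. i < n \<Longrightarrow> X i \<in> borel_measurable P"
  shows "(\<lambda>\<omega>. iter_partial I f (\<lambda>i. X i \<omega>)) \<in> borel_measurable P"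
proof -
  \<comment> \<open>Coordinates from n on are set to 0, since nothing is known about the
    measurability of \<open>X i\<close> there; the function does not see them.\<close>
  define Y where "Y \<omega> = (\<lambda>i. if i < n then X i \<omega> else 0)" for \<omega>
  have eq: "(\<lambda>\<omega>. iter_partial I f (\<lambda>i. X i \<omega>)) = (\<lambda>\<omega>. iter_partial I f (Y \<omega>))"
    by (intro ext smooth_poly_growth_local[OF f]) (simp add: Y_def)
  have "Y \<in> borel_measurable P"
  proof (rule measurable_coordinatewise_then_product)
    show "(\<lambda>\<omega>. Y \<omega> i) \<in> borel_measurable P" for i by (cases "i < n") (simp_all add: Y_def X)
  qed
  moreover have "iter_partial I f \<in> borel_measurable borel"
    using f unfolding smooth_poly_growth_def by (intro borel_measurable_continuous_onI) blast
  ultimately show ?thesis unfolding eq by (rule measurable_compose)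
qed

lemma sum_power_le:
  fixes y :: "nat \<Rightarrow> real"
  assumes "\<And>i. i < n \<Longrightarrow> 0 \<le> y i"
  shows "(1 + (\<Sum>i<n. y i)) ^ k \<le> (1 + real n) ^ k * (1 + (\<Sum>i<n. y i ^ k))"
proof -
  define M where "M = Max (insert 1 (y ` {..<n}))"
  have fin: "finite (insert 1 (y ` {..<n}))" by simp
  have le: "1 \<le> M" "\<And>i. i < n \<Longrightarrow> y i \<le> M" unfolding M_def by (auto intro: Max_ge[OF fin])
  have s: "(\<Sum>i<n. y i) \<le> (\<Sum>i<n. M)" by (intro sum_mono) (auto intro: le)
  have "1 + (\<Sum>i<n. y i) \<le> (1 + real n) * M" using s le(1) by (simp add: algebra_simps)
  then have "(1 + (\<Sum>i<n. y i)) ^ k \<le> ((1 + real n) * M) ^ k"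
    using assms by (intro power_mono add_nonneg_nonneg sum_nonneg) auto
  also have "\<dots> = (1 + real n) ^ k * M ^ k" by (rule power_mult_distrib)
  also have "M ^ k \<le> 1 + (\<Sum>i<n. y i ^ k)"
  proof -
    have "M \<in> insert 1 (y ` {..<n})" unfolding M_def by (rule Max_in[OF fin]) simp
    then consider "M = 1" | i where "i < n" "M = y i" by auto
    then show ?thesis
    proof cases
      case 1 then show ?thesis using assms by (auto intro!: sum_nonneg)
    next
      case 2
      have "y i ^ k \<le> (\<Sum>i<n. y i ^ k)" using 2 assms by (intro member_le_sum) auto
      then show ?thesis using 2 by simp
    qed
  qed
  finally show ?thesis by (simp add: mult_left_mono)
qed

text \<open>The polynomial bound on the function reduces integrability to the even moments of the
  \<open>X i\<close>, via \<open>sum_power_le\<close>.\<close>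

lemma iter_partial_square_integrable:
  assumes f: "smooth_poly_growth n f" "set I \<subseteq> {..<n}" and X: "\<And>i. i < n \<Longrightarrow> X i \<in> borel_measurable P"
    and mom: "\<And>i k. i < n \<Longrightarrow> (\<integral>\<^sup>+\<omega>. ennreal (X i \<omega> ^ (2 * k)) \<partial>P) < \<infinity>"
  shows "integrable P (\<lambda>\<omega>. (iter_partial I f (\<lambda>i. X i \<omega>))\<^sup>2)"
proof -
  obtain C N where C: "0 \<le> C" "\<And>x. \<bar>iter_partial I f x\<bar> \<le> C * (1 + (\<Sum>i<n. \<bar>x i\<bar>)) ^ N"
    using smooth_poly_growth_bound[OF f] by blast
  have Xi: "integrable P (\<lambda>\<omega>. X i \<omega> ^ (2 * N))" if "i < n" for i
  proof (rule integrableI_bounded)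
    show "(\<integral>\<^sup>+\<omega>. ennreal (norm (X i \<omega> ^ (2 * N))) \<partial>P) < \<infinity>"
      using mom[OF that, of N] by (simp add: power_mult power_abs)
  qed (use X[OF that] in measurable)
  show ?thesis
  proof (rule Bochner_Integration.integrable_bound)
    show "integrable P (\<lambda>\<omega>. C\<^sup>2 * ((1 + real n) ^ (2 * N) * (1 + (\<Sum>i<n. X i \<omega> ^ (2 * N)))))"
      by (intro integrable_mult_right Bochner_Integration.integrable_add Bochner_Integration.integrable_sum) (auto intro: Xi)
    show "(\<lambda>\<omega>. (iter_partial I f (\<lambda>i. X i \<omega>))\<^sup>2) \<in> borel_measurable P"
      using iter_partial_measurable[OF f X] by measurable
    show "AE \<omega> in P. norm ((iter_partial I f (\<lambda>i. X i \<omega>))\<^sup>2) \<le> norm (C\<^sup>2 * ((1 + real n) ^ (2 * N) * (1 + (\<Sum>i<n. X i \<omega> ^ (2 * N)))))"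
    proof (rule AE_I2)
      fix \<omega>
      let ?x = "\<lambda>i. X i \<omega>"
      have "\<bar>iter_partial I f ?x\<bar>\<^sup>2 \<le> (C * (1 + (\<Sum>i<n. \<bar>?x i\<bar>)) ^ N)\<^sup>2"
        by (intro power_mono C) simp
      also have "\<dots> = C\<^sup>2 * (1 + (\<Sum>i<n. \<bar>?x i\<bar>)) ^ (2 * N)" by (simp add: power_mult_distrib power_mult[symmetric] mult.commute)
      also have "\<dots> \<le> C\<^sup>2 * ((1 + real n) ^ (2 * N) * (1 + (\<Sum>i<n. \<bar>?x i\<bar> ^ (2 * N))))"
        by (intro mult_left_mono sum_power_le) auto
      also have "(\<Sum>i<n. \<bar>?x i\<bar> ^ (2 * N)) = (\<Sum>i<n. ?x i ^ (2 * N))" by (simp add: power_mult)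
      finally show "norm ((iter_partial I f ?x)\<^sup>2) \<le> norm (C\<^sup>2 * ((1 + real n) ^ (2 * N) * (1 + (\<Sum>i<n. ?x i ^ (2 * N)))))"
        by simp
    qed
  qed
qed

end

section \<open>The Cameron-Martin norm of the first derivative\<close>

lemma integrable_product_of_squares:
  fixes u v :: "'b \<Rightarrow> real"
  assumes [measurable]: "u \<in> borel_measurable M" "v \<in> borel_measurable M"
    and "integrable M (\<lambda>x. (u x)\<^sup>2)" "integrable M (\<lambda>x. (v x)\<^sup>2)"
  shows "integrable M (\<lambda>x. u x * v x)"
proof (rule Bochner_Integration.integrable_bound)
  show "integrable M (\<lambda>x. (u x)\<^sup>2 + (v x)\<^sup>2)" using assms by simp
  show "AE x in M. norm (u x * v x) \<le> norm ((u x)\<^sup>2 + (v x)\<^sup>2)"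
  proof (rule AE_I2)
    fix x
    have "2 * (\<bar>u x\<bar> * \<bar>v x\<bar>) \<le> (u x)\<^sup>2 + (v x)\<^sup>2" using sum_squares_bound[of "\<bar>u x\<bar>" "\<bar>v x\<bar>"] by simp
    moreover have "0 \<le> \<bar>u x\<bar> * \<bar>v x\<bar>" by simp
    ultimately have "\<bar>u x\<bar> * \<bar>v x\<bar> \<le> (u x)\<^sup>2 + (v x)\<^sup>2" by linarith
    then show "norm (u x * v x) \<le> norm ((u x)\<^sup>2 + (v x)\<^sup>2)" by (simp only: real_norm_def abs_mult abs_of_nonneg add_nonneg_nonneg zero_le_power2)
  qed
qed measurable

lemma cm_products_integrable:
  assumes "h \<in> cameron_martin" "k \<in> cameron_martin"
  shows "set_integrable lborel {0..} (\<lambda>s. deriv h s * deriv k s)"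
proof -
  let ?g = "\<lambda>h s. indicator {0..} s * deriv h s"
  have m: "?g h \<in> borel_measurable lborel" and i: "integrable lborel (\<lambda>s. (?g h s)\<^sup>2)" if "h \<in> cameron_martin" for h
  proof -
    have sq: "square_integrable (deriv h)" using that by (simp add: cameron_martin_def)
    then show "?g h \<in> borel_measurable lborel" unfolding square_integrable_def set_borel_measurable_def by simp
    have "(\<lambda>s. (?g h s)\<^sup>2) = (\<lambda>s. indicator {0..} s *\<^sub>R (deriv h s)\<^sup>2)" by (auto simp: indicator_def)
    then show "integrable lborel (\<lambda>s. (?g h s)\<^sup>2)" using sq unfolding square_integrable_def set_integrable_def by simp
  qed
  note [measurable] = m[OF assms(1)] m[OF assms(2)]
  have "integrable lborel (\<lambda>s. ?g h s * ?g k s)"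
    by (intro integrable_product_of_squares m i assms)
  moreover have "(\<lambda>s. ?g h s * ?g k s) = (\<lambda>s. indicator {0..} s *\<^sub>R (deriv h s * deriv k s))"
    by (auto simp: indicator_def)
  ultimately show ?thesis unfolding set_integrable_def by simp
qed

text \<open>The squared Cameron-Martin norm of the linear combination of the \<open>h i\<close> with
  coefficients \<open>c i\<close>; hence of DF when the \<open>c i\<close> are the first partial
  derivatives of f.\<close>

definition cm_form :: "nat \<Rightarrow> (nat \<Rightarrow> real \<Rightarrow> real) \<Rightarrow> (nat \<Rightarrow> real) \<Rightarrow> real" where
  "cm_form n h c = (\<Sum>i<n. \<Sum>j<n. c i * c j * cm_inner (h i) (h j))"

text \<open>As an integral of a square over s the form is visibly nonnegative and can be estimated
  pointwise in s.\<close>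

lemma cm_form_eq:
  assumes h: "\<forall>i<n. h i \<in> cameron_martin"
  shows "cm_form n h c = (LINT s:{0..}|lborel. (\<Sum>i<n. c i * deriv (h i) s)\<^sup>2)"
    and "set_integrable lborel {0..} (\<lambda>s. (\<Sum>i<n. c i * deriv (h i) s)\<^sup>2)"
proof -
  have ii: "integrable lborel (\<lambda>s. indicator {0..} s *\<^sub>R (deriv (h i) s * deriv (h j) s))" if "i < n" "j < n" for i j
    using cm_products_integrable[of "h i" "h j"] h that by (simp add: set_integrable_def)
  have eq: "indicator {0..} s *\<^sub>R (\<Sum>i<n. c i * deriv (h i) s)\<^sup>2 =
     (\<Sum>i<n. \<Sum>j<n. c i * c j * (indicator {0..} s *\<^sub>R (deriv (h i) s * deriv (h j) s)))" for s
    unfolding power2_eq_square sum_product by (simp add: sum_distrib_left mult_ac)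
  show "set_integrable lborel {0..} (\<lambda>s. (\<Sum>i<n. c i * deriv (h i) s)\<^sup>2)"
    unfolding set_integrable_def eq
    by (intro Bochner_Integration.integrable_sum integrable_mult_right ii) auto
  have "(LINT s:{0..}|lborel. (\<Sum>i<n. c i * deriv (h i) s)\<^sup>2) =
     (\<Sum>i<n. \<integral>s. (\<Sum>j<n. c i * c j * (indicator {0..} s *\<^sub>R (deriv (h i) s * deriv (h j) s))) \<partial>lborel)"
    unfolding set_lebesgue_integral_def eq
    by (rule Bochner_Integration.integral_sum)
      (intro Bochner_Integration.integrable_sum integrable_mult_right ii; simp)
  also have "\<dots> = (\<Sum>i<n. \<Sum>j<n. \<integral>s. c i * c j * (indicator {0..} s *\<^sub>R (deriv (h i) s * deriv (h j) s)) \<partial>lborel)"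
    by (intro sum.cong refl Bochner_Integration.integral_sum integrable_mult_right ii) auto
  also have "\<dots> = cm_form n h c"
    unfolding cm_form_def cm_inner_def set_lebesgue_integral_def
    by (intro sum.cong refl Bochner_Integration.integral_mult_right ii) auto
  finally show "cm_form n h c = (LINT s:{0..}|lborel. (\<Sum>i<n. c i * deriv (h i) s)\<^sup>2)" by simp
qed

lemma cm_form_nonneg:
  assumes h: "\<forall>i<n. h i \<in> cameron_martin" shows "0 \<le> cm_form n h c"
  unfolding cm_form_eq(1)[OF h] set_lebesgue_integral_def
  by (rule Bochner_Integration.integral_nonneg) (simp add: indicator_def)

lemma square_comb_le: "((a::real) * u + b * v)\<^sup>2 \<le> 2 * a\<^sup>2 * u\<^sup>2 + 2 * b\<^sup>2 * v\<^sup>2"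
  using zero_le_power2[of "a * u - b * v"] by (simp add: power2_eq_square algebra_simps)

definition concat_seq :: "nat \<Rightarrow> (nat \<Rightarrow> 'a) \<Rightarrow> (nat \<Rightarrow> 'a) \<Rightarrow> nat \<Rightarrow> 'a" where
  "concat_seq n h k i = (if i < n then h i else k (i - n))"

lemma sum_concat_split: "(\<Sum>i<n + (m::nat). u i) = (\<Sum>i<n. u i) + (\<Sum>i<m. u (i + n) :: real)"
  using sum.atLeastLessThan_concat[of 0 n "n + m" u] sum.shift_bounds_nat_ivl[of u 0 n m]
  by (simp add: atLeast0LessThan add.commute)

lemma cm_form_concat_le:
  assumes h: "\<forall>i<n. h i \<in> cameron_martin" and k: "\<forall>i<m. k i \<in> cameron_martin"
  shows "cm_form (n + m) (concat_seq n h k) (concat_seq n (\<lambda>i. a * c i) (\<lambda>i. b * d i))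
     \<le> 2 * a\<^sup>2 * cm_form n h c + 2 * b\<^sup>2 * cm_form m k d"
proof -
  have hk: "\<forall>i<n + m. concat_seq n h k i \<in> cameron_martin"
    using h k by (auto simp: concat_seq_def)
  let ?U = "\<lambda>s. \<Sum>i<n. c i * deriv (h i) s" and ?V = "\<lambda>s. \<Sum>i<m. d i * deriv (k i) s"
  have s: "(\<Sum>i<n + m. concat_seq n (\<lambda>i. a * c i) (\<lambda>i. b * d i) i * deriv (concat_seq n h k i) s) = a * ?U s + b * ?V s" for s
    unfolding sum_concat_split by (simp add: concat_seq_def sum_distrib_left mult.assoc)
  note iU = cm_form_eq(2)[OF h, where c=c, unfolded set_integrable_def]
  note iV = cm_form_eq(2)[OF k, where c=d, unfolded set_integrable_def]
  note iUV = cm_form_eq(2)[OF hk, where c="concat_seq n (\<lambda>i. a * c i) (\<lambda>i. b * d i)", unfolded set_integrable_def s]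
  have "cm_form (n + m) (concat_seq n h k) (concat_seq n (\<lambda>i. a * c i) (\<lambda>i. b * d i)) =
    (\<integral>s. indicator {0..} s *\<^sub>R (a * ?U s + b * ?V s)\<^sup>2 \<partial>lborel)"
    unfolding cm_form_eq(1)[OF hk] s set_lebesgue_integral_def ..
  also have "\<dots> \<le> (\<integral>s. 2 * a\<^sup>2 * (indicator {0..} s *\<^sub>R (?U s)\<^sup>2) + 2 * b\<^sup>2 * (indicator {0..} s *\<^sub>R (?V s)\<^sup>2) \<partial>lborel)"
  proof (rule Bochner_Integration.integral_mono[OF iUV])
    show "integrable lborel (\<lambda>s. 2 * a\<^sup>2 * (indicator {0..} s *\<^sub>R (?U s)\<^sup>2) + 2 * b\<^sup>2 * (indicator {0..} s *\<^sub>R (?V s)\<^sup>2))"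
      by (intro Bochner_Integration.integrable_add integrable_mult_right iU iV)
    show "indicator {0..} s *\<^sub>R (a * ?U s + b * ?V s)\<^sup>2 \<le> 2 * a\<^sup>2 * (indicator {0..} s *\<^sub>R (?U s)\<^sup>2) + 2 * b\<^sup>2 * (indicator {0..} s *\<^sub>R (?V s)\<^sup>2)" for s
      using square_comb_le[of a "?U s" b "?V s"] by (simp add: indicator_def)
  qed
  also have "\<dots> = 2 * a\<^sup>2 * cm_form n h c + 2 * b\<^sup>2 * cm_form m k d"
    unfolding cm_form_eq(1)[OF h] cm_form_eq(1)[OF k] set_lebesgue_integral_def
    by (subst Bochner_Integration.integral_add[OF integrable_mult_right[OF iU] integrable_mult_right[OF iV]])
      (simp only: integral_mult_right_zero)
  finally show ?thesis .
qed

lemma malliavin_norm_1: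
  "malliavin_norm P n f h 1 \<omega> = sqrt (cm_form n h (\<lambda>i. malliavin_coeff P f h [i] \<omega>))"
proof -
  have it: "index_tuples n 1 = (\<lambda>i. [i]) ` {..<n}"
    by (auto simp: index_tuples_def length_Suc_conv image_iff)
  have inj: "inj_on (\<lambda>i. [i]) {..<n}" by (auto simp: inj_on_def)
  show ?thesis unfolding malliavin_norm_def it cm_form_def by (simp add: sum.reindex[OF inj])
qed

text \<open>\<open>e\<close> is the squared \<open>\<D>\<^sup>2\<^sub>1\<close>-norm computed from some representation of \<open>F\<close>.\<close>

definition sobolev_energy :: "(real \<Rightarrow> real) measure \<Rightarrow> ((real \<Rightarrow> real) \<Rightarrow> real) \<Rightarrow> real \<Rightarrow> bool" where
  "sobolev_energy P F e \<longleftrightarrow> (\<exists>n f h. smooth_functional P n f h F \<and>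
     e = (\<integral>\<omega>. (F \<omega>)\<^sup>2 \<partial>P) + (\<integral>\<omega>. cm_form n h (\<lambda>i. malliavin_coeff P f h [i] \<omega>) \<partial>P))"

lemma sobolev_energy_nonneg: "sobolev_energy P F e \<Longrightarrow> 0 \<le> e"
  unfolding sobolev_energy_def smooth_functional_def
  by (auto intro!: add_nonneg_nonneg Bochner_Integration.integral_nonneg cm_form_nonneg)

lemma smooth_sobolev_norm_iff:
  "smooth_sobolev_norm P 2 1 F c \<longleftrightarrow> (\<exists>e. sobolev_energy P F e \<and> c = sqrt e)"
proof -
  have sq: "sqrt x powr 2 = x" if "0 \<le> x" for x using that by simp
  have abs: "\<bar>x\<bar> powr 2 = x\<^sup>2" for x :: real by simp
  have m: "malliavin_norm P n f h 1 \<omega> powr 2 = cm_form n h (\<lambda>i. malliavin_coeff P f h [i] \<omega>)"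
    if "smooth_functional P n f h F" for n f h \<omega>
    unfolding malliavin_norm_1 using that by (intro sq cm_form_nonneg) (auto simp: smooth_functional_def)
  have "((\<integral>\<omega>. \<bar>F \<omega>\<bar> powr 2 \<partial>P) + (\<Sum>k=1..1. \<integral>\<omega>. malliavin_norm P n f h k \<omega> powr 2 \<partial>P)) powr (1 / 2)
     = sqrt ((\<integral>\<omega>. (F \<omega>)\<^sup>2 \<partial>P) + (\<integral>\<omega>. cm_form n h (\<lambda>i. malliavin_coeff P f h [i] \<omega>) \<partial>P))"
    if "smooth_functional P n f h F" for n f h
  proof -
    have "0 \<le> (\<integral>\<omega>. (F \<omega>)\<^sup>2 \<partial>P) + (\<integral>\<omega>. cm_form n h (\<lambda>i. malliavin_coeff P f h [i] \<omega>) \<partial>P)"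
      by (rule sobolev_energy_nonneg[of P F]) (use that in \<open>auto simp: sobolev_energy_def\<close>)
    then show ?thesis using m[OF that] by (simp add: abs powr_half_sqrt)
  qed
  then have eq: "smooth_functional P n f h F \<and> c = ((\<integral>\<omega>. \<bar>F \<omega>\<bar> powr 2 \<partial>P) + (\<Sum>k=1..1. \<integral>\<omega>. malliavin_norm P n f h k \<omega> powr 2 \<partial>P)) powr (1 / 2)
     \<longleftrightarrow> smooth_functional P n f h F \<and> c = sqrt ((\<integral>\<omega>. (F \<omega>)\<^sup>2 \<partial>P) + (\<integral>\<omega>. cm_form n h (\<lambda>i. malliavin_coeff P f h [i] \<omega>) \<partial>P))" for n f h
    by auto
  show ?thesis unfolding smooth_sobolev_norm_def sobolev_energy_def eq by blast
qed

context wiener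
begin

lemma smooth_functional_square_integrable:
  assumes F: "smooth_functional P n f h F"
  shows "integrable P (\<lambda>\<omega>. (F \<omega>)\<^sup>2)"
    and "i < n \<Longrightarrow> malliavin_coeff P f h [i] \<in> borel_measurable P"
    and "i < n \<Longrightarrow> integrable P (\<lambda>\<omega>. (malliavin_coeff P f h [i] \<omega>)\<^sup>2)"
proof -
  have f: "smooth_poly_growth n f" and h: "\<And>i. i < n \<Longrightarrow> h i \<in> cameron_martin" and
    [measurable]: "F \<in> borel_measurable P" and AE: "AE \<omega> in P. F \<omega> = f (\<lambda>i. cm_integral P (h i) \<omega>)"
    using F by (auto simp: smooth_functional_def)
  note X = cm_integral_measurable_moments[OF h]
  have "integrable P (\<lambda>\<omega>. (iter_partial [] f (\<lambda>i. cm_integral P (h i) \<omega>))\<^sup>2)"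
    by (rule iter_partial_square_integrable[OF f _ X]) auto
  moreover have "(\<lambda>\<omega>. (iter_partial [] f (\<lambda>i. cm_integral P (h i) \<omega>))\<^sup>2) \<in> borel_measurable P"
    using iter_partial_measurable[of n f "[]" "\<lambda>i. cm_integral P (h i)"] f X(1) by simp
  moreover have "AE \<omega> in P. (iter_partial [] f (\<lambda>i. cm_integral P (h i) \<omega>))\<^sup>2 = (F \<omega>)\<^sup>2"
    using AE by eventually_elim simp
  ultimately show "integrable P (\<lambda>\<omega>. (F \<omega>)\<^sup>2)"
    by (subst (asm) integrable_cong_AE) auto
  show "malliavin_coeff P f h [i] \<in> borel_measurable P" if "i < n"
    unfolding malliavin_coeff_def[abs_def] by (rule iter_partial_measurable[OF f]) (use that X in auto)
  show "integrable P (\<lambda>\<omega>. (malliavin_coeff P f h [i] \<omega>)\<^sup>2)" if "i < n"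
    unfolding malliavin_coeff_def by (rule iter_partial_square_integrable[OF f _ X]) (use that in auto)
qed

lemma cm_form_integrable:
  assumes F: "smooth_functional P n f h F"
  shows "integrable P (\<lambda>\<omega>. cm_form n h (\<lambda>i. malliavin_coeff P f h [i] \<omega>))"
  unfolding cm_form_def
  by (intro Bochner_Integration.integrable_sum integrable_mult_left integrable_product_of_squares
      smooth_functional_square_integrable[OF F]) auto

text \<open>The combination is represented by concatenating the two representations, so an energy
  with the stated bound is only asserted to exist. The factors 2 take the place of the triangle
  inequality in the Sobolev space.\<close>

lemma sobolev_energy_comb:
  assumes "sobolev_energy P F d" "sobolev_energy P G e"
  obtains e' where "sobolev_energy P (\<lambda>\<omega>. a * F \<omega> + b * G \<omega>) e'" "e' \<le> 2 * a\<^sup>2 * d + 2 * b\<^sup>2 * e"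
proof -
  obtain n f h where F: "smooth_functional P n f h F"
    and d: "d = (\<integral>\<omega>. (F \<omega>)\<^sup>2 \<partial>P) + (\<integral>\<omega>. cm_form n h (\<lambda>i. malliavin_coeff P f h [i] \<omega>) \<partial>P)"
    using assms(1) unfolding sobolev_energy_def by blast
  obtain m g k where G: "smooth_functional P m g k G"
    and e: "e = (\<integral>\<omega>. (G \<omega>)\<^sup>2 \<partial>P) + (\<integral>\<omega>. cm_form m k (\<lambda>i. malliavin_coeff P g k [i] \<omega>) \<partial>P)"
    using assms(2) unfolding sobolev_energy_def by blast
  have f: "smooth_poly_growth n f" and h: "\<And>i. i < n \<Longrightarrow> h i \<in> cameron_martin"
    and Fm [measurable]: "F \<in> borel_measurable P" and FA: "AE \<omega> in P. F \<omega> = f (\<lambda>i. cm_integral P (h i) \<omega>)"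
    using F by (auto simp: smooth_functional_def)
  have g: "smooth_poly_growth m g" and k: "\<And>i. i < m \<Longrightarrow> k i \<in> cameron_martin"
    and Gm [measurable]: "G \<in> borel_measurable P" and GA: "AE \<omega> in P. G \<omega> = g (\<lambda>i. cm_integral P (k i) \<omega>)"
    using G by (auto simp: smooth_functional_def)
  let ?f = "concat_comb n a f b g" and ?h = "concat_seq n h k"
  have loc: "iter_partial I f (\<lambda>i. cm_integral P (?h i) \<omega>) = iter_partial I f (\<lambda>i. cm_integral P (h i) \<omega>)"
    if "set I \<subseteq> {..<n}" for I \<omega>
    by (rule smooth_poly_growth_local[OF f that]) (simp add: concat_seq_def)
  have sh: "(\<lambda>i. cm_integral P (?h (i + n)) \<omega>) = (\<lambda>i. cm_integral P (k i) \<omega>)" for \<omega>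
    by (simp add: concat_seq_def)
  have FG: "smooth_functional P (n + m) ?f ?h (\<lambda>\<omega>. a * F \<omega> + b * G \<omega>)"
    unfolding smooth_functional_def
  proof (intro conjI allI impI)
    show "smooth_poly_growth (n + m) ?f" by (rule smooth_poly_growth_concat_comb[OF f g])
    show "?h i \<in> cameron_martin" if "i < n + m" for i using that h k by (auto simp: concat_seq_def)
    show "AE \<omega> in P. a * F \<omega> + b * G \<omega> = ?f (\<lambda>i. cm_integral P (?h i) \<omega>)"
      using FA GA by eventually_elim (use loc[of "[]"] in \<open>simp add: concat_comb_def concat_seq_def\<close>)
  qed simp
  have co: "malliavin_coeff P ?f ?h [i] \<omega> =
     concat_seq n (\<lambda>i. a * malliavin_coeff P f h [i] \<omega>) (\<lambda>i. b * malliavin_coeff P g k [i] \<omega>) i" if "i < n + m" for i \<omega>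
  proof -
    have I: "set [i] \<subseteq> {..<n + m}" using that by simp
    show ?thesis
    proof (cases "i < n")
      case True
      then have "set [i] \<subseteq> {..<n}" "\<not> set [i] \<subseteq> {n..}" by auto
      then show ?thesis unfolding malliavin_coeff_def iter_partial_concat_comb(1)[OF f g I]
        using loc[of "[i]" \<omega>] True by (simp only: if_True if_False concat_seq_def mult_zero_right add_0_right)
    next
      case False
      then have "\<not> set [i] \<subseteq> {..<n}" "set [i] \<subseteq> {n..}" by auto
      then show ?thesis unfolding malliavin_coeff_def iter_partial_concat_comb(1)[OF f g I] sh
        using False by (simp only: if_True if_False concat_seq_def) simp
    qed
  qed
  have form: "cm_form (n + m) ?h (\<lambda>i. malliavin_coeff P ?f ?h [i] \<omega>) \<le>
     2 * a\<^sup>2 * cm_form n h (\<lambda>i. malliavin_coeff P f h [i] \<omega>) + 2 * b\<^sup>2 * cm_form m k (\<lambda>i. malliavin_coeff P g k [i] \<omega>)" for \<omega>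
  proof -
    have "cm_form (n + m) ?h (\<lambda>i. malliavin_coeff P ?f ?h [i] \<omega>) = cm_form (n + m) ?h
       (concat_seq n (\<lambda>i. a * malliavin_coeff P f h [i] \<omega>) (\<lambda>i. b * malliavin_coeff P g k [i] \<omega>))"
      unfolding cm_form_def by (intro sum.cong refl) (simp add: co)
    then show ?thesis using cm_form_concat_le[of n h m k] h k by simp
  qed
  define e' where "e' = (\<integral>\<omega>. (a * F \<omega> + b * G \<omega>)\<^sup>2 \<partial>P) + (\<integral>\<omega>. cm_form (n + m) ?h (\<lambda>i. malliavin_coeff P ?f ?h [i] \<omega>) \<partial>P)"
  have "sobolev_energy P (\<lambda>\<omega>. a * F \<omega> + b * G \<omega>) e'"
    unfolding sobolev_energy_def e'_def using FG by blast
  moreover have "e' \<le> 2 * a\<^sup>2 * d + 2 * b\<^sup>2 * e"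
  proof -
    note i = smooth_functional_square_integrable(1)
    have "(\<integral>\<omega>. (a * F \<omega> + b * G \<omega>)\<^sup>2 \<partial>P) \<le> (\<integral>\<omega>. 2 * a\<^sup>2 * (F \<omega>)\<^sup>2 + 2 * b\<^sup>2 * (G \<omega>)\<^sup>2 \<partial>P)"
      by (rule Bochner_Integration.integral_mono[OF i[OF FG]])
        (intro Bochner_Integration.integrable_add integrable_mult_right i[OF F] i[OF G], rule square_comb_le)
    also have "\<dots> = 2 * a\<^sup>2 * (\<integral>\<omega>. (F \<omega>)\<^sup>2 \<partial>P) + 2 * b\<^sup>2 * (\<integral>\<omega>. (G \<omega>)\<^sup>2 \<partial>P)"
      using i[OF F] i[OF G] by (subst Bochner_Integration.integral_add) simp_all
    finally have 1: "(\<integral>\<omega>. (a * F \<omega> + b * G \<omega>)\<^sup>2 \<partial>P) \<le> 2 * a\<^sup>2 * (\<integral>\<omega>. (F \<omega>)\<^sup>2 \<partial>P) + 2 * b\<^sup>2 * (\<integral>\<omega>. (G \<omega>)\<^sup>2 \<partial>P)" .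
    have "(\<integral>\<omega>. cm_form (n + m) ?h (\<lambda>i. malliavin_coeff P ?f ?h [i] \<omega>) \<partial>P) \<le>
      (\<integral>\<omega>. 2 * a\<^sup>2 * cm_form n h (\<lambda>i. malliavin_coeff P f h [i] \<omega>) + 2 * b\<^sup>2 * cm_form m k (\<lambda>i. malliavin_coeff P g k [i] \<omega>) \<partial>P)"
      by (rule Bochner_Integration.integral_mono[OF cm_form_integrable[OF FG]])
        (intro Bochner_Integration.integrable_add integrable_mult_right cm_form_integrable[OF F] cm_form_integrable[OF G], rule form)
    also have "\<dots> = 2 * a\<^sup>2 * (\<integral>\<omega>. cm_form n h (\<lambda>i. malliavin_coeff P f h [i] \<omega>) \<partial>P) + 2 * b\<^sup>2 * (\<integral>\<omega>. cm_form m k (\<lambda>i. malliavin_coeff P g k [i] \<omega>) \<partial>P)"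
      using cm_form_integrable[OF F] cm_form_integrable[OF G] by (subst Bochner_Integration.integral_add) simp_all
    finally show ?thesis using 1 unfolding e'_def d e by (simp add: algebra_simps)
  qed
  ultimately show ?thesis by (rule that)
qed

end

section \<open>Countable sums in the Sobolev space\<close>

lemma ennreal_square_add_le: "((x::ennreal) + y)\<^sup>2 \<le> 2 * x\<^sup>2 + 2 * y\<^sup>2"
proof (cases "x = top \<or> y = top")
  case True then show ?thesis by (auto simp: power2_eq_square ennreal_mult_top)
next
  case False
  then obtain a b where "x = ennreal a" "0 \<le> a" "y = ennreal b" "0 \<le> b"
    by (metis ennreal_cases)
  moreover have "(a + b)\<^sup>2 \<le> 2 * a\<^sup>2 + 2 * b\<^sup>2" using square_comb_le[of 1 a 1 b] by simp
  ultimately show ?thesis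
    by (simp add: power2_eq_square numeral_mult_ennreal ennreal_mult[symmetric] ennreal_plus[symmetric] del: ennreal_plus)
qed

text \<open>Splitting off one summand at a time costs a factor 2 per step, which accumulates to 2^(j
  + 1) for the j-th summand. Terms of order 4^(-j) outweigh it.\<close>

lemma ennreal_square_sum_le:
  "(\<Sum>j<n. a j :: ennreal)\<^sup>2 \<le> (\<Sum>j<n. 2 ^ (j + 1) * (a j)\<^sup>2)"
proof (induction n arbitrary: a)
  case (Suc n)
  have "(\<Sum>j<Suc n. a j)\<^sup>2 = (a 0 + (\<Sum>j<n. a (Suc j)))\<^sup>2" by (simp only: sum.lessThan_Suc_shift)
  also have "\<dots> \<le> 2 * (a 0)\<^sup>2 + 2 * (\<Sum>j<n. a (Suc j))\<^sup>2" by (rule ennreal_square_add_le)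
  also have "\<dots> \<le> 2 * (a 0)\<^sup>2 + 2 * (\<Sum>j<n. 2 ^ (j + 1) * (a (Suc j))\<^sup>2)"
    by (intro add_left_mono mult_left_mono Suc.IH) simp
  also have "\<dots> = (\<Sum>j<Suc n. 2 ^ (j + 1) * (a j)\<^sup>2)"
    by (simp add: sum.lessThan_Suc_shift sum_distrib_left mult.assoc del: sum.lessThan_Suc)
  finally show ?case .
qed simp

lemma ennreal_square_suminf_le:
  "(\<Sum>j. a j :: ennreal)\<^sup>2 \<le> (\<Sum>j. 2 ^ (j + 1) * (a j)\<^sup>2)"
proof (rule LIMSEQ_le_const2)
  have l: "(\<lambda>n. \<Sum>j<n. a j) \<longlonglongrightarrow> (\<Sum>j. a j)" by (rule summable_LIMSEQ) simp
  show "(\<lambda>n. (\<Sum>j<n. a j)\<^sup>2) \<longlonglongrightarrow> (\<Sum>j. a j)\<^sup>2"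
    unfolding power2_eq_square by (rule tendsto_mult_ennreal[OF l l]) auto
  show "\<exists>N. \<forall>n\<ge>N. (\<Sum>j<n. a j)\<^sup>2 \<le> (\<Sum>j. 2 ^ (j + 1) * (a j)\<^sup>2)"
    by (intro exI[of _ 0] allI impI order_trans[OF ennreal_square_sum_le] sum_le_suminf) auto
qed

lemma suminf_geometric_bound: "(\<Sum>j. 2 ^ (j + 1) * ennreal (C / 4 ^ j)) = ennreal (4 * C)" if "0 \<le> C"
proof -
  have eq: "2 ^ (j + 1) * ennreal (C / 4 ^ j) = ennreal (2 * C * (1/2) ^ j)" for j
  proof -
    have "(2::ennreal) ^ (j + 1) = ennreal 2 ^ (j + 1)" by simp
    also have "\<dots> = ennreal (2 ^ (j + 1))" by (rule ennreal_power) simp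
    finally have "(2::ennreal) ^ (j + 1) = ennreal (2 ^ (j + 1))" .
    then have "2 ^ (j + 1) * ennreal (C / 4 ^ j) = ennreal (2 ^ (j + 1)) * ennreal (C / 4 ^ j)"
      by (simp only:)
    also have "\<dots> = ennreal (2 ^ (j + 1) * (C / 4 ^ j))"
      using that by (intro ennreal_mult[symmetric]) auto
    also have "2 ^ (j + 1) * (C / 4 ^ j) = 2 * C * ((2 / 4) ^ j)" by (simp only: power_divide) simp
    also have "(2 / 4 :: real) = 1 / 2" by simp
    finally show ?thesis .
  qed
  have "(\<lambda>j. 2 * C * (1/2) ^ j) sums (2 * C * (1 / (1 - 1/2)))"
    by (intro sums_mult geometric_sums) simp
  then have "(\<lambda>j. 2 * C * (1/2) ^ j) sums (4 * C)" by simp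
  then show ?thesis unfolding eq using that by (intro suminf_ennreal_eq) auto
qed

context wiener
begin

lemma sobolev_energy_const: "sobolev_energy P (\<lambda>_. d) (d\<^sup>2)"
proof -
  have "smooth_poly_growth 0 (\<lambda>x. d)"
    unfolding smooth_poly_growth_def by (auto intro!: exI[of _ "\<bar>d\<bar>"])
  then have "smooth_functional P 0 (\<lambda>x. d) h (\<lambda>_. d)" for h by (simp add: smooth_functional_def)
  then show ?thesis unfolding sobolev_energy_def
    by (intro exI[of _ 0] exI[of _ "\<lambda>x. d"] exI[of _ "\<lambda>_ _. 0"]) (simp add: cm_form_def prob_space)
qed

text \<open>The weights 2^(j + 1) arise as in \<open>ennreal_square_sum_le\<close>, from one
  application of \<open>sobolev_energy_comb\<close> per summand.\<close>

lemma sobolev_energy_sum: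
  assumes "\<And>j. j < n \<Longrightarrow> \<exists>E\<le>x j. sobolev_energy P (G j) E"
  shows "\<exists>E \<le> (\<Sum>j<n. 2 ^ (j + 1) * x j). sobolev_energy P (\<lambda>\<omega>. \<Sum>j<n. G j \<omega>) E"
  using assms
proof (induction n arbitrary: G x)
  case 0 show ?case using sobolev_energy_const[of 0] by auto
next
  case (Suc n)
  obtain E0 where E0: "E0 \<le> x 0" "sobolev_energy P (G 0) E0" using Suc.prems[of 0] by auto
  obtain E1 where E1: "E1 \<le> (\<Sum>j<n. 2 ^ (j + 1) * x (Suc j))" "sobolev_energy P (\<lambda>\<omega>. \<Sum>j<n. G (Suc j) \<omega>) E1"
    using Suc.IH[of "\<lambda>j. x (Suc j)" "\<lambda>j. G (Suc j)"] Suc.prems by auto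
  obtain E where E: "sobolev_energy P (\<lambda>\<omega>. 1 * G 0 \<omega> + 1 * (\<Sum>j<n. G (Suc j) \<omega>)) E" "E \<le> 2 * 1\<^sup>2 * E0 + 2 * 1\<^sup>2 * E1"
    by (rule sobolev_energy_comb[OF E0(2) E1(2)])
  have "(\<lambda>\<omega>. 1 * G 0 \<omega> + 1 * (\<Sum>j<n. G (Suc j) \<omega>)) = (\<lambda>\<omega>. \<Sum>j<Suc n. G j \<omega>)"
    by (simp add: sum.lessThan_Suc_shift del: sum.lessThan_Suc)
  moreover have "E \<le> (\<Sum>j<Suc n. 2 ^ (j + 1) * x j)"
  proof -
    have "E \<le> 2 * x 0 + 2 * (\<Sum>j<n. 2 ^ (j + 1) * x (Suc j))" using E(2) E0 E1 by simp
    also have "\<dots> = (\<Sum>j<Suc n. 2 ^ (j + 1) * x j)"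
      by (simp add: sum.lessThan_Suc_shift sum_distrib_left mult.assoc del: sum.lessThan_Suc)
    finally show ?thesis .
  qed
  ultimately show ?case using E(1) by auto
qed

lemma sobolev_energy_L2: "sobolev_energy P F E \<Longrightarrow> F \<in> borel_measurable P \<and> (\<integral>\<^sup>+\<omega>. ennreal ((F \<omega>)\<^sup>2) \<partial>P) \<le> ennreal E"
proof -
  assume "sobolev_energy P F E"
  then obtain n f h where F: "smooth_functional P n f h F"
    and E: "E = (\<integral>\<omega>. (F \<omega>)\<^sup>2 \<partial>P) + (\<integral>\<omega>. cm_form n h (\<lambda>i. malliavin_coeff P f h [i] \<omega>) \<partial>P)"
    unfolding sobolev_energy_def by blast
  have "0 \<le> (\<integral>\<omega>. cm_form n h (\<lambda>i. malliavin_coeff P f h [i] \<omega>) \<partial>P)"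
    using F by (intro Bochner_Integration.integral_nonneg cm_form_nonneg) (simp add: smooth_functional_def)
  moreover have "(\<integral>\<^sup>+\<omega>. ennreal ((F \<omega>)\<^sup>2) \<partial>P) = ennreal (\<integral>\<omega>. (F \<omega>)\<^sup>2 \<partial>P)"
    by (rule nn_integral_eq_integral[OF smooth_functional_square_integrable(1)[OF F]]) simp
  ultimately show ?thesis using F E by (simp add: smooth_functional_def ennreal_leI)
qed

lemma sobolev_normE:
  assumes "sobolev_norm P 2 1 \<phi> c"
  obtains F d where "\<phi> \<in> borel_measurable P" "\<And>m. sobolev_energy P (F m) ((d m)\<^sup>2)" "d \<longlonglongrightarrow> c" "\<And>m. 0 \<le> d m"
    "\<And>\<epsilon>. 0 < \<epsilon> \<Longrightarrow> \<exists>M. \<forall>m\<ge>M. \<forall>l\<ge>M. \<exists>E<\<epsilon>\<^sup>2. sobolev_energy P (\<lambda>\<omega>. F m \<omega> - F l \<omega>) E"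
    "(\<lambda>m. \<integral>\<^sup>+\<omega>. ennreal ((F m \<omega> - \<phi> \<omega>)\<^sup>2) \<partial>P) \<longlonglongrightarrow> 0"
proof -
  from assms obtain F d where m: "\<phi> \<in> borel_measurable P" and F: "\<And>m. smooth_sobolev_norm P 2 1 (F m) (d m)"
    and d: "d \<longlonglongrightarrow> c"
    and C: "\<And>\<epsilon>. 0 < \<epsilon> \<Longrightarrow> \<exists>M. \<forall>m\<ge>M. \<forall>l\<ge>M. \<exists>e<\<epsilon>. smooth_sobolev_norm P 2 1 (\<lambda>\<omega>. F m \<omega> - F l \<omega>) e"
    and L: "(\<lambda>m. \<integral>\<^sup>+\<omega>. ennreal (\<bar>F m \<omega> - \<phi> \<omega>\<bar> powr 2) \<partial>P) \<longlonglongrightarrow> 0"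
    unfolding sobolev_norm_def by blast
  have 1: "sobolev_energy P G (e\<^sup>2) \<and> 0 \<le> e" if "smooth_sobolev_norm P 2 1 G e" for G e
    using that sobolev_energy_nonneg unfolding smooth_sobolev_norm_iff by auto
  show ?thesis
  proof (rule that[OF m _ d])
    show "sobolev_energy P (F m) ((d m)\<^sup>2)" "0 \<le> d m" for m using 1[OF F] by auto
    show "\<exists>M. \<forall>m\<ge>M. \<forall>l\<ge>M. \<exists>E<\<epsilon>\<^sup>2. sobolev_energy P (\<lambda>\<omega>. F m \<omega> - F l \<omega>) E" if eps: "0 < \<epsilon>" for \<epsilon>
    proof -
      obtain M where M: "\<And>m l. m \<ge> M \<Longrightarrow> l \<ge> M \<Longrightarrow> \<exists>e<\<epsilon>. smooth_sobolev_norm P 2 1 (\<lambda>\<omega>. F m \<omega> - F l \<omega>) e"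
        using C[OF eps] by blast
      have "\<exists>E<\<epsilon>\<^sup>2. sobolev_energy P (\<lambda>\<omega>. F m \<omega> - F l \<omega>) E" if ml: "m \<ge> M" "l \<ge> M" for m l
      proof -
        obtain e where e: "e < \<epsilon>" "smooth_sobolev_norm P 2 1 (\<lambda>\<omega>. F m \<omega> - F l \<omega>) e" using M[OF ml] by blast
        have "e\<^sup>2 < \<epsilon>\<^sup>2" using e(1) 1[OF e(2)] by (intro power_strict_mono) auto
        then show ?thesis using 1[OF e(2)] by blast
      qed
      then show ?thesis by blast
    qed
    show "(\<lambda>m. \<integral>\<^sup>+\<omega>. ennreal ((F m \<omega> - \<phi> \<omega>)\<^sup>2) \<partial>P) \<longlonglongrightarrow> 0" using L by simp
  qed
qed

lemma sobolev_normI: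
  assumes "\<phi> \<in> borel_measurable P" "\<And>m. sobolev_energy P (F m) (E m)" "(\<lambda>m. sqrt (E m)) \<longlonglongrightarrow> c"
    and C: "\<And>\<epsilon>. 0 < \<epsilon> \<Longrightarrow> \<exists>M. \<forall>m\<ge>M. \<forall>l\<ge>M. \<exists>e<\<epsilon>. sobolev_energy P (\<lambda>\<omega>. F m \<omega> - F l \<omega>) e"
    and L: "(\<lambda>m. \<integral>\<^sup>+\<omega>. ennreal ((F m \<omega> - \<phi> \<omega>)\<^sup>2) \<partial>P) \<longlonglongrightarrow> 0"
  shows "sobolev_norm P 2 1 \<phi> c"
  unfolding sobolev_norm_def
proof (rule conjI[OF assms(1)], rule exI[of _ F], rule exI[of _ "\<lambda>m. sqrt (E m)"], intro conjI allI impI)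
  show "smooth_sobolev_norm P 2 1 (F m) (sqrt (E m))" for m unfolding smooth_sobolev_norm_iff using assms(2) by blast
  show "(\<lambda>m. sqrt (E m)) \<longlonglongrightarrow> c" by fact
  show "(\<lambda>m. \<integral>\<^sup>+\<omega>. ennreal (\<bar>F m \<omega> - \<phi> \<omega>\<bar> powr 2) \<partial>P) \<longlonglongrightarrow> 0" using L by simp
  fix \<epsilon> :: real assume e: "0 < \<epsilon>"
  obtain M where M: "\<And>m l. m \<ge> M \<Longrightarrow> l \<ge> M \<Longrightarrow> \<exists>e<\<epsilon>\<^sup>2. sobolev_energy P (\<lambda>\<omega>. F m \<omega> - F l \<omega>) e"
    using C[of "\<epsilon>\<^sup>2"] e by auto
  have "\<exists>e<\<epsilon>. smooth_sobolev_norm P 2 1 (\<lambda>\<omega>. F m \<omega> - F l \<omega>) e" if ml: "m \<ge> M" "l \<ge> M" for m l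
  proof -
    obtain e' where e': "e' < \<epsilon>\<^sup>2" "sobolev_energy P (\<lambda>\<omega>. F m \<omega> - F l \<omega>) e'" using M[OF ml] by blast
    have "sqrt e' < \<epsilon>" using e'(1) e by (simp add: real_less_lsqrt sobolev_energy_nonneg[OF e'(2)])
    then show ?thesis unfolding smooth_sobolev_norm_iff using e'(2) by blast
  qed
  then show "\<exists>M. \<forall>m\<ge>M. \<forall>l\<ge>M. \<exists>e<\<epsilon>. smooth_sobolev_norm P 2 1 (\<lambda>\<omega>. F m \<omega> - F l \<omega>) e" by blast
qed

lemma sobolev_norm_nonneg: "sobolev_norm P 2 1 \<phi> c \<Longrightarrow> 0 \<le> c"
  by (erule sobolev_normE) (rule LIMSEQ_le_const, assumption, auto)

lemma sobolev_norm_of_energy: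
  assumes "sobolev_energy P F E" shows "sobolev_norm P 2 1 F (sqrt E)"
proof (rule sobolev_normI[where F="\<lambda>_. F" and E="\<lambda>_. E"])
  show "F \<in> borel_measurable P" using sobolev_energy_L2[OF assms] by simp
  \<comment> \<open>The difference F - F is represented as the constant 0 rather than by
    concatenation, which gives it energy 0.\<close>
  show "\<exists>M. \<forall>m\<ge>M. \<forall>l\<ge>M. \<exists>e<\<epsilon>. sobolev_energy P (\<lambda>\<omega>. F \<omega> - F \<omega>) e" if "0 < \<epsilon>" for \<epsilon>
    using sobolev_energy_const[of 0] that by auto
qed (use assms in simp_all)

text \<open>Explicit rates for the Cauchy property and for the L^2 convergence allow infinitely many
  approximating sequences to be combined diagonally in \<open>sobolev_countable_sum\<close>.\<close>

lemma fast_approximation: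
  assumes "sobolev_norm P 2 1 \<phi> c" "c < \<epsilon>" "0 < \<epsilon>" "\<epsilon> \<le> \<delta>"
  obtains F where "\<And>m. \<exists>E\<le>\<epsilon>\<^sup>2. sobolev_energy P (F m) E"
    "\<And>k m l. k \<le> m \<Longrightarrow> k \<le> l \<Longrightarrow> \<exists>E\<le>(\<delta> / 4 ^ k)\<^sup>2. sobolev_energy P (\<lambda>\<omega>. F m \<omega> - F l \<omega>) E"
    "\<And>m. (\<integral>\<^sup>+\<omega>. ennreal ((F m \<omega> - \<phi> \<omega>)\<^sup>2) \<partial>P) \<le> ennreal ((\<delta> / 4 ^ m)\<^sup>2)"
proof -
  obtain F d where "\<phi> \<in> borel_measurable P" and F: "\<And>m. sobolev_energy P (F m) ((d m)\<^sup>2)" and d: "d \<longlonglongrightarrow> c" "\<And>m. 0 \<le> d m"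
    and C: "\<And>\<epsilon>. 0 < \<epsilon> \<Longrightarrow> \<exists>M. \<forall>m\<ge>M. \<forall>l\<ge>M. \<exists>E<\<epsilon>\<^sup>2. sobolev_energy P (\<lambda>\<omega>. F m \<omega> - F l \<omega>) E"
    and L: "(\<lambda>m. \<integral>\<^sup>+\<omega>. ennreal ((F m \<omega> - \<phi> \<omega>)\<^sup>2) \<partial>P) \<longlonglongrightarrow> 0"
    by (rule sobolev_normE[OF assms(1)]) blast
  have dk: "0 < \<delta> / 4 ^ k" for k using assms by simp
  have "\<exists>T. \<forall>m\<ge>T. d m < \<epsilon> \<and> (\<integral>\<^sup>+\<omega>. ennreal ((F m \<omega> - \<phi> \<omega>)\<^sup>2) \<partial>P) < ennreal ((\<delta> / 4 ^ k)\<^sup>2) \<and>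
     (\<forall>l\<ge>T. \<exists>E<(\<delta> / 4 ^ k)\<^sup>2. sobolev_energy P (\<lambda>\<omega>. F m \<omega> - F l \<omega>) E)" for k
  proof -
    obtain T1 where T1: "\<And>m. m \<ge> T1 \<Longrightarrow> d m < \<epsilon>"
      using order_tendstoD(2)[OF d(1) assms(2)] unfolding eventually_sequentially by blast
    have "0 < ennreal ((\<delta> / 4 ^ k)\<^sup>2)" using zero_less_power[OF dk[of k], of 2] by (simp only: ennreal_less_zero_iff)
    from order_tendstoD(2)[OF L this]
    obtain T2 where T2: "\<And>m. m \<ge> T2 \<Longrightarrow> (\<integral>\<^sup>+\<omega>. ennreal ((F m \<omega> - \<phi> \<omega>)\<^sup>2) \<partial>P) < ennreal ((\<delta> / 4 ^ k)\<^sup>2)"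
      unfolding eventually_sequentially by blast
    obtain T3 where T3: "\<And>m l. m \<ge> T3 \<Longrightarrow> l \<ge> T3 \<Longrightarrow> \<exists>E<(\<delta> / 4 ^ k)\<^sup>2. sobolev_energy P (\<lambda>\<omega>. F m \<omega> - F l \<omega>) E"
      using C[OF dk] by blast
    show ?thesis
    proof (intro exI[of _ "max T1 (max T2 T3)"] allI impI conjI)
      fix m assume m: "max T1 (max T2 T3) \<le> m"
      show "d m < \<epsilon>" using T1 m by simp
      show "(\<integral>\<^sup>+\<omega>. ennreal ((F m \<omega> - \<phi> \<omega>)\<^sup>2) \<partial>P) < ennreal ((\<delta> / 4 ^ k)\<^sup>2)" using T2 m by simp
      show "\<exists>E<(\<delta> / 4 ^ k)\<^sup>2. sobolev_energy P (\<lambda>\<omega>. F m \<omega> - F l \<omega>) E" if "max T1 (max T2 T3) \<le> l" for l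
        using T3[of m l] m that by simp
    qed
  qed
  then have "\<forall>k. \<exists>T. \<forall>m\<ge>T. d m < \<epsilon> \<and> (\<integral>\<^sup>+\<omega>. ennreal ((F m \<omega> - \<phi> \<omega>)\<^sup>2) \<partial>P) < ennreal ((\<delta> / 4 ^ k)\<^sup>2) \<and>
     (\<forall>l\<ge>T. \<exists>E<(\<delta> / 4 ^ k)\<^sup>2. sobolev_energy P (\<lambda>\<omega>. F m \<omega> - F l \<omega>) E)" by (intro allI)
  from choice[OF this] obtain T where "\<forall>k. \<forall>m\<ge>T k. d m < \<epsilon> \<and> (\<integral>\<^sup>+\<omega>. ennreal ((F m \<omega> - \<phi> \<omega>)\<^sup>2) \<partial>P) < ennreal ((\<delta> / 4 ^ k)\<^sup>2) \<and>
     (\<forall>l\<ge>T k. \<exists>E<(\<delta> / 4 ^ k)\<^sup>2. sobolev_energy P (\<lambda>\<omega>. F m \<omega> - F l \<omega>) E)" ..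
  then have T: "\<And>k m. m \<ge> T k \<Longrightarrow> d m < \<epsilon>"
      "\<And>k m. m \<ge> T k \<Longrightarrow> (\<integral>\<^sup>+\<omega>. ennreal ((F m \<omega> - \<phi> \<omega>)\<^sup>2) \<partial>P) < ennreal ((\<delta> / 4 ^ k)\<^sup>2)"
      "\<And>k m l. m \<ge> T k \<Longrightarrow> l \<ge> T k \<Longrightarrow> \<exists>E<(\<delta> / 4 ^ k)\<^sup>2. sobolev_energy P (\<lambda>\<omega>. F m \<omega> - F l \<omega>) E"
    by simp_all
  \<comment> \<open>The sum dominates every \<open>T k\<close> with k \<le> m and thus serves as a
    maximum.\<close>
  define s where "s m = (\<Sum>k\<le>m. T k)" for m
  have s: "T k \<le> s m" if "k \<le> m" for k m
    unfolding s_def by (rule member_le_sum) (use that in auto)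
  show ?thesis
  proof (rule that[of "\<lambda>m. F (s m)"])
    show "\<exists>E\<le>\<epsilon>\<^sup>2. sobolev_energy P (F (s m)) E" for m
      using F[of "s m"] T(1)[OF s[of m m]] d(2)[of "s m"] by (intro exI[of _ "(d (s m))\<^sup>2"]) (auto intro: power_mono)
    show "\<exists>E\<le>(\<delta> / 4 ^ k)\<^sup>2. sobolev_energy P (\<lambda>\<omega>. F (s m) \<omega> - F (s l) \<omega>) E" if "k \<le> m" "k \<le> l" for k m l
      using T(3)[OF s[OF that(1)] s[OF that(2)]] by (meson less_imp_le)
    show "(\<integral>\<^sup>+\<omega>. ennreal ((F (s m) \<omega> - \<phi> \<omega>)\<^sup>2) \<partial>P) \<le> ennreal ((\<delta> / 4 ^ m)\<^sup>2)" for m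
      using T(2)[OF s[of m m]] by simp
  qed
qed

end

lemma ex_le_weaken: "\<exists>E\<le>x. Q E \<Longrightarrow> x \<le> (y::real) \<Longrightarrow> \<exists>E\<le>y. Q E"
  by (blast intro: order_trans)

context wiener
begin

text \<open>The sign is changed with \<open>sobolev_energy_comb\<close>; this is where the factor 2
  comes from.\<close>

lemma sobolev_energy_sub_commute:
  assumes "sobolev_energy P (\<lambda>\<omega>. F \<omega> - G \<omega>) E"
  shows "\<exists>E'\<le>2 * E. sobolev_energy P (\<lambda>\<omega>. G \<omega> - F \<omega>) E'"
proof -
  obtain E' where E': "sobolev_energy P (\<lambda>\<omega>. (- 1) * (F \<omega> - G \<omega>) + 0 * (F \<omega> - G \<omega>)) E'" "E' \<le> 2 * (- 1)\<^sup>2 * E + 2 * 0\<^sup>2 * E"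
    by (rule sobolev_energy_comb[OF assms assms])
  have "(\<lambda>\<omega>. (- 1) * (F \<omega> - G \<omega>) + 0 * (F \<omega> - G \<omega>)) = (\<lambda>\<omega>. G \<omega> - F \<omega>)" by auto
  then show ?thesis using E' by auto
qed

lemma weighted_sum_bound:
  fixes x :: "nat \<Rightarrow> real"
  assumes "\<And>j. j < n \<Longrightarrow> x j \<le> C / 4 ^ j" "0 \<le> C"
  shows "(\<Sum>j<n. 2 ^ (j + 1) * x j) \<le> 4 * C"
proof -
  have "(\<Sum>j<n. 2 ^ (j + 1) * x j) \<le> (\<Sum>j<n. 2 * C * (1/2) ^ j)"
  proof (rule sum_mono)
    fix j assume "j \<in> {..<n}"
    then have "2 ^ (j + 1) * x j \<le> 2 ^ (j + 1) * (C / 4 ^ j)" using assms(1)[of j] by (intro mult_left_mono) auto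
    also have "\<dots> = 2 * C * (2 / 4) ^ j" by (simp only: power_divide) simp
    finally show "2 ^ (j + 1) * x j \<le> 2 * C * (1/2) ^ j" by simp
  qed
  also have "\<dots> = 2 * C * (\<Sum>j<n. (1/2) ^ j)" by (simp add: sum_distrib_left)
  also have "\<dots> \<le> 2 * C * 2"
    using assms(2) by (intro mult_left_mono) (simp_all add: sum_gp_strict)
  finally show ?thesis by simp
qed

text \<open>Countable subadditivity of the capacity rests on this: the sum of nonnegative functions
  dominates each of them, and its norm is small if the norms decay fast. It is approximated
  diagonally by \<open>G m\<close>, the sum over j < m of the m-th approximants of the \<phi>
  j.\<close>

lemma sobolev_countable_sum:
  assumes \<phi>: "\<And>j. sobolev_norm P 2 1 (\<phi> j) (c j)" "\<And>j. c j < \<eta> / 4 ^ (j + 1)" and \<eta>: "0 < \<eta>"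
    and nonneg: "\<And>j. AE \<omega> in P. 0 \<le> \<phi> j \<omega>"
  obtains \<Phi> c' where "sobolev_norm P 2 1 \<Phi> c'" "c' < \<eta>" "AE \<omega> in P. \<forall>j. \<phi> j \<omega> \<le> \<Phi> \<omega>" "\<And>\<omega>. 0 \<le> \<Phi> \<omega>"
proof -
  \<comment> \<open>Only positivity and \<eta> \<le> \<delta> matter.\<close>
  define \<delta> where "\<delta> = 1 + \<eta>"
  have \<delta>: "0 < \<delta>" "\<eta> \<le> \<delta>" using \<eta> by (auto simp: \<delta>_def)
  define D where "D = 2 * \<delta>\<^sup>2"
  have D: "0 < D" using \<delta> by (simp add: D_def)
  define R where "R j F \<longleftrightarrow> (\<forall>m. \<exists>E\<le>(\<eta> / 4 ^ (j + 1))\<^sup>2. sobolev_energy P (F m) E) \<and>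
    (\<forall>k m l. k \<le> m \<longrightarrow> k \<le> l \<longrightarrow> (\<exists>E\<le>(\<delta> / 4 ^ j / 4 ^ k)\<^sup>2. sobolev_energy P (\<lambda>\<omega>. F m \<omega> - F l \<omega>) E)) \<and>
    (\<forall>m. (\<integral>\<^sup>+\<omega>. ennreal ((F m \<omega> - \<phi> j \<omega>)\<^sup>2) \<partial>P) \<le> ennreal ((\<delta> / 4 ^ j / 4 ^ m)\<^sup>2))" for j F
  have "\<exists>F. R j F" for j
  proof -
    have "\<eta> / 4 ^ (j + 1) \<le> \<delta> / 4 ^ j" using \<delta> \<eta> by (intro frac_le) auto
    moreover have "0 < \<eta> / 4 ^ (j + 1)" using \<eta> by simp
    ultimately obtain F where "\<And>m. \<exists>E\<le>(\<eta> / 4 ^ (j + 1))\<^sup>2. sobolev_energy P (F m) E"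
      "\<And>k m l. k \<le> m \<Longrightarrow> k \<le> l \<Longrightarrow> \<exists>E\<le>(\<delta> / 4 ^ j / 4 ^ k)\<^sup>2. sobolev_energy P (\<lambda>\<omega>. F m \<omega> - F l \<omega>) E"
      "\<And>m. (\<integral>\<^sup>+\<omega>. ennreal ((F m \<omega> - \<phi> j \<omega>)\<^sup>2) \<partial>P) \<le> ennreal ((\<delta> / 4 ^ j / 4 ^ m)\<^sup>2)"
      by (elim fast_approximation[OF \<phi>(1)[of j] \<phi>(2)[of j], rotated]) blast
    then have "R j F" unfolding R_def by blast
    then show ?thesis by blast
  qed
  then obtain F where R: "\<And>j. R j (F j)" by metis
  have F1: "\<exists>E\<le>(\<eta> / 4 ^ (j + 1))\<^sup>2. sobolev_energy P (F j m) E" for j m using R[of j] by (simp add: R_def)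
  have F2: "\<exists>E\<le>(\<delta> / 4 ^ j / 4 ^ k)\<^sup>2. sobolev_energy P (\<lambda>\<omega>. F j m \<omega> - F j l \<omega>) E" if "k \<le> m" "k \<le> l" for j k m l
    using R[of j] that by (simp add: R_def)
  have F3: "(\<integral>\<^sup>+\<omega>. ennreal ((F j m \<omega> - \<phi> j \<omega>)\<^sup>2) \<partial>P) \<le> ennreal ((\<delta> / 4 ^ j / 4 ^ m)\<^sup>2)" for j m using R[of j] by (simp add: R_def)
  have Fm [measurable]: "F j m \<in> borel_measurable P" for j m using F1[of j m] sobolev_energy_L2 by blast
  have \<phi>m [measurable]: "\<phi> j \<in> borel_measurable P" for j using \<phi>(1)[of j] by (simp add: sobolev_norm_def)
  \<comment> \<open>The square of 4^(-j-k) is at most 4^(-j-k) itself. This product form suits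
    \<open>weighted_sum_bound\<close> in j and keeps the decay in k.\<close>
  have small: "(\<delta> / 4 ^ j / 4 ^ k)\<^sup>2 \<le> (D / 4 ^ k) / 4 ^ j" for j k
  proof -
    have "(\<delta> / 4 ^ j / 4 ^ k)\<^sup>2 = \<delta>\<^sup>2 / (4 ^ j * 4 ^ k) * (1 / (4 ^ j * 4 ^ k))" by (simp add: power2_eq_square)
    also have "\<dots> \<le> \<delta>\<^sup>2 / (4 ^ j * 4 ^ k) * 1"
      using one_le_power[of "4::real" j] one_le_power[of "4::real" k] mult_mono[of 1 "4 ^ j" 1 "4 ^ k :: real"]
      by (intro mult_left_mono) (auto simp: divide_le_eq)
    also have "\<dots> \<le> (D / 4 ^ k) / 4 ^ j" unfolding D_def by (simp add: field_simps)
    finally show ?thesis .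
  qed
  have small': "(\<eta> / 4 ^ (j + 1))\<^sup>2 \<le> (D / 4 ^ k) / 4 ^ j" if "k \<le> j" for j k
  proof -
    have "(\<eta> / 4 ^ (j + 1))\<^sup>2 \<le> (\<delta> / 4 ^ j)\<^sup>2" using \<delta> \<eta> by (intro power_mono frac_le) auto
    also have "\<dots> = \<delta>\<^sup>2 / (4 ^ j * 4 ^ j)" by (simp add: power2_eq_square)
    also have "\<dots> \<le> D / (4 ^ k * 4 ^ j)"
      unfolding D_def using that \<delta> by (intro frac_le mult_right_mono power_increasing) auto
    finally show ?thesis by simp
  qed
  define G where "G m \<omega> = (\<Sum>j<m. F j m \<omega>)" for m \<omega>
  have Gm [measurable]: "G m \<in> borel_measurable P" for m unfolding G_def by measurable
  have G1: "\<exists>E\<le>\<eta>\<^sup>2 / 4. sobolev_energy P (G m) E" for m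
  proof -
    have "\<exists>E\<le>(\<Sum>j<m. 2 ^ (j + 1) * (\<eta> / 4 ^ (j + 1))\<^sup>2). sobolev_energy P (\<lambda>\<omega>. \<Sum>j<m. F j m \<omega>) E"
      by (rule sobolev_energy_sum) (rule F1)
    moreover have "(\<Sum>j<m. 2 ^ (j + 1) * (\<eta> / 4 ^ (j + 1))\<^sup>2) \<le> 4 * (\<eta>\<^sup>2 / 16)"
    proof (rule weighted_sum_bound)
      fix j
      have "(\<eta> / 4 ^ (j + 1))\<^sup>2 = \<eta>\<^sup>2 / 16 / 4 ^ j * (1 / 4 ^ j)" by (simp add: power2_eq_square)
      also have "\<dots> \<le> \<eta>\<^sup>2 / 16 / 4 ^ j * 1" by (intro mult_left_mono) (auto simp: divide_le_eq)
      finally show "(\<eta> / 4 ^ (j + 1))\<^sup>2 \<le> \<eta>\<^sup>2 / 16 / 4 ^ j" by simp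
    qed simp
    ultimately show ?thesis unfolding G_def by (rule ex_le_weaken[OF _ order_trans]) simp
  qed
  have G2: "\<exists>E\<le>4 * (D / 4 ^ k). sobolev_energy P (\<lambda>\<omega>. G m \<omega> - G l \<omega>) E" if kl: "k \<le> l" "l \<le> m" for k l m
  proof -
    \<comment> \<open>For j < l two approximants of the same function are subtracted. For the
      remaining j the approximant stands alone, and its energy is small because j \<ge> l \<ge>
      k.\<close>
    define H where "H j = (if j < l then (\<lambda>\<omega>. F j m \<omega> - F j l \<omega>) else F j m)" for j
    have "\<exists>E\<le>(D / 4 ^ k) / 4 ^ j. sobolev_energy P (H j) E" for j
    proof (cases "j < l")
      case True
      then show ?thesis using ex_le_weaken[OF F2[of k m l j] small] kl by (simp add: H_def)
    next
      case False
      then show ?thesis using ex_le_weaken[OF F1[of j m] small'[of k j]] kl by (simp add: H_def)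
    qed
    then have "\<exists>E\<le>(\<Sum>j<m. 2 ^ (j + 1) * ((D / 4 ^ k) / 4 ^ j)). sobolev_energy P (\<lambda>\<omega>. \<Sum>j<m. H j \<omega>) E"
      by (intro sobolev_energy_sum)
    moreover have "(\<Sum>j<m. 2 ^ (j + 1) * ((D / 4 ^ k) / 4 ^ j)) \<le> 4 * (D / 4 ^ k)"
      using D by (intro weighted_sum_bound) auto
    ultimately have "\<exists>E\<le>4 * (D / 4 ^ k). sobolev_energy P (\<lambda>\<omega>. \<Sum>j<m. H j \<omega>) E"
      by (rule ex_le_weaken)
    moreover have "(\<lambda>\<omega>. \<Sum>j<m. H j \<omega>) = (\<lambda>\<omega>. G m \<omega> - G l \<omega>)"
    proof
      fix \<omega>
      have "G l \<omega> = (\<Sum>j<m. if j < l then F j l \<omega> else 0)"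
        unfolding G_def using kl by (intro sum.mono_neutral_cong_left) auto
      then show "(\<Sum>j<m. H j \<omega>) = G m \<omega> - G l \<omega>"
        unfolding G_def H_def by (simp only: sum_subtractf[symmetric]) (intro sum.cong refl, simp)
    qed
    ultimately show ?thesis by simp
  qed
  have G3: "\<exists>E\<le>8 * (D / 4 ^ k). sobolev_energy P (\<lambda>\<omega>. G m \<omega> - G l \<omega>) E" if km: "k \<le> l" "k \<le> m" for k l m
  proof (cases "l \<le> m")
    case True
    have "4 * (D / 4 ^ k) \<le> 8 * (D / 4 ^ k)" using D by (intro mult_right_mono) auto
    then show ?thesis by (rule ex_le_weaken[OF G2[OF km(1) True]])
  next
    case False
    then obtain E where E: "E \<le> 4 * (D / 4 ^ k)" "sobolev_energy P (\<lambda>\<omega>. G l \<omega> - G m \<omega>) E"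
      using G2[of k m l] km by auto
    obtain E' where "E' \<le> 2 * E" "sobolev_energy P (\<lambda>\<omega>. G m \<omega> - G l \<omega>) E'"
      using sobolev_energy_sub_commute[OF E(2)] by blast
    then show ?thesis using E(1) by (intro exI[of _ E']) auto
  qed
  have small0: "\<exists>M. 8 * (D / 4 ^ M) < \<epsilon>" if "0 < \<epsilon>" for \<epsilon> :: real
  proof -
    have "(\<lambda>M. 8 * (D * (1/4) ^ M)) \<longlonglongrightarrow> 8 * (D * 0)"
      by (intro tendsto_mult tendsto_const LIMSEQ_realpow_zero) auto
    then have "(\<lambda>M. 8 * (D / 4 ^ M)) \<longlonglongrightarrow> 0" by (simp add: power_one_over)
    from order_tendstoD(2)[OF this that] show ?thesis by (auto simp: eventually_sequentially)
  qed
  have "\<forall>m. \<exists>E. E \<le> \<eta>\<^sup>2 / 4 \<and> sobolev_energy P (G m) E" using G1 by simp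
  from choice[OF this] obtain E where "\<forall>m. E m \<le> \<eta>\<^sup>2 / 4 \<and> sobolev_energy P (G m) (E m)" ..
  then have E: "\<And>m. E m \<le> \<eta>\<^sup>2 / 4" "\<And>m. sobolev_energy P (G m) (E m)" by simp_all
  \<comment> \<open>The energies belong to particular representations and need not converge. Being
    bounded they do so along a subsequence, and any approximating sequence may witness
    \<open>sobolev_norm\<close>.\<close>
  have "\<forall>m. sqrt (E m) \<in> {0..\<eta> / 2}"
  proof
    fix m
    have "sqrt (E m) \<le> sqrt ((\<eta> / 2)\<^sup>2)" using E(1)[of m] by (simp add: power_divide)
    then show "sqrt (E m) \<in> {0..\<eta> / 2}" using sobolev_energy_nonneg[OF E(2)[of m]] \<eta> by simp
  qed
  then obtain c' r where c': "c' \<in> {0..\<eta> / 2}" and r: "strict_mono (r :: nat \<Rightarrow> nat)" and lim: "((\<lambda>m. sqrt (E m)) \<circ> r) \<longlonglongrightarrow> c'"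
    by (rule seq_compactE[OF compact_imp_seq_compact[OF compact_Icc]])
  \<comment> \<open>The pointwise sum always exists in \<open>ennreal\<close>;
    \<open>enn2real\<close> sends the value infinity to 0, which happens only on a null set.\<close>
  define S where "S \<omega> = (\<Sum>j. ennreal (\<phi> j \<omega>))" for \<omega>
  define \<Phi> where "\<Phi> \<omega> = enn2real (S \<omega>)" for \<omega>
  have [measurable]: "S \<in> borel_measurable P" unfolding S_def[abs_def] by measurable
  have [measurable]: "\<Phi> \<in> borel_measurable P" unfolding \<Phi>_def[abs_def] by measurable
  have sum_bound: "(\<integral>\<^sup>+\<omega>. (\<Sum>j. y j \<omega>)\<^sup>2 \<partial>P) \<le> ennreal (4 * C)"
    if [measurable]: "\<And>j. y j \<in> borel_measurable P" and y: "\<And>j. (\<integral>\<^sup>+\<omega>. (y j \<omega>)\<^sup>2 \<partial>P) \<le> ennreal (C / 4 ^ j)" and C: "0 \<le> C"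
    for y :: "nat \<Rightarrow> (real \<Rightarrow> real) \<Rightarrow> ennreal" and C
  proof -
    have "(\<integral>\<^sup>+\<omega>. (\<Sum>j. y j \<omega>)\<^sup>2 \<partial>P) \<le> (\<integral>\<^sup>+\<omega>. (\<Sum>j. 2 ^ (j + 1) * (y j \<omega>)\<^sup>2) \<partial>P)"
      by (intro nn_integral_mono ennreal_square_suminf_le)
    also have "\<dots> = (\<Sum>j. \<integral>\<^sup>+\<omega>. 2 ^ (j + 1) * (y j \<omega>)\<^sup>2 \<partial>P)" by (rule nn_integral_suminf) measurable
    also have "\<dots> = (\<Sum>j. 2 ^ (j + 1) * (\<integral>\<^sup>+\<omega>. (y j \<omega>)\<^sup>2 \<partial>P))" by (intro suminf_cong nn_integral_cmult) measurable
    also have "\<dots> \<le> (\<Sum>j. 2 ^ (j + 1) * ennreal (C / 4 ^ j))" by (intro suminf_le mult_left_mono y) auto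
    also have "\<dots> = ennreal (4 * C)" by (rule suminf_geometric_bound[OF C])
    finally show ?thesis .
  qed
  have \<phi>2: "(\<integral>\<^sup>+\<omega>. (ennreal \<bar>\<phi> j \<omega>\<bar>)\<^sup>2 \<partial>P) \<le> ennreal (4 * (D / 4 ^ k) / 4 ^ j)" if "k \<le> j" for j k
  proof -
    obtain E0 where E0: "E0 \<le> (\<eta> / 4 ^ (j + 1))\<^sup>2" "sobolev_energy P (F j k) E0" using F1 by blast
    have "(\<integral>\<^sup>+\<omega>. (ennreal \<bar>\<phi> j \<omega>\<bar>)\<^sup>2 \<partial>P) = (\<integral>\<^sup>+\<omega>. ennreal ((0 - \<phi> j \<omega>)\<^sup>2) \<partial>P)"
      by (intro nn_integral_cong) (simp add: ennreal_power)
    also have "\<dots> \<le> 2 * (\<integral>\<^sup>+\<omega>. ennreal ((0 - F j k \<omega>)\<^sup>2) \<partial>P) + 2 * (\<integral>\<^sup>+\<omega>. ennreal ((F j k \<omega> - \<phi> j \<omega>)\<^sup>2) \<partial>P)"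
      by (rule nn_integral_square_diff_le) measurable
    also have "\<dots> \<le> 2 * ennreal ((D / 4 ^ k) / 4 ^ j) + 2 * ennreal ((D / 4 ^ k) / 4 ^ j)"
    proof (intro add_mono mult_left_mono)
      have "(\<integral>\<^sup>+\<omega>. ennreal ((0 - F j k \<omega>)\<^sup>2) \<partial>P) \<le> ennreal E0" using sobolev_energy_L2[OF E0(2)] by simp
      also have "\<dots> \<le> ennreal ((D / 4 ^ k) / 4 ^ j)" using E0(1) small'[OF that] by (intro ennreal_leI) linarith
      finally show "(\<integral>\<^sup>+\<omega>. ennreal ((0 - F j k \<omega>)\<^sup>2) \<partial>P) \<le> ennreal ((D / 4 ^ k) / 4 ^ j)" .
      show "(\<integral>\<^sup>+\<omega>. ennreal ((F j k \<omega> - \<phi> j \<omega>)\<^sup>2) \<partial>P) \<le> ennreal ((D / 4 ^ k) / 4 ^ j)"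
        by (rule order_trans[OF F3 ennreal_leI[OF small]])
    qed simp_all
    also have "\<dots> = ennreal (4 * (D / 4 ^ k) / 4 ^ j)"
      using D by (simp add: numeral_mult_ennreal ennreal_plus[symmetric] del: ennreal_plus)
    finally show ?thesis .
  qed
  have "(\<integral>\<^sup>+\<omega>. (S \<omega>)\<^sup>2 \<partial>P) \<le> (\<integral>\<^sup>+\<omega>. (\<Sum>j. ennreal \<bar>\<phi> j \<omega>\<bar>)\<^sup>2 \<partial>P)"
    unfolding S_def by (intro nn_integral_mono power_mono suminf_le ennreal_leI) auto
  also have "\<dots> \<le> ennreal (4 * (4 * (D / 4 ^ 0)))" by (rule sum_bound) (use \<phi>2[of 0] D in auto)
  also have "\<dots> < \<infinity>" by simp
  finally have "AE \<omega> in P. (S \<omega>)\<^sup>2 \<noteq> \<infinity>" by (intro nn_integral_noteq_infinite) auto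
  then have fin: "AE \<omega> in P. S \<omega> \<noteq> \<infinity>" by eventually_elim (auto simp: power2_eq_square)
  have nn: "AE \<omega> in P. \<forall>j. 0 \<le> \<phi> j \<omega>" using nonneg by (simp add: AE_all_countable)
  have conv: "(\<integral>\<^sup>+\<omega>. ennreal ((G m \<omega> - \<Phi> \<omega>)\<^sup>2) \<partial>P) \<le> ennreal (16 * (D / 4 ^ m))" for m
  proof -
    \<comment> \<open>The distance of \<open>G m\<close> from the full sum consists of the
      approximation errors for j < m and of the tail of the series.\<close>
    define y where "y j \<omega> = (if j < m then ennreal \<bar>F j m \<omega> - \<phi> j \<omega>\<bar> else ennreal \<bar>\<phi> j \<omega>\<bar>)" for j \<omega>
    have "(\<integral>\<^sup>+\<omega>. ennreal ((G m \<omega> - \<Phi> \<omega>)\<^sup>2) \<partial>P) \<le> (\<integral>\<^sup>+\<omega>. (\<Sum>j. y j \<omega>)\<^sup>2 \<partial>P)"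
    proof (rule nn_integral_mono_AE, use fin nn in eventually_elim)
      fix \<omega> assume f: "S \<omega> \<noteq> \<infinity>" and n: "\<forall>j. 0 \<le> \<phi> j \<omega>"
      have sm: "summable (\<lambda>j. \<phi> j \<omega>)"
        by (rule summable_suminf_not_top) (use f n in \<open>auto simp: S_def\<close>)
      have S: "S \<omega> = ennreal (\<Sum>j. \<phi> j \<omega>)" unfolding S_def by (rule suminf_ennreal2[OF _ sm]) (use n in auto)
      have \<Phi>: "\<Phi> \<omega> = (\<Sum>j. \<phi> j \<omega>)" unfolding \<Phi>_def S using sm n by (simp add: suminf_nonneg)
      have split: "(\<Sum>j. \<phi> j \<omega>) = (\<Sum>j. \<phi> (j + m) \<omega>) + (\<Sum>j<m. \<phi> j \<omega>)"
        by (rule suminf_split_initial_segment[OF sm])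
      have smm: "summable (\<lambda>j. \<phi> (j + m) \<omega>)" using sm by (rule summable_ignore_initial_segment)
      have tn: "0 \<le> (\<Sum>j. \<phi> (j + m) \<omega>)" by (rule suminf_nonneg[OF smm]) (use n in simp)
      have tail: "ennreal (\<Sum>j. \<phi> (j + m) \<omega>) = (\<Sum>j. y (j + m) \<omega>)"
        by (subst suminf_ennreal2[OF _ smm, symmetric]) (use n in \<open>auto simp: y_def\<close>)
      have "G m \<omega> - \<Phi> \<omega> = (\<Sum>j<m. F j m \<omega> - \<phi> j \<omega>) - (\<Sum>j. \<phi> (j + m) \<omega>)"
        unfolding \<Phi> split G_def by (simp add: sum_subtractf)
      then have "\<bar>G m \<omega> - \<Phi> \<omega>\<bar> \<le> (\<Sum>j<m. \<bar>F j m \<omega> - \<phi> j \<omega>\<bar>) + (\<Sum>j. \<phi> (j + m) \<omega>)"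
        using sum_abs[of "\<lambda>j. F j m \<omega> - \<phi> j \<omega>" "{..<m}"] tn by linarith
      then have "ennreal \<bar>G m \<omega> - \<Phi> \<omega>\<bar> \<le> ennreal ((\<Sum>j<m. \<bar>F j m \<omega> - \<phi> j \<omega>\<bar>) + (\<Sum>j. \<phi> (j + m) \<omega>))"
        by (rule ennreal_leI)
      also have "\<dots> = (\<Sum>j<m. y j \<omega>) + (\<Sum>j. y (j + m) \<omega>)"
        unfolding tail[symmetric] using n smm by (subst ennreal_plus) (auto simp: y_def sum_nonneg suminf_nonneg intro!: sum.cong)
      also have "\<dots> = (\<Sum>j. y j \<omega>)"
        by (subst suminf_offset[of "\<lambda>j. y j \<omega>" m]) (auto simp: add.commute)
      finally have "(ennreal \<bar>G m \<omega> - \<Phi> \<omega>\<bar>)\<^sup>2 \<le> (\<Sum>j. y j \<omega>)\<^sup>2" by (intro power_mono) auto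
      then show "ennreal ((G m \<omega> - \<Phi> \<omega>)\<^sup>2) \<le> (\<Sum>j. y j \<omega>)\<^sup>2" by (simp add: ennreal_power)
    qed
    also have "\<dots> \<le> ennreal (4 * (4 * (D / 4 ^ m)))"
    proof (rule sum_bound)
      show "y j \<in> borel_measurable P" for j unfolding y_def by measurable
      show "0 \<le> 4 * (D / 4 ^ m)" using D by simp
      show "(\<integral>\<^sup>+\<omega>. (y j \<omega>)\<^sup>2 \<partial>P) \<le> ennreal (4 * (D / 4 ^ m) / 4 ^ j)" for j
      proof (cases "j < m")
        case True
        then have "(\<integral>\<^sup>+\<omega>. (y j \<omega>)\<^sup>2 \<partial>P) = (\<integral>\<^sup>+\<omega>. ennreal ((F j m \<omega> - \<phi> j \<omega>)\<^sup>2) \<partial>P)"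
          by (intro nn_integral_cong) (simp add: y_def ennreal_power)
        also have "\<dots> \<le> ennreal ((D / 4 ^ m) / 4 ^ j)" by (rule order_trans[OF F3 ennreal_leI[OF small]])
        also have "\<dots> \<le> ennreal (4 * (D / 4 ^ m) / 4 ^ j)" using D
          by (intro ennreal_leI divide_right_mono) (auto simp: divide_right_mono)
        finally show ?thesis .
      next
        case False
        then show ?thesis using \<phi>2[of m j] by (simp add: y_def)
      qed
    qed
    finally show ?thesis by simp
  qed
  have G\<Phi>: "(\<lambda>m. \<integral>\<^sup>+\<omega>. ennreal ((G m \<omega> - \<Phi> \<omega>)\<^sup>2) \<partial>P) \<longlonglongrightarrow> 0"
  proof (rule tendsto_sandwich[OF _ _ tendsto_const])
    have "(\<lambda>M. ennreal (16 * (D * (1/4) ^ M))) \<longlonglongrightarrow> ennreal (16 * (D * 0))"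
      by (intro tendsto_ennrealI tendsto_mult tendsto_const LIMSEQ_realpow_zero) auto
    then show "(\<lambda>M. ennreal (16 * (D / 4 ^ M))) \<longlonglongrightarrow> 0" by (simp add: power_one_over)
  qed (use conv in auto)
  have "sobolev_norm P 2 1 \<Phi> c'"
  proof (rule sobolev_normI[where F="\<lambda>m. G (r m)" and E="\<lambda>m. E (r m)"])
    show "(\<lambda>m. sqrt (E (r m))) \<longlonglongrightarrow> c'" using lim by (simp add: o_def)
    show "(\<lambda>m. \<integral>\<^sup>+\<omega>. ennreal ((G (r m) \<omega> - \<Phi> \<omega>)\<^sup>2) \<partial>P) \<longlonglongrightarrow> 0"
      using LIMSEQ_subseq_LIMSEQ[OF G\<Phi> r] by (simp add: o_def)
    show "\<exists>M. \<forall>m\<ge>M. \<forall>l\<ge>M. \<exists>e<\<epsilon>. sobolev_energy P (\<lambda>\<omega>. G (r m) \<omega> - G (r l) \<omega>) e" if eps: "0 < \<epsilon>" for \<epsilon>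
    proof -
      obtain M where M: "8 * (D / 4 ^ M) < \<epsilon>" using small0[OF eps] by blast
      have "\<exists>e<\<epsilon>. sobolev_energy P (\<lambda>\<omega>. G (r m) \<omega> - G (r l) \<omega>) e" if ml: "M \<le> m" "M \<le> l" for m l
      proof -
        have "M \<le> r m" "M \<le> r l" using ml seq_suble[OF r, of m] seq_suble[OF r, of l] by auto
        from G3[OF this(2,1)] M show ?thesis by (meson le_less_trans)
      qed
      then show ?thesis by blast
    qed
  qed (use E in auto)
  moreover have "c' < \<eta>" using c' \<eta> by auto
  moreover have "AE \<omega> in P. \<forall>j. \<phi> j \<omega> \<le> \<Phi> \<omega>"
    using fin nn
  proof eventually_elim
    fix \<omega> assume f: "S \<omega> \<noteq> \<infinity>" and n: "\<forall>j. 0 \<le> \<phi> j \<omega>"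
    show "\<forall>j. \<phi> j \<omega> \<le> \<Phi> \<omega>"
    proof
      fix j
      have "ennreal (\<phi> j \<omega>) \<le> S \<omega>" unfolding S_def
        using sum_le_suminf[of "\<lambda>j. ennreal (\<phi> j \<omega>)" "{j}"] by simp
      then have "enn2real (ennreal (\<phi> j \<omega>)) \<le> \<Phi> \<omega>"
        unfolding \<Phi>_def using f by (intro enn2real_mono) (auto simp: less_top)
      then show "\<phi> j \<omega> \<le> \<Phi> \<omega>" using n by simp
    qed
  qed
  moreover have "0 \<le> \<Phi> \<omega>" for \<omega> by (simp add: \<Phi>_def)
  ultimately show ?thesis by (rule that)
qed

end

section \<open>Capacities\<close>

context wiener
begin

text \<open>The condition that the (2, 1)-capacity of A is less than \<epsilon>, with both infima
  replaced by witnesses. This confines the side conditions of the real \<open>Inf\<close> to the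
  lemmas converting to and from \<open>capacity\<close>.\<close>

definition cap_below :: "(real \<Rightarrow> real) set \<Rightarrow> real \<Rightarrow> bool" where
  "cap_below A \<epsilon> \<longleftrightarrow> (\<exists>U \<phi> c. openin wiener_topology U \<and> A \<subseteq> U \<and> sobolev_norm P 2 1 \<phi> c \<and> c < \<epsilon> \<and>
     (AE \<omega> in P. \<omega> \<in> U \<longrightarrow> 1 \<le> \<phi> \<omega>) \<and> (AE \<omega> in P. 0 \<le> \<phi> \<omega>))"

text \<open>The constant function 1 is always admissible. Without a member of the set its real
  \<open>Inf\<close> would carry no information.\<close>

lemma open_capacity_set_nonempty:
  "{c. \<exists>\<phi>. sobolev_norm P 2 1 \<phi> c \<and> (AE \<omega> in P. \<omega> \<in> U \<longrightarrow> \<phi> \<omega> \<ge> 1) \<and> (AE \<omega> in P. \<phi> \<omega> \<ge> 0)} \<noteq> {}"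
proof -
  have "sobolev_norm P 2 1 (\<lambda>_. 1) (sqrt (1\<^sup>2))" by (rule sobolev_norm_of_energy[OF sobolev_energy_const])
  then have "sqrt (1\<^sup>2) \<in> {c. \<exists>\<phi>. sobolev_norm P 2 1 \<phi> c \<and> (AE \<omega> in P. \<omega> \<in> U \<longrightarrow> \<phi> \<omega> \<ge> 1) \<and> (AE \<omega> in P. \<phi> \<omega> \<ge> 0)}"
    by (intro CollectI exI[of _ "\<lambda>_. 1"]) simp
  then show ?thesis by blast
qed

lemma open_capacity_nonneg: "0 \<le> open_capacity P 2 1 U"
  unfolding open_capacity_def
  by (rule cInf_greatest[OF open_capacity_set_nonempty]) (auto intro: sobolev_norm_nonneg)

lemma capacity_less_imp_cap_below:
  assumes "capacity P 2 1 A < \<epsilon>" "A \<subseteq> wiener_space" shows "cap_below A \<epsilon>"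
proof -
  have "openin wiener_topology wiener_space"
    using openin_topspace[of wiener_topology] by (simp add: topspace_wiener_topology)
  then have "{open_capacity P 2 1 U | U. openin wiener_topology U \<and> A \<subseteq> U} \<noteq> {}" using assms(2) by blast
  from cInf_lessD[OF this] assms(1) obtain U where U: "openin wiener_topology U" "A \<subseteq> U" "open_capacity P 2 1 U < \<epsilon>"
    unfolding capacity_def by blast
  from cInf_lessD[OF open_capacity_set_nonempty U(3)[unfolded open_capacity_def]]
  obtain c \<phi> where "sobolev_norm P 2 1 \<phi> c" "c < \<epsilon>" "AE \<omega> in P. \<omega> \<in> U \<longrightarrow> \<phi> \<omega> \<ge> 1" "AE \<omega> in P. \<phi> \<omega> \<ge> 0" by blast
  with U show ?thesis unfolding cap_below_def by blast
qed

lemma capacity_eq_0I: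
  assumes "\<And>\<epsilon>. 0 < \<epsilon> \<Longrightarrow> cap_below A \<epsilon>" shows "capacity P 2 1 A = 0"
proof (rule antisym)
  obtain U0 where U0: "openin wiener_topology U0" "A \<subseteq> U0" using assms[of 1] unfolding cap_below_def by auto
  have bdd: "bdd_below {open_capacity P 2 1 U | U. openin wiener_topology U \<and> A \<subseteq> U}"
    using open_capacity_nonneg by (auto intro!: bdd_belowI[of _ 0])
  show "0 \<le> capacity P 2 1 A"
    unfolding capacity_def by (rule cInf_greatest) (use U0 open_capacity_nonneg in auto)
  show "capacity P 2 1 A \<le> 0"
  proof (rule field_le_epsilon)
    fix \<epsilon> :: real assume "0 < \<epsilon>"
    from assms[OF this] obtain U \<phi> c where U: "openin wiener_topology U" "A \<subseteq> U" and \<phi>: "sobolev_norm P 2 1 \<phi> c" "c < \<epsilon>"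
     "AE \<omega> in P. \<omega> \<in> U \<longrightarrow> 1 \<le> \<phi> \<omega>" "AE \<omega> in P. 0 \<le> \<phi> \<omega>" unfolding cap_below_def by blast
    have "capacity P 2 1 A \<le> open_capacity P 2 1 U"
      unfolding capacity_def by (rule cInf_lower[OF _ bdd]) (use U in blast)
    also have "\<dots> \<le> c"
      unfolding open_capacity_def
      by (rule cInf_lower) (use \<phi> in \<open>auto intro!: bdd_belowI[of _ 0] intro: sobolev_norm_nonneg\<close>)
    finally show "capacity P 2 1 A \<le> 0 + \<epsilon>" using \<phi>(2) by simp
  qed
qed

lemma cap_below_UN:
  assumes "\<And>j::nat. cap_below (A j) (\<eta> / 4 ^ (j + 1))" "0 < \<eta>"
  shows "cap_below (\<Union>j. A j) \<eta>"
proof -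
  define Q where "Q j U \<phi> d \<longleftrightarrow> openin wiener_topology U \<and> A j \<subseteq> U \<and> sobolev_norm P 2 1 \<phi> d \<and> d < \<eta> / 4 ^ (j + 1) \<and>
     (AE \<omega> in P. \<omega> \<in> U \<longrightarrow> 1 \<le> \<phi> \<omega>) \<and> (AE \<omega> in P. 0 \<le> \<phi> \<omega>)" for j U \<phi> d
  have "\<exists>U \<phi> d. Q j U \<phi> d" for j
    using assms(1)[of j] unfolding cap_below_def Q_def .
  then have "\<forall>j. \<exists>p. Q j (fst p) (fst (snd p)) (snd (snd p))" by simp
  from choice[OF this] obtain p where p: "\<forall>j. Q j (fst (p j)) (fst (snd (p j))) (snd (snd (p j)))" ..
  define U where "U j = fst (p j)" for j
  define \<phi> where "\<phi> j = fst (snd (p j))" for j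
  define c where "c j = snd (snd (p j))" for j
  have q: "openin wiener_topology (U j)" "A j \<subseteq> U j" "sobolev_norm P 2 1 (\<phi> j) (c j)" "c j < \<eta> / 4 ^ (j + 1)"
     "AE \<omega> in P. \<omega> \<in> U j \<longrightarrow> 1 \<le> \<phi> j \<omega>" "AE \<omega> in P. 0 \<le> \<phi> j \<omega>" for j
    using p[rule_format, of j] unfolding U_def \<phi>_def c_def Q_def by simp_all
  obtain \<Phi> c' where \<Phi>: "sobolev_norm P 2 1 \<Phi> c'" "c' < \<eta>" "AE \<omega> in P. \<forall>j. \<phi> j \<omega> \<le> \<Phi> \<omega>" "\<And>\<omega>. 0 \<le> \<Phi> \<omega>"
    by (rule sobolev_countable_sum[of \<phi> c \<eta>, OF q(3) q(4) assms(2) q(6)]) blast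
  have "AE \<omega> in P. \<forall>j. \<omega> \<in> U j \<longrightarrow> 1 \<le> \<phi> j \<omega>" using q(5) by (simp add: AE_all_countable)
  with \<Phi>(3) have AE: "AE \<omega> in P. \<omega> \<in> (\<Union>j. U j) \<longrightarrow> 1 \<le> \<Phi> \<omega>"
    by eventually_elim (auto intro: order_trans)
  have "openin wiener_topology (\<Union>j. U j)" using q(1) by blast
  moreover have "(\<Union>j. A j) \<subseteq> (\<Union>j. U j)" using q(2) by blast
  moreover have "AE \<omega> in P. 0 \<le> \<Phi> \<omega>" using \<Phi>(4) by simp
  ultimately show ?thesis unfolding cap_below_def using \<Phi>(1,2) AE by blast
qed

text \<open>The set is open up to the exceptional sets of the quasi-continuity, and those contribute
  arbitrarily little.\<close>

lemma cap_below_quasi_continuous: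
  assumes qc: "\<And>m::nat. quasi_continuous P (X m)" and S: "finite S"
    and \<psi>: "sobolev_norm P 2 1 \<psi> c" "c < \<eta> / 4" "AE \<omega> in P. 0 \<le> \<psi> \<omega>"
      "AE \<omega> in P. (\<forall>m\<in>S. X m \<omega> < x m) \<longrightarrow> 1 \<le> \<psi> \<omega>" and \<eta>: "0 < \<eta>"
  shows "cap_below {\<omega> \<in> wiener_space. \<forall>m\<in>S. X m \<omega> < x m} \<eta>"
proof -
  define Q where "Q m U \<phi> d \<longleftrightarrow> openin wiener_topology U \<and> sobolev_norm P 2 1 \<phi> d \<and> d < \<eta> / 4 ^ (m + 2) \<and>
     (AE \<omega> in P. \<omega> \<in> U \<longrightarrow> 1 \<le> \<phi> \<omega>) \<and> (AE \<omega> in P. 0 \<le> \<phi> \<omega>) \<and>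
     continuous_map (subtopology wiener_topology (wiener_space - U)) euclideanreal (X m)" for m U \<phi> d
  have ex: "\<exists>U \<phi> d. Q m U \<phi> d" for m
  proof -
    have "0 < \<eta> / 4 ^ (m + 2)" using \<eta> by simp
    then have "\<exists>U. openin wiener_topology U \<and> capacity P 2 1 U < \<eta> / 4 ^ (m + 2) \<and>
       continuous_map (subtopology wiener_topology (wiener_space - U)) euclideanreal (X m)"
      using qc[of m, unfolded quasi_continuous_def, rule_format, of 1 2 "\<eta> / 4 ^ (m + 2)"] by simp
    then obtain U where U: "openin wiener_topology U" "capacity P 2 1 U < \<eta> / 4 ^ (m + 2)"
       "continuous_map (subtopology wiener_topology (wiener_space - U)) euclideanreal (X m)" by (elim exE conjE)
    have "U \<subseteq> wiener_space" using openin_subset[OF U(1)] by (simp add: topspace_wiener_topology)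
    from capacity_less_imp_cap_below[OF U(2) this, unfolded cap_below_def]
    obtain V \<phi> d where V: "U \<subseteq> V" "sobolev_norm P 2 1 \<phi> d" "d < \<eta> / 4 ^ (m + 2)"
      "AE \<omega> in P. \<omega> \<in> V \<longrightarrow> 1 \<le> \<phi> \<omega>" "AE \<omega> in P. 0 \<le> \<phi> \<omega>" by (elim exE conjE)
    have "AE \<omega> in P. \<omega> \<in> U \<longrightarrow> 1 \<le> \<phi> \<omega>" using V(4) by eventually_elim (use V(1) in blast)
    then have "Q m U \<phi> d" unfolding Q_def using U V by (intro conjI)
    then show ?thesis by (intro exI)
  qed
  then have "\<forall>m. \<exists>p. Q m (fst p) (fst (snd p)) (snd (snd p))" by simp
  from choice[OF this] obtain p where p: "\<forall>m. Q m (fst (p m)) (fst (snd (p m))) (snd (snd (p m)))" ..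
  define U where "U j = fst (p j)" for j
  define \<phi> where "\<phi> j = fst (snd (p j))" for j
  define d where "d j = snd (snd (p j))" for j
  have q: "openin wiener_topology (U m)" "sobolev_norm P 2 1 (\<phi> m) (d m)" "d m < \<eta> / 4 ^ (m + 2)"
     "AE \<omega> in P. \<omega> \<in> U m \<longrightarrow> 1 \<le> \<phi> m \<omega>" "AE \<omega> in P. 0 \<le> \<phi> m \<omega>"
     "continuous_map (subtopology wiener_topology (wiener_space - U m)) euclideanreal (X m)" for m
    using p[rule_format, of m] unfolding U_def \<phi>_def d_def Q_def by simp_all
  \<comment> \<open>\<psi> gets index 0 and the functionals of the exceptional sets are shifted by
    one, so that the bounds \<eta> / 4 and \<eta> / 4^(m + 2) become those required by
    \<open>sobolev_countable_sum\<close>.\<close>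
  define \<phi>' where "\<phi>' j = (case j of 0 \<Rightarrow> \<psi> | Suc m \<Rightarrow> \<phi> m)" for j
  define d' where "d' j = (case j of 0 \<Rightarrow> c | Suc m \<Rightarrow> d m)" for j
  obtain \<Phi> c' where \<Phi>: "sobolev_norm P 2 1 \<Phi> c'" "c' < \<eta>" "AE \<omega> in P. \<forall>j. \<phi>' j \<omega> \<le> \<Phi> \<omega>" "\<And>\<omega>. 0 \<le> \<Phi> \<omega>"
  proof (rule sobolev_countable_sum[of \<phi>' d' \<eta>])
    show "sobolev_norm P 2 1 (\<phi>' j) (d' j)" for j using \<psi> q by (cases j) (auto simp: \<phi>'_def d'_def)
    show "d' j < \<eta> / 4 ^ (j + 1)" for j using \<psi>(2) q(3) by (cases j) (auto simp: d'_def)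
    show "AE \<omega> in P. 0 \<le> \<phi>' j \<omega>" for j using \<psi> q by (cases j) (auto simp: \<phi>'_def)
  qed (use \<eta> in auto)
  \<comment> \<open>\<open>X m\<close> is continuous only off \<open>U m\<close>, so its sublevel
    set there is relatively open; adjoining the open set \<open>U m\<close> makes the union
    open.\<close>
  define V where "V m = {\<omega> \<in> wiener_space - U m. X m \<omega> < x m} \<union> U m" for m
  have V: "openin wiener_topology (V m)" for m
  proof -
    have "openin (subtopology wiener_topology (wiener_space - U m)) {\<omega> \<in> topspace (subtopology wiener_topology (wiener_space - U m)). X m \<omega> \<in> {..<x m}}"
      by (rule openin_continuous_map_preimage[OF q(6)]) (simp add: open_openin[symmetric])
    moreover have "topspace (subtopology wiener_topology (wiener_space - U m)) = wiener_space - U m"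
      by (auto simp: topspace_wiener_topology)
    ultimately obtain T where T: "openin wiener_topology T" "{\<omega> \<in> wiener_space - U m. X m \<omega> < x m} = T \<inter> (wiener_space - U m)"
      unfolding openin_subtopology by auto
    have "T \<subseteq> wiener_space" using openin_subset[OF T(1)] by (simp add: topspace_wiener_topology)
    then have "V m = T \<union> U m" unfolding V_def T(2) by blast
    then show ?thesis using T(1) q(1) by (simp add: openin_Un)
  qed
  \<comment> \<open>Intersecting with \<open>wiener_space\<close> covers the case
    \<open>S = {}\<close>.\<close>
  define W where "W = wiener_space \<inter> (\<Inter>m\<in>S. V m)"
  have "openin wiener_topology wiener_space"
    using openin_topspace[of wiener_topology] by (simp add: topspace_wiener_topology)
  then have W: "openin wiener_topology W"
    unfolding W_def using V S
  proof (cases "S = {}")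
    case False
    then have "openin wiener_topology (\<Inter>m\<in>S. V m)" using V S by (intro openin_Inter) auto
    then show "openin wiener_topology (wiener_space \<inter> (\<Inter>m\<in>S. V m))"
      using \<open>openin wiener_topology wiener_space\<close> by (simp add: openin_Int)
  qed simp
  moreover have "{\<omega> \<in> wiener_space. \<forall>m\<in>S. X m \<omega> < x m} \<subseteq> W" unfolding W_def V_def by blast
  moreover have "AE \<omega> in P. \<omega> \<in> W \<longrightarrow> 1 \<le> \<Phi> \<omega>"
  proof -
    have "AE \<omega> in P. \<forall>m. \<omega> \<in> U m \<longrightarrow> 1 \<le> \<phi> m \<omega>" using q(4) by (simp add: AE_all_countable)
    with \<Phi>(3) \<psi>(4) show ?thesis
    proof eventually_elim
      fix \<omega> assume a: "\<forall>j. \<phi>' j \<omega> \<le> \<Phi> \<omega>" and b: "(\<forall>m\<in>S. X m \<omega> < x m) \<longrightarrow> 1 \<le> \<psi> \<omega>"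
        and c: "\<forall>m. \<omega> \<in> U m \<longrightarrow> 1 \<le> \<phi> m \<omega>"
      show "\<omega> \<in> W \<longrightarrow> 1 \<le> \<Phi> \<omega>"
      proof
        assume w: "\<omega> \<in> W"
        show "1 \<le> \<Phi> \<omega>"
        proof (cases "\<exists>m. \<omega> \<in> U m")
          case True
          then obtain m where "1 \<le> \<phi> m \<omega>" using c by blast
          moreover have "\<phi> m \<omega> \<le> \<Phi> \<omega>" using a[rule_format, of "Suc m"] by (simp add: \<phi>'_def)
          ultimately show ?thesis by simp
        next
          case False
          then have "1 \<le> \<psi> \<omega>" using b w unfolding W_def V_def by blast
          moreover have "\<psi> \<omega> \<le> \<Phi> \<omega>" using a[rule_format, of 0] by (simp add: \<phi>'_def)
          ultimately show ?thesis by simp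
        qed
      qed
    qed
  qed
  moreover have "AE \<omega> in P. 0 \<le> \<Phi> \<omega>" using \<Phi>(4) by simp
  ultimately show ?thesis unfolding cap_below_def using \<Phi>(1,2) by blast
qed

end

section \<open>The kernel of fractional Brownian motion\<close>

text \<open>An incomplete Beta integral with parameters 2\<alpha> and 1 - \<alpha>, where \<alpha>
  stands for 1/2 - H. It is a gauge integral, which copes with the singularities at both
  ends.\<close>

definition beta_tail :: "real \<Rightarrow> real \<Rightarrow> real" where
  "beta_tail \<alpha> x = integral {x..1} (\<lambda>y. y powr (2 * \<alpha> - 1) * (1 - y) powr (- \<alpha>))"

text \<open>Up to a constant and the factor s^(-\<alpha>), the kernel K(t, s) is this function of s
  / t; see \<open>fbm_kernel_eq\<close>.\<close>

definition fbm_profile :: "real \<Rightarrow> real \<Rightarrow> real" where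
  "fbm_profile \<alpha> s = s powr (2 * \<alpha>) * (1 - s) powr (- \<alpha>) + \<alpha> * beta_tail \<alpha> s"

text \<open>An antiderivative of s^(-2\<alpha>) times the squared profile. Expanding the square and
  integrating the terms with \<open>beta_tail\<close> by parts leads to it, since the derivative of
  \<open>beta_tail\<close> is a product of powers.\<close>

definition profile_primitive :: "real \<Rightarrow> real \<Rightarrow> real" where
  "profile_primitive \<alpha> s = (\<alpha>\<^sup>2 * s powr (1 - 2 * \<alpha>) * (beta_tail \<alpha> s)\<^sup>2
     - 2 * \<alpha> * beta_tail \<alpha> s * (1 - s) powr (1 - \<alpha>) - s powr (2 * \<alpha>) * (1 - s) powr (1 - 2 * \<alpha>)) / (1 - 2 * \<alpha>)"

context
  fixes \<alpha> :: real
  assumes \<alpha>: "0 < \<alpha>" "\<alpha> < 1/2"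
begin

lemma beta_density_has_integral:
  "((\<lambda>y. y powr (2 * \<alpha> - 1) * (1 - y) powr (- \<alpha>)) has_integral Beta (2 * \<alpha>) (1 - \<alpha>)) {0..1}"
  using has_integral_Beta_real[of "2 * \<alpha>" "1 - \<alpha>"] \<alpha> by simp

lemma beta_tail_0: "beta_tail \<alpha> 0 = Beta (2 * \<alpha>) (1 - \<alpha>)"
  unfolding beta_tail_def using beta_density_has_integral by (rule integral_unique)

lemma beta_tail_1: "beta_tail \<alpha> 1 = 0"
  by (simp add: beta_tail_def)

lemma continuous_on_beta_tail: "continuous_on {0..1} (beta_tail \<alpha>)"
  unfolding beta_tail_def[abs_def]
  by (rule indefinite_integral_continuous_1'[OF has_integral_integrable[OF beta_density_has_integral]])

lemma beta_tail_deriv: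
  assumes x: "0 < x" "x < 1"
  shows "(beta_tail \<alpha> has_real_derivative - (x powr (2 * \<alpha> - 1) * (1 - x) powr (- \<alpha>))) (at x)"
proof -
  let ?f = "\<lambda>y::real. y powr (2 * \<alpha> - 1) * (1 - y) powr (- \<alpha>)"
  have int: "?f integrable_on {0..1}" using beta_density_has_integral by blast
  have "continuous (at x within ({0..1} - {})) ?f"
    using x by (intro continuous_intros) auto
  from integral_has_vector_derivative_continuous_at[OF int _ _ this] x
  have "((\<lambda>u. integral {0..u} ?f) has_vector_derivative ?f x) (at x within {0..1})" by simp
  then have "((\<lambda>u. integral {0..u} ?f) has_vector_derivative ?f x) (at x)"
    using x by (simp add: at_within_Icc_at)
  then have d: "((\<lambda>u. integral {0..u} ?f) has_real_derivative ?f x) (at x)"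
    by (simp add: has_real_derivative_iff_has_vector_derivative)
  have "((\<lambda>u. integral {0..1} ?f - integral {0..u} ?f) has_real_derivative - ?f x) (at x)"
    by (rule derivative_eq_intros d refl)+ simp
  then show ?thesis
  proof (rule has_field_derivative_transform_within_open[of _ _ _ "{0<..<1}"])
    show "integral {0..1} ?f - integral {0..u} ?f = beta_tail \<alpha> u" if "u \<in> {0<..<1}" for u
      using Henstock_Kurzweil_Integration.integral_combine[of 0 u 1 ?f] int that unfolding beta_tail_def by simp
  qed (use x in auto)
qed

lemma beta_tail_nonneg: "0 \<le> beta_tail \<alpha> x"
  unfolding beta_tail_def by (cases "(\<lambda>y. y powr (2 * \<alpha> - 1) * (1 - y) powr (- \<alpha>)) integrable_on {x..1}")
    (auto intro!: integral_nonneg simp: not_integrable_integral)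

lemma continuous_on_profile_primitive: "continuous_on {0..1} (profile_primitive \<alpha>)"
proof -
  have pw: "continuous_on {0..1} (\<lambda>s::real. s powr c)" "continuous_on {0..1} (\<lambda>s::real. (1 - s) powr c)"
    if "c > 0" for c
    using that by (intro continuous_on_powr' continuous_on_diff continuous_on_const continuous_on_id; simp)+
  show ?thesis
    unfolding profile_primitive_def[abs_def] using \<alpha>
    by (intro continuous_on_divide continuous_on_diff continuous_on_mult continuous_on_power continuous_on_const
      continuous_on_beta_tail pw) auto
qed

lemma profile_primitive_1: "profile_primitive \<alpha> 1 = 0"
  by (simp add: profile_primitive_def beta_tail_1)

lemma profile_primitive_0: "profile_primitive \<alpha> 0 = - 2 * \<alpha> * Beta (2 * \<alpha>) (1 - \<alpha>) / (1 - 2 * \<alpha>)"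
  by (simp add: profile_primitive_def beta_tail_0)

lemma profile_primitive_deriv:
  assumes s: "0 < s" "s < 1"
  shows "(profile_primitive \<alpha> has_real_derivative s powr (- 2 * \<alpha>) * (fbm_profile \<alpha> s)\<^sup>2) (at s)"
proof -
  \<comment> \<open>In terms of A, q, M and s all powers become rational expressions, so that the
    identity is one of field arithmetic.\<close>
  define A where "A = s powr (2 * \<alpha>)"
  define q where "q = (1 - s) powr (- \<alpha>)"
  define M where "M = beta_tail \<alpha> s"
  have nz: "A \<noteq> 0" "1 - 2 * \<alpha> \<noteq> 0" "s \<noteq> 0" using s \<alpha> by (auto simp: A_def)
  have q2: "(1 - s) powr (2 * \<alpha>) = (1 - s) powr \<alpha> * (1 - s) powr \<alpha>"
    by (simp flip: powr_add)
  have p: "s powr (2 * \<alpha> - 1) = A / s" "s powr (1 - 2 * \<alpha>) = s / A" "s powr (- 2 * \<alpha>) = 1 / A"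
    "s powr (- (2 * \<alpha>)) = 1 / A"
    "(1 - s) powr (1 - \<alpha>) = (1 - s) * q" "(1 - s) powr (1 - 2 * \<alpha>) = (1 - s) * q\<^sup>2"
    "(1 - s) powr (- 2 * \<alpha>) = q\<^sup>2" "(1 - s) powr (- (2 * \<alpha>)) = q\<^sup>2"
    using s by (auto simp: A_def q_def powr_diff powr_minus divide_inverse power2_eq_square q2)
  have dp: "((\<lambda>z. z powr c) has_real_derivative c * s powr (c - 1)) (at s)"
    "((\<lambda>z. (1 - z) powr c) has_real_derivative - c * (1 - s) powr (c - 1)) (at s)" for c
  proof -
    show "((\<lambda>z. z powr c) has_real_derivative c * s powr (c - 1)) (at s)"
      using s by (intro has_real_derivative_powr) auto
    have "((\<lambda>z. (1 - z) powr c) has_real_derivative c * (1 - s) powr (c - 1) * (0 - 1)) (at s)"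
      by (rule DERIV_chain2[where f="\<lambda>z. z powr c" and g="\<lambda>z. 1 - z"])
         (use s in \<open>auto intro!: has_real_derivative_powr derivative_eq_intros\<close>)
    then show "((\<lambda>z. (1 - z) powr c) has_real_derivative - c * (1 - s) powr (c - 1)) (at s)" by simp
  qed
  note dM = beta_tail_deriv[OF s]
  have e: "1 - 2 * \<alpha> - 1 = - 2 * \<alpha>" "1 - \<alpha> - 1 = - \<alpha>" by auto
  show ?thesis
    unfolding profile_primitive_def[abs_def]
    apply (rule DERIV_cong[OF DERIV_cdivide[OF DERIV_diff[OF DERIV_diff[OF
        DERIV_mult[OF DERIV_cmult[OF dp(1)] DERIV_power[OF dM, of 2]]
        DERIV_mult[OF DERIV_cmult[OF dM] dp(2)]] DERIV_mult[OF dp(1) dp(2)]]]])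
    unfolding e p fbm_profile_def M_def[symmetric] q_def[symmetric] A_def[symmetric]
    using nz by (simp add: field_simps power2_eq_square)
qed

text \<open>The integrand is singular at 0, and also at 1 when x = 1. The interior form of the
  fundamental theorem asks at the endpoints only for continuity of the primitive.\<close>

lemma profile_square_has_integral:
  assumes x: "0 \<le> x" "x \<le> 1"
  shows "((\<lambda>s. s powr (- 2 * \<alpha>) * (fbm_profile \<alpha> s)\<^sup>2) has_integral profile_primitive \<alpha> x - profile_primitive \<alpha> 0) {0..x}"
proof (rule fundamental_theorem_of_calculus_interior)
  show "continuous_on {0..x} (profile_primitive \<alpha>)"
    by (rule continuous_on_subset[OF continuous_on_profile_primitive]) (use x in auto)
  show "(profile_primitive \<alpha> has_vector_derivative s powr (- 2 * \<alpha>) * (fbm_profile \<alpha> s)\<^sup>2) (at s)"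
    if "s \<in> {0<..<x}" for s
    using profile_primitive_deriv[of s] that x by (simp add: has_real_derivative_iff_has_vector_derivative)
qed (use x in auto)

text \<open>The substitution y = s / u turns the integral into an incomplete Beta integral; in the
  proof it appears as an antiderivative in u.\<close>

lemma kernel_inner_integral:
  assumes s: "0 < s" "s < t"
  shows "(LINT u:{s..t}|lborel. u powr (- \<alpha> - 1) * (u - s) powr (- \<alpha>)) = s powr (- 2 * \<alpha>) * beta_tail \<alpha> (s / t)"
proof -
  let ?f = "\<lambda>u. u powr (- \<alpha> - 1) * (u - s) powr (- \<alpha>)"
  let ?F = "\<lambda>u. s powr (- 2 * \<alpha>) * beta_tail \<alpha> (s / u)"
  have "(?f has_integral (?F t - ?F s)) {s..t}"
  proof (rule fundamental_theorem_of_calculus_interior)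
    show "continuous_on {s..t} ?F"
      by (intro continuous_on_mult continuous_on_const continuous_on_compose2[OF continuous_on_beta_tail])
         (use s in \<open>auto intro!: continuous_intros simp: divide_le_eq\<close>)
    fix u assume u: "u \<in> {s<..<t}"
    then have su: "0 < s / u" "s / u < 1" "0 < u" using s by auto
    have "((\<lambda>u. s / u) has_real_derivative - s / u\<^sup>2) (at u)"
      using su by (auto intro!: derivative_eq_intros simp: power2_eq_square)
    from DERIV_chain2[OF beta_tail_deriv[OF su(1,2)] this]
    have d: "(?F has_real_derivative s powr (- 2 * \<alpha>) * (- ((s / u) powr (2 * \<alpha> - 1) * (1 - s / u) powr (- \<alpha>)) * (- s / u\<^sup>2))) (at u)"
      by (rule DERIV_cmult)
    have "1 - s / u = (u - s) / u" using su by (simp add: field_simps)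
    then have "s powr (- 2 * \<alpha>) * (- ((s / u) powr (2 * \<alpha> - 1) * (1 - s / u) powr (- \<alpha>)) * (- s / u\<^sup>2))
      = (s powr (- 2 * \<alpha>) * s powr (2 * \<alpha>)) * (u powr \<alpha> / (u powr \<alpha>)\<^sup>2 / u) * (u - s) powr (- \<alpha>)"
      using su s u by (simp add: powr_divide powr_diff powr_minus field_simps power2_eq_square powr_add[symmetric])
    also have "\<dots> = ?f u" using s su u
      by (simp add: powr_diff powr_minus field_simps power2_eq_square)
    finally show "(?F has_vector_derivative ?f u) (at u)"
      using d by (simp add: has_real_derivative_iff_has_vector_derivative)
  qed (use s in auto)
  then have I: "(?f has_integral ?F t) {s..t}" using s by (simp add: beta_tail_1)
  have nn: "(\<integral>\<^sup>+u. ennreal (?f u) * indicator {s..t} u \<partial>lborel) = ennreal (?F t)"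
    by (rule nn_integral_has_integral_lebesgue'[OF _ I]) simp
  have "(LINT u:{s..t}|lborel. ?f u) = enn2real (\<integral>\<^sup>+u. ennreal (indicator {s..t} u *\<^sub>R ?f u) \<partial>lborel)"
    unfolding set_lebesgue_integral_def by (rule integral_eq_nn_integral) auto
  also have "(\<integral>\<^sup>+u. ennreal (indicator {s..t} u *\<^sub>R ?f u) \<partial>lborel) = (\<integral>\<^sup>+u. ennreal (?f u) * indicator {s..t} u \<partial>lborel)"
    by (intro nn_integral_cong) (simp add: indicator_def)
  finally show ?thesis unfolding nn using beta_tail_nonneg by simp
qed

lemma fbm_profile_measurable_on: "(\<lambda>s. indicator {0<..<1} s * fbm_profile \<alpha> s) \<in> borel_measurable borel"
proof -
  have "continuous_on {0<..<1} (fbm_profile \<alpha>)"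
    unfolding fbm_profile_def[abs_def]
    by (intro continuous_intros continuous_on_subset[OF continuous_on_beta_tail]) auto
  then show ?thesis
    using borel_measurable_continuous_on_indicator[of "{0<..<1}" "fbm_profile \<alpha>"] by simp
qed

lemma nn_integral_profile_square:
  assumes x: "0 \<le> x" "x \<le> 1"
  shows "(\<integral>\<^sup>+s. ennreal (s powr (- 2 * \<alpha>) * (fbm_profile \<alpha> s)\<^sup>2) * indicator {0..x} s \<partial>lborel)
     = ennreal (profile_primitive \<alpha> x - profile_primitive \<alpha> 0)"
  by (rule nn_integral_has_integral_lebesgue'[OF _ profile_square_has_integral[OF x]]) simp

end

text \<open>The factor in front of the kernel, written in \<alpha>. Its square is the reciprocal of
  \<open>profile_primitive \<alpha> 1 - profile_primitive \<alpha> 0\<close>, which gives the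
  integrand at time t the squared norm t^(2H).\<close>

definition fbm_const :: "real \<Rightarrow> real" where
  "fbm_const \<alpha> = sqrt ((1 - 2 * \<alpha>) / (2 * \<alpha> * Beta (2 * \<alpha>) (1 - \<alpha>)))"

abbreviation fbm_integrand :: "real \<Rightarrow> real \<Rightarrow> real \<Rightarrow> real" where
  "fbm_integrand H t s \<equiv> fbm_kernel H t s * indicator {0<..<t} s"

lemma fbm_kernel_eq:
  assumes H: "0 < H" "H < 1/2" and \<alpha>: "\<alpha> = 1/2 - H" and s: "0 < s" "s < t"
  shows "fbm_kernel H t s = fbm_const \<alpha> * (s powr (- \<alpha>) * fbm_profile \<alpha> (s / t))"
proof -
  have a: "0 < \<alpha>" "\<alpha> < 1/2" using H \<alpha> by auto
  have e: "H - 1/2 = - \<alpha>" "H - 3/2 = - \<alpha> - 1" "1/2 - H = \<alpha>" "1 - 2 * H = 2 * \<alpha>" "2 * H = 1 - 2 * \<alpha>" "H + 1/2 = 1 - \<alpha>"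
    using \<alpha> by (auto simp: field_simps)
  have "1 - s / t = (t - s) / t" using s by (simp add: field_simps)
  then have 1: "(t / s) powr (- \<alpha>) * (t - s) powr (- \<alpha>) = s powr (- \<alpha>) * ((s / t) powr (2 * \<alpha>) * (1 - s / t) powr (- \<alpha>))"
  proof -
    assume r: "1 - s / t = (t - s) / t"
    have d: "x powr (2 * \<alpha>) = x powr \<alpha> * x powr \<alpha>" "x powr (\<alpha> * 2) = x powr \<alpha> * x powr \<alpha>" for x :: real
      by (simp_all add: mult.commute flip: powr_add)
    show ?thesis unfolding r using s by (simp add: powr_divide powr_minus d field_simps)
  qed
  have 2: "s powr \<alpha> * (s powr (- 2 * \<alpha>) * b) = s powr (- \<alpha>) * b" for b
  proof -
    have "s powr \<alpha> * s powr (- 2 * \<alpha>) = s powr (- \<alpha>)" by (simp flip: powr_add)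
    then show ?thesis by (simp add: mult.assoc[symmetric])
  qed
  have "fbm_kernel H t s = fbm_const \<alpha> * ((t / s) powr (- \<alpha>) * (t - s) powr (- \<alpha>)
     - (- \<alpha>) * s powr \<alpha> * (LINT u:{s..t}|lborel. u powr (- \<alpha> - 1) * (u - s) powr (- \<alpha>)))"
    using H unfolding fbm_kernel_def fbm_const_def e by simp
  also have "\<dots> = fbm_const \<alpha> * (s powr (- \<alpha>) * fbm_profile \<alpha> (s / t))"
    unfolding kernel_inner_integral[OF a s] 1 fbm_profile_def using 2[of "beta_tail \<alpha> (s / t)"]
    by (simp add: algebra_simps)
  finally show ?thesis .
qed

lemma fbm_integrand_measurable:
  assumes H: "0 < H" "H \<le> 1/2"
  shows "fbm_integrand H t \<in> borel_measurable borel"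
proof (cases "H = 1/2")
  case True then show ?thesis by (simp add: fbm_kernel_def)
next
  case False
  define \<alpha> where "\<alpha> = 1/2 - H"
  have a: "0 < \<alpha>" "\<alpha> < 1/2" "H < 1/2" using H False by (auto simp: \<alpha>_def)
  note [measurable] = fbm_profile_measurable_on[OF a(1,2)]
  have "fbm_integrand H t = (\<lambda>s. fbm_const \<alpha> * s powr (- \<alpha>) * (indicator {0<..<1} (s / t) * fbm_profile \<alpha> (s / t)) * indicator {0<..<t} s)"
    using fbm_kernel_eq[OF H(1) a(3) \<alpha>_def] by (intro ext) (auto simp: indicator_def field_simps)
  also have "\<dots> \<in> borel_measurable borel"
    using measurable_compose[OF _ fbm_profile_measurable_on[OF a(1,2)], of "\<lambda>s. s / t" borel] by measurable
  finally show ?thesis .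
qed

text \<open>Continuity off the two exceptional points makes the primitive of the integrand
  differentiable there, so that \<open>deriv\<close> returns the integrand.\<close>

lemma isCont_fbm_integrand:
  assumes H: "0 < H" "H \<le> 1/2" and s: "s \<noteq> 0" "s \<noteq> t"
  shows "isCont (fbm_integrand H t) s"
proof (cases "0 < s \<and> s < t")
  case False
  then have "s \<in> - {0..t}" using s by auto
  moreover have "open (- {0..t})" by auto
  ultimately have "eventually (\<lambda>u. u \<in> - {0..t}) (nhds s)" by (intro eventually_nhds_in_open)
  then have e: "eventually (\<lambda>u. fbm_integrand H t u = 0) (nhds s)" by eventually_elim auto
  show ?thesis using isCont_cong[OF e] by simp
next
  case True
  then have "eventually (\<lambda>u. u \<in> {0<..<t}) (nhds s)"
    by (intro eventually_nhds_in_open) auto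
  show ?thesis
  proof (cases "H = 1/2")
    case h: True
    from \<open>eventually (\<lambda>u. u \<in> {0<..<t}) (nhds s)\<close>
    have e: "eventually (\<lambda>u. fbm_integrand H t u = 1) (nhds s)" by eventually_elim (simp add: fbm_kernel_def h)
    show ?thesis using isCont_cong[OF e] by simp
  next
    case False
    define \<alpha> where "\<alpha> = 1/2 - H"
    have a: "0 < \<alpha>" "\<alpha> < 1/2" "H < 1/2" using H False by (auto simp: \<alpha>_def)
    from \<open>eventually (\<lambda>u. u \<in> {0<..<t}) (nhds s)\<close>
    have e: "eventually (\<lambda>u. fbm_integrand H t u = fbm_const \<alpha> * (u powr (- \<alpha>) * fbm_profile \<alpha> (u / t))) (nhds s)"
      by eventually_elim (simp add: fbm_kernel_eq[OF H(1) a(3) \<alpha>_def])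
    have "isCont (beta_tail \<alpha>) (s / t)"
      using beta_tail_deriv[OF a(1,2), of "s / t"] True by (intro DERIV_isCont) auto
    then have "isCont (\<lambda>u. beta_tail \<alpha> (u / t)) s"
      using True by (intro isCont_o2[where g="beta_tail \<alpha>" and f="\<lambda>u. u / t"]) (auto intro!: continuous_intros)
    then have "isCont (\<lambda>u. fbm_const \<alpha> * (u powr (- \<alpha>) * fbm_profile \<alpha> (u / t))) s"
      unfolding fbm_profile_def using True by (intro continuous_intros) auto
    then show ?thesis using isCont_cong[OF e] by simp
  qed
qed

text \<open>\<kappa> x is the fraction of the variance at time t that comes from [0, x t]; by
  self-similarity it does not depend on t. Continuity at 0, where \<kappa> vanishes, later yields
  the ratio q.\<close>

lemma fbm_integrand_norm:
  assumes H: "0 < H" "H \<le> 1/2"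
  obtains \<kappa> where "continuous_on {0..1} \<kappa>" "\<kappa> 0 = 0" "\<kappa> 1 = 1"
    "\<And>t x. 0 < t \<Longrightarrow> 0 \<le> x \<Longrightarrow> x \<le> 1 \<Longrightarrow>
      (\<integral>\<^sup>+s\<in>{0..x * t}. ennreal ((fbm_integrand H t s)\<^sup>2) \<partial>lborel) = ennreal (t powr (2 * H) * \<kappa> x)"
proof (cases "H = 1/2")
  case True
  show ?thesis
  proof (rule that[of "\<lambda>x. x"])
    fix t x :: real assume t: "0 < t" "0 \<le> x" "x \<le> 1"
    have xt: "x * t \<le> t" using t by (simp add: mult_left_le_one_le)
    have "(\<integral>\<^sup>+s\<in>{0..x * t}. ennreal ((fbm_integrand H t s)\<^sup>2) \<partial>lborel) = (\<integral>\<^sup>+s. indicator {0..x * t} s \<partial>lborel)"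
    proof (rule nn_integral_cong_AE, use AE_lborel_singleton[of "0::real"] AE_lborel_singleton[of t] in eventually_elim)
      fix s assume "s \<noteq> 0" "s \<noteq> t"
      moreover have "s < t" if "s \<le> x * t" using that xt \<open>s \<noteq> t\<close> by linarith
      ultimately show "ennreal ((fbm_integrand H t s)\<^sup>2) * indicator {0..x * t} s = indicator {0..x * t} s"
        by (auto simp: fbm_kernel_def True indicator_def)
    qed
    also have "\<dots> = ennreal (x * t)" using t by simp
    finally show "(\<integral>\<^sup>+s\<in>{0..x * t}. ennreal ((fbm_integrand H t s)\<^sup>2) \<partial>lborel) = ennreal (t powr (2 * H) * x)"
      using t by (simp add: True mult.commute)
  qed (auto intro!: continuous_intros)
next
  case False
  define \<alpha> where "\<alpha> = 1/2 - H"
  have a: "0 < \<alpha>" "\<alpha> < 1/2" "H < 1/2" using H False by (auto simp: \<alpha>_def)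
  have b: "Beta (2 * \<alpha>) (1 - \<alpha>) > 0" using a unfolding Beta_def by (intro divide_pos_pos mult_pos_pos Gamma_real_pos) auto
  have c2: "(fbm_const \<alpha>)\<^sup>2 = (1 - 2 * \<alpha>) / (2 * \<alpha> * Beta (2 * \<alpha>) (1 - \<alpha>))"
    unfolding fbm_const_def using a b by (intro real_sqrt_pow2) auto
  let ?k = "\<lambda>x. (fbm_const \<alpha>)\<^sup>2 * (profile_primitive \<alpha> x - profile_primitive \<alpha> 0)"
  show ?thesis
  proof (rule that[of ?k])
    show "continuous_on {0..1} ?k"
      by (intro continuous_intros continuous_on_profile_primitive[OF a(1,2)])
    show "?k 1 = 1"
      unfolding profile_primitive_1[OF a(1,2)] profile_primitive_0[OF a(1,2)] c2 using a b by (simp add: field_simps)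
    fix t x :: real assume t: "0 < t" "0 \<le> x" "x \<le> 1"
    note [measurable] = fbm_integrand_measurable[OF H, of t]
    have "(\<integral>\<^sup>+s\<in>{0..x * t}. ennreal ((fbm_integrand H t s)\<^sup>2) \<partial>lborel) =
      ennreal \<bar>t\<bar> * (\<integral>\<^sup>+u. ennreal ((fbm_integrand H t (0 + t * u))\<^sup>2) * indicator {0..x * t} (0 + t * u) \<partial>lborel)"
      by (rule nn_integral_real_affine) (use t in auto)
    also have "(\<integral>\<^sup>+u. ennreal ((fbm_integrand H t (0 + t * u))\<^sup>2) * indicator {0..x * t} (0 + t * u) \<partial>lborel) =
      (\<integral>\<^sup>+u. ennreal ((fbm_const \<alpha>)\<^sup>2 * t powr (- 2 * \<alpha>)) * (ennreal (u powr (- 2 * \<alpha>) * (fbm_profile \<alpha> u)\<^sup>2) * indicator {0..x} u) \<partial>lborel)"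
    proof (rule nn_integral_cong_AE, use AE_lborel_singleton[of "0::real"] AE_lborel_singleton[of "1::real"] in eventually_elim)
      fix u :: real assume u: "u \<noteq> 0" "u \<noteq> 1"
      show "ennreal ((fbm_integrand H t (0 + t * u))\<^sup>2) * indicator {0..x * t} (0 + t * u) =
        ennreal ((fbm_const \<alpha>)\<^sup>2 * t powr (- 2 * \<alpha>)) * (ennreal (u powr (- 2 * \<alpha>) * (fbm_profile \<alpha> u)\<^sup>2) * indicator {0..x} u)"
      proof (cases "0 < u \<and> u \<le> x")
        case True
        then have v: "0 < t * u" "t * u < t" "t * u \<le> x * t" "0 < u" using t u by (auto simp: mult.commute)
        have "(fbm_integrand H t (t * u))\<^sup>2 = (fbm_const \<alpha> * ((t * u) powr (- \<alpha>) * fbm_profile \<alpha> u))\<^sup>2"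
          using fbm_kernel_eq[OF H(1) a(3) \<alpha>_def v(1,2)] v t by simp
        also have "\<dots> = (fbm_const \<alpha>)\<^sup>2 * ((t powr (- \<alpha>))\<^sup>2 * ((u powr (- \<alpha>))\<^sup>2 * (fbm_profile \<alpha> u)\<^sup>2))"
          using t v by (simp add: power_mult_distrib powr_mult)
        also have "(t powr (- \<alpha>))\<^sup>2 = t powr (- 2 * \<alpha>)" by (simp add: power2_eq_square flip: powr_add)
        also have "(u powr (- \<alpha>))\<^sup>2 = u powr (- 2 * \<alpha>)" by (simp add: power2_eq_square flip: powr_add)
        finally have "(fbm_integrand H t (t * u))\<^sup>2 = ((fbm_const \<alpha>)\<^sup>2 * t powr (- 2 * \<alpha>)) * (u powr (- 2 * \<alpha>) * (fbm_profile \<alpha> u)\<^sup>2)"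
          by (simp only: mult.assoc)
        then have "ennreal ((fbm_integrand H t (t * u))\<^sup>2) = ennreal ((fbm_const \<alpha>)\<^sup>2 * t powr (- 2 * \<alpha>)) * ennreal (u powr (- 2 * \<alpha>) * (fbm_profile \<alpha> u)\<^sup>2)"
          by (simp only:) (rule ennreal_mult; simp)
        then show ?thesis using v True by (simp add: mult.commute[of x])
      next
        case False
        then have "t * u \<notin> {0..x * t}" "u \<notin> {0..x}" using t u by (auto simp: zero_le_mult_iff mult.commute)
        then show ?thesis by simp
      qed
    qed
    also have "\<dots> = ennreal ((fbm_const \<alpha>)\<^sup>2 * t powr (- 2 * \<alpha>)) * ennreal (profile_primitive \<alpha> x - profile_primitive \<alpha> 0)"
    proof (subst nn_integral_cmult)
      show "(\<lambda>u. ennreal (u powr (- 2 * \<alpha>) * (fbm_profile \<alpha> u)\<^sup>2) * indicator {0..x} u) \<in> borel_measurable lborel"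
      proof -
        \<comment> \<open>Measurability of the profile is known on (0, 1) only; the two endpoints
          are treated as a countable exception.\<close>
        note [measurable] = fbm_profile_measurable_on[OF a(1,2)]
        have "(\<lambda>u. ennreal (u powr (- 2 * \<alpha>) * (indicator {0<..<1} u * fbm_profile \<alpha> u)\<^sup>2) * indicator {0..x} u) \<in> borel_measurable lborel"
          by measurable
        then show ?thesis
          by (rule measurable_discrete_difference[where X="{0, 1}"]) (use t in \<open>auto simp: indicator_def\<close>)
      qed
    qed (simp only: nn_integral_profile_square[OF a(1,2) t(2,3)])
    also have "ennreal \<bar>t\<bar> * \<dots> = ennreal (t powr (2 * H) * ?k x)"
    proof -
      have 1: "t powr (2 * H) * ?k x = t * (((fbm_const \<alpha>)\<^sup>2 * t powr (- 2 * \<alpha>)) * (profile_primitive \<alpha> x - profile_primitive \<alpha> 0))"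
      proof -
        have "t powr (2 * H) = t * t powr (- 2 * \<alpha>)"
          using t by (simp add: powr_mult_base \<alpha>_def algebra_simps)
        then show ?thesis by (simp only: mult_ac)
      qed
      have 2: "\<bar>t\<bar> = t" using t by simp
      show ?thesis unfolding 1 2
        by (subst ennreal_mult', use t in simp, subst ennreal_mult', simp, rule refl)
    qed
    finally show "(\<integral>\<^sup>+s\<in>{0..x * t}. ennreal ((fbm_integrand H t s)\<^sup>2) \<partial>lborel) = ennreal (t powr (2 * H) * ?k x)" .
  qed simp
qed

section \<open>Cameron--Martin functions with prescribed derivative\<close>

lemma set_integrable_of_square_integrable:
  fixes g :: "real \<Rightarrow> real"
  assumes [measurable]: "g \<in> borel_measurable borel"
    and g2: "integrable lborel (\<lambda>s. (g s)\<^sup>2 * indicator {0..} s)"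
  shows "set_integrable lborel {0..T} g"
  unfolding set_integrable_def
proof (rule Bochner_Integration.integrable_bound)
  show "integrable lborel (\<lambda>s. indicator {0..T} s + (g s)\<^sup>2 * indicator {0..} s)"
    using g2 by (intro Bochner_Integration.integrable_add integrable_real_indicator) (auto simp: emeasure_lborel_Icc_eq)
  have "\<bar>y\<bar> \<le> 1 + y\<^sup>2" for y :: real
  proof -
    have "0 \<le> (\<bar>y\<bar> - 1)\<^sup>2 + \<bar>y\<bar>" by simp
    then show ?thesis by (simp add: power2_eq_square algebra_simps)
  qed
  then show "AE s in lborel. norm (indicator {0..T} s *\<^sub>R g s) \<le> norm (indicator {0..T} s + (g s)\<^sup>2 * indicator {0..} s)"
    by (intro AE_I2) (simp add: indicator_def)
qed simp

text \<open>The estimate |y| \<le> c + y^2 / c takes the place of the Cauchy-Schwarz inequality: a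
  large c makes the quadratic part small on every set, after which a small total length takes care
  of the rest.\<close>

lemma abs_continuous_on_primitive:
  fixes g :: "real \<Rightarrow> real"
  assumes gm [measurable]: "g \<in> borel_measurable borel"
    and g2: "integrable lborel (\<lambda>s. (g s)\<^sup>2 * indicator {0..} s)"
  shows "abs_continuous_on {0..T} (\<lambda>x. LINT s:{0..x}|lborel. g s)"
  unfolding abs_continuous_on_def
proof (intro allI impI)
  fix \<epsilon> :: real assume e: "0 < \<epsilon>"
  define h where "h x = (LINT s:{0..x}|lborel. g s)" for x
  define G where "G = (\<integral>s. (g s)\<^sup>2 * indicator {0..} s \<partial>lborel)"
  have G: "0 \<le> G" unfolding G_def by (rule Bochner_Integration.integral_nonneg) simp
  \<comment> \<open>This makes G / c at most \<epsilon> / 2; the summand 1 keeps c positive when G =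
    0.\<close>
  define c where "c = 2 * (G + 1) / \<epsilon>"
  have c: "0 < c" using e G by (simp add: c_def)
  have int: "set_integrable lborel {0..x} g" for x by (rule set_integrable_of_square_integrable[OF gm g2])
  have main: "(\<Sum>i<n. \<bar>h (b i) - h (a i)\<bar>) < \<epsilon>"
    if ab: "\<And>i. i < n \<Longrightarrow> a i \<le> b i" "\<And>i. i < n \<Longrightarrow> {a i..b i} \<subseteq> {0..T}"
    and dj: "\<And>i j. i < n \<Longrightarrow> j < n \<Longrightarrow> i \<noteq> j \<Longrightarrow> {a i<..<b i} \<inter> {a j<..<b j} = {}"
    and small: "(\<Sum>i<n. b i - a i) < \<epsilon> / (2 * c)" for n and a b :: "nat \<Rightarrow> real"
  proof -
    let ?E = "\<lambda>i. {a i<..<b i}"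
    have nn: "0 \<le> a i" if "i < n" for i using ab(1,2)[OF that] by auto
    have q: "\<bar>y\<bar> \<le> c + y\<^sup>2 / c" for y
    proof -
      have "0 \<le> (\<bar>y\<bar> - c)\<^sup>2 + \<bar>y\<bar> * c" using c by simp
      then have "\<bar>y\<bar> * c \<le> c\<^sup>2 + y\<^sup>2" by (simp add: power2_eq_square algebra_simps)
      then show ?thesis using c by (simp add: field_simps power2_eq_square)
    qed
    have g2i: "integrable lborel (\<lambda>s. (g s)\<^sup>2 * indicator (?E i) s)" if "i < n" for i
      by (rule Bochner_Integration.integrable_bound[OF g2]) (use nn[OF that] in \<open>auto simp: indicator_def\<close>)
    have one: "\<bar>h (b i) - h (a i)\<bar> \<le> c * (b i - a i) + (\<integral>s. (g s)\<^sup>2 * indicator (?E i) s \<partial>lborel) / c"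
      if i: "i < n" for i
    proof -
      have gi: "integrable lborel (\<lambda>s. indicator {0..x} s * g s)" for x
        using int[of x] by (simp add: set_integrable_def)
      have "h (b i) - h (a i) = (\<integral>s. indicator {0..b i} s * g s - indicator {0..a i} s * g s \<partial>lborel)"
        unfolding h_def set_lebesgue_integral_def using gi by simp
      also have "\<dots> = (\<integral>s. indicator (?E i) s * g s \<partial>lborel)"
        by (rule integral_cong_AE, simp, simp, use AE_lborel_singleton[of "a i"] AE_lborel_singleton[of "b i"] in eventually_elim)
          (use nn[OF i] ab(1)[OF i] in \<open>auto simp: indicator_def\<close>)
      finally have "\<bar>h (b i) - h (a i)\<bar> = norm (\<integral>s. indicator (?E i) s * g s \<partial>lborel)" by simp
      also have "\<dots> \<le> (\<integral>s. c * indicator (?E i) s + (g s)\<^sup>2 * indicator (?E i) s / c \<partial>lborel)"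
      proof (rule Bochner_Integration.integral_norm_bound_integral)
        show "integrable lborel (\<lambda>s. indicator (?E i) s * g s)"
          by (rule Bochner_Integration.integrable_bound[OF gi[of "b i"]]) (use nn[OF i] in \<open>auto simp: indicator_def\<close>)
        show "integrable lborel (\<lambda>s. c * indicator (?E i) s + (g s)\<^sup>2 * indicator (?E i) s / c)"
          using g2i[OF i] ab(1)[OF i]
          by (intro Bochner_Integration.integrable_add integrable_mult_right integrable_real_indicator) (auto simp: emeasure_lborel_Ioo)
        show "norm (indicator (?E i) s * g s) \<le> c * indicator (?E i) s + (g s)\<^sup>2 * indicator (?E i) s / c" for s
          using q[of "g s"] by (simp add: indicator_def)
      qed
      also have "\<dots> = c * (b i - a i) + (\<integral>s. (g s)\<^sup>2 * indicator (?E i) s \<partial>lborel) / c"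
        using g2i[OF i] ab(1)[OF i]
        by (subst Bochner_Integration.integral_add)
          (auto intro!: integrable_mult_right integrable_real_indicator simp: emeasure_lborel_Ioo)
      finally show ?thesis .
    qed
    have "(\<Sum>i<n. \<bar>h (b i) - h (a i)\<bar>) \<le> (\<Sum>i<n. c * (b i - a i) + (\<integral>s. (g s)\<^sup>2 * indicator (?E i) s \<partial>lborel) / c)"
      by (rule sum_mono) (simp add: one)
    also have "\<dots> = c * (\<Sum>i<n. b i - a i) + (\<integral>s. (\<Sum>i<n. (g s)\<^sup>2 * indicator (?E i) s) \<partial>lborel) / c"
    proof -
      have "(\<integral>s. (\<Sum>i<n. (g s)\<^sup>2 * indicator (?E i) s) \<partial>lborel) = (\<Sum>i<n. \<integral>s. (g s)\<^sup>2 * indicator (?E i) s \<partial>lborel)"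
        by (rule Bochner_Integration.integral_sum) (simp add: g2i)
      then show ?thesis by (simp only: sum.distrib sum_distrib_left sum_divide_distrib)
    qed
    also have "(\<integral>s. (\<Sum>i<n. (g s)\<^sup>2 * indicator (?E i) s) \<partial>lborel) \<le> G"
      unfolding G_def
    proof (rule Bochner_Integration.integral_mono)
      show "integrable lborel (\<lambda>s. \<Sum>i<n. (g s)\<^sup>2 * indicator (?E i) s)"
        by (intro Bochner_Integration.integrable_sum) (simp add: g2i)
      fix s
      have "(\<Sum>i<n. indicator (?E i) s) \<le> (indicator {0..} s :: real)"
      proof (cases "\<exists>i<n. s \<in> ?E i")
        case True
        then obtain i where i: "i < n" "s \<in> ?E i" by blast
        have "(\<Sum>j<n. indicator (?E j) s) = (\<Sum>j<n. if j = i then 1 else (0::real))"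
        proof (rule sum.cong[OF refl])
          fix j assume "j \<in> {..<n}"
          then show "indicator (?E j) s = (if j = i then 1 else (0::real))"
            using dj[of i j] i by (cases "j = i") (auto simp: indicator_def)
        qed
        also have "\<dots> = 1" using i by simp
        finally show ?thesis using i nn[of i] by (auto simp: indicator_def)
      next
        case False
        then have "(\<Sum>i<n. indicator (?E i) s) = (0::real)" by (intro sum.neutral) (auto simp: indicator_def)
        then show ?thesis by simp
      qed
      then show "(\<Sum>i<n. (g s)\<^sup>2 * indicator (?E i) s) \<le> (g s)\<^sup>2 * indicator {0..} s"
        by (simp add: sum_distrib_left[symmetric] mult_left_mono)
    qed (use g2 in simp)
    finally have "(\<Sum>i<n. \<bar>h (b i) - h (a i)\<bar>) \<le> c * (\<Sum>i<n. b i - a i) + G / c"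
      using c by (simp add: divide_right_mono)
    also have "c * (\<Sum>i<n. b i - a i) < \<epsilon> / 2"
      using mult_strict_left_mono[OF small c] c by (simp add: field_simps)
    also have "G / c \<le> \<epsilon> / 2"
      unfolding c_def using e G by (simp add: field_simps)
    finally show ?thesis by simp
  qed
  show "\<exists>\<delta>>0. \<forall>(n::nat) a b. (\<forall>i<n. a i \<le> b i \<and> {a i..b i} \<subseteq> {0..T}) \<and>
      (\<forall>i<n. \<forall>j<n. i \<noteq> j \<longrightarrow> {a i<..<b i} \<inter> {a j<..<b j} = {}) \<and> (\<Sum>i<n. b i - a i) < \<delta>
      \<longrightarrow> (\<Sum>i<n. \<bar>(LINT s:{0..b i}|lborel. g s) - (LINT s:{0..a i}|lborel. g s)\<bar>) < \<epsilon>"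
    unfolding h_def[symmetric]
  proof (intro exI[of _ "\<epsilon> / (2 * c)"] conjI allI impI)
    show "0 < \<epsilon> / (2 * c)" using c e by simp
    fix n :: nat and a b
    assume A: "(\<forall>i<n. a i \<le> b i \<and> {a i..b i} \<subseteq> {0..T}) \<and>
      (\<forall>i<n. \<forall>j<n. i \<noteq> j \<longrightarrow> {a i<..<b i} \<inter> {a j<..<b j} = {}) \<and> (\<Sum>i<n. b i - a i) < \<epsilon> / (2 * c)"
    show "(\<Sum>i<n. \<bar>h (b i) - h (a i)\<bar>) < \<epsilon>"
      by (rule main) (use A in blast)+
  qed
qed

text \<open>A single interval with endpoints x and y in order is enough; \<open>x + 1\<close> leaves
  room to the right of x.\<close>

lemma abs_continuous_on_imp_continuous:
  assumes "abs_continuous_on {0..x + 1} h" "0 \<le> (x::real)"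
  shows "continuous (at x within {0..}) h"
  unfolding continuous_within_eps_delta
proof (intro allI impI)
  fix \<epsilon> :: real assume "0 < \<epsilon>"
  from mp[OF spec[OF assms(1)[unfolded abs_continuous_on_def], of \<epsilon>] this]
  obtain \<delta> where "0 < \<delta> \<and> (\<forall>(n::nat) a b.
       (\<forall>i<n. a i \<le> b i \<and> {a i..b i} \<subseteq> {0..x+1}) \<and>
       (\<forall>i<n. \<forall>j<n. i \<noteq> j \<longrightarrow> {a i<..<b i} \<inter> {a j<..<b j} = {}) \<and>
       (\<Sum>i<n. b i - a i) < \<delta> \<longrightarrow> (\<Sum>i<n. \<bar>h (b i) - h (a i)\<bar>) < \<epsilon>)" ..
  then have d: "0 < \<delta>" and d2: "\<And>(n::nat) a b.
       (\<forall>i<n. a i \<le> b i \<and> {a i..b i} \<subseteq> {0..x+1}) \<and>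
       (\<forall>i<n. \<forall>j<n. i \<noteq> j \<longrightarrow> {a i<..<b i} \<inter> {a j<..<b j} = {}) \<and>
       (\<Sum>i<n. b i - a i) < \<delta> \<Longrightarrow> (\<Sum>i<n. \<bar>h (b i) - h (a i)\<bar>) < \<epsilon>"
    by simp_all
  have "dist (h y) (h x) < \<epsilon>" if y: "y \<in> {0..}" "dist y x < min \<delta> 1" for y
  proof -
    have "\<bar>h (max x y) - h (min x y)\<bar> < \<epsilon>"
    proof -
      have "min x y \<le> max x y" "0 \<le> min x y" "max x y \<le> x + 1" "max x y - min x y < \<delta>"
        using y assms(2) by (auto simp: dist_real_def)
      then show ?thesis using d2[of 1 "\<lambda>_. min x y" "\<lambda>_. max x y"] by simp
    qed
    then show ?thesis by (cases "x \<le> y") (simp_all add: dist_real_def abs_minus_commute)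
  qed
  then show "\<exists>d>0. \<forall>y\<in>{0..}. dist y x < d \<longrightarrow> dist (h y) (h x) < \<epsilon>"
    using d by (intro exI[of _ "min \<delta> 1"]) auto
qed

text \<open>\<open>cm_integral\<close> and \<open>cm_inner\<close> are defined through
  \<open>deriv\<close>, so the primitive must be differentiable with derivative g off a finite set.
  The point 0 is always excepted, because the primitive is continued by 0 to the left.\<close>

lemma cameron_martin_primitive:
  fixes g :: "real \<Rightarrow> real"
  assumes gm [measurable]: "g \<in> borel_measurable borel"
    and g2: "integrable lborel (\<lambda>s. (g s)\<^sup>2 * indicator {0..} s)"
    and neg: "\<And>s. s < 0 \<Longrightarrow> g s = 0" and F: "finite F" "\<And>s. s \<notin> F \<Longrightarrow> isCont g s"
  obtains h where "h \<in> cameron_martin" "\<And>s. s \<notin> insert 0 F \<Longrightarrow> deriv h s = g s"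
proof -
  define h where "h x = (LINT s:{0..x}|lborel. g s)" for x
  have ac: "abs_continuous_on {0..T} h" for T
    unfolding h_def[abs_def] by (rule abs_continuous_on_primitive[OF gm g2])
  have h0: "h x = 0" if "x < 0" for x using that by (simp add: h_def set_lebesgue_integral_def)
  have d: "deriv h s = g s" if s: "s \<notin> insert 0 F" for s
  proof (cases "s < 0")
    case True
    have "(h has_real_derivative 0) (at s)"
      by (rule has_field_derivative_transform_within_open[of "\<lambda>_. 0" _ _ "{..<0}"]) (use True h0 in simp_all)
    then show ?thesis using neg[OF True] by (simp add: DERIV_imp_deriv)
  next
    case False
    then have s0: "s > 0" using s by auto
    have int: "set_integrable lborel {0..x} g" for x by (rule set_integrable_of_square_integrable[OF gm g2])
    have hi: "h x = integral {0..x} g" for x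
      unfolding h_def by (rule set_borel_integral_eq_integral[OF int])
    have gi: "g integrable_on {0..s+1}" by (rule set_borel_integral_eq_integral[OF int])
    have "isCont g s" using F(2)[of s] s by simp
    then have gc: "continuous (at s within ({0..s + 1} - {})) g"
      by (rule continuous_at_imp_continuous_at_within)
    have "((\<lambda>u. integral {0..u} g) has_vector_derivative g s) (at s within ({0..s+1} - {}))"
      by (rule integral_has_vector_derivative_continuous_at[OF gi _ _ gc]) (use s0 in simp_all)
    then have "((\<lambda>u. integral {0..u} g) has_vector_derivative g s) (at s)"
      using s0 by (simp add: at_within_Icc_at)
    then have "(h has_real_derivative g s) (at s)"
      unfolding hi[abs_def] by (simp add: has_real_derivative_iff_has_vector_derivative)
    then show ?thesis by (rule DERIV_imp_deriv)
  qed
  have dm: "deriv h \<in> borel_measurable borel"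
  proof (rule measurable_discrete_difference[where X="insert 0 F", OF gm])
    show "countable (insert 0 F)" using F(1) by (simp add: countable_finite)
    show "g x = deriv h x" if "x \<notin> insert 0 F" for x using d[OF that] by simp
  qed simp_all
  have AE: "AE s in lborel. s \<notin> insert 0 F"
    using F(1) by (intro AE_not_in finite_imp_null_set_lborel) simp
  have ws: "h \<in> wiener_space"
    unfolding wiener_space_def
  proof (intro CollectI conjI allI impI)
    show "continuous_on {0..} h"
      unfolding continuous_on_eq_continuous_within
    proof
      fix x :: real assume "x \<in> {0..}"
      then show "continuous (at x within {0..}) h" by (intro abs_continuous_on_imp_continuous ac) simp
    qed
    have "h 0 = (\<integral>s. 0 \<partial>(lborel :: real measure))"
      unfolding h_def set_lebesgue_integral_def
    proof (rule integral_cong_AE)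
      show "AE s in lborel. indicator {0..0} s *\<^sub>R g s = 0"
        using AE_lborel_singleton[of "0::real"] by eventually_elim (simp add: indicator_def)
    qed simp_all
    then show "h 0 = 0" by simp
  qed (rule h0)
  have "integrable lborel (\<lambda>s. indicator {0..} s *\<^sub>R (deriv h s)\<^sup>2) = integrable lborel (\<lambda>s. (g s)\<^sup>2 * indicator {0..} s)"
  proof (rule integrable_cong_AE)
    show "AE s in lborel. indicator {0..} s *\<^sub>R (deriv h s)\<^sup>2 = (g s)\<^sup>2 * indicator {0..} s"
      using AE by eventually_elim (simp add: d mult.commute)
  qed (use dm in measurable)
  then have "square_integrable (deriv h)"
    unfolding square_integrable_def set_borel_measurable_def set_integrable_def using g2 dm by simp
  then have "h \<in> cameron_martin" unfolding cameron_martin_def using ws ac by simp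
  then show ?thesis using d by (rule that)
qed

section \<open>A lower bound along geometric sequences\<close>

context wiener
begin

text \<open>Merging with an empty step function replaces a partition with repeated points by a
  strictly increasing grid.\<close>

lemma step_integral_gauss_weak:
  assumes "partition_upto n \<tau>"
  obtains v where "0 \<le> v" "gauss (step_integral n a \<tau>) v"
    "ennreal v = (\<integral>\<^sup>+s\<in>{0..}. ennreal ((step_fun n a \<tau> s)\<^sup>2) \<partial>lborel)"
proof -
  have p0: "partition_upto 0 (\<lambda>_. 0)" by (simp add: partition_upto_def)
  obtain N b \<sigma> where g: "0 \<le> \<sigma> 0" "\<And>i. i < N \<Longrightarrow> \<sigma> i < \<sigma> (Suc i)"
    and f: "\<And>s. step_fun N b \<sigma> s = step_fun n a \<tau> s - step_fun 0 (\<lambda>_. 0) (\<lambda>_. 0) s"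
      "\<And>\<omega>. step_integral N b \<sigma> \<omega> = step_integral n a \<tau> \<omega> - step_integral 0 (\<lambda>_. 0) (\<lambda>_. 0) \<omega>"
    by (rule common_grid[OF assms p0]) blast
  have e: "step_fun N b \<sigma> = step_fun n a \<tau>" "step_integral N b \<sigma> = step_integral n a \<tau>"
    using f by (auto simp: fun_eq_iff step_fun_def[of 0] step_integral_def[of 0])
  define v where "v = (\<Sum>i<N. (b i)\<^sup>2 * (\<sigma> (Suc i) - \<sigma> i))"
  have "0 \<le> v" unfolding v_def using g by (intro sum_nonneg) (auto simp: less_imp_le)
  moreover have "gauss (step_integral n a \<tau>) v"
    using step_integral_gauss[of \<sigma> N b, OF g] unfolding v_def e .
  moreover have "ennreal v = (\<integral>\<^sup>+s\<in>{0..}. ennreal ((step_fun n a \<tau> s)\<^sup>2) \<partial>lborel)"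
    using nn_integral_step_fun_square[OF partition_upto_strict[of \<sigma> N, OF g], of b] unfolding v_def e by simp
  ultimately show ?thesis by (rule that)
qed

text \<open>For u < -y one has u^2 \<ge> y^2 + (u + y)^2, so the density at u is at most exp(-y^2 /
  (2v)) times the density centred at -y. The bound V appears because the variance is later known
  from above only and may be 0.\<close>

lemma gauss_tail_upper:
  assumes X: "gauss X v" "v \<le> V" "0 < V" and y: "0 \<le> y"
  shows "prob {\<omega> \<in> space P. X \<omega> < - y} \<le> exp (- y\<^sup>2 / (2 * V))"
proof (cases "v = 0")
  case True
  then show ?thesis using X y by (auto simp: gauss_def)
next
  case False
  then have v: "0 < v" and d: "distributed P lborel X (normal_density 0 (sqrt v))" using X by (auto simp: gauss_def)
  have dens: "normal_density 0 (sqrt v) u * indicator {..< - y} u \<le> exp (- y\<^sup>2 / (2 * v)) * normal_density (- y) (sqrt v) u" for u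
  proof (cases "u < - y")
    case True
    have "0 \<le> - 2 * y * (u + y)" using True y by (simp add: mult_nonneg_nonpos)
    then have "y\<^sup>2 + (u + y)\<^sup>2 \<le> u\<^sup>2" by (simp add: power2_eq_square algebra_simps)
    then have "(y\<^sup>2 + (u + y)\<^sup>2) / (2 * v) \<le> u\<^sup>2 / (2 * v)" using v by (intro divide_right_mono) auto
    then have "- u\<^sup>2 / (2 * v) \<le> - y\<^sup>2 / (2 * v) + - (u + y)\<^sup>2 / (2 * v)" by (simp add: add_divide_distrib)
    then have "exp (- u\<^sup>2 / (2 * v)) \<le> exp (- y\<^sup>2 / (2 * v)) * exp (- (u + y)\<^sup>2 / (2 * v))"
      unfolding exp_add[symmetric] by (simp only: exp_le_cancel_iff)
    then have "1 / sqrt (2 * pi * v) * exp (- u\<^sup>2 / (2 * v)) \<le> 1 / sqrt (2 * pi * v) * (exp (- y\<^sup>2 / (2 * v)) * exp (- (u + y)\<^sup>2 / (2 * v)))"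
      using v by (intro mult_left_mono) auto
    then show ?thesis using True v by (simp add: normal_density_def mult_ac)
  next
    case False
    then show ?thesis using v by (simp add: normal_density_nonneg)
  qed
  have "emeasure P (X -` {..< - y} \<inter> space P) = (\<integral>\<^sup>+u. ennreal (normal_density 0 (sqrt v) u) * indicator {..< - y} u \<partial>lborel)"
    by (rule distributed_emeasure[OF d]) simp
  also have "\<dots> \<le> (\<integral>\<^sup>+u. ennreal (exp (- y\<^sup>2 / (2 * v))) * ennreal (normal_density (- y) (sqrt v) u) \<partial>lborel)"
  proof (rule nn_integral_mono)
    fix u
    have "ennreal (normal_density 0 (sqrt v) u) * indicator {..< - y} u = ennreal (normal_density 0 (sqrt v) u * indicator {..< - y} u)"
      by (simp add: indicator_def)
    also have "\<dots> \<le> ennreal (exp (- y\<^sup>2 / (2 * v)) * normal_density (- y) (sqrt v) u)" by (rule ennreal_leI[OF dens])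
    also have "\<dots> = ennreal (exp (- y\<^sup>2 / (2 * v))) * ennreal (normal_density (- y) (sqrt v) u)" by (rule ennreal_mult) auto
    finally show "ennreal (normal_density 0 (sqrt v) u) * indicator {..< - y} u \<le> ennreal (exp (- y\<^sup>2 / (2 * v))) * ennreal (normal_density (- y) (sqrt v) u)" .
  qed
  also have "\<dots> = ennreal (exp (- y\<^sup>2 / (2 * v))) * (\<integral>\<^sup>+u. ennreal (normal_density (- y) (sqrt v) u) \<partial>lborel)"
    by (rule nn_integral_cmult) simp
  also have "(\<integral>\<^sup>+u. ennreal (normal_density (- y) (sqrt v) u) \<partial>lborel) = 1"
  proof -
    have "(\<integral>\<^sup>+u. ennreal (normal_density (- y) (sqrt v) u) \<partial>lborel) = ennreal (\<integral>u. normal_density (- y) (sqrt v) u \<partial>lborel)"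
      by (rule nn_integral_eq_integral) (use v in auto)
    then show ?thesis using v by simp
  qed
  finally have "emeasure P (X -` {..< - y} \<inter> space P) \<le> ennreal (exp (- y\<^sup>2 / (2 * v)))" by simp
  then have "prob (X -` {..< - y} \<inter> space P) \<le> exp (- y\<^sup>2 / (2 * v))" by (simp add: emeasure_eq_measure)
  also have "\<dots> \<le> exp (- y\<^sup>2 / (2 * V))"
    using X v by (simp add: divide_left_mono)
  also have "X -` {..< - y} \<inter> space P = {\<omega> \<in> space P. X \<omega> < - y}" by auto
  finally show ?thesis .
qed

text \<open>The interval (x, x + sqrt v] has at least the mass given by its length times the density
  at its right end.\<close>

lemma gauss_tail_lower:
  assumes X: "gauss X v" "0 < v" and x: "0 \<le> x"
  shows "1 / sqrt (2 * pi) * exp (- (x / sqrt v + 1)\<^sup>2 / 2) \<le> prob {\<omega> \<in> space P. x < X \<omega>}"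
proof -
  have d: "distributed P lborel X (normal_density 0 (sqrt v))" using X by (auto simp: gauss_def)
  let ?c = "normal_density 0 (sqrt v) (x + sqrt v)"
  have "?c * sqrt v = 1 / sqrt (2 * pi) * exp (- (x / sqrt v + 1)\<^sup>2 / 2)"
  proof -
    have "(x + sqrt v)\<^sup>2 / (2 * v) = (x / sqrt v + 1)\<^sup>2 / 2"
    proof -
      have "x / sqrt v + 1 = (x + sqrt v) / sqrt v" using X(2) by (simp add: add_divide_distrib)
      then have "(x / sqrt v + 1)\<^sup>2 = (x + sqrt v)\<^sup>2 / v" using X(2) by (simp add: power_divide)
      then show ?thesis by simp
    qed
    then show ?thesis using X(2) by (simp add: normal_density_def real_sqrt_mult)
  qed
  have "ennreal (?c * sqrt v) = (\<integral>\<^sup>+u. ennreal ?c * indicator {x<..x + sqrt v} u \<partial>lborel)"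
    using X(2) by (subst nn_integral_cmult_indicator) (auto simp: ennreal_mult normal_density_nonneg)
  also have "\<dots> \<le> (\<integral>\<^sup>+u. ennreal (normal_density 0 (sqrt v) u) * indicator {x<..} u \<partial>lborel)"
  proof (intro nn_integral_mono)
    fix u
    have "?c \<le> normal_density 0 (sqrt v) u" if u: "x < u" "u \<le> x + sqrt v"
    proof -
      have "u\<^sup>2 \<le> (x + sqrt v)\<^sup>2" using u x by (intro power_mono) auto
      then have "u\<^sup>2 / (2 * v) \<le> (x + sqrt v)\<^sup>2 / (2 * v)" using X(2) by (intro divide_right_mono) auto
      then have "exp (- (x + sqrt v)\<^sup>2 / (2 * v)) \<le> exp (- u\<^sup>2 / (2 * v))" by simp
      then show ?thesis using X(2) by (simp add: normal_density_def divide_right_mono)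
    qed
    then show "ennreal ?c * indicator {x<..x + sqrt v} u \<le> ennreal (normal_density 0 (sqrt v) u) * indicator {x<..} u"
      by (auto simp: indicator_def intro!: ennreal_leI)
  qed
  also have "\<dots> = emeasure P (X -` {x<..} \<inter> space P)"
    by (rule distributed_emeasure[OF d, symmetric]) simp
  also have "X -` {x<..} \<inter> space P = {\<omega> \<in> space P. x < X \<omega>}" by auto
  finally have "?c * sqrt v \<le> prob {\<omega> \<in> space P. x < X \<omega>}" by (simp add: emeasure_eq_measure)
  then show ?thesis using \<open>?c * sqrt v = _\<close> by simp
qed

text \<open>On a common grid the integral with index m uses only the increments over cells whose
  right endpoint lies in \<open>I m\<close>. Disjoint sets \<open>I m\<close> select disjoint groups
  of independent increments.\<close>

lemma step_integrals_indep:
  assumes J: "finite J" and part: "\<And>m. m \<in> J \<Longrightarrow> partition_upto (n m) (\<tau> m)"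
    and supp: "\<And>m s. m \<in> J \<Longrightarrow> s \<notin> I m \<Longrightarrow> step_fun (n m) (a m) (\<tau> m) s = 0" and dj: "disjoint_family_on I J"
  shows "indep_vars (\<lambda>_. borel) (\<lambda>m. step_integral (n m) (a m) (\<tau> m)) J"
proof (cases "J = {}")
  case True then show ?thesis by (simp add: indep_vars_def indep_sets_def)
next
  case False
  define D where "D = (\<Union>m\<in>J. \<tau> m ` {..n m})"
  have "finite D" "D \<noteq> {}" using J False by (auto simp: D_def)
  then obtain N \<sigma> where \<sigma>: "\<And>i j. i < j \<Longrightarrow> j \<le> N \<Longrightarrow> \<sigma> i < \<sigma> j" "\<sigma> ` {..(N::nat)} = D"
    by (rule finite_grid) blast
  have pos: "\<sigma> ` {..N} \<subseteq> {0..}" unfolding \<sigma>(2) D_def using part partition_upto_nonneg by fastforce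
  define K where "K m = {j. j < N \<and> \<sigma> (Suc j) \<in> I m}" for m
  let ?b = "\<lambda>m j. step_fun (n m) (a m) (\<tau> m) (\<sigma> (Suc j))"
  let ?\<Delta> = "\<lambda>j \<omega>. \<omega> (\<sigma> (Suc j)) - \<omega> (\<sigma> j) :: real"
  have eq: "step_integral (n m) (a m) (\<tau> m) \<omega> = (\<Sum>j\<in>K m. ?b m j * ?\<Delta> j \<omega>)" if m: "m \<in> J" for m \<omega>
  proof -
    have "\<tau> m ` {..n m} \<subseteq> \<sigma> ` {..N}" unfolding \<sigma>(2) D_def using m by blast
    then have "step_integral (n m) (a m) (\<tau> m) \<omega> = step_integral N (?b m) \<sigma> \<omega>"
      by (intro step_integral_on_grid \<sigma>(1) part m)
    also have "\<dots> = (\<Sum>j\<in>K m. ?b m j * ?\<Delta> j \<omega>)"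
      unfolding step_integral_def
      by (intro sum.mono_neutral_right) (auto simp: K_def supp[OF m])
    finally show ?thesis .
  qed
  have "0 \<le> \<sigma> 0" using pos by auto
  then have "indep_vars (\<lambda>_. borel) ?\<Delta> {..<N}"
    by (intro increments_indep) (use \<sigma>(1) in auto)
  moreover have "K m \<subseteq> {..<N}" for m by (auto simp: K_def)
  moreover have "disjoint_family_on K J" using dj by (auto simp: disjoint_family_on_def K_def)
  ultimately have "indep_vars (\<lambda>m. PiM (K m) (\<lambda>_. borel)) (\<lambda>m \<omega>. restrict (\<lambda>j. ?\<Delta> j \<omega>) (K m)) J"
    by (intro indep_vars_restrict)
  then have "indep_vars (\<lambda>_. borel) (\<lambda>m \<omega>. (\<lambda>r. \<Sum>j\<in>K m. ?b m j * r j) (restrict (\<lambda>j. ?\<Delta> j \<omega>) (K m))) J"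
    by (rule indep_vars_compose2[where Y="\<lambda>m r. \<Sum>j\<in>K m. ?b m j * r j"])
       (intro borel_measurable_sum borel_measurable_times borel_measurable_const measurable_component_singleton)
  then show ?thesis
    by (subst indep_vars_cong[where Y="\<lambda>m \<omega>. (\<lambda>r. \<Sum>j\<in>K m. ?b m j * r j) (restrict (\<lambda>j. ?\<Delta> j \<omega>) (K m))", OF refl _ refl])
       (auto simp: eq fun_eq_iff)
qed

end

text \<open>Restriction to (c, d] needs no new partition points: moving every point into [c, d]
  leaves the outer cells empty.\<close>

lemma step_fun_clamp:
  assumes "partition_upto n \<tau>" "c \<le> d"
  shows "step_fun n a (\<lambda>i. max c (min d (\<tau> i))) s = step_fun n a \<tau> s * indicator {c<..d} s"
  unfolding step_fun_def sum_distrib_right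
proof (rule sum.cong[OF refl])
  fix i assume "i \<in> {..<n}"
  then have "\<tau> i \<le> \<tau> (Suc i)" using assms by (auto simp: partition_upto_def)
  then show "a i * indicator {max c (min d (\<tau> i))<..max c (min d (\<tau> (Suc i)))} s = a i * indicator {\<tau> i<..\<tau> (Suc i)} s * indicator {c<..d} s"
    using assms(2) by (auto simp: indicator_def)
qed

lemma step_fun_above:
  assumes "partition_upto n \<tau>"
  shows "step_fun n a (\<lambda>i. max d (\<tau> i)) s = step_fun n a \<tau> s * indicator {d<..} s"
  unfolding step_fun_def sum_distrib_right
proof (rule sum.cong[OF refl])
  fix i assume "i \<in> {..<n}"
  then have "\<tau> i \<le> \<tau> (Suc i)" using assms by (auto simp: partition_upto_def)
  then show "a i * indicator {max d (\<tau> i)<..max d (\<tau> (Suc i))} s = a i * indicator {\<tau> i<..\<tau> (Suc i)} s * indicator {d<..} s"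
    by (auto simp: indicator_def)
qed

lemma partition_upto_clamp:
  "partition_upto n \<tau> \<Longrightarrow> 0 \<le> c \<Longrightarrow> partition_upto n (\<lambda>i. max c (min d (\<tau> i)))"
  "partition_upto n \<tau> \<Longrightarrow> 0 \<le> d \<Longrightarrow> partition_upto n (\<lambda>i. max d (\<tau> i))"
  unfolding partition_upto_def by (force simp: le_max_iff_disj min_le_iff_disj)+

lemma step_integral_split:
  assumes "partition_upto n \<tau>" "0 \<le> c" "c \<le> d"
  shows "step_integral n a \<tau> \<omega> = step_integral n a (\<lambda>i. max 0 (min c (\<tau> i))) \<omega>
     + step_integral n a (\<lambda>i. max c (min d (\<tau> i))) \<omega> + step_integral n a (\<lambda>i. max d (\<tau> i)) \<omega>"
proof -
  \<comment> \<open>One of the three clamped values is x itself and the other two are c and d. These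
    constants cancel in the increments.\<close>
  have *: "\<omega> x = \<omega> (max 0 (min c x)) + \<omega> (max c (min d x)) + \<omega> (max d x) - \<omega> c - \<omega> d" if "0 \<le> x" for x
  proof -
    consider "x \<le> c" | "c \<le> x" "x \<le> d" | "d \<le> x" by linarith
    then show ?thesis using assms that by cases (auto simp: max_def min_def)
  qed
  show ?thesis
    unfolding step_integral_def sum.distrib[symmetric] distrib_left[symmetric]
  proof (rule sum.cong[OF refl])
    fix i assume "i \<in> {..<n}"
    then have "0 \<le> \<tau> i" "0 \<le> \<tau> (Suc i)" using partition_upto_nonneg[OF assms(1)] by auto
    from *[OF this(1)] *[OF this(2)]
    show "a i * (\<omega> (\<tau> (Suc i)) - \<omega> (\<tau> i)) = a i * (\<omega> (max 0 (min c (\<tau> (Suc i)))) - \<omega> (max 0 (min c (\<tau> i))) +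
       (\<omega> (max c (min d (\<tau> (Suc i)))) - \<omega> (max c (min d (\<tau> i)))) + (\<omega> (max d (\<tau> (Suc i))) - \<omega> (max d (\<tau> i))))" by simp
  qed
qed

text \<open>The weight keeps the coefficient of w^2 close to 1. The plain factor 2 would halve the
  variance and with it spoil the constant in the iterated logarithm.\<close>

lemma square_le_weighted:
  fixes u w \<theta> :: real
  assumes "0 < \<theta>" shows "u\<^sup>2 \<le> (1 + \<theta>) * w\<^sup>2 + (1 + 1 / \<theta>) * (u - w)\<^sup>2"
proof -
  have "0 \<le> \<theta> * (w - (u - w) / \<theta>)\<^sup>2" using assms by simp
  also have "\<dots> = (1 + \<theta>) * w\<^sup>2 + (1 + 1 / \<theta>) * (u - w)\<^sup>2 - u\<^sup>2"
    using assms by (simp add: power2_eq_square field_simps)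
  finally show ?thesis by simp
qed

section \<open>Splitting a Wiener integral at an intermediate time\<close>

context wiener
begin

text \<open>All pieces are cut from one step approximation of g: Y lives on (0, c], the main part on
  (c, t], and the remainder is small in L^2. The approximation is split rather than X, because the
  independence is available for step integrals.\<close>

lemma wiener_integral_decomposition:
  assumes X: "is_wiener_integral P g X" and g [measurable]: "g \<in> borel_measurable borel"
    and supp: "\<And>s. t \<le> s \<Longrightarrow> g s = 0" and ct: "0 \<le> c" "c \<le> t"
    and A: "(\<integral>\<^sup>+s\<in>{0..c}. ennreal ((g s)\<^sup>2) \<partial>lborel) = ennreal A" "0 \<le> A"
    and B: "(\<integral>\<^sup>+s\<in>{c<..t}. ennreal ((g s)\<^sup>2) \<partial>lborel) = ennreal B" "0 \<le> B"
    and \<delta>: "0 < \<delta>" and \<theta>: "0 < \<theta>"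
  obtains n a \<tau> Y u v where "partition_upto n \<tau>" "\<And>s. s \<notin> {c<..t} \<Longrightarrow> step_fun n a \<tau> s = 0"
    "gauss (step_integral n a \<tau>) v" "0 \<le> v" "B \<le> (1 + \<theta>) * v + (1 + 1 / \<theta>) * \<delta>"
    "Y \<in> borel_measurable P" "gauss Y u" "u \<le> 2 * \<delta> + 2 * A"
    "(\<integral>\<^sup>+\<omega>. ennreal ((X \<omega> - Y \<omega> - step_integral n a \<tau> \<omega>)\<^sup>2) \<partial>P) \<le> ennreal (4 * \<delta>)"
proof -
  obtain nn aa \<tau>\<tau> where t0: "\<And>m. 0 \<le> \<tau>\<tau> m 0" "\<And>m i. i < nn m \<Longrightarrow> \<tau>\<tau> m i < \<tau>\<tau> m (Suc i)"
    and gl: "(\<lambda>m. \<integral>\<^sup>+s\<in>{0..}. ennreal ((g s - step_fun (nn m) (aa m) (\<tau>\<tau> m) s)\<^sup>2) \<partial>lborel) \<longlonglongrightarrow> 0"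
    and Xl: "(\<lambda>m. \<integral>\<^sup>+\<omega>. ennreal ((X \<omega> - step_integral (nn m) (aa m) (\<tau>\<tau> m) \<omega>)\<^sup>2) \<partial>P) \<longlonglongrightarrow> 0"
    by (rule is_wiener_integralE[OF X]) blast
  have d: "0 < ennreal \<delta>" using \<delta> by simp
  from eventually_conj[OF order_tendstoD(2)[OF gl d] order_tendstoD(2)[OF Xl d]]
  obtain m where m: "(\<integral>\<^sup>+s\<in>{0..}. ennreal ((g s - step_fun (nn m) (aa m) (\<tau>\<tau> m) s)\<^sup>2) \<partial>lborel) < ennreal \<delta>"
    "(\<integral>\<^sup>+\<omega>. ennreal ((X \<omega> - step_integral (nn m) (aa m) (\<tau>\<tau> m) \<omega>)\<^sup>2) \<partial>P) < ennreal \<delta>"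
    by (auto simp: eventually_sequentially)
  define n where "n = nn m"
  define a where "a = aa m"
  define \<tau> where "\<tau> = \<tau>\<tau> m"
  define S where "S = step_fun n a \<tau>"
  have part: "partition_upto n \<tau>" unfolding n_def \<tau>_def by (rule partition_upto_strict) (use t0 in auto)
  have gS: "(\<integral>\<^sup>+s\<in>{0..}. ennreal ((g s - S s)\<^sup>2) \<partial>lborel) \<le> ennreal \<delta>"
    and XS: "(\<integral>\<^sup>+\<omega>. ennreal ((X \<omega> - step_integral n a \<tau> \<omega>)\<^sup>2) \<partial>P) \<le> ennreal \<delta>"
    using m by (auto simp: n_def a_def \<tau>_def S_def)
  have [measurable]: "X \<in> borel_measurable P" using X by (simp add: is_wiener_integral_def)
  have [measurable]: "S \<in> borel_measurable borel" unfolding S_def by measurable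
  let ?\<tau>Y = "\<lambda>i. max 0 (min c (\<tau> i))" and ?\<tau>Z = "\<lambda>i. max c (min t (\<tau> i))" and ?\<tau>W = "\<lambda>i. max t (\<tau> i)"
  have pY: "partition_upto n ?\<tau>Y" and pZ: "partition_upto n ?\<tau>Z" and pW: "partition_upto n ?\<tau>W"
    using ct partition_upto_clamp[OF part] by auto
  have sY: "step_fun n a ?\<tau>Y s = S s * indicator {0<..c} s" for s unfolding S_def by (rule step_fun_clamp[OF part ct(1)])
  have sZ: "step_fun n a ?\<tau>Z s = S s * indicator {c<..t} s" for s unfolding S_def by (rule step_fun_clamp[OF part ct(2)])
  have sW: "step_fun n a ?\<tau>W s = S s * indicator {t<..} s" for s unfolding S_def by (rule step_fun_above[OF part])
  note [measurable] = step_integral_measurable[OF part] step_integral_measurable[OF pY] step_integral_measurable[OF pZ] step_integral_measurable[OF pW]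
  obtain u where u: "0 \<le> u" "gauss (step_integral n a ?\<tau>Y) u"
    "ennreal u = (\<integral>\<^sup>+s\<in>{0..}. ennreal ((step_fun n a ?\<tau>Y s)\<^sup>2) \<partial>lborel)"
    by (rule step_integral_gauss_weak[OF pY])
  obtain v where v: "0 \<le> v" "gauss (step_integral n a ?\<tau>Z) v"
    "ennreal v = (\<integral>\<^sup>+s\<in>{0..}. ennreal ((step_fun n a ?\<tau>Z s)\<^sup>2) \<partial>lborel)"
    by (rule step_integral_gauss_weak[OF pZ])
  have mono: "(\<integral>\<^sup>+s. ennreal ((f s)\<^sup>2) \<partial>lborel) \<le> ennreal \<delta>"
    if "\<And>s. \<bar>f s\<bar> \<le> \<bar>g s - S s\<bar> * indicator {0..} s" for f
  proof -
    have "(\<integral>\<^sup>+s. ennreal ((f s)\<^sup>2) \<partial>lborel) \<le> (\<integral>\<^sup>+s\<in>{0..}. ennreal ((g s - S s)\<^sup>2) \<partial>lborel)"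
    proof (rule nn_integral_mono)
      fix s
      have "\<bar>f s\<bar>\<^sup>2 \<le> (\<bar>g s - S s\<bar> * indicator {0..} s)\<^sup>2" by (intro power_mono that) simp
      then have "(f s)\<^sup>2 \<le> (g s - S s)\<^sup>2 * indicator {0..} s" by (cases "0 \<le> s") simp_all
      then have "ennreal ((f s)\<^sup>2) \<le> ennreal ((g s - S s)\<^sup>2 * indicator {0..} s)" by (rule ennreal_leI)
      then show "ennreal ((f s)\<^sup>2) \<le> ennreal ((g s - S s)\<^sup>2) * indicator {0..} s" by (cases "0 \<le> s") simp_all
    qed
    with gS show ?thesis by (rule order_trans[rotated])
  qed
  have "ennreal u \<le> ennreal (2 * \<delta> + 2 * A)"
  proof -
    have "ennreal u = (\<integral>\<^sup>+s. ennreal ((S s * indicator {0<..c} s - 0)\<^sup>2) \<partial>lborel)"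
      unfolding u(3) sY by (intro nn_integral_cong) (auto simp: indicator_def)
    also have "\<dots> \<le> 2 * (\<integral>\<^sup>+s. ennreal ((S s * indicator {0<..c} s - g s * indicator {0<..c} s)\<^sup>2) \<partial>lborel)
       + 2 * (\<integral>\<^sup>+s. ennreal ((g s * indicator {0<..c} s - 0)\<^sup>2) \<partial>lborel)"
      by (rule nn_integral_square_diff_le) measurable
    also have "\<dots> \<le> 2 * ennreal \<delta> + 2 * ennreal A"
    proof (intro add_mono mult_left_mono)
      show "(\<integral>\<^sup>+s. ennreal ((S s * indicator {0<..c} s - g s * indicator {0<..c} s)\<^sup>2) \<partial>lborel) \<le> ennreal \<delta>"
        by (rule mono) (auto simp: indicator_def)
      have "(\<integral>\<^sup>+s. ennreal ((g s * indicator {0<..c} s - 0)\<^sup>2) \<partial>lborel) \<le> (\<integral>\<^sup>+s\<in>{0..c}. ennreal ((g s)\<^sup>2) \<partial>lborel)"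
        by (intro nn_integral_mono) (auto simp: indicator_def)
      then show "(\<integral>\<^sup>+s. ennreal ((g s * indicator {0<..c} s - 0)\<^sup>2) \<partial>lborel) \<le> ennreal A" unfolding A(1) .
    qed simp_all
    also have "\<dots> = ennreal (2 * \<delta> + 2 * A)" using \<delta> A(2) by (simp add: numeral_mult_ennreal)
    finally show ?thesis .
  qed
  then have u2: "u \<le> 2 * \<delta> + 2 * A" using \<delta> A(2) by (subst (asm) ennreal_le_iff) auto
  have "ennreal B \<le> ennreal ((1 + \<theta>) * v + (1 + 1 / \<theta>) * \<delta>)"
  proof -
    have "ennreal B = (\<integral>\<^sup>+s. ennreal ((g s * indicator {c<..t} s)\<^sup>2) \<partial>lborel)"
      unfolding B(1)[symmetric] by (intro nn_integral_cong) (simp add: indicator_def)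
    also have "\<dots> \<le> (\<integral>\<^sup>+s. ennreal (1 + \<theta>) * ennreal ((S s * indicator {c<..t} s)\<^sup>2) +
       ennreal (1 + 1 / \<theta>) * ennreal ((g s * indicator {c<..t} s - S s * indicator {c<..t} s)\<^sup>2) \<partial>lborel)"
    proof (rule nn_integral_mono)
      fix s
      have "ennreal ((g s * indicator {c<..t} s)\<^sup>2) \<le> ennreal ((1 + \<theta>) * (S s * indicator {c<..t} s)\<^sup>2 + (1 + 1 / \<theta>) * (g s * indicator {c<..t} s - S s * indicator {c<..t} s)\<^sup>2)"
        by (rule ennreal_leI[OF square_le_weighted[OF \<theta>]])
      also have "\<dots> = ennreal (1 + \<theta>) * ennreal ((S s * indicator {c<..t} s)\<^sup>2) +
       ennreal (1 + 1 / \<theta>) * ennreal ((g s * indicator {c<..t} s - S s * indicator {c<..t} s)\<^sup>2)"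
        using \<theta> by (subst ennreal_plus) (auto simp: ennreal_mult simp del: ennreal_plus)
      finally show "ennreal ((g s * indicator {c<..t} s)\<^sup>2) \<le> ennreal (1 + \<theta>) * ennreal ((S s * indicator {c<..t} s)\<^sup>2) +
       ennreal (1 + 1 / \<theta>) * ennreal ((g s * indicator {c<..t} s - S s * indicator {c<..t} s)\<^sup>2)" .
    qed
    also have "\<dots> = ennreal (1 + \<theta>) * (\<integral>\<^sup>+s. ennreal ((S s * indicator {c<..t} s)\<^sup>2) \<partial>lborel) +
       ennreal (1 + 1 / \<theta>) * (\<integral>\<^sup>+s. ennreal ((g s * indicator {c<..t} s - S s * indicator {c<..t} s)\<^sup>2) \<partial>lborel)"
      by (subst nn_integral_add) (simp_all add: nn_integral_cmult del: ennreal_plus)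
    also have "\<dots> \<le> ennreal (1 + \<theta>) * ennreal v + ennreal (1 + 1 / \<theta>) * ennreal \<delta>"
    proof (intro add_mono mult_left_mono)
      show "(\<integral>\<^sup>+s. ennreal ((S s * indicator {c<..t} s)\<^sup>2) \<partial>lborel) \<le> ennreal v"
        unfolding v(3) sZ using ct by (intro nn_integral_mono) (auto simp: indicator_def)
      show "(\<integral>\<^sup>+s. ennreal ((g s * indicator {c<..t} s - S s * indicator {c<..t} s)\<^sup>2) \<partial>lborel) \<le> ennreal \<delta>"
        by (rule mono) (use ct in \<open>auto simp: indicator_def\<close>)
    qed simp_all
    also have "\<dots> = ennreal ((1 + \<theta>) * v + (1 + 1 / \<theta>) * \<delta>)"
      using \<theta> v(1) \<delta> by (subst ennreal_plus) (auto simp: ennreal_mult simp del: ennreal_plus)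
    finally show ?thesis .
  qed
  then have B2: "B \<le> (1 + \<theta>) * v + (1 + 1 / \<theta>) * \<delta>" using \<theta> v(1) \<delta> by (subst (asm) ennreal_le_iff) auto
  \<comment> \<open>Besides the error in approximating X there remains the part of the step integral
    beyond t. Since g vanishes there, this part is an approximation error as well.\<close>
  have "(\<integral>\<^sup>+\<omega>. ennreal ((X \<omega> - step_integral n a ?\<tau>Y \<omega> - step_integral n a ?\<tau>Z \<omega>)\<^sup>2) \<partial>P) =
     (\<integral>\<^sup>+\<omega>. ennreal ((X \<omega> - (step_integral n a \<tau> \<omega> - step_integral n a ?\<tau>W \<omega>))\<^sup>2) \<partial>P)"
    using step_integral_split[OF part ct] by (intro nn_integral_cong) (simp add: algebra_simps)
  also have "\<dots> \<le> 2 * (\<integral>\<^sup>+\<omega>. ennreal ((X \<omega> - step_integral n a \<tau> \<omega>)\<^sup>2) \<partial>P) +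
     2 * (\<integral>\<^sup>+\<omega>. ennreal ((step_integral n a \<tau> \<omega> - (step_integral n a \<tau> \<omega> - step_integral n a ?\<tau>W \<omega>))\<^sup>2) \<partial>P)"
    by (rule nn_integral_square_diff_le) measurable
  also have "\<dots> \<le> 2 * ennreal \<delta> + 2 * ennreal \<delta>"
  proof (intro add_mono mult_left_mono XS)
    have "(\<integral>\<^sup>+\<omega>. ennreal ((step_integral n a \<tau> \<omega> - (step_integral n a \<tau> \<omega> - step_integral n a ?\<tau>W \<omega>))\<^sup>2) \<partial>P)
       = (\<integral>\<^sup>+s\<in>{0..}. ennreal ((step_fun n a ?\<tau>W s)\<^sup>2) \<partial>lborel)"
      using nn_integral_step_integral[OF pW] by simp
    also have "\<dots> = (\<integral>\<^sup>+s. ennreal ((S s * indicator {t<..} s)\<^sup>2) \<partial>lborel)"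
      unfolding sW using ct by (intro nn_integral_cong) (auto simp: indicator_def)
    also have "\<dots> \<le> ennreal \<delta>"
      by (rule mono) (use ct supp in \<open>auto simp: indicator_def\<close>)
    finally show "(\<integral>\<^sup>+\<omega>. ennreal ((step_integral n a \<tau> \<omega> - (step_integral n a \<tau> \<omega> - step_integral n a ?\<tau>W \<omega>))\<^sup>2) \<partial>P) \<le> ennreal \<delta>" .
  qed simp_all
  also have "\<dots> = ennreal (4 * \<delta>)" using \<delta> by (simp add: numeral_mult_ennreal ennreal_plus[symmetric] del: ennreal_plus)
  finally have R: "(\<integral>\<^sup>+\<omega>. ennreal ((X \<omega> - step_integral n a ?\<tau>Y \<omega> - step_integral n a ?\<tau>Z \<omega>)\<^sup>2) \<partial>P) \<le> ennreal (4 * \<delta>)" .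
  show ?thesis
    by (rule that[of n ?\<tau>Z a v "step_integral n a ?\<tau>Y" u, OF pZ _ v(2,1) B2 _ u(2) u2 R])
       (simp_all add: sZ)
qed

lemma L2_tail_bound:
  assumes [measurable]: "R \<in> borel_measurable P" and b: "(\<integral>\<^sup>+\<omega>. ennreal ((R \<omega>)\<^sup>2) \<partial>P) \<le> ennreal C" and x: "0 < x" "0 \<le> C"
  shows "prob {\<omega> \<in> space P. R \<omega> < - x} \<le> C / x\<^sup>2"
proof -
  have "ennreal (x\<^sup>2) * emeasure P {\<omega> \<in> space P. R \<omega> < - x} = (\<integral>\<^sup>+\<omega>. ennreal (x\<^sup>2) * indicator {\<omega> \<in> space P. R \<omega> < - x} \<omega> \<partial>P)"
    by (rule nn_integral_cmult_indicator[symmetric]) measurable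
  also have "\<dots> \<le> (\<integral>\<^sup>+\<omega>. ennreal ((R \<omega>)\<^sup>2) \<partial>P)"
  proof (rule nn_integral_mono)
    fix \<omega>
    have "x\<^sup>2 \<le> (R \<omega>)\<^sup>2" if "R \<omega> < - x" using that x power_mono[of x "- R \<omega>" 2] by simp
    then show "ennreal (x\<^sup>2) * indicator {\<omega> \<in> space P. R \<omega> < - x} \<omega> \<le> ennreal ((R \<omega>)\<^sup>2)"
      by (auto simp: indicator_def intro!: ennreal_leI)
  qed
  also note b
  finally have "ennreal (x\<^sup>2 * prob {\<omega> \<in> space P. R \<omega> < - x}) \<le> ennreal C"
    by (simp add: emeasure_eq_measure ennreal_mult)
  then have "x\<^sup>2 * prob {\<omega> \<in> space P. R \<omega> < - x} \<le> C" using x by (subst (asm) ennreal_le_iff) auto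
  then show ?thesis using x by (simp add: pos_le_divide_eq mult.commute)
qed

text \<open>The inequality 1 - p \<le> exp(-p) turns the product over independent events into a
  quantitative form of the second Borel-Cantelli lemma.\<close>

lemma prob_all_le_of_indep:
  fixes Z :: "nat \<Rightarrow> (real \<Rightarrow> real) \<Rightarrow> real"
  assumes ind: "indep_vars (\<lambda>_. borel) Z J" and J: "finite J" "J \<noteq> {}"
    and p: "\<And>m. m \<in> J \<Longrightarrow> p m \<le> prob {\<omega> \<in> space P. z m < Z m \<omega>}"
  shows "prob {\<omega> \<in> space P. \<forall>m\<in>J. Z m \<omega> \<le> z m} \<le> exp (- (\<Sum>m\<in>J. p m))"
proof -
  have Zm: "Z m \<in> borel_measurable P" if "m \<in> J" for m using ind that by (auto simp: indep_vars_def)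
  have "{\<omega> \<in> space P. \<forall>m\<in>J. Z m \<omega> \<le> z m} = (\<Inter>m\<in>J. Z m -` {..z m} \<inter> space P)" using J by auto
  also have "prob \<dots> = (\<Prod>m\<in>J. prob (Z m -` {..z m} \<inter> space P))"
    by (rule indep_varsD[OF ind J(2,1) order_refl]) simp
  also have "\<dots> \<le> (\<Prod>m\<in>J. exp (- p m))"
  proof (rule prod_mono)
    fix m assume m: "m \<in> J"
    have "Z m -` {..z m} \<inter> space P = space P - {\<omega> \<in> space P. z m < Z m \<omega>}" by auto
    moreover have "{\<omega> \<in> space P. z m < Z m \<omega>} \<in> events" using Zm[OF m] by measurable
    ultimately have "prob (Z m -` {..z m} \<inter> space P) = 1 - prob {\<omega> \<in> space P. z m < Z m \<omega>}"
      by (simp add: prob_compl)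
    also have "\<dots> \<le> 1 + (- p m)" using p[OF m] by simp
    also have "\<dots> \<le> exp (- p m)" by (rule exp_ge_add_one_self)
    finally show "0 \<le> prob (Z m -` {..z m} \<inter> space P) \<and> prob (Z m -` {..z m} \<inter> space P) \<le> exp (- p m)" by simp
  qed
  also have "\<dots> = exp (- (\<Sum>m\<in>J. p m))" using J by (simp add: exp_sum sum_negf[symmetric])
  finally show ?thesis .
qed

end

section \<open>The iterated logarithm along the times q^m\<close>

definition lil_scale :: "real \<Rightarrow> real \<Rightarrow> real" where
  "lil_scale H t = sqrt (2 * t powr (2 * H) * ln (ln (1 / t)))"

text \<open>Gaussian tails at this scale have order exp(-L) = 1 / (m ln(1/q)), the terms of a
  divergent series. The bounds on ln m and ln(1/q) keep L away from 0 and the scale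
  positive.\<close>

lemma lil_scale_geometric:
  fixes q :: real
  assumes q: "0 < q" "1 \<le> ln (1 / q)" and m: "2 \<le> ln (real m)"
  defines "L \<equiv> ln (real m * ln (1 / q))"
  shows "(lil_scale H (q ^ m))\<^sup>2 = 2 * (q ^ m) powr (2 * H) * L" "0 < lil_scale H (q ^ m)"
    "2 \<le> L" "exp (- L) = 1 / (real m * ln (1 / q))"
proof -
  have m0: "0 < m" using m by (cases m) auto
  have "ln (1 / q ^ m) = real m * ln (1 / q)" using q by (simp add: ln_div ln_realpow)
  then have eq: "ln (ln (1 / q ^ m)) = L" by (simp add: L_def)
  have L: "L = ln (real m) + ln (ln (1 / q))" unfolding L_def using m0 q by (subst ln_mult) auto
  show L2: "2 \<le> L" unfolding L using m q by (simp add: ln_ge_zero add_increasing2)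
  have pos: "0 < 2 * (q ^ m) powr (2 * H) * L" using q L2 by simp
  show "(lil_scale H (q ^ m))\<^sup>2 = 2 * (q ^ m) powr (2 * H) * L"
    unfolding lil_scale_def eq using pos by simp
  show "0 < lil_scale H (q ^ m)" unfolding lil_scale_def eq using pos by (simp only: real_sqrt_gt_0_iff)
  show "exp (- L) = 1 / (real m * ln (1 / q))"
  proof -
    have "0 < real m * ln (1 / q)" using m0 q(2) by (intro mult_pos_pos) linarith+
    then have "exp L = real m * ln (1 / q)" unfolding L_def by (rule exp_ln)
    then show ?thesis by (simp only: exp_minus inverse_eq_divide)
  qed
qed

context wiener
begin

text \<open>Of the three margins in 1 - 3\<epsilon>, one goes to the main part Z of
  \<open>wiener_integral_decomposition\<close>, one to the early part Y and one to the remainder.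
  The probability that Z is high is at least of order 1 / m, which is not summable, whereas the
  errors of the other two are summable.\<close>

lemma lil_step:
  fixes H \<epsilon> q :: real and m :: nat
  assumes H: "0 < H" "H \<le> 1/2" and \<epsilon>: "0 < \<epsilon>" "\<epsilon> < 1" and q: "0 < q" "q < 1" "1 \<le> ln (1 / q)"
    and \<kappa>: "\<And>t x. 0 < t \<Longrightarrow> 0 \<le> x \<Longrightarrow> x \<le> 1 \<Longrightarrow>
      (\<integral>\<^sup>+s\<in>{0..x * t}. ennreal ((fbm_integrand H t s)\<^sup>2) \<partial>lborel) = ennreal (t powr (2 * H) * \<kappa> x)" "\<kappa> 1 = 1"
    and \<kappa>q: "\<kappa> q \<le> \<epsilon>\<^sup>2 / 8" and X: "is_wiener_integral P (fbm_integrand H (q ^ m)) X"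
    and m: "2 \<le> ln (real m)"
  shows "\<exists>n a \<tau>. partition_upto n \<tau> \<and> (\<forall>s. s \<notin> {q ^ Suc m<..q ^ m} \<longrightarrow> step_fun n a \<tau> s = 0) \<and>
    1 / sqrt (2 * pi) * exp (- (1 + 1 / \<epsilon>) / 2) / (real m * ln (1 / q)) \<le>
      prob {\<omega> \<in> space P. (1 - \<epsilon>) * lil_scale H (q ^ m) < step_integral n a \<tau> \<omega>} \<and>
    prob {\<omega> \<in> space P. X \<omega> \<le> (1 - 3 * \<epsilon>) * lil_scale H (q ^ m) \<and> (1 - \<epsilon>) * lil_scale H (q ^ m) < step_integral n a \<tau> \<omega>}
      \<le> 1 / (real m)\<^sup>2 + (1/2) ^ m"
proof -
  define t where "t = q ^ m"
  define T where "T = t powr (2 * H)"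
  define \<phi> where "\<phi> = lil_scale H t"
  define L where "L = ln (real m * ln (1 / q))"
  have t: "0 < t" using q by (simp add: t_def)
  have T: "0 < T" using t by (simp add: T_def)
  have \<phi>: "\<phi>\<^sup>2 = 2 * T * L" "0 < \<phi>" "2 \<le> L" "exp (- L) = 1 / (real m * ln (1 / q))"
    using lil_scale_geometric[OF q(1,3) m] by (simp_all add: \<phi>_def t_def T_def L_def)
  have m0: "0 < m" using m by (cases m) auto
  let ?g = "fbm_integrand H t"
  note [measurable] = fbm_integrand_measurable[OF H, of t]
  \<comment> \<open>The sign of \<kappa> q is not known; \<open>ennreal\<close> sends negative
    values to 0, so the maximum with 0 describes the same integral.\<close>
  define K where "K = max (\<kappa> q) 0"
  have K: "0 \<le> K" "K \<le> \<epsilon>\<^sup>2 / 8" unfolding K_def using \<kappa>q by (simp, intro max.boundedI) simp_all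
  have A: "(\<integral>\<^sup>+s\<in>{0..q * t}. ennreal ((?g s)\<^sup>2) \<partial>lborel) = ennreal (T * K)"
    using \<kappa>(1)[OF t, of q] q T unfolding T_def[symmetric] K_def
    by (cases "0 \<le> \<kappa> q") (auto simp: max_def ennreal_neg mult_nonneg_nonpos)
  have full: "(\<integral>\<^sup>+s\<in>{0..t}. ennreal ((?g s)\<^sup>2) \<partial>lborel) = ennreal T"
    using \<kappa>(1)[OF t, of 1] by (simp add: T_def \<kappa>(2))
  have qt: "0 \<le> q * t" "q * t \<le> t" using q t by (auto simp: mult_le_cancel_right1)
  have sum: "ennreal T = ennreal (T * K) + (\<integral>\<^sup>+s\<in>{q * t<..t}. ennreal ((?g s)\<^sup>2) \<partial>lborel)"
  proof -
    have "ennreal T = (\<integral>\<^sup>+s. ennreal ((?g s)\<^sup>2) * indicator {0..q * t} s + ennreal ((?g s)\<^sup>2) * indicator {q * t<..t} s \<partial>lborel)"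
      unfolding full[symmetric] using qt by (intro nn_integral_cong) (auto simp: indicator_def)
    also have "\<dots> = ennreal (T * K) + (\<integral>\<^sup>+s\<in>{q * t<..t}. ennreal ((?g s)\<^sup>2) \<partial>lborel)"
      by (subst nn_integral_add) (simp_all add: A)
    finally show ?thesis .
  qed
  define b where "b = (\<integral>\<^sup>+s\<in>{q * t<..t}. ennreal ((?g s)\<^sup>2) \<partial>lborel)"
  have "b \<noteq> top" using sum by (metis b_def ennreal_neq_top ennreal_add_eq_top)
  then obtain B where B: "b = ennreal B" "0 \<le> B" by (cases b) auto
  have BT: "T = T * K + B"
  proof -
    have "ennreal T = ennreal (T * K + B)" using sum B T K by (simp add: b_def)
    then show ?thesis using B(2) T K by (subst (asm) ennreal_inj) auto
  qed
  \<comment> \<open>The factor \<epsilon>^2 / 16 limits the loss of variance, and 2^(-m) makes the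
    probability of a large remainder summable.\<close>
  define \<delta> where "\<delta> = T * (\<epsilon>\<^sup>2 / 16) * (1/2) ^ m"
  have \<delta>: "0 < \<delta>" using T \<epsilon> by (simp add: \<delta>_def)
  have \<delta>le: "\<delta> \<le> T * (\<epsilon>\<^sup>2 / 16)" unfolding \<delta>_def using T by (intro mult_left_le) (auto simp: power_le_one)
  have \<theta>: "0 < \<epsilon> / 4" using \<epsilon> by simp
  have TK: "0 \<le> T * K" using T K by simp
  have gt: "?g s = 0" if "t \<le> s" for s using that by simp
  obtain n a \<tau> Y u v where part: "partition_upto n \<tau>" and supp: "\<And>s. s \<notin> {q * t<..t} \<Longrightarrow> step_fun n a \<tau> s = 0"
    and Z: "gauss (step_integral n a \<tau>) v" "0 \<le> v" "B \<le> (1 + \<epsilon> / 4) * v + (1 + 1 / (\<epsilon> / 4)) * \<delta>"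
    and Y: "Y \<in> borel_measurable P" "gauss Y u" "u \<le> 2 * \<delta> + 2 * (T * K)"
    and R: "(\<integral>\<^sup>+\<omega>. ennreal ((X \<omega> - Y \<omega> - step_integral n a \<tau> \<omega>)\<^sup>2) \<partial>P) \<le> ennreal (4 * \<delta>)"
    by (rule wiener_integral_decomposition[OF X[folded t_def] fbm_integrand_measurable[OF H] gt qt A TK B(1)[unfolded b_def] B(2) \<delta> \<theta>])
       (assumption, (rule that; assumption))
  have Xm [measurable]: "X \<in> borel_measurable P" using X by (simp add: is_wiener_integral_def)
  note [measurable] = Y(1) step_integral_measurable[OF part]
  \<comment> \<open>The losses are \<epsilon> / 8 for the interval [0, q t], 5\<epsilon> / 16 for
    the approximation, and the factor 1 + \<epsilon> / 4; together they cost at most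
    \<epsilon>.\<close>
  have vT: "(1 - \<epsilon>) * T \<le> v"
  proof -
    have e2: "\<epsilon>\<^sup>2 \<le> \<epsilon>" using \<epsilon> by (simp add: power2_eq_square)
    have "(1 + 1 / (\<epsilon> / 4)) * \<delta> \<le> (1 + 1 / (\<epsilon> / 4)) * (T * (\<epsilon>\<^sup>2 / 16))"
      using \<epsilon> by (intro mult_left_mono \<delta>le) auto
    also have "\<dots> = T * (\<epsilon>\<^sup>2 / 16 + \<epsilon> / 4)" using \<epsilon> by (simp add: field_simps power2_eq_square)
    also have "\<dots> \<le> T * (5 * \<epsilon> / 16)" using T e2 by (intro mult_left_mono) auto
    finally have 1: "(1 + 1 / (\<epsilon> / 4)) * \<delta> \<le> T * (5 * \<epsilon> / 16)" .
    have "T * K \<le> T * (\<epsilon> / 8)" using T K e2 by (intro mult_left_mono) auto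
    moreover have "T * (1 - 7 * \<epsilon> / 16) = T - T * (5 * \<epsilon> / 16) - T * (\<epsilon> / 8)"
      by (simp add: algebra_simps)
    ultimately have "T * (1 - 7 * \<epsilon> / 16) \<le> (1 + \<epsilon> / 4) * v" using BT Z(3) 1 by linarith
    moreover have "(1 + \<epsilon> / 4) * ((1 - \<epsilon>) * T) \<le> T * (1 - 7 * \<epsilon> / 16)"
    proof -
      have "(1 + \<epsilon> / 4) * (1 - \<epsilon>) \<le> 1 - 7 * \<epsilon> / 16" using \<epsilon> by (simp add: algebra_simps)
      from mult_right_mono[OF this, of T] T show ?thesis by (simp add: mult_ac)
    qed
    ultimately have "(1 + \<epsilon> / 4) * ((1 - \<epsilon>) * T) \<le> (1 + \<epsilon> / 4) * v" by linarith
    then show ?thesis using \<epsilon> by (simp add: mult_le_cancel_left_pos)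
  qed
  have v0: "0 < v" using vT T \<epsilon> by (smt (verit) mult_pos_pos)
  have low: "1 / sqrt (2 * pi) * exp (- (1 + 1 / \<epsilon>) / 2) / (real m * ln (1 / q)) \<le>
      prob {\<omega> \<in> space P. (1 - \<epsilon>) * \<phi> < step_integral n a \<tau> \<omega>}"
  proof -
    define x where "x = (1 - \<epsilon>) * \<phi> / sqrt v"
    have x2: "x\<^sup>2 \<le> (1 - \<epsilon>) * (2 * L)"
    proof -
      have "x\<^sup>2 = (1 - \<epsilon>)\<^sup>2 * \<phi>\<^sup>2 / v" using v0 by (simp add: x_def power_divide power_mult_distrib)
      also have "\<dots> \<le> (1 - \<epsilon>)\<^sup>2 * \<phi>\<^sup>2 / ((1 - \<epsilon>) * T)"
        using vT \<epsilon> T v0 by (intro divide_left_mono) auto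
      also have "\<dots> = (1 - \<epsilon>) * (2 * L)" unfolding \<phi>(1) using \<epsilon> T by (simp add: power2_eq_square)
      finally show ?thesis .
    qed
    \<comment> \<open>The shift by 1 in \<open>gauss_tail_lower\<close> is absorbed into a factor 1
      + \<epsilon>. Then (1 + \<epsilon>)(1 - \<epsilon>) \<le> 1 brings the exponent back to -L, up
      to the constant (1 + 1 / \<epsilon>) / 2.\<close>
    have "2 * x \<le> \<epsilon> * x\<^sup>2 + 1 / \<epsilon>"
    proof -
      have "0 \<le> \<epsilon> * (x - 1 / \<epsilon>)\<^sup>2" using \<epsilon> by simp
      also have "\<dots> = \<epsilon> * x\<^sup>2 + 1 / \<epsilon> - 2 * x" using \<epsilon> by (simp add: power2_eq_square field_simps)
      finally show ?thesis by simp
    qed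
    then have "(x + 1)\<^sup>2 \<le> (1 + \<epsilon>) * x\<^sup>2 + 1 + 1 / \<epsilon>" by (simp add: power2_eq_square algebra_simps)
    also have "(1 + \<epsilon>) * x\<^sup>2 \<le> (1 + \<epsilon>) * ((1 - \<epsilon>) * (2 * L))" using x2 \<epsilon> by (intro mult_left_mono) auto
    also have "\<dots> = 2 * L - \<epsilon>\<^sup>2 * (2 * L)" by (simp add: power2_eq_square algebra_simps)
    also have "\<dots> \<le> 2 * L" using \<phi>(3) by simp
    finally have "(x + 1)\<^sup>2 \<le> 2 * L + 1 + 1 / \<epsilon>" by simp
    then have "- (1 + 1 / \<epsilon>) / 2 + - L \<le> - (x + 1)\<^sup>2 / 2" by (simp add: field_simps)
    then have "exp (- (1 + 1 / \<epsilon>) / 2 + - L) \<le> exp (- (x + 1)\<^sup>2 / 2)" by (simp only: exp_le_cancel_iff)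
    then have "1 / sqrt (2 * pi) * exp (- (1 + 1 / \<epsilon>) / 2 + - L) \<le> 1 / sqrt (2 * pi) * exp (- (x + 1)\<^sup>2 / 2)"
      by (intro mult_left_mono) auto
    also have "\<dots> \<le> prob {\<omega> \<in> space P. (1 - \<epsilon>) * \<phi> < step_integral n a \<tau> \<omega>}"
      using gauss_tail_lower[OF Z(1) v0, of "(1 - \<epsilon>) * \<phi>"] \<epsilon> \<phi> by (simp add: x_def)
    finally show ?thesis unfolding exp_add \<phi>(4) by simp
  qed
  \<comment> \<open>The smallness of \<kappa> q and \<delta> bounds the variance of Y by T
    \<epsilon>^2 / 2, so that the exponent is -2L and the probability is at most 1 / m^2.\<close>
  have Yb: "prob {\<omega> \<in> space P. Y \<omega> < - (\<epsilon> * \<phi>)} \<le> 1 / (real m)\<^sup>2"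
  proof -
    have "u \<le> T * (\<epsilon>\<^sup>2 / 2)"
    proof -
      have "T * K \<le> T * (\<epsilon>\<^sup>2 / 8)" using T K by (intro mult_left_mono) auto
      moreover have "0 \<le> T * \<epsilon>\<^sup>2" using T by simp
      ultimately show ?thesis using Y(3) \<delta>le by simp
    qed
    then have "prob {\<omega> \<in> space P. Y \<omega> < - (\<epsilon> * \<phi>)} \<le> exp (- (\<epsilon> * \<phi>)\<^sup>2 / (2 * (T * (\<epsilon>\<^sup>2 / 2))))"
      using T \<epsilon> \<phi> by (intro gauss_tail_upper[OF Y(2)]) auto
    also have "- (\<epsilon> * \<phi>)\<^sup>2 / (2 * (T * (\<epsilon>\<^sup>2 / 2))) = - L + - L"
      unfolding power_mult_distrib \<phi>(1) using T \<epsilon> by (simp add: field_simps)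
    also have "exp (- L + - L) = (1 / (real m * ln (1 / q)))\<^sup>2"
      unfolding exp_add \<phi>(4) by (simp add: power2_eq_square)
    also have "\<dots> \<le> (1 / real m)\<^sup>2"
    proof (intro power_mono)
      show "1 / (real m * ln (1 / q)) \<le> 1 / real m"
        using m0 q(3) by (intro divide_left_mono) auto
      show "0 \<le> 1 / (real m * ln (1 / q))" using q(3) by simp
    qed
    finally show ?thesis by (simp add: power_divide)
  qed
  have Rb: "prob {\<omega> \<in> space P. X \<omega> - Y \<omega> - step_integral n a \<tau> \<omega> < - (\<epsilon> * \<phi>)} \<le> (1/2) ^ m"
  proof -
    have "prob {\<omega> \<in> space P. X \<omega> - Y \<omega> - step_integral n a \<tau> \<omega> < - (\<epsilon> * \<phi>)} \<le> 4 * \<delta> / (\<epsilon> * \<phi>)\<^sup>2"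
      using R \<epsilon> \<phi> \<delta> by (intro L2_tail_bound) auto
    also have "\<dots> = (1/2) ^ m / (8 * L)"
      unfolding power_mult_distrib \<phi>(1) \<delta>_def using T \<epsilon> \<phi>(3) by (simp add: field_simps)
    also have "\<dots> \<le> (1/2) ^ m / 1" using \<phi>(3) by (intro divide_left_mono) auto
    finally show ?thesis by simp
  qed
  have "prob {\<omega> \<in> space P. X \<omega> \<le> (1 - 3 * \<epsilon>) * \<phi> \<and> (1 - \<epsilon>) * \<phi> < step_integral n a \<tau> \<omega>} \<le>
    prob ({\<omega> \<in> space P. Y \<omega> < - (\<epsilon> * \<phi>)} \<union> {\<omega> \<in> space P. X \<omega> - Y \<omega> - step_integral n a \<tau> \<omega> < - (\<epsilon> * \<phi>)})"
  proof (rule finite_measure_mono)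
    show "{\<omega> \<in> space P. X \<omega> \<le> (1 - 3 * \<epsilon>) * \<phi> \<and> (1 - \<epsilon>) * \<phi> < step_integral n a \<tau> \<omega>} \<subseteq>
       {\<omega> \<in> space P. Y \<omega> < - (\<epsilon> * \<phi>)} \<union> {\<omega> \<in> space P. X \<omega> - Y \<omega> - step_integral n a \<tau> \<omega> < - (\<epsilon> * \<phi>)}"
      by (auto simp: algebra_simps)
  qed measurable
  also have "\<dots> \<le> prob {\<omega> \<in> space P. Y \<omega> < - (\<epsilon> * \<phi>)} + prob {\<omega> \<in> space P. X \<omega> - Y \<omega> - step_integral n a \<tau> \<omega> < - (\<epsilon> * \<phi>)}"
    by (rule measure_Un_le) measurable
  also have "\<dots> \<le> 1 / (real m)\<^sup>2 + (1/2) ^ m" using Yb Rb by simp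
  finally have up: "prob {\<omega> \<in> space P. X \<omega> \<le> (1 - 3 * \<epsilon>) * \<phi> \<and> (1 - \<epsilon>) * \<phi> < step_integral n a \<tau> \<omega>} \<le> 1 / (real m)\<^sup>2 + (1/2) ^ m" .
  have "q ^ Suc m = q * t" by (simp add: t_def)
  then show ?thesis
    using part supp low up unfolding \<phi>_def t_def by (intro exI[of _ n] exI[of _ a] exI[of _ \<tau>]) simp
qed

text \<open>If X is low at all times, then either every main part Z is low, which independence and
  the divergence of the harmonic series make unlikely, or some Z is high while X is low, which the
  summable errors of \<open>lil_step\<close> control. The ratio q is chosen from H and \<epsilon>
  alone, before X, n and \<eta>.\<close>

lemma lil_lower_bound:
  assumes H: "0 < H" "H \<le> 1/2" and \<epsilon>: "0 < \<epsilon>" "\<epsilon> < 1"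
  obtains q :: real where "0 < q" "q < 1" "1 \<le> ln (1 / q)"
    "\<And>X n \<eta>. (\<And>m. is_wiener_integral P (fbm_integrand H (q ^ m)) (X m)) \<Longrightarrow> 0 < \<eta> \<Longrightarrow>
      \<exists>M. prob {\<omega> \<in> space P. \<forall>m\<in>{n..<M}. X m \<omega> \<le> (1 - 3 * \<epsilon>) * lil_scale H (q ^ m)} < \<eta>"
proof -
  obtain \<kappa> where \<kappa>: "continuous_on {0..1} \<kappa>" "\<kappa> 0 = 0" "\<kappa> 1 = 1"
    "\<And>t x. 0 < t \<Longrightarrow> 0 \<le> x \<Longrightarrow> x \<le> 1 \<Longrightarrow>
      (\<integral>\<^sup>+s\<in>{0..x * t}. ennreal ((fbm_integrand H t s)\<^sup>2) \<partial>lborel) = ennreal (t powr (2 * H) * \<kappa> x)"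
    using fbm_integrand_norm[OF H] by blast
  have "0 < \<epsilon>\<^sup>2 / 8" using \<epsilon> by simp
  then obtain d where d: "0 < d" "\<And>x. x \<in> {0..1} \<Longrightarrow> dist x 0 < d \<Longrightarrow> dist (\<kappa> x) (\<kappa> 0) < \<epsilon>\<^sup>2 / 8"
    using \<kappa>(1) unfolding continuous_on_iff by (metis atLeastAtMost_iff order_refl zero_le_one)
  \<comment> \<open>d / 2 lies in the neighbourhood of 0 where \<kappa> is below \<epsilon>^2 / 8,
    and exp(-1) ensures 1 \<le> ln(1/q).\<close>
  define q where "q = min (d / 2) (exp (- 1))"
  have e1: "exp (- 1) < (1::real)" by simp
  have q: "0 < q" "q \<le> exp (- 1)" "q < d" using d by (auto simp: q_def min_def)
  have q1: "q < 1" using q(2) e1 by linarith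
  have ql: "1 \<le> ln (1 / q)"
  proof -
    have "ln q \<le> ln (exp (- 1))" using q by (subst ln_le_cancel_iff) auto
    then show ?thesis using q by (simp add: ln_div)
  qed
  have "dist (\<kappa> q) (\<kappa> 0) < \<epsilon>\<^sup>2 / 8" using d(2)[of q] q q1 by (simp add: dist_real_def)
  then have \<kappa>q: "\<kappa> q \<le> \<epsilon>\<^sup>2 / 8" using \<kappa>(2) by (simp add: dist_real_def)
  show ?thesis
  proof (rule that[OF q(1) q1 ql])
    fix X n and \<eta> :: real assume X: "\<And>m. is_wiener_integral P (fbm_integrand H (q ^ m)) (X m)" and \<eta>: "0 < \<eta>"
    have Xm [measurable]: "X m \<in> borel_measurable P" for m using X[of m] by (simp add: is_wiener_integral_def)
    define \<phi> where "\<phi> m = lil_scale H (q ^ m)" for m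
    define k where "k = 1 / sqrt (2 * pi) * exp (- (1 + 1 / \<epsilon>) / 2) / ln (1 / q)"
    have k: "0 < k" using ql by (simp add: k_def)
    define f where "f m = 1 / (real m)\<^sup>2 + (1/2) ^ m" for m :: nat
    have "summable f"
      unfolding f_def using inverse_power_summable[of 2, where 'a=real]
      by (intro summable_add summable_geometric) (simp_all add: inverse_eq_divide)
    then obtain N1 where N1: "\<And>m M. m \<ge> N1 \<Longrightarrow> norm (sum f {m..<M}) < \<eta> / 2"
      using \<eta> unfolding summable_Cauchy by (meson half_gt_zero)
    obtain N2 :: nat where N2: "exp 2 \<le> real N2" using real_arch_simple by blast
    \<comment> \<open>From N1 on the errors sum to less than \<eta> / 2, and from N2 on
      \<open>lil_step\<close> applies. The bound N \<ge> 1 lets {1..N - 1} and J partition {1..M -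
      1}.\<close>
    define N where "N = max n (max N1 (max N2 1))"
    have lnm: "2 \<le> ln (real m)" if "N \<le> m" for m
    proof -
      have "exp 2 \<le> real m" using N2 that by (simp add: N_def)
      then have "ln (exp 2) \<le> ln (real m)" by (intro ln_mono) auto
      then show ?thesis by simp
    qed
    define good where "good m p \<longleftrightarrow> partition_upto (fst p) (snd (snd p)) \<and>
       (\<forall>s. s \<notin> {q ^ Suc m<..q ^ m} \<longrightarrow> step_fun (fst p) (fst (snd p)) (snd (snd p)) s = 0) \<and>
       k / real m \<le> prob {\<omega> \<in> space P. (1 - \<epsilon>) * \<phi> m < step_integral (fst p) (fst (snd p)) (snd (snd p)) \<omega>} \<and>
       prob {\<omega> \<in> space P. X m \<omega> \<le> (1 - 3 * \<epsilon>) * \<phi> m \<and> (1 - \<epsilon>) * \<phi> m < step_integral (fst p) (fst (snd p)) (snd (snd p)) \<omega>} \<le> f m" for m p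
    have "\<exists>p. good m p" if Nm: "N \<le> m" for m
    proof -
      have "\<exists>n' a \<tau>. partition_upto n' \<tau> \<and> (\<forall>s. s \<notin> {q ^ Suc m<..q ^ m} \<longrightarrow> step_fun n' a \<tau> s = 0) \<and>
        1 / sqrt (2 * pi) * exp (- (1 + 1 / \<epsilon>) / 2) / (real m * ln (1 / q)) \<le>
          prob {\<omega> \<in> space P. (1 - \<epsilon>) * lil_scale H (q ^ m) < step_integral n' a \<tau> \<omega>} \<and>
        prob {\<omega> \<in> space P. X m \<omega> \<le> (1 - 3 * \<epsilon>) * lil_scale H (q ^ m) \<and> (1 - \<epsilon>) * lil_scale H (q ^ m) < step_integral n' a \<tau> \<omega>}
          \<le> 1 / (real m)\<^sup>2 + (1/2) ^ m"
        by (rule lil_step[OF H \<epsilon> q(1) q1 ql _ \<kappa>(3) \<kappa>q X[of m] lnm[OF Nm]]) (rule \<kappa>(4))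
      then obtain n' a \<tau> where s: "partition_upto n' \<tau> \<and> (\<forall>s. s \<notin> {q ^ Suc m<..q ^ m} \<longrightarrow> step_fun n' a \<tau> s = 0) \<and>
        1 / sqrt (2 * pi) * exp (- (1 + 1 / \<epsilon>) / 2) / (real m * ln (1 / q)) \<le>
          prob {\<omega> \<in> space P. (1 - \<epsilon>) * lil_scale H (q ^ m) < step_integral n' a \<tau> \<omega>} \<and>
        prob {\<omega> \<in> space P. X m \<omega> \<le> (1 - 3 * \<epsilon>) * lil_scale H (q ^ m) \<and> (1 - \<epsilon>) * lil_scale H (q ^ m) < step_integral n' a \<tau> \<omega>}
          \<le> 1 / (real m)\<^sup>2 + (1/2) ^ m"
        by (elim exE)
      have kk: "k / real m = 1 / sqrt (2 * pi) * exp (- (1 + 1 / \<epsilon>) / 2) / (real m * ln (1 / q))"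
        by (simp add: k_def field_simps)
      have "good m (n', a, \<tau>)" unfolding good_def kk \<phi>_def f_def fst_conv snd_conv by (rule s)
      then show ?thesis ..
    qed
    then have "\<forall>m. \<exists>p. N \<le> m \<longrightarrow> good m p" by blast
    from choice[OF this] obtain p where p: "\<forall>m. N \<le> m \<longrightarrow> good m (p m)" ..
    define Z where "Z m = step_integral (fst (p m)) (fst (snd (p m))) (snd (snd (p m)))" for m
    have Zpart: "partition_upto (fst (p m)) (snd (snd (p m)))"
      and Zsupp: "\<And>s. s \<notin> {q ^ Suc m<..q ^ m} \<Longrightarrow> step_fun (fst (p m)) (fst (snd (p m))) (snd (snd (p m))) s = 0"
      and Zlow: "k / real m \<le> prob {\<omega> \<in> space P. (1 - \<epsilon>) * \<phi> m < Z m \<omega>}"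
      and Zup: "prob {\<omega> \<in> space P. X m \<omega> \<le> (1 - 3 * \<epsilon>) * \<phi> m \<and> (1 - \<epsilon>) * \<phi> m < Z m \<omega>} \<le> f m" if "N \<le> m" for m
      using p that unfolding good_def Z_def by auto
    have Zm: "Z m \<in> borel_measurable P" if "N \<le> m" for m unfolding Z_def by (rule step_integral_measurable[OF Zpart[OF that]])
    \<comment> \<open>Divergence of the harmonic series: k times its part over {N..<M} is to exceed
      -ln(\<eta> / 2), and the 1 makes the inequality strict.\<close>
    have "eventually (\<lambda>M. (1 - ln (\<eta> / 2)) / k + harm N < (harm M :: real)) sequentially"
      using harm_at_top unfolding filterlim_at_top_dense by blast
    then obtain M0 where M0: "\<And>M. M \<ge> M0 \<Longrightarrow> (1 - ln (\<eta> / 2)) / k + harm N < (harm M :: real)"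
      unfolding eventually_sequentially by blast
    define M where "M = max (M0 + 1) (N + 1)"
    define J where "J = {N..<M}"
    have J: "finite J" "J \<noteq> {}" "\<And>m. m \<in> J \<Longrightarrow> N \<le> m" by (auto simp: J_def M_def)
    have dj: "disjoint_family_on (\<lambda>m. {q ^ Suc m<..q ^ m}) J"
    proof -
      have "{q ^ Suc i<..q ^ i} \<inter> {q ^ Suc j<..q ^ j} = {}" if "i < j" for i j
        using power_decreasing[of "Suc i" j q] that q(1) q1 by auto
      then show ?thesis unfolding disjoint_family_on_def by (metis Int_commute nat_neq_iff)
    qed
    have ind: "indep_vars (\<lambda>_. borel) Z J"
      unfolding Z_def[abs_def] by (rule step_integrals_indep[OF J(1) Zpart Zsupp dj]) (use J(3) in auto)
    have p1: "prob {\<omega> \<in> space P. \<forall>m\<in>J. Z m \<omega> \<le> (1 - \<epsilon>) * \<phi> m} < \<eta> / 2"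
    proof -
      have "prob {\<omega> \<in> space P. \<forall>m\<in>J. Z m \<omega> \<le> (1 - \<epsilon>) * \<phi> m} \<le> exp (- (\<Sum>m\<in>J. k / real m))"
        by (rule prob_all_le_of_indep[OF ind J(1,2)]) (rule Zlow[OF J(3)])
      also have "(\<Sum>m\<in>J. k / real m) = k * (harm (M - 1) - harm (N - 1))"
      proof -
        have h: "(harm (M - 1) :: real) = harm (N - 1) + (\<Sum>m\<in>J. inverse (real m))"
        proof -
          have "{1..M - 1} = {1..N - 1} \<union> J" "{1..N - 1} \<inter> J = {}" by (auto simp: J_def N_def M_def)
          then show ?thesis unfolding harm_def using J(1) by (simp add: sum.union_disjoint)
        qed
        then show ?thesis by (simp add: sum_distrib_left divide_inverse)
      qed
      also have "exp (- (k * (harm (M - 1) - harm (N - 1)))) < exp (ln (\<eta> / 2))"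
      proof -
        have "(1 - ln (\<eta> / 2)) / k + harm N < (harm (M - 1) :: real)" by (rule M0) (simp add: M_def)
        moreover have "harm (N - 1) \<le> (harm N :: real)" by (rule harm_mono) simp
        ultimately have "(1 - ln (\<eta> / 2)) / k < harm (M - 1) - harm (N - 1)" by linarith
        then have "1 - ln (\<eta> / 2) < k * (harm (M - 1) - harm (N - 1))" using k by (simp add: pos_divide_less_eq mult.commute)
        then show ?thesis by simp
      qed
      finally show ?thesis using \<eta> by simp
    qed
    have "prob {\<omega> \<in> space P. \<forall>m\<in>{n..<M}. X m \<omega> \<le> (1 - 3 * \<epsilon>) * \<phi> m} \<le>
      prob ({\<omega> \<in> space P. \<forall>m\<in>J. Z m \<omega> \<le> (1 - \<epsilon>) * \<phi> m} \<union>
        (\<Union>m\<in>J. {\<omega> \<in> space P. X m \<omega> \<le> (1 - 3 * \<epsilon>) * \<phi> m \<and> (1 - \<epsilon>) * \<phi> m < Z m \<omega>}))"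
    proof (rule finite_measure_mono)
      have Jn: "J \<subseteq> {n..<M}" by (auto simp: J_def N_def)
      show "{\<omega> \<in> space P. \<forall>m\<in>{n..<M}. X m \<omega> \<le> (1 - 3 * \<epsilon>) * \<phi> m} \<subseteq> {\<omega> \<in> space P. \<forall>m\<in>J. Z m \<omega> \<le> (1 - \<epsilon>) * \<phi> m} \<union>
        (\<Union>m\<in>J. {\<omega> \<in> space P. X m \<omega> \<le> (1 - 3 * \<epsilon>) * \<phi> m \<and> (1 - \<epsilon>) * \<phi> m < Z m \<omega>})"
      proof
        fix \<omega> assume w: "\<omega> \<in> {\<omega> \<in> space P. \<forall>m\<in>{n..<M}. X m \<omega> \<le> (1 - 3 * \<epsilon>) * \<phi> m}"
        show "\<omega> \<in> {\<omega> \<in> space P. \<forall>m\<in>J. Z m \<omega> \<le> (1 - \<epsilon>) * \<phi> m} \<union>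
          (\<Union>m\<in>J. {\<omega> \<in> space P. X m \<omega> \<le> (1 - 3 * \<epsilon>) * \<phi> m \<and> (1 - \<epsilon>) * \<phi> m < Z m \<omega>})"
        proof (cases "\<forall>m\<in>J. Z m \<omega> \<le> (1 - \<epsilon>) * \<phi> m")
          case False
          then obtain m where "m \<in> J" "(1 - \<epsilon>) * \<phi> m < Z m \<omega>" by (auto simp: not_le)
          then show ?thesis using w Jn by blast
        qed (use w in simp)
      qed
      have 1: "{\<omega> \<in> space P. \<forall>m\<in>J. Z m \<omega> \<le> (1 - \<epsilon>) * \<phi> m} \<in> events"
      proof (rule sets.sets_Collect_finite_All[OF _ J(1)])
        fix m assume "m \<in> J"
        note [measurable] = Zm[OF J(3)[OF this]]
        show "{\<omega> \<in> space P. Z m \<omega> \<le> (1 - \<epsilon>) * \<phi> m} \<in> events" by measurable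
      qed
      have 2: "{\<omega> \<in> space P. X m \<omega> \<le> (1 - 3 * \<epsilon>) * \<phi> m \<and> (1 - \<epsilon>) * \<phi> m < Z m \<omega>} \<in> events" if "m \<in> J" for m
      proof -
        note [measurable] = Zm[OF J(3)[OF that]]
        show ?thesis by measurable
      qed
      show "{\<omega> \<in> space P. \<forall>m\<in>J. Z m \<omega> \<le> (1 - \<epsilon>) * \<phi> m} \<union>
        (\<Union>m\<in>J. {\<omega> \<in> space P. X m \<omega> \<le> (1 - 3 * \<epsilon>) * \<phi> m \<and> (1 - \<epsilon>) * \<phi> m < Z m \<omega>}) \<in> events"
        by (intro sets.Un 1 sets.finite_UN J(1) 2)
    qed
    also have "\<dots> \<le> prob {\<omega> \<in> space P. \<forall>m\<in>J. Z m \<omega> \<le> (1 - \<epsilon>) * \<phi> m} +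
        prob (\<Union>m\<in>J. {\<omega> \<in> space P. X m \<omega> \<le> (1 - 3 * \<epsilon>) * \<phi> m \<and> (1 - \<epsilon>) * \<phi> m < Z m \<omega>})"
      by (rule measure_Un_le) (use J Zm in \<open>auto intro!: sets.finite_UN sets.sets_Collect_finite_All sets.sets_Collect_conj
          borel_measurable_le borel_measurable_less\<close>)
    also have "prob (\<Union>m\<in>J. {\<omega> \<in> space P. X m \<omega> \<le> (1 - 3 * \<epsilon>) * \<phi> m \<and> (1 - \<epsilon>) * \<phi> m < Z m \<omega>})
      \<le> (\<Sum>m\<in>J. prob {\<omega> \<in> space P. X m \<omega> \<le> (1 - 3 * \<epsilon>) * \<phi> m \<and> (1 - \<epsilon>) * \<phi> m < Z m \<omega>})"
      by (rule measure_UNION_le[OF J(1)]) (use J Zm in \<open>auto intro!: sets.sets_Collect_conj borel_measurable_le borel_measurable_less\<close>)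
    also have "\<dots> \<le> (\<Sum>m\<in>J. f m)" by (intro sum_mono Zup J(3))
    also have "\<dots> \<le> norm (sum f {N..<M})" unfolding J_def by simp
    also have "\<dots> < \<eta> / 2" by (rule N1) (simp add: N_def)
    finally have "prob {\<omega> \<in> space P. \<forall>m\<in>{n..<M}. X m \<omega> \<le> (1 - 3 * \<epsilon>) * \<phi> m} < \<eta>" using p1 by simp
    then show "\<exists>M. prob {\<omega> \<in> space P. \<forall>m\<in>{n..<M}. X m \<omega> \<le> (1 - 3 * \<epsilon>) * lil_scale H (q ^ m)} < \<eta>"
      unfolding \<phi>_def by blast
  qed
qed

end

section \<open>A smooth maximum\<close>

locale softmax =
  fixes N :: nat and \<beta> \<gamma> a :: real and c :: "nat \<Rightarrow> real"
  assumes N: "0 < N" and \<beta>: "0 < \<beta>"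
begin

definition expsum :: "(nat \<Rightarrow> real) \<Rightarrow> real" where
  "expsum x = (\<Sum>i<N. exp (\<beta> * c i * x i))"

text \<open>The derivative of ln(expsum x) / \<beta> in direction k is
  \<open>c k * weight k x\<close>; the weights are those of the convex combination that forms the
  gradient of the smooth maximum.\<close>

definition weight :: "nat \<Rightarrow> (nat \<Rightarrow> real) \<Rightarrow> real" where
  "weight k x = exp (\<beta> * c k * x k) / expsum x"

text \<open>A smooth version of the indicator of \<open>max\<^sub>i c\<^sub>i x\<^sub>i \<le> a\<close>: for large \<open>\<beta>\<close> the number \<open>ln (expsum x) / \<beta>\<close>
  is close to the maximum, and the logistic function of slope \<open>\<gamma>\<close> is applied to it.\<close>

definition soft_ind :: "(nat \<Rightarrow> real) \<Rightarrow> real" where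
  "soft_ind x = 1 / (1 + exp (- (\<gamma> * a)) * expsum x powr (\<gamma> / \<beta>))"

lemma expsum_pos: "0 < expsum x"
  unfolding expsum_def using N by (intro sum_pos) auto

lemma soft_ind_bounds: "0 < soft_ind x" "soft_ind x < 1"
  unfolding soft_ind_def using expsum_pos[of x] by (auto intro!: divide_pos_pos add_pos_pos simp: divide_less_eq_1)

lemma weight_nonneg: "0 \<le> weight k x"
  unfolding weight_def using expsum_pos[of x] by (intro divide_nonneg_pos) auto

lemma weight_sum: "(\<Sum>k<N. weight k x) = 1"
  unfolding weight_def using expsum_pos[of x] by (simp add: sum_divide_distrib[symmetric] expsum_def[symmetric])

lemma weight_le_1: "k < N \<Longrightarrow> weight k x \<le> 1"
  using member_le_sum[of k "{..<N}" "\<lambda>k. weight k x"] weight_nonneg weight_sum by simp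

lemma expsum_deriv:
  assumes "i < N"
  shows "((\<lambda>s. expsum (x(i := s))) has_real_derivative \<beta> * c i * exp (\<beta> * c i * x i)) (at (x i))"
proof -
  have "((\<lambda>s. \<Sum>j<N. exp (\<beta> * c j * (x(i := s)) j)) has_real_derivative
     (\<Sum>j<N. if j = i then \<beta> * c i * exp (\<beta> * c i * x i) else 0)) (at (x i))"
  proof (rule DERIV_sum)
    fix j
    show "((\<lambda>s. exp (\<beta> * c j * (x(i := s)) j)) has_real_derivative
       (if j = i then \<beta> * c i * exp (\<beta> * c i * x i) else 0)) (at (x i))"
      by (cases "j = i") (auto intro!: derivative_eq_intros)
  qed
  then show ?thesis using assms unfolding expsum_def[abs_def] by simp
qed

lemma weight_deriv:
  assumes "i < N"
  shows "((\<lambda>s. weight k (x(i := s))) has_real_derivative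
    (if k = i then \<beta> * c i else 0) * weight k x + (- (\<beta> * c i)) * (weight i x * weight k x)) (at (x i))"
proof -
  have 1: "((\<lambda>s. exp (\<beta> * c k * (x(i := s)) k)) has_real_derivative
       (if k = i then \<beta> * c i else 0) * exp (\<beta> * c k * x k)) (at (x i))"
    by (cases "k = i") (auto intro!: derivative_eq_intros)
  have nz: "expsum (x(i := x i)) \<noteq> 0" using expsum_pos[of x] by simp
  have "((\<lambda>s. weight k (x(i := s))) has_real_derivative
    ((if k = i then \<beta> * c i else 0) * exp (\<beta> * c k * x k) * expsum (x(i := x i)) - exp (\<beta> * c k * (x(i := x i)) k) * (\<beta> * c i * exp (\<beta> * c i * x i)))
     / (expsum (x(i := x i)) * expsum (x(i := x i)))) (at (x i))"
    unfolding weight_def[abs_def] by (rule DERIV_divide[OF 1 expsum_deriv[OF assms] nz])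
  then show ?thesis
    by (rule DERIV_cong) (use expsum_pos[of x] in \<open>simp add: weight_def field_simps\<close>)
qed

text \<open>The logistic function satisfies s' = s (1 - s), and the chain rule supplies the softmax
  weight. The difference is spelled as a sum so that the expression is built from the operations of
  \<open>soft_algebra\<close>.\<close>

lemma soft_ind_deriv:
  assumes "i < N"
  shows "((\<lambda>s. soft_ind (x(i := s))) has_real_derivative
    (- (\<gamma> * c i)) * (weight i x * (soft_ind x * (1 + (- 1) * soft_ind x)))) (at (x i))"
proof -
  let ?r = "\<gamma> / \<beta>" and ?S = "expsum x" and ?E = "exp (- (\<gamma> * a))"
  have S: "0 < ?S" by (rule expsum_pos)
  define p where "p = ?S powr ?r"
  have p: "0 < p" using S by (simp add: p_def)
  have den: "0 < 1 + ?E * p" using p by (intro add_pos_pos) auto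
  have "((\<lambda>s. expsum (x(i := s)) powr ?r) has_real_derivative ?r * expsum (x(i := x i)) powr (?r - 1) * (\<beta> * c i * exp (\<beta> * c i * x i))) (at (x i))"
    by (rule DERIV_chain2[OF has_real_derivative_powr expsum_deriv[OF assms]]) (use S in simp)
  then have 1: "((\<lambda>s. 1 + ?E * expsum (x(i := s)) powr ?r) has_real_derivative ?E * (?r * (p / ?S) * (\<beta> * c i * exp (\<beta> * c i * x i)))) (at (x i))"
    using DERIV_add[OF DERIV_const[of 1] DERIV_cmult[of _ _ "x i" UNIV ?E]] S by (simp add: p_def powr_diff)
  have "((\<lambda>s. 1 / (1 + ?E * expsum (x(i := s)) powr ?r)) has_real_derivative
     (0 * (1 + ?E * expsum (x(i := x i)) powr ?r) - 1 * (?E * (?r * (p / ?S) * (\<beta> * c i * exp (\<beta> * c i * x i)))))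
      / ((1 + ?E * expsum (x(i := x i)) powr ?r) * (1 + ?E * expsum (x(i := x i)) powr ?r))) (at (x i))"
    by (rule DERIV_divide[OF DERIV_const 1]) (use den in \<open>simp add: p_def\<close>)
  then have "((\<lambda>s. soft_ind (x(i := s))) has_real_derivative
     (- (?E * (?r * (p / ?S) * (\<beta> * c i * exp (\<beta> * c i * x i))))) / ((1 + ?E * p) * (1 + ?E * p))) (at (x i))"
    unfolding soft_ind_def[abs_def] by (simp add: p_def)
  then show ?thesis
  proof (rule DERIV_cong)
    have w: "exp (\<beta> * c i * x i) = weight i x * ?S" using S by (simp add: weight_def)
    have o: "1 + (- 1) * soft_ind x = ?E * p / (1 + ?E * p)"
      using den by (simp add: soft_ind_def p_def[symmetric] field_simps)
    have s: "soft_ind x = 1 / (1 + ?E * p)" by (simp add: soft_ind_def p_def)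
    have "(?E * (?r * (p / ?S) * (\<beta> * c i * exp (\<beta> * c i * x i)))) = \<gamma> * c i * weight i x * (?E * p)"
      unfolding w using S \<beta> by (simp add: field_simps)
    then show "(- (?E * (?r * (p / ?S) * (\<beta> * c i * exp (\<beta> * c i * x i))))) / ((1 + ?E * p) * (1 + ?E * p))
       = (- (\<gamma> * c i)) * (weight i x * (soft_ind x * (1 + (- 1) * soft_ind x)))"
      unfolding o unfolding s by simp
  qed
qed

text \<open>The functions below form an algebra that is closed under partial derivatives.\<close>

inductive_set soft_algebra :: "((nat \<Rightarrow> real) \<Rightarrow> real) set" where
  const: "(\<lambda>x. d) \<in> soft_algebra"
| weight: "k < N \<Longrightarrow> weight k \<in> soft_algebra"
| soft_ind: "soft_ind \<in> soft_algebra"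
| add: "f \<in> soft_algebra \<Longrightarrow> g \<in> soft_algebra \<Longrightarrow> (\<lambda>x. f x + g x) \<in> soft_algebra"
| mult: "f \<in> soft_algebra \<Longrightarrow> g \<in> soft_algebra \<Longrightarrow> (\<lambda>x. f x * g x) \<in> soft_algebra"

lemma continuous_on_expsum: "continuous_on UNIV expsum"
  unfolding expsum_def[abs_def] by (intro continuous_intros continuous_on_product_coordinates)

lemma soft_algebra_continuous: "f \<in> soft_algebra \<Longrightarrow> continuous_on UNIV f"
proof (induction rule: soft_algebra.induct)
  case (weight k)
  have nz: "\<forall>x\<in>UNIV. expsum x \<noteq> 0" using expsum_pos by (metis less_irrefl)
  show ?case unfolding weight_def[abs_def]
    by (intro continuous_on_divide continuous_on_expsum nz continuous_intros continuous_on_product_coordinates)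
next
  case soft_ind
  have nz: "\<forall>x\<in>UNIV. 1 + exp (- (\<gamma> * a)) * expsum x powr (\<gamma> / \<beta>) \<noteq> 0"
  proof
    fix x
    have "0 < 1 + exp (- (\<gamma> * a)) * expsum x powr (\<gamma> / \<beta>)" by (intro add_pos_nonneg) auto
    then show "1 + exp (- (\<gamma> * a)) * expsum x powr (\<gamma> / \<beta>) \<noteq> 0" by simp
  qed
  have nz': "\<forall>x\<in>UNIV. expsum x \<noteq> 0" using expsum_pos by (metis less_irrefl)
  show ?case unfolding soft_ind_def[abs_def]
    by (intro continuous_on_divide continuous_on_add continuous_on_mult continuous_on_const
        continuous_on_powr continuous_on_expsum nz nz')
qed (auto intro: continuous_on_add continuous_on_mult)

lemma soft_algebra_bounded: "f \<in> soft_algebra \<Longrightarrow> \<exists>C. \<forall>x. \<bar>f x\<bar> \<le> C"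
proof (induction rule: soft_algebra.induct)
  case (weight k) then show ?case using weight_nonneg weight_le_1 by (intro exI[of _ 1]) auto
next
  case soft_ind show ?case using soft_ind_bounds by (intro exI[of _ 1]) (auto simp: less_imp_le)
next
  case (add f g)
  then obtain C D where "\<forall>x. \<bar>f x\<bar> \<le> C" "\<forall>x. \<bar>g x\<bar> \<le> D" by blast
  then have "\<forall>x. \<bar>f x + g x\<bar> \<le> C + D" by (meson abs_triangle_ineq add_mono order_trans)
  then show ?case ..
next
  case (mult f g)
  then obtain C D where CD: "\<forall>x. \<bar>f x\<bar> \<le> C" "\<forall>x. \<bar>g x\<bar> \<le> D" by blast
  have "\<bar>f x * g x\<bar> \<le> C * D" for x
    unfolding abs_mult using CD abs_ge_zero by (intro mult_mono) (auto intro: order_trans)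
  then show ?case by blast
qed auto

lemma soft_algebra_deriv:
  "f \<in> soft_algebra \<Longrightarrow> i < N \<Longrightarrow> \<exists>g\<in>soft_algebra. \<forall>x. ((\<lambda>s. f (x(i := s))) has_real_derivative g x) (at (x i))"
proof (induction rule: soft_algebra.induct)
  case (const d)
  show ?case by (intro bexI[of _ "\<lambda>x. 0"] allI DERIV_const soft_algebra.const)
next
  case (weight k)
  let ?g = "\<lambda>x. (if k = i then \<beta> * c i else 0) * weight k x + (- (\<beta> * c i)) * (weight i x * weight k x)"
  have "?g \<in> soft_algebra" using weight by (intro soft_algebra.intros)
  then show ?case by (rule bexI[rotated]) (intro allI weight_deriv weight.prems)
next
  case soft_ind
  let ?g = "\<lambda>x. (- (\<gamma> * c i)) * (weight i x * (soft_ind x * (1 + (- 1) * soft_ind x)))"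
  have "?g \<in> soft_algebra" using soft_ind by (intro soft_algebra.intros)
  then show ?case by (rule bexI[rotated]) (intro allI soft_ind_deriv soft_ind.prems)
next
  case (add f g)
  then obtain f' g' where fg: "f' \<in> soft_algebra" "g' \<in> soft_algebra"
    "\<And>x. ((\<lambda>s. f (x(i := s))) has_real_derivative f' x) (at (x i))"
    "\<And>x. ((\<lambda>s. g (x(i := s))) has_real_derivative g' x) (at (x i))" by blast
  then show ?case
    by (intro bexI[of _ "\<lambda>x. f' x + g' x"] allI DERIV_add soft_algebra.add)
next
  case (mult f g)
  then obtain f' g' where fg: "f' \<in> soft_algebra" "g' \<in> soft_algebra"
    "\<And>x. ((\<lambda>s. f (x(i := s))) has_real_derivative f' x) (at (x i))"
    "\<And>x. ((\<lambda>s. g (x(i := s))) has_real_derivative g' x) (at (x i))" by blast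
  have d: "((\<lambda>s. f (x(i := s)) * g (x(i := s))) has_real_derivative f' x * g x + g' x * f x) (at (x i))" for x
    using DERIV_mult[OF fg(3)[of x] fg(4)[of x]] by simp
  have "(\<lambda>x. f' x * g x + g' x * f x) \<in> soft_algebra"
    using fg mult.hyps by (intro soft_algebra.add soft_algebra.mult)
  then show ?case by (rule bexI[rotated]) (intro allI d)
qed

lemma soft_algebra_local: "f \<in> soft_algebra \<Longrightarrow> (\<And>i. i < N \<Longrightarrow> x i = y i) \<Longrightarrow> f x = f y"
proof (induction rule: soft_algebra.induct)
  case (weight k)
  then have "expsum x = expsum y" unfolding expsum_def by (intro sum.cong) auto
  with weight show ?case by (simp add: weight_def)
next
  case soft_ind
  then have "expsum x = expsum y" unfolding expsum_def by (intro sum.cong) auto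
  then show ?case by (simp add: soft_ind_def)
qed auto

lemma iter_partial_soft_algebra:
  assumes "f \<in> soft_algebra"
  shows "set I \<subseteq> {..<N} \<Longrightarrow> iter_partial I f \<in> soft_algebra"
proof (induction I)
  case (Cons i I)
  then have "iter_partial I f \<in> soft_algebra" "i < N" by auto
  from soft_algebra_deriv[OF this] obtain g where g: "g \<in> soft_algebra"
    "\<And>x. ((\<lambda>s. iter_partial I f (x(i := s))) has_real_derivative g x) (at (x i))" by blast
  have "iter_partial (i # I) f = g" by (auto simp: partial_deriv_def DERIV_imp_deriv[OF g(2)])
  with g show ?case by simp
qed (use assms in simp)

text \<open>All iterated partial derivatives stay in the algebra and are therefore bounded, so the
  growth exponent is 0.\<close>

lemma smooth_poly_growth_soft_algebra:
  assumes f: "f \<in> soft_algebra" shows "smooth_poly_growth N f"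
  unfolding smooth_poly_growth_def
proof (intro conjI allI impI)
  show "f x = f y" if "\<forall>i<N. x i = y i" for x y using soft_algebra_local[OF f] that by blast
  fix I assume I: "set I \<subseteq> {..<N}"
  have A: "iter_partial I f \<in> soft_algebra" by (rule iter_partial_soft_algebra[OF f I])
  show "continuous_on UNIV (iter_partial I f)" by (rule soft_algebra_continuous[OF A])
  show "(\<lambda>s. iter_partial I f (x(i := s))) differentiable (at (x i))" if "i < N" for x i
    using soft_algebra_deriv[OF A that] real_differentiable_def by blast
  obtain C where C: "\<forall>x. \<bar>iter_partial I f x\<bar> \<le> C" using soft_algebra_bounded[OF A] by blast
  show "\<exists>C. \<exists>N'::nat. \<forall>x. \<bar>iter_partial I f x\<bar> \<le> C * (1 + (\<Sum>i<N. \<bar>x i\<bar>)) ^ N'"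
    by (intro exI[of _ C] exI[of _ 0]) (use C in simp)
qed

lemma partial_soft_ind:
  assumes "i < N"
  shows "iter_partial [i] (\<lambda>x. 2 * soft_ind x) x = - 2 * (\<gamma> * c i) * (weight i x * (soft_ind x * (1 - soft_ind x)))"
proof -
  have "((\<lambda>s. 2 * soft_ind (x(i := s))) has_real_derivative
    2 * ((- (\<gamma> * c i)) * (weight i x * (soft_ind x * (1 + (- 1) * soft_ind x))))) (at (x i))"
    by (rule DERIV_cmult[OF soft_ind_deriv[OF assms]])
  from DERIV_imp_deriv[OF this] show ?thesis by (simp add: partial_deriv_def)
qed

text \<open>A single term of \<open>expsum\<close> already forces the smooth maximum above a +
  \<delta>. Hence the bound involves neither the number of variables nor \<beta>.\<close>

lemma soft_ind_small:
  assumes "i < N" "0 \<le> \<gamma>" "a + \<delta> \<le> c i * x i"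
  shows "soft_ind x \<le> exp (- (\<gamma> * \<delta>))"
proof -
  have "exp (\<beta> * (a + \<delta>)) \<le> exp (\<beta> * c i * x i)" using assms \<beta> by (simp add: mult.assoc)
  also have "\<dots> \<le> expsum x"
    unfolding expsum_def using assms(1) by (intro member_le_sum) auto
  finally have "exp (\<beta> * (a + \<delta>)) powr (\<gamma> / \<beta>) \<le> expsum x powr (\<gamma> / \<beta>)"
    using assms \<beta> by (intro powr_mono2) auto
  moreover have "exp (\<beta> * (a + \<delta>)) powr (\<gamma> / \<beta>) = exp (\<gamma> * (a + \<delta>))"
    using \<beta> by (simp add: exp_powr_real)
  ultimately have "exp (- (\<gamma> * a)) * exp (\<gamma> * (a + \<delta>)) \<le> exp (- (\<gamma> * a)) * expsum x powr (\<gamma> / \<beta>)"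
    by (intro mult_left_mono) auto
  moreover have "exp (- (\<gamma> * a)) * exp (\<gamma> * (a + \<delta>)) = exp (\<gamma> * \<delta>)"
    by (simp add: exp_add[symmetric] algebra_simps)
  ultimately have "exp (\<gamma> * \<delta>) \<le> 1 + exp (- (\<gamma> * a)) * expsum x powr (\<gamma> / \<beta>)" by simp
  then have "1 / (1 + exp (- (\<gamma> * a)) * expsum x powr (\<gamma> / \<beta>)) \<le> 1 / exp (\<gamma> * \<delta>)"
    by (intro divide_left_mono mult_pos_pos) (auto intro: less_le_trans[OF exp_gt_zero])
  then show ?thesis unfolding soft_ind_def by (simp add: exp_minus inverse_eq_divide)
qed

text \<open>The smooth maximum exceeds the true one by at most ln N / \<beta> \<le> \<delta>, so it
  is at most a, the level at which the logistic function equals 1/2.\<close>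

lemma soft_ind_large:
  assumes "0 \<le> \<gamma>" "\<And>i. i < N \<Longrightarrow> c i * x i \<le> a - \<delta>" "ln N \<le> \<beta> * \<delta>"
  shows "1 / 2 \<le> soft_ind x"
proof -
  have "expsum x \<le> (\<Sum>i<N. exp (\<beta> * (a - \<delta>)))"
    unfolding expsum_def using assms(2) \<beta> by (intro sum_mono) (simp add: mult.assoc)
  also have "\<dots> = exp (ln N + \<beta> * (a - \<delta>))" using N by (simp add: exp_add)
  also have "\<dots> \<le> exp (\<beta> * a)" using assms(3) by (simp add: algebra_simps)
  finally have "expsum x powr (\<gamma> / \<beta>) \<le> exp (\<beta> * a) powr (\<gamma> / \<beta>)"
    using assms \<beta> expsum_pos[of x] by (intro powr_mono2) auto
  also have "\<dots> = exp (\<gamma> * a)" using \<beta> by (simp add: exp_powr_real)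
  finally have "exp (- (\<gamma> * a)) * expsum x powr (\<gamma> / \<beta>) \<le> exp (- (\<gamma> * a)) * exp (\<gamma> * a)"
    by (intro mult_left_mono) auto
  also have "\<dots> = 1" by (simp flip: exp_add)
  finally show ?thesis
    unfolding soft_ind_def by (intro divide_left_mono) (auto intro!: mult_pos_pos add_pos_nonneg)
qed

end

section \<open>Conclusion\<close>

lemma cm_inner_commute: "cm_inner h k = cm_inner k h"
  by (simp add: cm_inner_def mult.commute)

text \<open>Cauchy-Schwarz, from the nonnegativity of the form at h / r + k / s and h / r - k / s.
  Scaling by the bounds r and s avoids division by norms that may vanish.\<close>

lemma cm_inner_bound:
  assumes h: "h \<in> cameron_martin" "k \<in> cameron_martin" and r: "0 < r" "0 < s"
    and n: "cm_inner h h \<le> r\<^sup>2" "cm_inner k k \<le> s\<^sup>2"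
  shows "\<bar>cm_inner h k\<bar> \<le> r * s"
proof -
  have nn: "0 \<le> cm_inner h h / r\<^sup>2 + 2 * e * (cm_inner h k / (r * s)) + e\<^sup>2 * (cm_inner k k / s\<^sup>2)" for e
  proof -
    let ?f = "\<lambda>i::nat. if i = 0 then h else k"
    have "0 \<le> cm_form 2 ?f (\<lambda>i. if i = 0 then 1 / r else e / s)"
      by (rule cm_form_nonneg) (use h in auto)
    also have "\<dots> = cm_inner h h / r\<^sup>2 + 2 * e * (cm_inner h k / (r * s)) + e\<^sup>2 * (cm_inner k k / s\<^sup>2)"
      using r by (simp add: cm_form_def numeral_2_eq_2 cm_inner_commute[of k h] field_simps power2_eq_square)
    finally show ?thesis .
  qed
  have le: "cm_inner h h / r\<^sup>2 \<le> 1" "cm_inner k k / s\<^sup>2 \<le> 1" using n r by (auto simp: divide_le_eq)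
  have "\<bar>cm_inner h k / (r * s)\<bar> \<le> 1" using nn[of 1] nn[of "- 1"] le by (simp add: abs_le_iff)
  then show ?thesis using r by (simp add: abs_mult divide_le_eq)
qed

text \<open>The triangle inequality for the Cameron-Martin norm, in squared form, with
  \<open>r i\<close> as a bound for the norm of \<open>h i\<close>.\<close>

lemma cm_form_le:
  assumes "\<And>i j. i < n \<Longrightarrow> j < n \<Longrightarrow> \<bar>cm_inner (h i) (h j)\<bar> \<le> r i * r j"
  shows "cm_form n h c \<le> (\<Sum>i<n. \<bar>c i\<bar> * r i)\<^sup>2"
proof -
  have "cm_form n h c \<le> (\<Sum>i<n. \<Sum>j<n. (\<bar>c i\<bar> * r i) * (\<bar>c j\<bar> * r j))"
    unfolding cm_form_def
  proof (intro sum_mono)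
    fix i j assume "i \<in> {..<n}" "j \<in> {..<n}"
    then have b: "\<bar>cm_inner (h i) (h j)\<bar> \<le> r i * r j" using assms by simp
    have "c i * c j * cm_inner (h i) (h j) \<le> \<bar>c i * c j * cm_inner (h i) (h j)\<bar>" by simp
    also have "\<dots> = \<bar>c i\<bar> * \<bar>c j\<bar> * \<bar>cm_inner (h i) (h j)\<bar>" by (simp add: abs_mult)
    also have "\<dots> \<le> \<bar>c i\<bar> * \<bar>c j\<bar> * (r i * r j)" by (intro mult_left_mono b) simp
    finally show "c i * c j * cm_inner (h i) (h j) \<le> (\<bar>c i\<bar> * r i) * (\<bar>c j\<bar> * r j)" by (simp add: mult_ac)
  qed
  also have "\<dots> = (\<Sum>i<n. \<bar>c i\<bar> * r i)\<^sup>2" by (simp add: power2_eq_square sum_product)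
  finally show ?thesis .
qed

section \<open>The kernels as Cameron-Martin directions\<close>

lemma fbm_integrand_square_integrable:
  assumes H: "0 < H" "H \<le> 1/2" and t: "0 < t"
  shows "(\<integral>\<^sup>+s\<in>{0..}. ennreal ((fbm_integrand H t s)\<^sup>2) \<partial>lborel) = ennreal (t powr (2 * H))"
proof -
  obtain \<kappa> where \<kappa>: "\<kappa> 1 = 1" "\<And>t x. 0 < t \<Longrightarrow> 0 \<le> x \<Longrightarrow> x \<le> 1 \<Longrightarrow>
      (\<integral>\<^sup>+s\<in>{0..x * t}. ennreal ((fbm_integrand H t s)\<^sup>2) \<partial>lborel) = ennreal (t powr (2 * H) * \<kappa> x)"
    by (rule fbm_integrand_norm[OF H]) blast
  have "(\<integral>\<^sup>+s\<in>{0..}. ennreal ((fbm_integrand H t s)\<^sup>2) \<partial>lborel) = (\<integral>\<^sup>+s\<in>{0..1 * t}. ennreal ((fbm_integrand H t s)\<^sup>2) \<partial>lborel)"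
    by (intro nn_integral_cong) (auto simp: indicator_def)
  then show ?thesis using \<kappa>(2)[OF t, of 1] by (simp add: \<kappa>(1))
qed

text \<open>This presents the integrals of the kernels in the form [h], the only arguments allowed
  in smooth functionals, and supplies the norms for the gradient bound.\<close>

lemma fbm_cameron_martin:
  assumes H: "0 < H" "H \<le> 1/2" and t: "0 < t"
  obtains h where "h \<in> cameron_martin" "\<And>P. cm_integral P h = wiener_integral P (fbm_integrand H t)"
    "cm_inner h h = t powr (2 * H)"
proof -
  let ?g = "fbm_integrand H t"
  note gm [measurable] = fbm_integrand_measurable[OF H, of t]
  have nn: "(\<integral>\<^sup>+s. ennreal ((?g s)\<^sup>2 * indicator {0..} s) \<partial>lborel) = ennreal (t powr (2 * H))"
    unfolding fbm_integrand_square_integrable[OF H t, symmetric] by (intro nn_integral_cong) (simp add: indicator_def)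
  have int: "integrable lborel (\<lambda>s. (?g s)\<^sup>2 * indicator {0..} s)"
    by (rule integrableI_nonneg) (use nn in simp_all)
  have neg: "?g s = 0" if "s < 0" for s using that by simp
  obtain h where h: "h \<in> cameron_martin" "\<And>s. s \<notin> insert 0 {0, t} \<Longrightarrow> deriv h s = ?g s"
  proof (rule cameron_martin_primitive[OF gm int neg])
    show "finite {0, t}" by simp
    show "isCont ?g s" if "s \<notin> {0, t}" for s using that by (intro isCont_fbm_integrand H) auto
  qed (assumption, (rule that; assumption))
  have AE: "AE s in lborel. deriv h s = ?g s"
    using AE_lborel_singleton[of "0::real"] AE_lborel_singleton[of t] by eventually_elim (rule h(2), simp)
  have "cm_integral P h = wiener_integral P ?g" for P
    unfolding cm_integral_def by (rule wiener_integral_cong) (use AE in eventually_elim, simp)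
  moreover have "cm_inner h h = t powr (2 * H)"
  proof -
    have "set_integrable lborel {0..} (\<lambda>s. deriv h s * deriv h s)" by (rule cm_products_integrable[OF h(1) h(1)])
    then have "cm_inner h h = enn2real (\<integral>\<^sup>+s. ennreal (indicator {0..} s *\<^sub>R (deriv h s * deriv h s)) \<partial>lborel)"
      unfolding cm_inner_def set_lebesgue_integral_def set_integrable_def by (intro integral_eq_nn_integral) auto
    also have "(\<integral>\<^sup>+s. ennreal (indicator {0..} s *\<^sub>R (deriv h s * deriv h s)) \<partial>lborel) = (\<integral>\<^sup>+s. ennreal ((?g s)\<^sup>2 * indicator {0..} s) \<partial>lborel)"
      by (rule nn_integral_cong_AE) (use AE in eventually_elim, simp only: power2_eq_square, simp add: mult.commute)
    finally show ?thesis using nn by simp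
  qed
  ultimately show ?thesis using h(1) by (intro that)
qed

text \<open>Exponential decay in \<gamma> beats the growth of \<gamma>^2; the substitution x = 2
  \<gamma> \<delta> reduces this to standard limits.\<close>

lemma exists_large_slope:
  fixes \<delta> \<eta> :: real
  assumes "0 < \<delta>" "0 < \<eta>"
  obtains \<gamma> where "0 < \<gamma>" "(1 + \<gamma>\<^sup>2) * (4 * exp (- (2 * \<gamma> * \<delta>))) < \<eta>"
proof -
  have "((\<lambda>x::real. 4 * (x ^ 0 / exp x + x ^ 2 / exp x / (4 * \<delta>\<^sup>2))) \<longlongrightarrow> 4 * (0 + 0 / (4 * \<delta>\<^sup>2))) at_top"
    by (intro tendsto_mult tendsto_const tendsto_add tendsto_divide tendsto_power_div_exp_0) (use assms in auto)
  then have "eventually (\<lambda>x::real. 4 * (x ^ 0 / exp x + x ^ 2 / exp x / (4 * \<delta>\<^sup>2)) < \<eta>) at_top"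
    using assms by (intro order_tendstoD(2)) auto
  then have ev: "eventually (\<lambda>x::real. 4 * (x ^ 0 / exp x + x ^ 2 / exp x / (4 * \<delta>\<^sup>2)) < \<eta> \<and> 0 < x) at_top"
    using eventually_gt_at_top[of "0::real"] by eventually_elim simp
  from eventually_happens[OF ev] obtain x :: real where x: "4 * (x ^ 0 / exp x + x ^ 2 / exp x / (4 * \<delta>\<^sup>2)) < \<eta>" "0 < x"
    by auto
  show ?thesis
  proof (rule that[of "x / (2 * \<delta>)"])
    show "0 < x / (2 * \<delta>)" using x assms by simp
    have "2 * (x / (2 * \<delta>)) * \<delta> = x" using assms by simp
    then show "(1 + (x / (2 * \<delta>))\<^sup>2) * (4 * exp (- (2 * (x / (2 * \<delta>)) * \<delta>))) < \<eta>"
      using x(1) by (simp add: exp_minus power_divide power_mult_distrib field_simps)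
  qed
qed

section \<open>Energy of the cut-offs and capacity of the exceptional sets\<close>

context wiener
begin

text \<open>Because the softmax weights sum to 1 and each normalised direction has norm at most 1,
  neither N nor \<beta> enters the gradient bound. The factor 2 lifts the value 1/2 of
  \<open>soft_ind_large\<close> to 1.\<close>

lemma soft_ind_energy:
  fixes X :: "nat \<Rightarrow> (real \<Rightarrow> real) \<Rightarrow> real"
  assumes h: "\<And>i. i < N \<Longrightarrow> h i \<in> cameron_martin" "\<And>i. i < N \<Longrightarrow> cm_integral P (h i) = X i"
    and \<phi>: "\<And>i. i < N \<Longrightarrow> 0 < \<phi> i" "\<And>i. i < N \<Longrightarrow> cm_inner (h i) (h i) \<le> (\<phi> i)\<^sup>2"
    and N: "0 < N" and \<beta>: "0 < \<beta>" and \<gamma>: "0 < \<gamma>" and \<delta>: "0 < \<delta>"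
  shows "\<exists>E \<le> (1 + \<gamma>\<^sup>2) * (4 * prob {\<omega> \<in> space P. \<forall>i<N. X i \<omega> \<le> (a + \<delta>) * \<phi> i} + 4 * exp (- (2 * \<gamma> * \<delta>))).
    sobolev_energy P (\<lambda>\<omega>. 2 * softmax.soft_ind N \<beta> \<gamma> a (\<lambda>i. 1 / \<phi> i) (\<lambda>i. X i \<omega>)) E"
proof -
  interpret softmax N \<beta> \<gamma> a "\<lambda>i. 1 / \<phi> i" by unfold_locales (use N \<beta> in auto)
  define f where "f x = 2 * soft_ind x" for x
  have fA: "f \<in> soft_algebra" unfolding f_def[abs_def] by (intro soft_algebra.intros)
  have fs: "smooth_poly_growth N f" by (rule smooth_poly_growth_soft_algebra[OF fA])
  define F where "F \<omega> = f (\<lambda>i. X i \<omega>)" for \<omega>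
  have Xm [measurable]: "X i \<in> borel_measurable P" if "i < N" for i
    using cm_integral_measurable_moments(1)[OF h(1)[OF that]] h(2)[OF that] by simp
  have Fm [measurable]: "F \<in> borel_measurable P"
    using iter_partial_measurable[OF fs, of "[]" X] Xm unfolding F_def[abs_def] by simp
  have cm: "f (\<lambda>i. cm_integral P (h i) \<omega>) = F \<omega>" for \<omega>
    unfolding F_def by (rule soft_algebra_local[OF fA]) (simp add: h(2))
  have SF: "smooth_functional P N f h F"
    unfolding smooth_functional_def using fs h(1) Fm cm by simp
  have F0: "0 \<le> F \<omega>" "F \<omega> \<le> 2" for \<omega>
    using soft_ind_bounds[of "\<lambda>i. X i \<omega>"] by (auto simp: F_def f_def)
  have form: "cm_form N h (\<lambda>i. malliavin_coeff P f h [i] \<omega>) \<le> \<gamma>\<^sup>2 * (F \<omega>)\<^sup>2" for \<omega>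
  proof -
    let ?x = "\<lambda>i. cm_integral P (h i) \<omega>"
    let ?s = "soft_ind ?x"
    have b: "\<bar>cm_inner (h i) (h j)\<bar> \<le> \<phi> i * \<phi> j" if "i < N" "j < N" for i j
      using that by (intro cm_inner_bound h(1) \<phi>)
    have s: "0 < ?s" "?s < 1" using soft_ind_bounds by auto
    have "(\<Sum>i<N. \<bar>malliavin_coeff P f h [i] \<omega>\<bar> * \<phi> i) = (\<Sum>i<N. 2 * \<gamma> * (?s * (1 - ?s)) * weight i ?x)"
    proof (rule sum.cong[OF refl])
      fix i assume i: "i \<in> {..<N}"
      have "malliavin_coeff P f h [i] \<omega> = - 2 * (\<gamma> * (1 / \<phi> i)) * (weight i ?x * (?s * (1 - ?s)))"
        unfolding malliavin_coeff_def f_def[abs_def] using i by (intro partial_soft_ind) simp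
      moreover have "0 < \<phi> i" using \<phi>(1) i by simp
      ultimately show "\<bar>malliavin_coeff P f h [i] \<omega>\<bar> * \<phi> i = 2 * \<gamma> * (?s * (1 - ?s)) * weight i ?x"
        using \<gamma> s weight_nonneg[of i ?x] by (simp add: abs_mult)
    qed
    also have "\<dots> = 2 * \<gamma> * (?s * (1 - ?s))" by (simp add: sum_distrib_left[symmetric] weight_sum)
    \<comment> \<open>Dropping the factor 1 - s leaves a multiple of F itself, so the gradient is
      small wherever F is, and one estimate of E[F^2] serves both parts of the norm.\<close>
    also have "\<dots> \<le> \<gamma> * (2 * ?s)" using s \<gamma> by (simp add: mult_left_le)
    also have "2 * ?s = F \<omega>" using cm[of \<omega>] by (simp add: f_def)
    finally have le: "(\<Sum>i<N. \<bar>malliavin_coeff P f h [i] \<omega>\<bar> * \<phi> i) \<le> \<gamma> * F \<omega>" .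
    have "cm_form N h (\<lambda>i. malliavin_coeff P f h [i] \<omega>) \<le> (\<Sum>i<N. \<bar>malliavin_coeff P f h [i] \<omega>\<bar> * \<phi> i)\<^sup>2"
      by (rule cm_form_le[OF b])
    also have "\<dots> \<le> (\<gamma> * F \<omega>)\<^sup>2"
      using le \<phi>(1) by (intro power_mono sum_nonneg mult_nonneg_nonneg) (auto simp: less_imp_le)
    finally show ?thesis by (simp add: power_mult_distrib)
  qed
  define E where "E = (\<integral>\<omega>. (F \<omega>)\<^sup>2 \<partial>P) + (\<integral>\<omega>. cm_form N h (\<lambda>i. malliavin_coeff P f h [i] \<omega>) \<partial>P)"
  have F2: "integrable P (\<lambda>\<omega>. (F \<omega>)\<^sup>2)" by (rule smooth_functional_square_integrable(1)[OF SF])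
  let ?A = "{\<omega> \<in> space P. \<forall>i<N. X i \<omega> \<le> (a + \<delta>) * \<phi> i}"
  have Am: "?A \<in> events"
  proof -
    have "{\<omega> \<in> space P. \<forall>i\<in>{..<N}. X i \<omega> \<le> (a + \<delta>) * \<phi> i} \<in> events"
      by (rule sets.sets_Collect_finite_All) (use Xm in \<open>auto intro!: borel_measurable_le\<close>)
    then show ?thesis by (simp add: Ball_def)
  qed
  have Fb: "(F \<omega>)\<^sup>2 \<le> 4 * indicator ?A \<omega> + 4 * exp (- (2 * \<gamma> * \<delta>))" if w: "\<omega> \<in> space P" for \<omega>
  proof (cases "\<omega> \<in> ?A")
    case True
    have "(F \<omega>)\<^sup>2 \<le> 2\<^sup>2" using F0 by (intro power_mono) auto
    then show ?thesis using True by (simp add: add_increasing2)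
  next
    case False
    then obtain i where i: "i < N" "(a + \<delta>) * \<phi> i < X i \<omega>" using w by (auto simp: not_le)
    then have "a + \<delta> \<le> 1 / \<phi> i * X i \<omega>" using \<phi>(1)[OF i(1)] by (simp add: field_simps)
    then have "soft_ind (\<lambda>i. X i \<omega>) \<le> exp (- (\<gamma> * \<delta>))" using \<gamma> i(1) by (intro soft_ind_small) auto
    then have "F \<omega> \<le> 2 * exp (- (\<gamma> * \<delta>))" by (simp add: F_def f_def)
    then have "(F \<omega>)\<^sup>2 \<le> (2 * exp (- (\<gamma> * \<delta>)))\<^sup>2" using F0 by (intro power_mono) auto
    also have "\<dots> = 4 * exp (- (2 * \<gamma> * \<delta>))" by (simp add: power_mult_distrib exp_double[symmetric] algebra_simps)
    finally show ?thesis using False by simp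
  qed
  have "(\<integral>\<omega>. (F \<omega>)\<^sup>2 \<partial>P) \<le> (\<integral>\<omega>. 4 * indicator ?A \<omega> + 4 * exp (- (2 * \<gamma> * \<delta>)) \<partial>P)"
    using Am by (intro Bochner_Integration.integral_mono[OF F2] Fb) (auto intro!: Bochner_Integration.integrable_add integrable_real_indicator simp: emeasure_eq_measure)
  also have "\<dots> = 4 * prob ?A + 4 * exp (- (2 * \<gamma> * \<delta>))"
    using Am by (subst Bochner_Integration.integral_add) (auto simp: emeasure_eq_measure prob_space intro!: integrable_real_indicator)
  finally have I1: "(\<integral>\<omega>. (F \<omega>)\<^sup>2 \<partial>P) \<le> 4 * prob ?A + 4 * exp (- (2 * \<gamma> * \<delta>))" .
  have "(\<integral>\<omega>. cm_form N h (\<lambda>i. malliavin_coeff P f h [i] \<omega>) \<partial>P) \<le> (\<integral>\<omega>. \<gamma>\<^sup>2 * (F \<omega>)\<^sup>2 \<partial>P)"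
    using F2 by (intro Bochner_Integration.integral_mono[OF cm_form_integrable[OF SF]] form) auto
  then have "E \<le> (1 + \<gamma>\<^sup>2) * (\<integral>\<omega>. (F \<omega>)\<^sup>2 \<partial>P)" unfolding E_def by (simp add: algebra_simps)
  also have "\<dots> \<le> (1 + \<gamma>\<^sup>2) * (4 * prob ?A + 4 * exp (- (2 * \<gamma> * \<delta>)))"
    by (intro mult_left_mono I1) simp
  finally have "E \<le> (1 + \<gamma>\<^sup>2) * (4 * prob ?A + 4 * exp (- (2 * \<gamma> * \<delta>)))" .
  moreover have "sobolev_energy P F E" unfolding sobolev_energy_def E_def using SF by blast
  ultimately show ?thesis unfolding F_def[abs_def] f_def by blast
qed

lemma cap_below_mono: "cap_below A \<eta> \<Longrightarrow> A' \<subseteq> A \<Longrightarrow> cap_below A' \<eta>"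
  unfolding cap_below_def by blast

text \<open>For a fixed start n only finitely many times are used in the cut-off; imposing fewer
  conditions enlarges the set, and \<open>cap_below_mono\<close> returns to the infinite
  one.\<close>

lemma cap_below_lil:
  assumes H: "0 < H" "H \<le> 1/2" and B: "fbm_version P H B" and \<epsilon>: "0 < \<epsilon>" "\<epsilon> < 1"
  obtains q :: real where "0 < q" "q < 1" "1 \<le> ln (1 / q)"
    "\<And>n \<eta>. 0 < \<eta> \<Longrightarrow> cap_below {\<omega> \<in> wiener_space. \<forall>m\<ge>n. B (q ^ m) \<omega> < (1 - \<epsilon>) * lil_scale H (q ^ m)} \<eta>"
proof -
  \<comment> \<open>Since 3 * (\<epsilon> / 6) = \<epsilon> / 2, the probability is small at level 1
    - \<epsilon> / 2 = a + \<delta>, while the functional must reach 1 at level 1 - \<epsilon> = a -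
    \<delta>.\<close>
  have \<epsilon>6: "0 < \<epsilon> / 6" "\<epsilon> / 6 < 1" using \<epsilon> by auto
  obtain q where q: "0 < q" "q < 1" "1 \<le> ln (1 / q)"
    and lil: "\<And>X n \<eta>. (\<And>m. is_wiener_integral P (fbm_integrand H (q ^ m)) (X m)) \<Longrightarrow> 0 < \<eta> \<Longrightarrow>
      \<exists>M. prob {\<omega> \<in> space P. \<forall>m\<in>{n..<M}. X m \<omega> \<le> (1 - 3 * (\<epsilon> / 6)) * lil_scale H (q ^ m)} < \<eta>"
    by (rule lil_lower_bound[OF H \<epsilon>6]) blast
  have t: "0 < q ^ m" for m using q by simp
  define X where "X m = wiener_integral P (fbm_integrand H (q ^ m))" for m
  have W: "is_wiener_integral P (fbm_integrand H (q ^ m)) (X m)" for m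
    unfolding X_def by (rule wiener_integral[OF fbm_integrand_measurable[OF H]])
      (simp only: fbm_integrand_square_integrable[OF H t], simp)
  have Xm [measurable]: "X m \<in> borel_measurable P" for m using W[of m] by (simp add: is_wiener_integral_def)
  define \<phi> where "\<phi> m = lil_scale H (q ^ m)" for m
  show ?thesis
  proof (rule that[OF q])
    fix n and \<eta> :: real assume \<eta>: "0 < \<eta>"
    obtain N2 :: nat where N2: "exp 2 \<le> real N2" using real_arch_simple by blast
    \<comment> \<open>From n0 on the scale is positive and dominates the standard deviation, as the
      gradient bound requires.\<close>
    define n0 where "n0 = max n (max N2 1)"
    have \<phi>: "0 < \<phi> m" "(q ^ m) powr (2 * H) \<le> (\<phi> m)\<^sup>2" if "n0 \<le> m" for m
    proof -
      have "exp 2 \<le> real m" using N2 that by (simp add: n0_def)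
      then have "ln (exp 2) \<le> ln (real m)" by (intro ln_mono) auto
      then have m: "2 \<le> ln (real m)" by simp
      show "0 < \<phi> m" unfolding \<phi>_def by (rule lil_scale_geometric(2)[OF q(1,3) m])
      have "(q ^ m) powr (2 * H) * 1 \<le> (q ^ m) powr (2 * H) * (2 * ln (real m * ln (1 / q)))"
        using lil_scale_geometric(3)[OF q(1,3) m] by (intro mult_left_mono) auto
      then show "(q ^ m) powr (2 * H) \<le> (\<phi> m)\<^sup>2"
        unfolding \<phi>_def lil_scale_geometric(1)[OF q(1,3) m] by (simp add: mult_ac)
    qed
    define \<delta> where "\<delta> = \<epsilon> / 4"
    define a where "a = 1 - 3 * \<epsilon> / 4"
    have \<delta>: "0 < \<delta>" "a + \<delta> = 1 - 3 * (\<epsilon> / 6)" "a - \<delta> = 1 - \<epsilon>" using \<epsilon> by (auto simp: \<delta>_def a_def)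
    \<comment> \<open>Two terms below \<eta>^2 / 32 give an energy below (\<eta> / 4)^2, the bound
      needed for \<open>cap_below_quasi_continuous\<close>.\<close>
    have "0 < \<eta>\<^sup>2 / 32" using \<eta> by simp
    then obtain \<gamma> where \<gamma>: "0 < \<gamma>" "(1 + \<gamma>\<^sup>2) * (4 * exp (- (2 * \<gamma> * \<delta>))) < \<eta>\<^sup>2 / 32"
      using exists_large_slope[OF \<delta>(1)] by blast
    have g1: "0 < 4 * (1 + \<gamma>\<^sup>2)" by (intro mult_pos_pos add_pos_nonneg) auto
    then have "0 < \<eta>\<^sup>2 / 32 / (4 * (1 + \<gamma>\<^sup>2))" using \<eta> by (intro divide_pos_pos) auto
    from lil[OF W this] obtain M0 where
      M0: "prob {\<omega> \<in> space P. \<forall>m\<in>{n0..<M0}. X m \<omega> \<le> (1 - 3 * (\<epsilon> / 6)) * \<phi> m} < \<eta>\<^sup>2 / 32 / (4 * (1 + \<gamma>\<^sup>2))"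
      unfolding \<phi>_def by blast
    \<comment> \<open>At least one time is kept, as \<open>softmax\<close> requires; going beyond M0
      only makes the event smaller.\<close>
    define N where "N = max M0 (n0 + 1) - n0"
    have Npos: "0 < N" and NM: "M0 \<le> n0 + N" by (auto simp: N_def)
    define \<beta> where "\<beta> = max 1 (ln (real N) / \<delta>)"
    have \<beta>: "0 < \<beta>" and \<beta>N: "ln (real N) \<le> \<beta> * \<delta>"
    proof -
      show "0 < \<beta>" by (simp add: \<beta>_def)
      have "ln (real N) / \<delta> \<le> \<beta>" by (simp add: \<beta>_def)
      then show "ln (real N) \<le> \<beta> * \<delta>" using \<delta>(1) by (simp add: pos_divide_le_eq)
    qed
    have "\<exists>h. h \<in> cameron_martin \<and> cm_integral P h = X m \<and> cm_inner h h = (q ^ m) powr (2 * H)" for m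
      by (rule fbm_cameron_martin[OF H t[of m]]) (auto simp: X_def)
    then have "\<forall>m. \<exists>h. h \<in> cameron_martin \<and> cm_integral P h = X m \<and> cm_inner h h = (q ^ m) powr (2 * H)" by blast
    from choice[OF this] obtain h where h: "\<forall>m. h m \<in> cameron_martin \<and> cm_integral P (h m) = X m \<and> cm_inner (h m) (h m) = (q ^ m) powr (2 * H)" ..
    define \<psi> where "\<psi> \<omega> = 2 * softmax.soft_ind N \<beta> \<gamma> a (\<lambda>i. 1 / \<phi> (n0 + i)) (\<lambda>i. X (n0 + i) \<omega>)" for \<omega>
    interpret soft: softmax N \<beta> \<gamma> a "\<lambda>i. 1 / \<phi> (n0 + i)" by unfold_locales (use Npos \<beta> in auto)
    have "\<exists>E \<le> (1 + \<gamma>\<^sup>2) * (4 * prob {\<omega> \<in> space P. \<forall>i<N. X (n0 + i) \<omega> \<le> (a + \<delta>) * \<phi> (n0 + i)} + 4 * exp (- (2 * \<gamma> * \<delta>))).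
        sobolev_energy P \<psi> E"
      unfolding \<psi>_def[abs_def]
      by (rule soft_ind_energy[where h="\<lambda>i. h (n0 + i)"]) (use h \<phi> Npos \<beta> \<gamma>(1) \<delta>(1) in auto)
    then obtain E where E: "E \<le> (1 + \<gamma>\<^sup>2) * (4 * prob {\<omega> \<in> space P. \<forall>i<N. X (n0 + i) \<omega> \<le> (a + \<delta>) * \<phi> (n0 + i)} + 4 * exp (- (2 * \<gamma> * \<delta>)))"
       "sobolev_energy P \<psi> E" by blast
    have "prob {\<omega> \<in> space P. \<forall>i<N. X (n0 + i) \<omega> \<le> (a + \<delta>) * \<phi> (n0 + i)}
       \<le> prob {\<omega> \<in> space P. \<forall>m\<in>{n0..<M0}. X m \<omega> \<le> (1 - 3 * (\<epsilon> / 6)) * \<phi> m}"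
    proof (rule finite_measure_mono)
      show "{\<omega> \<in> space P. \<forall>m\<in>{n0..<M0}. X m \<omega> \<le> (1 - 3 * (\<epsilon> / 6)) * \<phi> m} \<in> events"
        by (rule sets.sets_Collect_finite_All) (use Xm in \<open>auto intro!: borel_measurable_le\<close>)
      show "{\<omega> \<in> space P. \<forall>i<N. X (n0 + i) \<omega> \<le> (a + \<delta>) * \<phi> (n0 + i)}
         \<subseteq> {\<omega> \<in> space P. \<forall>m\<in>{n0..<M0}. X m \<omega> \<le> (1 - 3 * (\<epsilon> / 6)) * \<phi> m}"
      proof safe
        fix \<omega> m assume A: "\<forall>i<N. X (n0 + i) \<omega> \<le> (a + \<delta>) * \<phi> (n0 + i)" and m: "m \<in> {n0..<M0}"
        have "m - n0 < N" "n0 + (m - n0) = m" using m NM by auto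
        then show "X m \<omega> \<le> (1 - 3 * (\<epsilon> / 6)) * \<phi> m" using A[rule_format, of "m - n0"] \<delta>(2) by simp
      qed
    qed
    with M0 have p: "prob {\<omega> \<in> space P. \<forall>i<N. X (n0 + i) \<omega> \<le> (a + \<delta>) * \<phi> (n0 + i)} < \<eta>\<^sup>2 / 32 / (4 * (1 + \<gamma>\<^sup>2))"
      by linarith
    have "4 * (1 + \<gamma>\<^sup>2) * prob {\<omega> \<in> space P. \<forall>i<N. X (n0 + i) \<omega> \<le> (a + \<delta>) * \<phi> (n0 + i)} < \<eta>\<^sup>2 / 32"
      using p g1 by (simp only: pos_less_divide_eq mult.commute)
    then have "E < \<eta>\<^sup>2 / 32 + \<eta>\<^sup>2 / 32" using E(1) \<gamma>(2) by (simp add: algebra_simps)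
    then have "E < (\<eta> / 4)\<^sup>2" by (simp add: power_divide)
    then have sE: "sqrt E < \<eta> / 4" using \<eta> sobolev_energy_nonneg[OF E(2)] by (intro real_less_lsqrt) auto
    have "cap_below {\<omega> \<in> wiener_space. \<forall>m\<in>{n0..<n0 + N}. B (q ^ m) \<omega> < (1 - \<epsilon>) * \<phi> m} \<eta>"
    proof (rule cap_below_quasi_continuous[OF _ _ sobolev_norm_of_energy[OF E(2)] sE _ _ \<eta>])
      show "quasi_continuous P (B (q ^ m))" for m using B t[of m] unfolding fbm_version_def by (simp add: less_imp_le)
      show "AE \<omega> in P. 0 \<le> \<psi> \<omega>" using soft.soft_ind_bounds by (simp add: \<psi>_def less_imp_le)
      have "AE \<omega> in P. \<forall>m. B (q ^ m) \<omega> = X m \<omega>"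
        using B t unfolding fbm_version_def X_def by (simp add: AE_all_countable less_imp_le)
      then show "AE \<omega> in P. (\<forall>m\<in>{n0..<n0 + N}. B (q ^ m) \<omega> < (1 - \<epsilon>) * \<phi> m) \<longrightarrow> 1 \<le> \<psi> \<omega>"
      proof eventually_elim
        fix \<omega> assume eq: "\<forall>m. B (q ^ m) \<omega> = X m \<omega>"
        show "(\<forall>m\<in>{n0..<n0 + N}. B (q ^ m) \<omega> < (1 - \<epsilon>) * \<phi> m) \<longrightarrow> 1 \<le> \<psi> \<omega>"
        proof
          assume A: "\<forall>m\<in>{n0..<n0 + N}. B (q ^ m) \<omega> < (1 - \<epsilon>) * \<phi> m"
          have "1 / 2 \<le> soft.soft_ind (\<lambda>i. X (n0 + i) \<omega>)"
          proof (rule soft.soft_ind_large[OF _ _ \<beta>N])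
            show "1 / \<phi> (n0 + i) * X (n0 + i) \<omega> \<le> a - \<delta>" if "i < N" for i
              using A[rule_format, of "n0 + i"] eq that \<phi>(1)[of "n0 + i"] \<delta>(3) by (simp add: pos_divide_le_eq less_imp_le)
          qed (use \<gamma> in simp)
          then show "1 \<le> \<psi> \<omega>" by (simp add: \<psi>_def)
        qed
      qed
    qed simp
    then show "cap_below {\<omega> \<in> wiener_space. \<forall>m\<ge>n. B (q ^ m) \<omega> < (1 - \<epsilon>) * lil_scale H (q ^ m)} \<eta>"
      by (rule cap_below_mono) (auto simp: \<phi>_def n0_def)
  qed
qed

end

theorem theorem6p2:
  fixes P :: "(real \<Rightarrow> real) measure"
    and H :: real
    and B :: "real \<Rightarrow> (real \<Rightarrow> real) \<Rightarrow> real"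
  assumes "wiener_measure P"
    and "0 < H" and "H \<le> 1/2"
    and "fbm_version P H B"
  shows "capacity P 2 1 {\<omega> \<in> wiener_space.
      Limsup (at_right 0)
        (\<lambda>t. ereal (B t \<omega> / sqrt (2 * t powr (2 * H) * ln (ln (1 / t))))) < 1} = 0"
proof -
  interpret prob_space P using assms(1) by (simp add: wiener_measure_def)
  interpret wiener P by unfold_locales (rule assms(1))
  \<comment> \<open>Countably many margins suffice; the offset 2 keeps each of them below 1.\<close>
  define \<epsilon> where "\<epsilon> k = 1 / real (k + 2)" for k :: nat
  have \<epsilon>: "0 < \<epsilon> k" "\<epsilon> k < 1" for k by (auto simp: \<epsilon>_def)
  have "\<forall>k. \<exists>q. 0 < q \<and> q < 1 \<and> 1 \<le> ln (1 / q) \<and> (\<forall>n \<eta>. 0 < \<eta> \<longrightarrow>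
     cap_below {\<omega> \<in> wiener_space. \<forall>m\<ge>n. B (q ^ m) \<omega> < (1 - \<epsilon> k) * lil_scale H (q ^ m)} \<eta>)"
  proof
    fix k
    show "\<exists>q. 0 < q \<and> q < 1 \<and> 1 \<le> ln (1 / q) \<and> (\<forall>n \<eta>. 0 < \<eta> \<longrightarrow>
     cap_below {\<omega> \<in> wiener_space. \<forall>m\<ge>n. B (q ^ m) \<omega> < (1 - \<epsilon> k) * lil_scale H (q ^ m)} \<eta>)"
      by (rule cap_below_lil[OF assms(2-4) \<epsilon>[of k]]) blast
  qed
  from choice[OF this] obtain q where q: "\<forall>k. 0 < q k \<and> q k < 1 \<and> 1 \<le> ln (1 / q k) \<and> (\<forall>n \<eta>. 0 < \<eta> \<longrightarrow>
     cap_below {\<omega> \<in> wiener_space. \<forall>m\<ge>n. B (q k ^ m) \<omega> < (1 - \<epsilon> k) * lil_scale H (q k ^ m)} \<eta>)" ..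
  define A where "A k n = {\<omega> \<in> wiener_space. \<forall>m\<ge>n. B (q k ^ m) \<omega> < (1 - \<epsilon> k) * lil_scale H (q k ^ m)}" for k n
  have cap: "cap_below (A k n) \<eta>" if "0 < \<eta>" for k n \<eta> using q that unfolding A_def by blast
  let ?L = "{\<omega> \<in> wiener_space. Limsup (at_right 0)
        (\<lambda>t. ereal (B t \<omega> / sqrt (2 * t powr (2 * H) * ln (ln (1 / t))))) < 1}"
  \<comment> \<open>A limsup below 1 is below some 1 - \<epsilon> k, and then so are all late terms
    along q k ^ m. The ratio may differ with k, since only a countable union is formed;
    \<open>prod_decode\<close> indexes it as \<open>cap_below_UN\<close> expects.\<close>
  have sub: "?L \<subseteq> (\<Union>j. A (fst (prod_decode j)) (snd (prod_decode j)))"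
  proof
    fix \<omega> assume w: "\<omega> \<in> ?L"
    let ?f = "\<lambda>t. ereal (B t \<omega> / lil_scale H t)"
    have "Limsup (at_right 0) ?f < 1" using w by (simp add: lil_scale_def)
    \<comment> \<open>The limsup is an extended real and may be minus infinity, so a real number is
      interposed before \<epsilon> k is chosen.\<close>
    then obtain r where r: "Limsup (at_right 0) ?f < ereal r" "ereal r < 1" using ereal_dense2 by blast
    have "0 < 1 - r" using r(2) by simp
    then obtain k where k: "inverse (real (Suc k)) < 1 - r" using reals_Archimedean by blast
    have "\<epsilon> k \<le> inverse (real (Suc k))" unfolding \<epsilon>_def inverse_eq_divide by (intro divide_left_mono) auto
    then have "ereal r \<le> ereal (1 - \<epsilon> k)" using k by simp
    with r(1) have "Limsup (at_right 0) ?f < ereal (1 - \<epsilon> k)" by (rule less_le_trans)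
    then have ev: "eventually (\<lambda>t. ?f t < ereal (1 - \<epsilon> k)) (at_right 0)" by (rule Limsup_lessD)
    have qk: "0 < q k" "q k < 1" "1 \<le> ln (1 / q k)" using q by auto
    have "(\<lambda>m. q k ^ m) \<longlonglongrightarrow> 0" using qk by (intro LIMSEQ_realpow_zero) auto
    then have "filterlim (\<lambda>m. q k ^ m) (at_right 0) sequentially"
      by (rule tendsto_imp_filterlim_at_right) (use qk in auto)
    from eventually_compose_filterlim[OF ev this]
    obtain n1 where n1: "\<And>m. n1 \<le> m \<Longrightarrow> ?f (q k ^ m) < ereal (1 - \<epsilon> k)" by (auto simp: eventually_sequentially)
    \<comment> \<open>From exp 2 on the scale is positive, so the quotient can be multiplied
      out.\<close>
    obtain n2 :: nat where n2: "exp 2 \<le> real n2" using real_arch_simple by blast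
    have "B (q k ^ m) \<omega> < (1 - \<epsilon> k) * lil_scale H (q k ^ m)" if m: "max n1 n2 \<le> m" for m
    proof -
      have "exp 2 \<le> real m" using n2 m by simp
      then have "ln (exp 2) \<le> ln (real m)" by (intro ln_mono) auto
      then have "0 < lil_scale H (q k ^ m)" by (intro lil_scale_geometric(2) qk) simp
      then show ?thesis using n1[of m] m by (simp add: pos_divide_less_eq)
    qed
    then have "\<omega> \<in> A k (max n1 n2)" using w by (simp add: A_def)
    then show "\<omega> \<in> (\<Union>j. A (fst (prod_decode j)) (snd (prod_decode j)))"
      by (intro UN_I[of "prod_encode (k, max n1 n2)"]) auto
  qed
  show ?thesis
  proof (rule capacity_eq_0I)
    fix \<eta> :: real assume \<eta>: "0 < \<eta>"
    have "cap_below (\<Union>j. A (fst (prod_decode j)) (snd (prod_decode j))) \<eta>"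
      by (rule cap_below_UN[OF cap \<eta>]) (use \<eta> in simp)
    then show "cap_below ?L \<eta>" by (rule cap_below_mono[OF _ sub])
  qed
qed

end
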